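(* Fix $n\in\mathbb{N}$. The map $\iota\colon\mathsf{W}\mathsf{L}_n\to\mathsf{D}\mathsf{L}_n$ is bijective. Consequently $\varepsilon_n^{-1}\circ\iota$ is a bijection between the set $\mathsf{W}\mathsf{L}_n$ of $n$-webs and the monoid $\mathsf{L}_n$, and $\rho\circ\pi$ is a bijection between $\mathsf{W}\mathsf{L}_n$ and $\operatorname{II}_n$; in particular the elements of $\mathsf{L}_n$, the $n$-webs, and the elements of $\operatorname{II}_n$ are in bijection via these maps.
   Context: $\mathsf{L}_n$ is the monoid with generators $x_1,\dots,x_n$ and relations $x_i^2=x_i$; $x_ix_j=x_jx_i$ for $|i-j|>1$; $x_ix_{i+1}x_i=x_{i+1}x_ix_{i+1}=x_ix_{i+1}$ for $1\le i<n$. An $n$-diagram is a continuous map from $n+1$ copies of $[0,1]$ to $\mathbb{R}\times[0,1]$, each strand projecting vertically bijectively onto $[0,1]$, endpoints at $(k,0),(l,1)$ with $k,l\in\{1,\dots,n+1\}$, injective except at finitely many interior transverse double points; up to isotopy, composed by stacking ($dd'$ = $d$ on top of $d'$). The elementary $d_i$ has vertical strands except two strands $(i,0)\to(i+1,1)$ and $(i+1,0)\to(i,1)$ crossing once. 2-move: locally, two arcs crossing twice $\leftrightarrow$ two arcs with the same boundary points crossing once. 3-move: locally, with lower points $B_1<B_2<B_3$, upper points $T_1<T_2<T_3$, three pairwise crossing arcs $B_1T_3,B_2T_2,B_3T_1$ $\leftrightarrow$ arcs $B_1T_3,B_2T_1,B_3T_2$ with $B_1T_3$ crossing the other two once and these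 not crossing. $\mathsf{D}\mathsf{L}_n$ is the monoid of $n$-diagrams modulo 2- and 3-moves, and $\varepsilon_n\colon\mathsf{L}_n\to\mathsf{D}\mathsf{L}_n$, $x_i\mapsto d_i$, is a monoid isomorphism. An $n$-web is an $n$-diagram where any two strands cross at most once and no three cross pairwise; $\mathsf{W}\mathsf{L}_n$ is the set of $n$-webs up to isotopy, and $\iota$ sends an $n$-web to its class in $\mathsf{D}\mathsf{L}_n$. $\pi(w)\in S_{n+1}$ sends the $x$-coordinate of the lower endpoint of each strand of $w$ to that of its upper endpoint. For $s\in S_{n+1}$, $\rho(s)=((a_t),(b_t))$ where $(a_t)$ is the increasing list of all $i$ with $s(i)>i$ and $b_t=s(a_t)$. $\operatorname{II}_n$ is the set of couples $((a_1,\dots,a_k),(b_1,\dots,b_k))$, $0\le k\le n$, of integers with $1\le a_1<\dots<a_k$, $b_1<\dots<b_k\le n+1$, $a_t<b_t$ for all $t$.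
   Formalization: The product of diagrams is read upwards (in dd', d lies below d'): with d on top, the stated 3-move gives d_i d_{i+1} d_i = d_{i+1} d_i, not d_i d_{i+1}, so x_i ↦ d_i would not respect the relations of L_n for n ≥ 2. *)

theory Defs
  imports "HOL-Analysis.Analysis" "HOL-Algebra.Group"
begin

section \<open>The monoid \<open>L\<^sub>n\<close>\<close>

text \<open>Words are lists of generator indices; the list \<open>[i, j]\<close> stands for \<open>x\<^sub>i x\<^sub>j\<close>.\<close>

inductive L_relation :: "nat \<Rightarrow> nat list \<Rightarrow> nat list \<Rightarrow> bool" for n where
  idem: "i \<in> {1..n} \<Longrightarrow> L_relation n [i, i] [i]"
| comm: "i \<in> {1..n} \<Longrightarrow> j \<in> {1..n} \<Longrightarrow> \<bar>int i - int j\<bar> > 1 \<Longrightarrow> L_relation n [i, j] [j, i]"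
| braid_left: "1 \<le> i \<Longrightarrow> i < n \<Longrightarrow> L_relation n [i, i + 1, i] [i, i + 1]"
| braid_right: "1 \<le> i \<Longrightarrow> i < n \<Longrightarrow> L_relation n [i + 1, i, i + 1] [i, i + 1]"

definition L_step :: "nat \<Rightarrow> nat list \<Rightarrow> nat list \<Rightarrow> bool" where
  "L_step n w w' \<longleftrightarrow> (\<exists>u v l r. L_relation n l r \<and> w = u @ l @ v \<and> w' = u @ r @ v)"

definition L_rel :: "nat \<Rightarrow> (nat list \<times> nat list) set" where
  "L_rel n = {(w, w'). equivclp (L_step n) w w'}"

definition L_monoid :: "nat \<Rightarrow> nat list set monoid" where
  "L_monoid n = \<lparr>carrier = lists {1..n} // L_rel n,
     mult = (\<lambda>X Y. \<Union>u\<in>X. \<Union>v\<in>Y. L_rel n `` {u @ v}),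
     one = L_rel n `` {[]}\<rparr>"

section \<open>Diagrams\<close>

text \<open>A map from \<open>n + 1\<close> copies of \<open>[0,1]\<close> to the strip is a function \<open>D\<close> of the index
  \<open>i \<in> {1..n+1}\<close> of the copy and of the parameter \<open>s \<in> [0,1]\<close>; its values for other arguments
  are irrelevant. The index \<open>i\<close> need not be related to the endpoints of the strand.\<close>

type_synonym diagram = "nat \<Rightarrow> real \<Rightarrow> real \<times> real"

definition strip :: "(real \<times> real) set" where
  "strip = UNIV \<times> {0..1}"

definition strand :: "diagram \<Rightarrow> nat \<Rightarrow> (real \<times> real) set" where
  "strand D i = D i ` {0..1}"

definition diagram_image :: "nat \<Rightarrow> diagram \<Rightarrow> (real \<times> real) set" where
  "diagram_image n D = (\<Union>i\<in>{1..n+1}. strand D i)"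

definition strand_x :: "diagram \<Rightarrow> nat \<Rightarrow> real \<Rightarrow> real" where
  "strand_x D i y = (THE x. (x, y) \<in> strand D i)"

text \<open>Strands are merely continuous, so transversality of a double point is the topological one:
  the two strands, seen as graphs over the height, exchange sides there.\<close>

definition crosses_at :: "(real \<Rightarrow> real) \<Rightarrow> (real \<Rightarrow> real) \<Rightarrow> real \<Rightarrow> bool" where
  "crosses_at f g y \<longleftrightarrow> f y = g y \<and>
     (\<exists>e>0. \<forall>u\<in>{y - e<..<y}. \<forall>v\<in>{y<..<y + e}. (f u - g u) * (f v - g v) < 0)"

definition double_points :: "nat \<Rightarrow> diagram \<Rightarrow> (real \<times> real) set" where
  "double_points n D =
     {p. \<exists>i\<in>{1..n+1}. \<exists>j\<in>{1..n+1}. i \<noteq> j \<and> p \<in> strand D i \<inter> strand D j}"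

text \<open>A single strand has no self-intersection because its vertical projection is injective.\<close>

definition ndiagram :: "nat \<Rightarrow> diagram \<Rightarrow> bool" where
  "ndiagram n D \<longleftrightarrow>
     (\<forall>i\<in>{1..n+1}. continuous_on {0..1} (D i) \<and> bij_betw (snd \<circ> D i) {0..1} {0..1} \<and>
        (\<exists>k\<in>{1..n+1}. \<exists>l\<in>{1..n+1}. D i 0 = (real k, 0) \<and> D i 1 = (real l, 1))) \<and>
     finite (double_points n D) \<and>
     (\<forall>p\<in>double_points n D. 0 < snd p \<and> snd p < 1 \<and> card {i\<in>{1..n+1}. p \<in> strand D i} = 2) \<and>
     (\<forall>i\<in>{1..n+1}. \<forall>j\<in>{1..n+1}. \<forall>y\<in>{0..1}. i \<noteq> j \<longrightarrow> strand_x D i y = strand_x D j y \<longrightarrow>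
        crosses_at (strand_x D i) (strand_x D j) y)"

text \<open>Ambient isotopy of the strip relative to its boundary, through diagrams. Comparing images at
  the end disregards the numbering of the copies and the parametrization of the strands; nothing
  else is lost, since at a transverse double point the image determines how strands continue.\<close>

definition isotopic :: "nat \<Rightarrow> diagram \<Rightarrow> diagram \<Rightarrow> bool" where
  "isotopic n D D' \<longleftrightarrow> ndiagram n D \<and> ndiagram n D' \<and>
     (\<exists>H :: real \<Rightarrow> real \<times> real \<Rightarrow> real \<times> real.
        continuous_on ({0..1} \<times> strip) (\<lambda>(t, p). H t p) \<and>
        (\<forall>p\<in>strip. H 0 p = p) \<and>
        (\<forall>t\<in>{0..1}. (\<exists>G. homeomorphism strip strip (H t) G) \<and>
           (\<forall>p\<in>UNIV \<times> {0, 1}. H t p = p) \<and>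
           ndiagram n (\<lambda>i s. H t (D i s))) \<and>
        diagram_image n (\<lambda>i s. H 1 (D i s)) = diagram_image n D')"

definition isotopy_rel :: "nat \<Rightarrow> (diagram \<times> diagram) set" where
  "isotopy_rel n = {(D, D'). isotopic n D D'}"

definition identity_diagram :: diagram where
  "identity_diagram j s = (real j, s)"

definition elementary :: "nat \<Rightarrow> diagram" where
  "elementary i j s =
     (if j = i then (real i + s, s)
      else if j = i + 1 then (real (i + 1) - s, s)
      else (real j, s))"

text \<open>\<open>D\<close> on top of \<open>E\<close>.\<close>

definition stack :: "nat \<Rightarrow> diagram \<Rightarrow> diagram \<Rightarrow> diagram" where
  "stack n D E i s =
     (if s \<le> 1/2 then (fst (E i (2 * s)), snd (E i (2 * s)) / 2)
      else let j = (THE j. j \<in> {1..n+1} \<and> fst (D j 0) = fst (E i 1)); q = D j (2 * s - 1)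
           in (fst q, (1 + snd q) / 2))"

section \<open>Moves\<close>

definition arc_graph :: "real \<Rightarrow> real \<Rightarrow> (real \<Rightarrow> real) \<Rightarrow> (real \<times> real) set" where
  "arc_graph c d f = (\<lambda>y. (f y, y)) ` {c..d}"

definition local_picture ::
  "nat \<Rightarrow> diagram \<Rightarrow> real \<Rightarrow> real \<Rightarrow> real \<Rightarrow> real \<Rightarrow> (real \<Rightarrow> real) set \<Rightarrow> bool" where
  "local_picture n D a b c d F \<longleftrightarrow>
     diagram_image n D \<inter> ({a..b} \<times> {c..d}) = (\<Union>f\<in>F. arc_graph c d f) \<and>
     (\<forall>f\<in>F. continuous_on {c..d} f \<and> f ` {c..d} \<subseteq> {a<..<b})"

definition arcs_cross :: "real \<Rightarrow> real \<Rightarrow> (real \<Rightarrow> real) \<Rightarrow> (real \<Rightarrow> real) \<Rightarrow> nat \<Rightarrow> bool" where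
  "arcs_cross c d f g m \<longleftrightarrow>
     finite {y\<in>{c..d}. f y = g y} \<and> card {y\<in>{c..d}. f y = g y} = m \<and>
     (\<forall>y\<in>{c..d}. f y = g y \<longrightarrow> crosses_at f g y)"

text \<open>A move replaces the picture inside a rectangle, whose sides \<open>x = a\<close> and \<open>x = b\<close> the diagram
  does not meet. Images are compared, since a 2-move changes which strand passes where outside the
  rectangle.\<close>

definition move2 :: "nat \<Rightarrow> diagram \<Rightarrow> diagram \<Rightarrow> bool" where
  "move2 n D D' \<longleftrightarrow> ndiagram n D \<and> ndiagram n D' \<and>
     (\<exists>a b c d f\<^sub>1 f\<^sub>2 g\<^sub>1 g\<^sub>2 B\<^sub>1 B\<^sub>2 T\<^sub>1 T\<^sub>2.
        a < b \<and> 0 \<le> c \<and> c < d \<and> d \<le> 1 \<and>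
        diagram_image n D - {a..b} \<times> {c..d} = diagram_image n D' - {a..b} \<times> {c..d} \<and>
        local_picture n D a b c d {f\<^sub>1, f\<^sub>2} \<and> local_picture n D' a b c d {g\<^sub>1, g\<^sub>2} \<and>
        B\<^sub>1 < B\<^sub>2 \<and> T\<^sub>1 < T\<^sub>2 \<and>
        f\<^sub>1 c = B\<^sub>1 \<and> f\<^sub>1 d = T\<^sub>1 \<and> f\<^sub>2 c = B\<^sub>2 \<and> f\<^sub>2 d = T\<^sub>2 \<and> arcs_cross c d f\<^sub>1 f\<^sub>2 2 \<and>
        g\<^sub>1 c = B\<^sub>1 \<and> g\<^sub>1 d = T\<^sub>2 \<and> g\<^sub>2 c = B\<^sub>2 \<and> g\<^sub>2 d = T\<^sub>1 \<and> arcs_cross c d g\<^sub>1 g\<^sub>2 1)"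

definition move3 :: "nat \<Rightarrow> diagram \<Rightarrow> diagram \<Rightarrow> bool" where
  "move3 n D D' \<longleftrightarrow> ndiagram n D \<and> ndiagram n D' \<and>
     (\<exists>a b c d f\<^sub>1 f\<^sub>2 f\<^sub>3 g\<^sub>1 g\<^sub>2 g\<^sub>3 B\<^sub>1 B\<^sub>2 B\<^sub>3 T\<^sub>1 T\<^sub>2 T\<^sub>3.
        a < b \<and> 0 \<le> c \<and> c < d \<and> d \<le> 1 \<and>
        diagram_image n D - {a..b} \<times> {c..d} = diagram_image n D' - {a..b} \<times> {c..d} \<and>
        local_picture n D a b c d {f\<^sub>1, f\<^sub>2, f\<^sub>3} \<and> local_picture n D' a b c d {g\<^sub>1, g\<^sub>2, g\<^sub>3} \<and>
        B\<^sub>1 < B\<^sub>2 \<and> B\<^sub>2 < B\<^sub>3 \<and> T\<^sub>1 < T\<^sub>2 \<and> T\<^sub>2 < T\<^sub>3 \<and>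
        f\<^sub>1 c = B\<^sub>1 \<and> f\<^sub>1 d = T\<^sub>3 \<and> f\<^sub>2 c = B\<^sub>2 \<and> f\<^sub>2 d = T\<^sub>2 \<and> f\<^sub>3 c = B\<^sub>3 \<and> f\<^sub>3 d = T\<^sub>1 \<and>
        arcs_cross c d f\<^sub>1 f\<^sub>2 1 \<and> arcs_cross c d f\<^sub>1 f\<^sub>3 1 \<and> arcs_cross c d f\<^sub>2 f\<^sub>3 1 \<and>
        g\<^sub>1 c = B\<^sub>1 \<and> g\<^sub>1 d = T\<^sub>3 \<and> g\<^sub>2 c = B\<^sub>2 \<and> g\<^sub>2 d = T\<^sub>1 \<and> g\<^sub>3 c = B\<^sub>3 \<and> g\<^sub>3 d = T\<^sub>2 \<and>
        arcs_cross c d g\<^sub>1 g\<^sub>2 1 \<and> arcs_cross c d g\<^sub>1 g\<^sub>3 1 \<and> arcs_cross c d g\<^sub>2 g\<^sub>3 0)"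

definition DL_rel :: "nat \<Rightarrow> (diagram \<times> diagram) set" where
  "DL_rel n = {(D, D'). equivclp (\<lambda>E E'. isotopic n E E' \<or> move2 n E E' \<or> move3 n E E') D D'}"

text \<open>The product is read upwards: in \<open>X \<otimes> Y\<close> the diagrams of \<open>X\<close> are the lower factors. The
  3-move identifies the triangle with the picture in which \<open>B\<^sub>1T\<^sub>3\<close> crosses the other two arcs,
  that is, with \<open>d\<^sub>i\<close> below and \<open>d\<^sub>i\<^sub>+\<^sub>1\<close> above. As \<open>x\<^sub>i x\<^sub>i\<^sub>+\<^sub>1 x\<^sub>i = x\<^sub>i x\<^sub>i\<^sub>+\<^sub>1\<close> in \<open>L\<^sub>n\<close>, this is the only
  order of stacking for which \<open>x\<^sub>i \<mapsto> d\<^sub>i\<close> extends to a homomorphism; with the left factor on top it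
  would be an anti-homomorphism.\<close>

definition DL_monoid :: "nat \<Rightarrow> diagram set monoid" where
  "DL_monoid n = \<lparr>carrier = {D. ndiagram n D} // DL_rel n,
     mult = (\<lambda>X Y. \<Union>D\<in>X. \<Union>E\<in>Y. DL_rel n `` {stack n E D}),
     one = DL_rel n `` {identity_diagram}\<rparr>"

definition epsilon :: "nat \<Rightarrow> nat list set \<Rightarrow> diagram set" where
  "epsilon n X = (\<Union>w\<in>X. foldr (\<lambda>i Y. DL_rel n `` {elementary i} \<otimes>\<^bsub>DL_monoid n\<^esub> Y) w \<one>\<^bsub>DL_monoid n\<^esub>)"

section \<open>Webs\<close>

definition nweb :: "nat \<Rightarrow> diagram \<Rightarrow> bool" where
  "nweb n D \<longleftrightarrow> ndiagram n D \<and>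
     (\<forall>i\<in>{1..n+1}. \<forall>j\<in>{1..n+1}. i \<noteq> j \<longrightarrow> card (strand D i \<inter> strand D j) \<le> 1) \<and>
     \<not> (\<exists>i\<in>{1..n+1}. \<exists>j\<in>{1..n+1}. \<exists>k\<in>{1..n+1}. i \<noteq> j \<and> i \<noteq> k \<and> j \<noteq> k \<and>
          strand D i \<inter> strand D j \<noteq> {} \<and> strand D i \<inter> strand D k \<noteq> {} \<and>
          strand D j \<inter> strand D k \<noteq> {})"

definition WL :: "nat \<Rightarrow> diagram set set" where
  "WL n = {D. nweb n D} // isotopy_rel n"

definition iota :: "nat \<Rightarrow> diagram set \<Rightarrow> diagram set" where
  "iota n W = (\<Union>D\<in>W. DL_rel n `` {D})"

definition endpoint_perm :: "nat \<Rightarrow> diagram \<Rightarrow> nat \<Rightarrow> nat" where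
  "endpoint_perm n D k =
     (if k \<in> {1..n+1}
      then THE l. \<exists>i\<in>{1..n+1}. D i 0 = (real k, 0) \<and> D i 1 = (real l, 1)
      else k)"

definition web_perm :: "nat \<Rightarrow> diagram set \<Rightarrow> nat \<Rightarrow> nat" where
  "web_perm n W = the_elem (endpoint_perm n ` W)"

definition rho :: "nat \<Rightarrow> (nat \<Rightarrow> nat) \<Rightarrow> nat list \<times> nat list" where
  "rho n s = (let a = sorted_list_of_set {i\<in>{1..n+1}. s i > i} in (a, map s a))"

definition II :: "nat \<Rightarrow> (nat list \<times> nat list) set" where
  "II n = {(a, b). length a = length b \<and> length a \<le> n \<and>
     sorted_wrt (<) a \<and> sorted_wrt (<) b \<and>
     (\<forall>x\<in>set a. 1 \<le> x) \<and> (\<forall>x\<in>set b. x \<le> n + 1) \<and>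
     (\<forall>t<length a. a ! t < b ! t)}"

end

theory Submission imports Defs begin

text \<open>
  The complete invariant of a diagram \<open>D\<close> is the map \<open>F\<close> sending \<open>k\<close> to the rightmost upper endpoint
  that can be reached from \<open>(k, 0)\<close> by going upwards in the image of \<open>D\<close>, switching strands at
  will at crossings. It is invariant under isotopy and under both moves, stacking corresponds to
  composition, and \<open>d\<^sub>i\<close> acts as the map that sends \<open>i\<close> to \<open>i + 1\<close> and fixes everything else.

  A word none of whose commutation equivalents contains a factor \<open>i i\<close>, \<open>i (i+1) i\<close> or
  \<open>(i+1) i (i+1)\<close> is commutation equivalent to a product of ascending blocks
  \<open>(a\<^sub>k \<dots> b\<^sub>k - 1) \<dots> (a\<^sub>1 \<dots> b\<^sub>1 - 1)\<close> with \<open>(a, b) \<in> II\<^sub>n\<close>, and \<open>F\<close> of this product determines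
  \<open>(a, b)\<close>. Hence \<open>L\<^sub>n\<close> is faithfully represented by the maps \<open>F\<close>.

  Reading off the crossings of a diagram from bottom to top gives a word, and diagrams with
  commutation equivalent words are isotopic: if the crossings sit at the same places of the
  left-to-right ordered strands and at the same heights, a horizontal piecewise linear isotopy does
  it, and a single crossing can be moved vertically as long as no neighbouring crossing is in the way.
  So the moves, which realize the defining relations of \<open>L\<^sub>n\<close>, identify diagrams exactly when their
  maps \<open>F\<close> agree. The word of a web has no reducible factor; so a web is isotopic to the diagram of a
  normal form, whose exceedances are \<open>a\<^sub>t \<mapsto> b\<^sub>t\<close>.
\<close>

section \<open>Words\<close>

text \<open>The permutation of the endpoints is no invariant of classes, since a 2-move alters it;
  what survives is a maximum. In both pictures of either move the rightmost upper point of the box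
  is reachable from every lower point, and a choice made further right later on absorbs earlier
  ones.

  The obstacle is that an isotopy may tilt horizontal lines, while everything else is done with
  graphs over the height. Invariance is therefore proved along strands, and, apart from reversal and
  concatenation, only two explicit kinds of isotopy are ever constructed, one horizontal and one
  vertical.

  Strands are merely continuous and pictures are compared as sets. That the set determines the
  strands rests on transversality, and this is what makes isotopies reversible and composable.

  The equivalences close up in a circle: relations of words are realized by moves, moves preserve
  the map, equal maps give equal normal forms, and words with equal normal forms are related. Normal
  forms are webs because their strands can be coloured with two colours so that only strands of
  different colours cross.\<close>

definition swap_at :: "nat \<Rightarrow> nat \<Rightarrow> nat" where
  "swap_at i p = (if p = i then i + 1 else if p = i + 1 then i else p)"

text \<open>Effect of a crossing on the rightmost place that can be occupied: from \<open>i\<close>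
  the strand leads to \<open>i + 1\<close>, and from \<open>i + 1\<close> the path turns back at the
  crossing and stays on the right.\<close>

definition push_at :: "nat \<Rightarrow> nat \<Rightarrow> nat" where
  "push_at i p = (if p = i then i + 1 else p)"

text \<open>The head of a word is the lowest crossing and acts before the others; hence
  \<open>fold\<close>, and hence \<open>u\<close> before \<open>v\<close> on
  \<open>u @ v\<close>.\<close>

definition word_perm :: "nat list \<Rightarrow> nat \<Rightarrow> nat" where
  "word_perm w = fold swap_at w"

definition word_map :: "nat list \<Rightarrow> nat \<Rightarrow> nat" where
  "word_map w = fold push_at w"

text \<open>\<open>k\<close> and \<open>l\<close> are places at the bottom; the recursion follows
  the two strands upwards, so it counts how often these strands meet in the picture of the
  word.\<close>

fun word_cross :: "nat list \<Rightarrow> nat \<Rightarrow> nat \<Rightarrow> nat" where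
  "word_cross [] k l = 0"
| "word_cross (i # w) k l =
     (if {k, l} = {i, i + 1} then 1 else 0) + word_cross w (swap_at i k) (swap_at i l)"

lemma word_perm_simps [simp]:
  "word_perm [] k = k" "word_perm (i # w) k = word_perm w (swap_at i k)"
  "word_perm (u @ v) k = word_perm v (word_perm u k)"
  by (simp_all add: word_perm_def)

lemma word_map_simps [simp]:
  "word_map [] k = k" "word_map (i # w) k = word_map w (push_at i k)"
  "word_map (u @ v) k = word_map v (word_map u k)"
  by (simp_all add: word_map_def)

lemma word_cross_append:
  "word_cross (u @ v) k l = word_cross u k l + word_cross v (word_perm u k) (word_perm u l)"
  by (induction u arbitrary: k l) auto

lemma swap_at_swap_at [simp]: "swap_at i (swap_at i p) = p"
  by (simp add: swap_at_def)

lemma inj_swap_at: "swap_at i p = swap_at i q \<longleftrightarrow> p = q"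
  by (metis swap_at_swap_at)

lemma swap_at_in: "i \<in> {1..n} \<Longrightarrow> swap_at i p \<in> {1..n+1} \<longleftrightarrow> p \<in> {1..n+1}"
  by (auto simp: swap_at_def)

lemma word_perm_surj: "set w \<subseteq> {1..n} \<Longrightarrow> q \<in> {1..n+1} \<Longrightarrow> \<exists>p\<in>{1..n+1}. word_perm w p = q"
proof (induction w arbitrary: q)
  case (Cons i w)
  then have "\<exists>p\<in>{1..n+1}. word_perm w p = q" by (intro Cons.IH) auto
  then obtain p where p: "p \<in> {1..n+1}" "word_perm w p = q" by blast
  have "swap_at i p \<in> {1..n+1}" using Cons.prems p(1) swap_at_in[of i n p] by auto
  then show ?case using p(2) by (intro bexI[of _ "swap_at i p"]) auto
qed auto

subsection \<open>Commutation classes\<close>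

text \<open>Letters are unrestricted here; the bound \<open>n\<close> is recovered from the fact
  that a commutation class has a fixed set of letters.\<close>

definition comm_step :: "nat list \<Rightarrow> nat list \<Rightarrow> bool" where
  "comm_step w w' \<longleftrightarrow> (\<exists>u v i j. \<bar>int i - int j\<bar> > 1 \<and> w = u @ [i, j] @ v \<and> w' = u @ [j, i] @ v)"

abbreviation comm_eq :: "nat list \<Rightarrow> nat list \<Rightarrow> bool" where
  "comm_eq \<equiv> comm_step\<^sup>*\<^sup>*"

lemma comm_step_sym: "comm_step w w' \<Longrightarrow> comm_step w' w"
  unfolding comm_step_def by (metis abs_minus_commute)

lemma comm_eq_sym: "comm_eq w w' \<Longrightarrow> comm_eq w' w"
  by (induction rule: rtranclp_induct) (auto intro: comm_step_sym converse_rtranclp_into_rtranclp)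

lemma comm_step_context: "comm_step w w' \<Longrightarrow> comm_step (x @ w @ y) (x @ w' @ y)"
  unfolding comm_step_def by (metis append.assoc)

lemma comm_eq_context: "comm_eq w w' \<Longrightarrow> comm_eq (x @ w @ y) (x @ w' @ y)"
  by (induction rule: rtranclp_induct) (auto intro: comm_step_context rtranclp.rtrancl_into_rtrancl)

lemma comm_step_set: "comm_step w w' \<Longrightarrow> set w' = set w"
  unfolding comm_step_def by auto

lemma comm_eq_set: "comm_eq w w' \<Longrightarrow> set w' = set w"
  by (induction rule: rtranclp_induct) (auto simp: comm_step_set)

lemma comm_step_length: "comm_step w w' \<Longrightarrow> length w' = length w"
  unfolding comm_step_def by auto

lemma comm_eq_length: "comm_eq w w' \<Longrightarrow> length w' = length w"
  by (induction rule: rtranclp_induct) (auto simp: comm_step_length)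

lemma comm_eq_letter: "\<forall>y\<in>set v. \<bar>int x - int y\<bar> > 1 \<Longrightarrow> comm_eq (x # v) (v @ [x])"
proof (induction v)
  case (Cons y v)
  have "comm_step (x # y # v) (y # x # v)"
    unfolding comm_step_def using Cons.prems
    by (intro exI[of _ "[]"] exI[of _ v] exI[of _ x] exI[of _ y]) auto
  moreover have "comm_eq (y # x # v) (y # v @ [x])"
    using comm_eq_context[OF Cons.IH, of "[y]" "[]"] Cons.prems by auto
  ultimately show ?case by (simp add: converse_rtranclp_into_rtranclp)
qed simp

lemma comm_eq_append:
  "\<forall>x\<in>set u. \<forall>y\<in>set v. \<bar>int x - int y\<bar> > 1 \<Longrightarrow> comm_eq (u @ v) (v @ u)"
proof (induction u)
  case (Cons x u)
  have "comm_eq (x # u @ v) (x # v @ u)"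
    using comm_eq_context[OF Cons.IH, of "[x]" "[]"] Cons.prems by auto
  moreover have "comm_eq (x # v @ u) (v @ x # u)"
    using comm_eq_context[OF comm_eq_letter[of v x], of "[]" u] Cons.prems by auto
  ultimately show ?case by (simp add: rtranclp_trans)
qed simp

section \<open>Words that cannot be shortened\<close>

definition reducible_factor :: "nat list \<Rightarrow> bool" where
  "reducible_factor l \<longleftrightarrow> (\<exists>i. l = [i, i] \<or> l = [i, i + 1, i] \<or> l = [i + 1, i, i + 1])"

definition irred :: "nat list \<Rightarrow> bool" where
  "irred w \<longleftrightarrow> (\<forall>u l v. comm_eq w (u @ l @ v) \<longrightarrow> \<not> reducible_factor l)"

lemma irred_factor: "irred (x @ w @ y) \<Longrightarrow> irred w"
  unfolding irred_def by (metis append.assoc comm_eq_context)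

lemma irred_comm_eq: "irred w \<Longrightarrow> comm_eq w w' \<Longrightarrow> irred w'"
  unfolding irred_def by (meson rtranclp_trans)

lemma irredD: "irred w \<Longrightarrow> comm_eq w (u @ l @ v) \<Longrightarrow> \<not> reducible_factor l"
  unfolding irred_def by blast

text \<open>Between two consecutive occurrences of the maximal letter \<open>m\<close> there is, by induction, at most
  one letter \<open>m - 1\<close>, and all other letters commute with \<open>m\<close>.\<close>

lemma irred_max_letter_once:
  assumes "irred w" "set w \<subseteq> {1..m}" "w = x @ m # r"
  shows "m \<notin> set r"
  using assms
proof (induction m arbitrary: w x r)
  case 0
  then show ?case by auto
next
  case (Suc m)
  show ?case
  proof
    assume "Suc m \<in> set r"
    then obtain u z where r: "r = u @ Suc m # z" and u: "Suc m \<notin> set u"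
      by (metis split_list_first)
    have w: "w = (x @ [Suc m]) @ u @ (Suc m # z)" using Suc.prems r by simp
    have iu: "irred u" using Suc.prems(1) w irred_factor by blast
    have su: "set u \<subseteq> {1..m}"
    proof
      fix y assume "y \<in> set u"
      then show "y \<in> {1..m}" using Suc.prems(2) w u by (cases "y = Suc m") auto
    qed
    show False
    proof (cases "m \<in> set u")
      case False
      then have "\<forall>y\<in>set u. \<bar>int (Suc m) - int y\<bar> > 1"
      proof (intro ballI)
        fix y assume "y \<in> set u"
        then have "y \<le> m" "y \<noteq> m" using su False by auto
        then show "\<bar>int (Suc m) - int y\<bar> > 1" by linarith
      qed
      then have "comm_eq (Suc m # u) (u @ [Suc m])" by (rule comm_eq_letter)
      from comm_eq_context[OF this, of x "Suc m # z"]
      have "comm_eq w ((x @ u) @ [Suc m, Suc m] @ z)" using w by simp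
      from irredD[OF Suc.prems(1) this] show False by (auto simp: reducible_factor_def)
    next
      case True
      then obtain u1 u2 where u12: "u = u1 @ m # u2" "m \<notin> set u1" by (metis split_list_first)
      have u2: "m \<notin> set u2" using Suc.IH[OF iu su u12(1)] .
      have m: "m \<ge> 1" using True su by auto
      have far: "\<bar>int (Suc m) - int y\<bar> > 1" if "y \<in> set u1 \<union> set u2" for y
      proof -
        have "y \<le> m" "y \<noteq> m" using su u12 u2 that by auto
        then show ?thesis by linarith
      qed
      have "comm_eq (Suc m # u1) (u1 @ [Suc m])" using far by (intro comm_eq_letter) auto
      from comm_eq_context[OF this, of x "m # u2 @ Suc m # z"]
      have 1: "comm_eq w (x @ u1 @ Suc m # m # u2 @ Suc m # z)" using w u12 by simp
      have "comm_eq (Suc m # u2) (u2 @ [Suc m])" using far by (intro comm_eq_letter) auto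
      from comm_eq_context[OF comm_eq_sym[OF this], of "x @ u1 @ [Suc m, m]" z]
      have 2: "comm_eq (x @ u1 @ Suc m # m # u2 @ Suc m # z) ((x @ u1) @ [Suc m, m, Suc m] @ u2 @ z)"
        by simp
      from irredD[OF Suc.prems(1) rtranclp_trans[OF 1 2]] show False
        by (auto simp: reducible_factor_def)
    qed
  qed
qed

text \<open>The ascending block grows to the left. If the letter just below its start does not occur
  in \<open>u\<close>, then all of \<open>u\<close> commutes with the block and passes behind it.
  Otherwise that letter, the maximum of \<open>u\<close>, occurs there once; what follows it in
  \<open>u\<close> commutes with the block and passes behind it, and the letter joins the
  block.\<close>

lemma irred_collect_block:
  assumes "irred w" "w = u @ [j..<Suc m] @ v" "set u \<subseteq> {1..<j}" "set v \<subseteq> {1..<m}" "1 \<le> j" "j \<le> m"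
  shows "\<exists>j' v'. 1 \<le> j' \<and> j' \<le> m \<and> comm_eq w ([j'..<Suc m] @ v') \<and> set v' \<subseteq> {1..<m}"
  using assms
proof (induction j arbitrary: w u v)
  case 0
  then show ?case by auto
next
  case (Suc j)
  show ?case
  proof (cases "j \<in> set u")
    case False
    have "comm_eq (u @ [Suc j..<Suc m]) ([Suc j..<Suc m] @ u)"
    proof (intro comm_eq_append ballI)
      fix x y assume "x \<in> set u" "y \<in> set [Suc j..<Suc m]"
      then have "x < j" "y > j" using Suc.prems(3) False by (fastforce intro: le_neq_implies_less)+
      then show "\<bar>int x - int y\<bar> > 1" by linarith
    qed
    from comm_eq_context[OF this, of "[]" v]
    have "comm_eq w ([Suc j..<Suc m] @ u @ v)" using Suc.prems by simp
    moreover have "set (u @ v) \<subseteq> {1..<m}" using Suc.prems by auto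
    ultimately show ?thesis using Suc.prems by blast
  next
    case True
    then obtain u1 u2 where u12: "u = u1 @ j # u2" "j \<notin> set u1" by (metis split_list_first)
    have iu: "irred u" using irred_factor[of "[]" u "[Suc j..<Suc m] @ v"] Suc.prems by simp
    have "set u \<subseteq> {1..j}" using Suc.prems by auto
    from irred_max_letter_once[OF iu this u12(1)] have u2: "j \<notin> set u2" .
    have "comm_eq (u2 @ [Suc j..<Suc m]) ([Suc j..<Suc m] @ u2)"
    proof (intro comm_eq_append ballI)
      fix x y assume "x \<in> set u2" "y \<in> set [Suc j..<Suc m]"
      then have "x < j" "y > j" using Suc.prems(3) u12 u2 by (fastforce intro: le_neq_implies_less)+
      then show "\<bar>int x - int y\<bar> > 1" by linarith
    qed
    from comm_eq_context[OF this, of "u1 @ [j]" v]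
    have 1: "comm_eq w (u1 @ (j # [Suc j..<Suc m]) @ (u2 @ v))" using Suc.prems u12 by simp
    have "j # [Suc j..<Suc m] = [j..<Suc m]" using Suc.prems(6) by (simp add: upt_conv_Cons)
    then have 2: "comm_eq w (u1 @ [j..<Suc m] @ (u2 @ v))" using 1 by simp
    have s1: "set u1 \<subseteq> {1..<j}"
    proof
      fix y assume "y \<in> set u1"
      then show "y \<in> {1..<j}" using Suc.prems(3) u12 by (cases "y = j") auto
    qed
    have s2: "set (u2 @ v) \<subseteq> {1..<m}" using Suc.prems u12 by auto
    have j1: "1 \<le> j" using True Suc.prems(3) by auto
    from Suc.IH[OF irred_comm_eq[OF Suc.prems(1) 2] refl s1 s2 j1] Suc.prems(6) 2
    show ?thesis by (meson Suc_leD rtranclp_trans)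
  qed
qed

subsection \<open>Normal forms\<close>

definition nf_word :: "(nat \<times> nat) list \<Rightarrow> nat list" where
  "nf_word bl = concat (map (\<lambda>(a, b). [a..<b]) bl)"

definition nf_blocks :: "nat \<Rightarrow> (nat \<times> nat) list \<Rightarrow> bool" where
  "nf_blocks n bl \<longleftrightarrow> sorted_wrt (\<lambda>(a, b) (a', b'). a' < a \<and> b' < b) bl \<and>
     (\<forall>(a, b)\<in>set bl. 1 \<le> a \<and> a < b \<and> b \<le> n + 1)"

lemma nf_word_simps [simp]: "nf_word [] = []" "nf_word ((a, b) # bl) = [a..<b] @ nf_word bl"
  by (simp_all add: nf_word_def)

lemma nf_blocks_Nil [simp]: "nf_blocks n []"
  by (simp add: nf_blocks_def)

lemma nf_blocks_Cons:
  "nf_blocks n ((a, b) # bl) \<longleftrightarrow>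
     1 \<le> a \<and> a < b \<and> b \<le> n + 1 \<and> nf_blocks n bl \<and> (\<forall>(a', b')\<in>set bl. a' < a \<and> b' < b)"
  by (auto simp: nf_blocks_def)

lemma nf_word_set: "nf_blocks n bl \<Longrightarrow> set (nf_word bl) \<subseteq> {1..n}"
  by (induction bl) (fastforce simp: nf_blocks_Cons)+

text \<open>The unique occurrence of the largest letter is completed to a block that is brought to
  the front. The remainder uses smaller letters and is treated by induction; only the comparison of
  the new block with the next one needs irreducibility again.\<close>

lemma irred_normal_form:
  assumes "irred w" "set w \<subseteq> {1..m}"
  shows "\<exists>bl. nf_blocks m bl \<and> comm_eq w (nf_word bl)"
  using assms
proof (induction m arbitrary: w)
  case 0
  then show ?case by (intro exI[of _ "[]"]) auto
next
  case (Suc m)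
  have weaken: "nf_blocks m bl \<Longrightarrow> nf_blocks (Suc m) bl" for bl
    by (auto simp: nf_blocks_def)
  show ?case
  proof (cases "Suc m \<in> set w")
    case False
    then have "set w \<subseteq> {1..m}" using Suc.prems(2) by (auto simp: le_Suc_eq)
    with Suc weaken show ?thesis by blast
  next
    case True
    then obtain u v where uv: "w = u @ Suc m # v" "Suc m \<notin> set u" by (metis split_list_first)
    have v: "Suc m \<notin> set v" using irred_max_letter_once[OF Suc.prems uv(1)] .
    have s: "set u \<subseteq> {1..<Suc m}" "set v \<subseteq> {1..<Suc m}"
      using Suc.prems(2) uv v by (fastforce intro: le_neq_implies_less)+
    have "w = u @ [Suc m..<Suc (Suc m)] @ v" using uv by simp
    from irred_collect_block[OF Suc.prems(1) this s] obtain j v' where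
      j: "1 \<le> j" "j \<le> Suc m" and w': "comm_eq w ([j..<Suc (Suc m)] @ v')" and v': "set v' \<subseteq> {1..<Suc m}"
      by auto
    have iw': "irred ([j..<Suc (Suc m)] @ v')" using irred_comm_eq[OF Suc.prems(1) w'] .
    then have "irred v'" using irred_factor[of "[j..<Suc (Suc m)]" v' "[]"] by simp
    moreover have "set v' \<subseteq> {1..m}" using v' by auto
    ultimately obtain bl where bl: "nf_blocks m bl" "comm_eq v' (nf_word bl)"
      using Suc.IH by blast
    have w2: "comm_eq w ([j..<Suc (Suc m)] @ nf_word bl)"
      using rtranclp_trans[OF w' comm_eq_context[OF bl(2), of "[j..<Suc (Suc m)]" "[]", unfolded append_Nil2]] .
    have "nf_blocks (Suc m) ((j, Suc (Suc m)) # bl)"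
    proof (cases bl)
      case Nil
      then show ?thesis using j by (simp add: nf_blocks_Cons)
    next
      case (Cons p bl')
      obtain a b where p: "p = (a, b)" by force
      have ab: "1 \<le> a" "a < b" "b \<le> m + 1" "\<forall>(a', b')\<in>set bl'. a' < a \<and> b' < b"
        using bl(1) Cons p by (auto simp: nf_blocks_Cons)
      \<comment> \<open>Otherwise \<open>a\<close> and \<open>a + 1\<close> both occur in the new
        block, and the leading letter \<open>a\<close> of the next block commutes with everything in
        between, which produces the factor \<open>a (a+1) a\<close>.\<close>
      have "a < j"
      proof (rule ccontr)
        assume "\<not> a < j"
        then have "j \<le> a" by simp
        have 1: "[j..<Suc (Suc m)] = [j..<a] @ [a, a + 1] @ [a + 2..<Suc (Suc m)]"
        proof -
          have "[j..<Suc (Suc m)] = [j..<a] @ [a..<Suc (Suc m)]"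
            using \<open>j \<le> a\<close> ab upt_add_eq_append[of j a "Suc (Suc m) - a"] by simp
          also have "[a..<Suc (Suc m)] = a # (a + 1) # [a + 2..<Suc (Suc m)]"
            using ab by (simp add: upt_conv_Cons del: upt_Suc)
          finally show ?thesis by simp
        qed
        have 2: "[a..<b] = a # [a + 1..<b]" using ab by (simp add: upt_conv_Cons)
        have "comm_eq (a # [a + 2..<Suc (Suc m)]) ([a + 2..<Suc (Suc m)] @ [a])"
          by (intro comm_eq_letter) auto
        from comm_eq_context[OF comm_eq_sym[OF this], of "[j..<a] @ [a, a + 1]" "[a + 1..<b] @ nf_word bl'"]
        have "comm_eq ([j..<Suc (Suc m)] @ nf_word bl)
          ([j..<a] @ [a, a + 1, a] @ [a + 2..<Suc (Suc m)] @ [a + 1..<b] @ nf_word bl')"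
          unfolding 1 Cons p nf_word_simps 2 by simp
        from irredD[OF Suc.prems(1) rtranclp_trans[OF w2 this]] show False
          by (auto simp: reducible_factor_def)
      qed
      then show ?thesis using Cons p ab j bl(1) weaken[OF bl(1)] unfolding Cons p nf_blocks_Cons by fastforce
    qed
    moreover have "comm_eq w (nf_word ((j, Suc (Suc m)) # bl))" using w2 by simp
    ultimately show ?thesis by blast
  qed
qed

section \<open>Action and crossing numbers of normal forms\<close>

lemma word_map_block: "word_map [a..<b] p = (if a \<le> p \<and> p < b then b else p)"
proof (induction b)
  case (Suc b)
  then show ?case by (auto simp: push_at_def)
qed simp

lemma word_perm_block:
  "a \<le> b \<Longrightarrow> word_perm [a..<b] p = (if p = a then b else if a < p \<and> p \<le> b then p - 1 else p)"
proof (induction b)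
  case (Suc b)
  show ?case
  proof (cases "a \<le> b")
    case True
    then show ?thesis using Suc by (auto simp: swap_at_def)
  next
    case False
    then have "a = Suc b" using Suc.prems by simp
    then show ?thesis by simp
  qed
qed simp

text \<open>All crossings of an ascending block involve the strand from \<open>a\<close>: when the
  letter \<open>b\<close> is reached it sits at place \<open>b\<close>, and the strand at place
  \<open>b + 1\<close> has not moved yet.\<close>

lemma word_cross_block:
  "a \<le> b \<Longrightarrow> k \<noteq> l \<Longrightarrow> word_cross [a..<b] k l =
     (if k = a \<and> a < l \<and> l \<le> b \<or> l = a \<and> a < k \<and> k \<le> b then 1 else 0)"
proof (induction b)
  case (Suc b)
  show ?case
  proof (cases "a \<le> b")
    case True
    let ?p = "word_perm [a..<b]"
    have eq: "word_cross [a..<Suc b] k l =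
      word_cross [a..<b] k l + (if {?p k, ?p l} = {b, b + 1} then 1 else 0)"
      using True by (simp add: word_cross_append)
    have pa: "?p a = b" and po: "q \<noteq> a \<Longrightarrow> ?p q \<noteq> b" "q \<noteq> a \<Longrightarrow> ?p q = b + 1 \<longleftrightarrow> q = b + 1" for q
      using True by (auto simp: word_perm_block)
    have "{?p k, ?p l} = {b, b + 1} \<longleftrightarrow> k = a \<and> l = b + 1 \<or> l = a \<and> k = b + 1"
      using pa po[of k] po[of l] Suc.prems(2) by (cases "k = a"; cases "l = a") (auto simp: doubleton_eq_iff)
    then show ?thesis unfolding eq Suc.IH[OF True Suc.prems(2)] using True Suc.prems(2)
      by (cases "k = a"; cases "l = a"; simp; linarith)
  next
    case False
    then have "a = Suc b" using Suc.prems by simp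
    then show ?thesis by auto
  qed
qed auto

lemma word_map_nf_bounded:
  "nf_blocks n bl \<Longrightarrow> \<forall>(a', b')\<in>set bl. b' \<le> p \<Longrightarrow> word_map (nf_word bl) p = p"
proof (induction bl arbitrary: p)
  case (Cons x bl)
  obtain a b where "x = (a, b)" by force
  then show ?case using Cons by (auto simp: nf_blocks_Cons word_map_block)
qed simp

text \<open>Meant for the strand that a block carries to its end \<open>b\<close>: the later blocks
  all end below \<open>b\<close>, so it is not touched again.\<close>

lemma word_perm_nf_above:
  "nf_blocks n bl \<Longrightarrow> \<forall>(a', b')\<in>set bl. b' < p \<Longrightarrow> word_perm (nf_word bl) p = p"
proof (induction bl arbitrary: p)
  case (Cons x bl)
  obtain a b where "x = (a, b)" by force
  then show ?case using Cons by (auto simp: nf_blocks_Cons word_perm_block)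
qed simp

lemma word_cross_nf_above:
  "nf_blocks n bl \<Longrightarrow> k \<noteq> l \<Longrightarrow> \<forall>(a', b')\<in>set bl. b' < k \<Longrightarrow>
     word_cross (nf_word bl) k l = 0 \<and> word_cross (nf_word bl) l k = 0"
proof (induction bl arbitrary: k l)
  case (Cons x bl)
  obtain a b where x: "x = (a, b)" by force
  then have ab: "a < b" "b < k" "nf_blocks n bl" "\<forall>(a', b')\<in>set bl. b' < k"
    using Cons.prems by (auto simp: nf_blocks_Cons)
  have k: "word_perm [a..<b] k = k" using ab by (simp add: word_perm_block)
  have ne: "k \<noteq> word_perm [a..<b] l"
    using ab \<open>k \<noteq> l\<close> by (auto simp: word_perm_block)
  show ?case using Cons.IH[OF ab(3) ne ab(4)] ab \<open>k \<noteq> l\<close>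
    by (auto simp: x word_cross_append word_cross_block k)
qed simp

text \<open>Blocks are listed with decreasing \<open>a\<close> and \<open>b\<close>. Those with
  \<open>a > p\<close> do nothing; the next one lifts \<open>p\<close> to the maximum of
  \<open>p\<close> and \<open>b\<close>, which dominates the ends of all blocks that follow.\<close>

lemma word_map_nf:
  "nf_blocks n bl \<Longrightarrow> word_map (nf_word bl) p = Max (insert p {b. \<exists>a. (a, b) \<in> set bl \<and> a \<le> p})"
proof (induction bl)
  case (Cons x bl)
  obtain a b where x: "x = (a, b)" by force
  have ab: "a < b" "nf_blocks n bl" "\<forall>(a', b')\<in>set bl. a' < a \<and> b' < b"
    using Cons.prems x by (auto simp: nf_blocks_Cons)
  have fin: "finite {b. \<exists>a. (a, b) \<in> set bl' \<and> a \<le> p}" for bl' :: "(nat \<times> nat) list"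
  proof (rule finite_subset)
    show "{b. \<exists>a. (a, b) \<in> set bl' \<and> a \<le> p} \<subseteq> snd ` set bl'" by (auto intro: rev_image_eqI)
  qed simp
  show ?case
  proof (cases "a \<le> p")
    case True
    have S: "{b'. \<exists>a'. (a', b') \<in> set (x # bl) \<and> a' \<le> p} = insert b {b'. \<exists>a'. (a', b') \<in> set bl \<and> a' \<le> p}"
      using True x by auto
    have "word_map (nf_word (x # bl)) p = max p b"
    proof (cases "p < b")
      case True
      then show ?thesis using \<open>a \<le> p\<close> x word_map_nf_bounded[OF ab(2), of b] ab(3)
        by (auto simp: word_map_block less_imp_le case_prod_unfold)
    next
      case False
      then show ?thesis using x word_map_nf_bounded[OF ab(2), of p] ab(3)
        by (force simp: word_map_block)
    qed
    also have "max p b = Max (insert p (insert b {b'. \<exists>a'. (a', b') \<in> set bl \<and> a' \<le> p}))"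
    proof (intro Max_eqI[symmetric])
      show "y \<le> max p b" if "y \<in> insert p (insert b {b'. \<exists>a'. (a', b') \<in> set bl \<and> a' \<le> p})" for y
        using that ab(3) by force
    qed (use fin in \<open>auto simp: max_def\<close>)
    finally show ?thesis unfolding S .
  next
    case False
    then have "{b'. \<exists>a'. (a', b') \<in> set (x # bl) \<and> a' \<le> p} = {b'. \<exists>a'. (a', b') \<in> set bl \<and> a' \<le> p}"
      using x by auto
    then show ?thesis using False Cons.IH[OF ab(2)] x by (simp add: word_map_block)
  qed
qed simp

lemma nf_blocks_mono:
  assumes nb: "nf_blocks n bl" and "(a, b) \<in> set bl" "(a', b') \<in> set bl"
  shows "a < a' \<longleftrightarrow> b < b'"
proof -
  obtain s where s: "s < length bl" "bl ! s = (a, b)"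
    using assms(2) in_set_conv_nth[of "(a, b)" bl] by blast
  obtain t where t: "t < length bl" "bl ! t = (a', b')"
    using assms(3) in_set_conv_nth[of "(a', b')" bl] by blast
  have "sorted_wrt (\<lambda>(a, b) (a', b'). a' < a \<and> b' < b) bl" using nb by (simp add: nf_blocks_def)
  note * = sorted_wrt_nth_less[OF this]
  consider "s < t" | "s = t" | "t < s" by linarith
  then show ?thesis using *[of s t] *[of t s] s t by cases auto
qed

text \<open>The blocks are the strict records of the map: \<open>(a, b)\<close> is a block exactly
  if \<open>a\<close> is moved up to \<open>b\<close> and every smaller place stays below
  \<open>b\<close>. So the map determines the set of blocks, and the order of the list is forced by
  the decreasing first components.\<close>

lemma nf_blocks_unique:
  assumes "nf_blocks n bl" "nf_blocks n bl'"
    and "\<forall>p\<in>{1..n+1}. word_map (nf_word bl) p = word_map (nf_word bl') p"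
  shows "bl = bl'"
proof -
  have jump: "(a, b) \<in> set bl \<longleftrightarrow> a \<in> {1..n+1} \<and> word_map (nf_word bl) a = b \<and> b > a \<and>
      (\<forall>p\<in>{1..n+1}. p < a \<longrightarrow> word_map (nf_word bl) p < b)" if nb: "nf_blocks n bl" for bl a b
  proof -
    have fin: "finite (insert p {b. \<exists>a. (a, b) \<in> set bl \<and> a \<le> p})" for p
    proof (rule finite_subset)
      show "insert p {b. \<exists>a. (a, b) \<in> set bl \<and> a \<le> p} \<subseteq> insert p (snd ` set bl)"
        by (auto intro: rev_image_eqI)
    qed simp
    note mono = nf_blocks_mono[OF nb]
    have bnd: "1 \<le> a'" "a' < b'" "b' \<le> n + 1" if "(a', b') \<in> set bl" for a' b'
      using that nb by (auto simp: nf_blocks_def)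
    show ?thesis
    proof
      assume ab: "(a, b) \<in> set bl"
      have 1: "word_map (nf_word bl) a = b"
        unfolding word_map_nf[OF nb]
      proof (intro Max_eqI)
        fix y assume y: "y \<in> insert a {b. \<exists>a'. (a', b) \<in> set bl \<and> a' \<le> a}"
        then consider "y = a" | a' where "(a', y) \<in> set bl" "a' \<le> a" by blast
        then show "y \<le> b"
        proof cases
          case 2
          then show ?thesis using mono[OF ab 2(1)] by simp
        qed (use bnd[OF ab] in simp)
      qed (use ab fin in auto)
      have 2: "word_map (nf_word bl) p < b" if "p < a" for p
      proof -
        have "word_map (nf_word bl) p \<in> insert p {b. \<exists>a. (a, b) \<in> set bl \<and> a \<le> p}"
          unfolding word_map_nf[OF nb] using fin by (intro Max_in) auto
        then consider "word_map (nf_word bl) p = p" | a' where "(a', word_map (nf_word bl) p) \<in> set bl" "a' \<le> p"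
          by blast
        then show ?thesis
        proof cases
          case 2
          then show ?thesis using mono[OF 2(1) ab] that by simp
        qed (use that bnd[OF ab] in simp)
      qed
      show "a \<in> {1..n+1} \<and> word_map (nf_word bl) a = b \<and> b > a \<and>
          (\<forall>p\<in>{1..n+1}. p < a \<longrightarrow> word_map (nf_word bl) p < b)"
        using 1 2 bnd[OF ab] by auto
    next
      assume A: "a \<in> {1..n+1} \<and> word_map (nf_word bl) a = b \<and> b > a \<and>
          (\<forall>p\<in>{1..n+1}. p < a \<longrightarrow> word_map (nf_word bl) p < b)"
      have "word_map (nf_word bl) a \<in> insert a {b. \<exists>a'. (a', b) \<in> set bl \<and> a' \<le> a}"
        unfolding word_map_nf[OF nb] using fin by (intro Max_in) auto
      then obtain a' where a': "(a', b) \<in> set bl" "a' \<le> a" using A by auto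
      have "b \<le> word_map (nf_word bl) a'"
        unfolding word_map_nf[OF nb] using fin a' by (intro Max_ge) auto
      then have "\<not> a' < a" using A bnd[OF a'(1)] by force
      then show "(a, b) \<in> set bl" using a' by simp
    qed
  qed
  have "(a, b) \<in> set bl \<longleftrightarrow> (a, b) \<in> set bl'" for a b
    unfolding jump[OF assms(1)] jump[OF assms(2)] using assms(3) by auto
  then have "set bl = set bl'" by auto
  moreover have "sorted_wrt (\<lambda>x y. fst y < fst x) bl" "sorted_wrt (\<lambda>x y. fst y < fst x) bl'"
    using assms(1,2) unfolding nf_blocks_def by (auto elim!: sorted_wrt_mono_rel[rotated])
  \<comment> \<open>A strictly decreasing list is determined by its set: the heads are the
    maxima.\<close>
  moreover have "xs = ys" if "set xs = set ys" "sorted_wrt (\<lambda>x y. fst y < fst x) xs"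
    "sorted_wrt (\<lambda>x y. fst y < fst x) ys" for xs ys :: "(nat \<times> nat) list"
    using that
  proof (induction xs arbitrary: ys)
    case (Cons x xs)
    then obtain y ys' where ys: "ys = y # ys'" by (cases ys) auto
    have "x = y"
    proof (rule ccontr)
      assume "x \<noteq> y"
      then have "x \<in> set ys'" "y \<in> set xs" using Cons.prems(1) ys by auto
      then show False using Cons.prems(2,3) ys by fastforce
    qed
    moreover have "x \<notin> set xs" "y \<notin> set ys'" using Cons.prems ys by auto
    ultimately have "set xs = set ys'" using Cons.prems(1) ys by (metis insert_ident list.simps(15))
    then show ?case using Cons.IH[of ys'] Cons.prems ys \<open>x = y\<close> by auto
  qed simp
  ultimately show ?thesis by blast
qed

text \<open>A block carries \<open>a\<close> to \<open>b\<close> and lowers the places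
  \<open>a + 1\<close> to \<open>b\<close> by one. The strand at \<open>b\<close> is out of reach of
  the later blocks, and a lowered strand sits at or above \<open>a\<close>, where no later block
  starts. Hence exactly the starts of blocks are exceedances.\<close>

lemma word_perm_nf:
  "nf_blocks n bl \<Longrightarrow> (\<forall>(a, b)\<in>set bl. word_perm (nf_word bl) a = b) \<and>
     (\<forall>p. p \<notin> fst ` set bl \<longrightarrow> word_perm (nf_word bl) p \<le> p)"
proof (induction bl)
  case (Cons x bl)
  obtain a b where x: "x = (a, b)" by force
  have ab: "a < b" "nf_blocks n bl" "\<forall>(a', b')\<in>set bl. a' < a \<and> b' < b"
    using Cons.prems x by (auto simp: nf_blocks_Cons)
  note IH = Cons.IH[OF ab(2)]
  have 1: "word_perm (nf_word (x # bl)) a = b"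
    using ab word_perm_nf_above[OF ab(2), of b] by (auto simp: x word_perm_block)
  have 2: "word_perm (nf_word (x # bl)) a' = b'" if "(a', b') \<in> set bl" for a' b'
    using that ab IH by (auto simp: x word_perm_block)
  have 3: "word_perm (nf_word (x # bl)) p \<le> p" if "p \<noteq> a" "p \<notin> fst ` set bl" for p
  proof (cases "a < p \<and> p \<le> b")
    case True
    \<comment> \<open>\<open>p - 1\<close> is at least \<open>a\<close>, hence larger than the
      starts of all later blocks.\<close>
    have "p - 1 \<notin> fst ` set bl" using True ab(3) by force
    then have "word_perm (nf_word bl) (p - 1) \<le> p - 1" using IH by blast
    then show ?thesis using True ab by (simp add: x word_perm_block)
  next
    case False
    then show ?thesis using that IH ab by (auto simp: x word_perm_block)
  qed
  show ?case using 1 2 3 by (auto simp: x)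
qed simp

text \<open>The starts of blocks form one colour class and the other places a second one. The second
  part says that only strands of different colours cross, so no three strands can cross
  pairwise.\<close>

lemma word_cross_nf:
  "nf_blocks n bl \<Longrightarrow> k \<noteq> l \<Longrightarrow> word_cross (nf_word bl) k l \<le> 1 \<and>
     (word_cross (nf_word bl) k l \<noteq> 0 \<longrightarrow> (k \<in> fst ` set bl) \<noteq> (l \<in> fst ` set bl))"
proof (induction bl arbitrary: k l)
  case (Cons x bl)
  obtain a b where x: "x = (a, b)" by force
  have ab: "a < b" "nf_blocks n bl" "\<forall>(a', b')\<in>set bl. a' < a \<and> b' < b"
    using Cons.prems x by (auto simp: nf_blocks_Cons)
  have a: "q \<notin> fst ` set bl" if "q \<ge> a" for q using ab(3) that by force
  let ?k = "word_perm [a..<b] k" and ?l = "word_perm [a..<b] l"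
  have ne: "?k \<noteq> ?l" using ab \<open>k \<noteq> l\<close> by (auto simp: word_perm_block split: if_splits)
  have eq: "word_cross (nf_word (x # bl)) k l = word_cross [a..<b] k l + word_cross (nf_word bl) ?k ?l"
    by (simp add: x word_cross_append)
  consider (ka) "k = a" | (la) "l = a" | (no) "k \<noteq> a" "l \<noteq> a" by blast
  then show ?case
  proof cases
    case ka
    then have "?k = b" using ab by (simp add: word_perm_block)
    then have "word_cross (nf_word bl) ?k ?l = 0" using word_cross_nf_above[OF ab(2) ne] ab(3) by auto
    then show ?thesis using ka ab a[of l] \<open>k \<noteq> l\<close> unfolding eq by (auto simp: word_cross_block x)
  next
    case la
    then have "?l = b" using ab by (simp add: word_perm_block)
    then have "word_cross (nf_word bl) ?k ?l = 0"
      using word_cross_nf_above[OF ab(2) ne[symmetric]] ab(3) by auto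
    then show ?thesis using la ab a[of k] \<open>k \<noteq> l\<close> unfolding eq by (auto simp: word_cross_block x)
  next
    case no
    \<comment> \<open>Colours are compatible with the first block: places below \<open>a\<close> are
      not moved, and places above \<open>a\<close> stay at or above \<open>a\<close>, where neither
      the old nor the new place is the start of a later block.\<close>
    have P: "word_perm [a..<b] q \<in> fst ` set bl \<longleftrightarrow> q \<in> fst ` set (x # bl)" if "q \<noteq> a" for q
    proof (cases "q < a")
      case True
      then show ?thesis using ab that by (simp add: word_perm_block x)
    next
      case False
      then have "a \<le> word_perm [a..<b] q" "a \<le> q" using ab that by (auto simp: word_perm_block)
      then show ?thesis using a that by (auto simp: x)
    qed
    have "word_cross [a..<b] k l = 0" using no ab \<open>k \<noteq> l\<close> by (simp add: word_cross_block)
    then show ?thesis unfolding eq using Cons.IH[OF ab(2) ne] P[OF no(1)] P[OF no(2)] by simp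
  qed
qed simp

text \<open>Blocks are listed from the largest to the smallest, the sequences in \<open>II\<close>
  increase; hence the reversal.\<close>

definition nf_pair :: "(nat \<times> nat) list \<Rightarrow> nat list \<times> nat list" where
  "nf_pair bl = (rev (map fst bl), rev (map snd bl))"

lemma rho_nf:
  assumes nb: "nf_blocks n bl" and s: "\<And>k. k \<in> {1..n+1} \<Longrightarrow> s k = word_perm (nf_word bl) k"
  shows "rho n s = nf_pair bl"
proof -
  have bnd: "1 \<le> a" "a < b" "b \<le> n + 1" if "(a, b) \<in> set bl" for a b
    using that nb by (auto simp: nf_blocks_def)
  have "{i\<in>{1..n+1}. s i > i} = fst ` set bl"
  proof (intro Set.set_eqI iffI)
    fix i assume i: "i \<in> {i\<in>{1..n+1}. s i > i}"
    show "i \<in> fst ` set bl"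
    proof (rule ccontr)
      assume "i \<notin> fst ` set bl"
      then have "s i \<le> i" using word_perm_nf[OF nb] s[of i] i by auto
      then show False using i by auto
    qed
  next
    fix i assume "i \<in> fst ` set bl"
    then obtain b where ib: "(i, b) \<in> set bl" by force
    have "word_perm (nf_word bl) i = b" using ib word_perm_nf[OF nb] by fastforce
    then show "i \<in> {i\<in>{1..n+1}. s i > i}" using s[of i] bnd[OF ib] by auto
  qed
  also have "\<dots> = set (rev (map fst bl))" by simp
  finally have A: "{i\<in>{1..n+1}. s i > i} = set (rev (map fst bl))" .
  have "sorted_wrt (\<lambda>x y. fst y < fst x) bl"
    using nb unfolding nf_blocks_def by (auto elim!: sorted_wrt_mono_rel[rotated])
  then have "sorted_wrt (<) (rev (map fst bl))"
    by (simp add: sorted_wrt_rev sorted_wrt_map)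
  then have B: "sorted_list_of_set {i\<in>{1..n+1}. s i > i} = rev (map fst bl)"
    unfolding A by (metis sorted_list_of_set.idem_if_sorted_distinct strict_sorted_iff)
  have "map s (map fst bl) = map snd bl"
  proof -
    have "s (fst x) = snd x" if x: "x \<in> set bl" for x
    proof -
      have "(fst x, snd x) \<in> set bl" using x by simp
      then have "word_perm (nf_word bl) (fst x) = snd x" "fst x \<in> {1..n+1}"
        using word_perm_nf[OF nb] bnd[of "fst x" "snd x"] by fastforce+
      then show ?thesis using s by simp
    qed
    then show ?thesis by simp
  qed
  then show ?thesis unfolding rho_def B nf_pair_def Let_def rev_map[symmetric] by simp
qed

lemma nf_pair_II: "nf_pair ` {bl. nf_blocks n bl} = II n"
proof (intro Set.set_eqI iffI)
  fix x assume "x \<in> nf_pair ` {bl. nf_blocks n bl}"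
  then obtain bl where x: "x = nf_pair bl" and nb: "nf_blocks n bl" by auto
  have s: "sorted_wrt (\<lambda>x y. fst y < fst x) bl" "sorted_wrt (\<lambda>x y. snd y < snd x) bl"
    using nb unfolding nf_blocks_def by (auto elim!: sorted_wrt_mono_rel[rotated])
  have bnd: "1 \<le> a" "a < b" "b \<le> n + 1" if "(a, b) \<in> set bl" for a b
    using that nb by (auto simp: nf_blocks_def)
  have sl: "sorted_wrt (<) (rev (map fst bl))" "sorted_wrt (<) (rev (map snd bl))"
    using s by (simp_all add: sorted_wrt_rev sorted_wrt_map)
  have "distinct (rev (map fst bl))" using sl(1) strict_sorted_iff by blast
  then have "length bl = card (set (rev (map fst bl)))" using distinct_card by fastforce
  \<comment> \<open>Each start lies below an end that is at most \<open>n + 1\<close>, so the starts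
    are distinct elements of \<open>{1..n}\<close>; this is the bound on the length in
    \<open>II\<close>.\<close>
  also have "\<dots> \<le> card {1..n}" using bnd by (intro card_mono) fastforce+
  finally have len: "length bl \<le> n" by simp
  have lt: "rev (map fst bl) ! t < rev (map snd bl) ! t" if "t < length bl" for t
    using that bnd[of "fst (bl ! (length bl - Suc t))" "snd (bl ! (length bl - Suc t))"]
    by (simp add: rev_nth)
  show "x \<in> II n" unfolding x nf_pair_def II_def using sl len lt bnd by fastforce
next
  fix x assume "x \<in> II n"
  then obtain a b where x: "x = (a, b)" and ab: "length a = length b" "length a \<le> n"
     "sorted_wrt (<) a" "sorted_wrt (<) b" "\<forall>x\<in>set a. 1 \<le> x" "\<forall>x\<in>set b. x \<le> n + 1"
     "\<forall>t<length a. a ! t < b ! t" unfolding II_def by auto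
  define bl where "bl = rev (zip a b)"
  have "sorted_wrt (\<lambda>(a, b) (a', b'). a' < a \<and> b' < b) bl"
    unfolding bl_def sorted_wrt_rev using ab(1,3,4) by (auto simp: sorted_wrt_iff_nth_less)
  moreover have "\<forall>(a, b)\<in>set bl. 1 \<le> a \<and> a < b \<and> b \<le> n + 1"
  proof -
    have "1 \<le> a ! i \<and> a ! i < b ! i \<and> b ! i \<le> n + 1" if "i < length a" for i
      using that ab by auto
    then show ?thesis using ab(1) by (auto simp: bl_def in_set_zip)
  qed
  ultimately have "nf_blocks n bl" by (simp add: nf_blocks_def)
  moreover have "nf_pair bl = x" using ab(1) by (simp add: nf_pair_def bl_def x rev_map)
  ultimately show "x \<in> nf_pair ` {bl. nf_blocks n bl}" by blast
qed

lemma inj_nf_pair: "nf_pair bl = nf_pair bl' \<Longrightarrow> bl = bl'"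
  by (simp add: nf_pair_def) (metis zip_map_fst_snd)

subsection \<open>The monoid presentation\<close>

lemma L_relation_set: "L_relation n l r \<Longrightarrow> set l \<subseteq> {1..n} \<and> set r \<subseteq> {1..n}"
  by (induction rule: L_relation.induct) auto

lemma L_step_set: "L_step n w w' \<Longrightarrow> set w \<subseteq> {1..n} \<longleftrightarrow> set w' \<subseteq> {1..n}"
  unfolding L_step_def using L_relation_set by fastforce

text \<open>Both sides of each relation act equally on places. In particular the words
  \<open>i (i+1)\<close>, \<open>i (i+1) i\<close> and \<open>(i+1) i (i+1)\<close> all send
  \<open>i\<close> and \<open>i + 1\<close> to \<open>i + 2\<close> and fix the rest.\<close>

lemma L_step_word_map: "L_step n w w' \<Longrightarrow> word_map w k = word_map w' k"
proof -
  have "L_relation n l r \<Longrightarrow> word_map l k = word_map r k" for l r k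
    by (induction rule: L_relation.induct) (auto simp: push_at_def)
  then show "L_step n w w' \<Longrightarrow> word_map w k = word_map w' k"
    unfolding L_step_def by auto
qed

lemma L_rel_equiv: "equiv UNIV (L_rel n)"
  unfolding L_rel_def
  by (intro equivI) (auto simp: refl_on_def sym_def trans_def intro: equivclp_sym equivclp_trans)

lemma L_rel_inv:
  assumes "(w, w') \<in> L_rel n"
  shows "(set w \<subseteq> {1..n} \<longleftrightarrow> set w' \<subseteq> {1..n}) \<and> (\<forall>k. word_map w k = word_map w' k)"
proof -
  have "equivclp (L_step n) w w'" using assms by (simp add: L_rel_def)
  then show ?thesis
  proof (induction rule: equivclp_induct)
    case (step y z)
    then show ?case using L_step_set[of n y z] L_step_set[of n z y] L_step_word_map[of n y z]
      L_step_word_map[of n z y] by auto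
  qed simp
qed

lemma comm_eq_L_rel: "comm_eq w w' \<Longrightarrow> set w \<subseteq> {1..n} \<Longrightarrow> (w, w') \<in> L_rel n"
proof (induction rule: rtranclp_induct)
  case base
  then show ?case by (simp add: L_rel_def)
next
  case (step y z)
  have "set y \<subseteq> {1..n}" using comm_eq_set[OF step(1)] step.prems by simp
  moreover obtain u v i j where "\<bar>int i - int j\<bar> > 1" "y = u @ [i, j] @ v" "z = u @ [j, i] @ v"
    using step(2) unfolding comm_step_def by blast
  moreover from calculation have "L_relation n [i, j] [j, i]" by (intro L_relation.comm) auto
  ultimately have "L_step n y z" unfolding L_step_def by blast
  then show ?case using step unfolding L_rel_def
    by (simp add: equivclp_trans r_into_equivclp)
qed

text \<open>Each reducible factor is the longer side of a defining relation, so rewriting modulo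
  commutations shortens the word until it is irreducible.\<close>

lemma L_rel_normal_form:
  "set w \<subseteq> {1..n} \<Longrightarrow> \<exists>bl. nf_blocks n bl \<and> (w, nf_word bl) \<in> L_rel n"
proof (induction "length w" arbitrary: w rule: less_induct)
  case less
  show ?case
  proof (cases "irred w")
    case True
    then show ?thesis using irred_normal_form[OF True less.prems] comm_eq_L_rel[OF _ less.prems] by blast
  next
    case False
    then obtain u l v where l: "comm_eq w (u @ l @ v)" "reducible_factor l" unfolding irred_def by blast
    have sl: "set l \<subseteq> {1..n}" using comm_eq_set[OF l(1)] less.prems by auto
    obtain i where "l = [i, i] \<or> l = [i, i + 1, i] \<or> l = [i + 1, i, i + 1]"
      using l(2) unfolding reducible_factor_def by blast
    then have "\<exists>r. L_relation n l r \<and> length r < length l"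
    proof (elim disjE)
      assume "l = [i, i]"
      then show ?thesis using L_relation.idem[of i n] sl by (intro exI[of _ "[i]"]) auto
    next
      assume "l = [i, i + 1, i]"
      then show ?thesis using L_relation.braid_left[of i n] sl by (intro exI[of _ "[i, i + 1]"]) auto
    next
      assume "l = [i + 1, i, i + 1]"
      then show ?thesis using L_relation.braid_right[of i n] sl by (intro exI[of _ "[i, i + 1]"]) auto
    qed
    then obtain r where r: "L_relation n l r" "length r < length l" by blast
    have step: "L_step n (u @ l @ v) (u @ r @ v)" unfolding L_step_def using r by blast
    have "set (u @ r @ v) \<subseteq> {1..n}"
      using L_step_set[OF step] comm_eq_set[OF l(1)] less.prems by blast
    moreover have "length (u @ r @ v) < length w" using comm_eq_length[OF l(1)] r(2) by simp
    ultimately obtain bl where "nf_blocks n bl" "(u @ r @ v, nf_word bl) \<in> L_rel n"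
      using less.hyps by blast
    moreover have "(w, u @ r @ v) \<in> L_rel n"
      using comm_eq_L_rel[OF l(1) less.prems] step unfolding L_rel_def
      by (auto intro: equivclp_trans)
    ultimately show ?thesis unfolding L_rel_def by (auto intro: equivclp_trans)
  qed
qed

lemma L_rel_iff:
  assumes "set w \<subseteq> {1..n}" "set w' \<subseteq> {1..n}"
  shows "(w, w') \<in> L_rel n \<longleftrightarrow> (\<forall>k\<in>{1..n+1}. word_map w k = word_map w' k)"
proof
  assume "(w, w') \<in> L_rel n"
  then show "\<forall>k\<in>{1..n+1}. word_map w k = word_map w' k" using L_rel_inv by blast
next
  assume eq: "\<forall>k\<in>{1..n+1}. word_map w k = word_map w' k"
  obtain bl bl' where bl: "nf_blocks n bl" "(w, nf_word bl) \<in> L_rel n"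
    and bl': "nf_blocks n bl'" "(w', nf_word bl') \<in> L_rel n"
    using L_rel_normal_form assms by metis
  have "bl = bl'" using nf_blocks_unique[OF bl(1) bl'(1)] eq L_rel_inv[OF bl(2)] L_rel_inv[OF bl'(2)] by simp
  then show "(w, w') \<in> L_rel n" using bl(2) bl'(2) unfolding L_rel_def
    by (auto intro: equivclp_trans equivclp_sym)
qed

section \<open>Strands as graphs over the height\<close>

text \<open>Crossing depends only on the signs of the difference on both sides of the point, so it
  survives any change of the functions that keeps these signs, up to an increasing continuous change
  of height. All later checks of transversality for transformed diagrams reduce to this.\<close>

lemma crosses_at_transfer:
  fixes f g f' g' \<phi> :: "real \<Rightarrow> real"
  assumes cr: "crosses_at f g (\<phi> y)" and y: "l < y" "y < r"
    and cont: "continuous_on {l<..<r} \<phi>"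
    and mono: "\<And>u v. l < u \<Longrightarrow> u < v \<Longrightarrow> v < r \<Longrightarrow> \<phi> u < \<phi> v"
    and sg: "\<And>u. l < u \<Longrightarrow> u < r \<Longrightarrow> sgn (f' u - g' u) = sgn (f (\<phi> u) - g (\<phi> u))"
  shows "crosses_at f' g' y"
proof -
  obtain e where e: "e > 0" "\<And>u v. u \<in> {\<phi> y - e<..<\<phi> y} \<Longrightarrow> v \<in> {\<phi> y<..<\<phi> y + e} \<Longrightarrow>
      (f u - g u) * (f v - g v) < 0" and eq: "f (\<phi> y) = g (\<phi> y)"
    using cr unfolding crosses_at_def by blast
  have "isCont \<phi> y" using cont y by (simp add: continuous_on_eq_continuous_at)
  then obtain d where d: "d > 0" "\<And>u. \<bar>u - y\<bar> < d \<Longrightarrow> \<bar>\<phi> u - \<phi> y\<bar> < e"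
    using e(1) unfolding continuous_at_eps_delta dist_real_def by meson
  define d' where "d' = min d (min (y - l) (r - y))"
  have d': "d' > 0" "d' \<le> d" "d' \<le> y - l" "d' \<le> r - y" using d(1) y by (auto simp: d'_def)
  have "f' y = g' y" using sg[of y] y eq by (simp add: sgn_eq_0_iff)
  moreover have "(f' u - g' u) * (f' v - g' v) < 0"
    if "u \<in> {y - d'<..<y}" "v \<in> {y<..<y + d'}" for u v
  proof -
    have uv: "l < u" "u < y" "y < v" "v < r" "\<bar>u - y\<bar> < d" "\<bar>v - y\<bar> < d" using that d' by auto
    have "\<phi> u \<in> {\<phi> y - e<..<\<phi> y}" using mono[of u y] d(2)[of u] uv y by auto
    moreover have "\<phi> v \<in> {\<phi> y<..<\<phi> y + e}" using mono[of y v] d(2)[of v] uv y by auto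
    ultimately have "(f (\<phi> u) - g (\<phi> u)) * (f (\<phi> v) - g (\<phi> v)) < 0" by (rule e(2))
    then have "sgn (f' u - g' u) * sgn (f' v - g' v) < 0"
      using sg[of u] sg[of v] uv y by (simp flip: sgn_mult)
    then show ?thesis by (simp flip: sgn_mult)
  qed
  ultimately show ?thesis unfolding crosses_at_def using d'(1) by blast
qed

text \<open>If the value dropped from \<open>s\<close> to \<open>t\<close>, the intermediate value
  theorem on \<open>{0..s}\<close> would give a second point with the value at \<open>t\<close>,
  against injectivity.\<close>

lemma increasing_on_unit:
  fixes \<phi> :: "real \<Rightarrow> real"
  assumes "continuous_on {0..1} \<phi>" "inj_on \<phi> {0..1}" "\<phi> 0 = 0" "\<And>s. s \<in> {0..1} \<Longrightarrow> 0 \<le> \<phi> s"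
    and "0 \<le> s" "s < t" "t \<le> 1"
  shows "\<phi> s < \<phi> t"
proof (rule ccontr)
  assume "\<not> \<phi> s < \<phi> t"
  then have "\<phi> t \<le> \<phi> s" by simp
  moreover have "continuous_on {0..s} \<phi>" using assms by (intro continuous_on_subset[OF assms(1)]) auto
  moreover have "\<phi> 0 \<le> \<phi> t" using assms(3) assms(4)[of t] assms(5-7) by simp
  ultimately obtain x where x: "0 \<le> x" "x \<le> s" "\<phi> x = \<phi> t"
    using IVT'[of \<phi> 0 "\<phi> t" s] assms(5) by blast
  have "x \<in> {0..1}" "t \<in> {0..1}" using x assms(5-7) by auto
  then have "x = t" using inj_onD[OF assms(2) x(3)] by blast
  then show False using x(2) assms(6) by simp
qed

section \<open>Single strands and families of strands\<close>

definition strand_ok :: "nat \<Rightarrow> (real \<Rightarrow> real \<times> real) \<Rightarrow> bool" where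
  "strand_ok n \<gamma> \<longleftrightarrow> continuous_on {0..1} \<gamma> \<and> bij_betw (snd \<circ> \<gamma>) {0..1} {0..1} \<and>
     (\<exists>k\<in>{1..n+1}. \<exists>l\<in>{1..n+1}. \<gamma> 0 = (real k, 0) \<and> \<gamma> 1 = (real l, 1))"

lemma strand_ok_height:
  assumes "strand_ok n \<gamma>" "s \<in> {0..1}"
  shows "snd (\<gamma> s) \<in> {0..1}"
  using assms unfolding strand_ok_def bij_betw_def by auto

lemma strand_ok_inj: "strand_ok n \<gamma> \<Longrightarrow> s \<in> {0..1} \<Longrightarrow> t \<in> {0..1} \<Longrightarrow> snd (\<gamma> s) = snd (\<gamma> t) \<Longrightarrow> s = t"
  unfolding strand_ok_def bij_betw_def inj_on_def by auto

lemma strand_ok_surj: "strand_ok n \<gamma> \<Longrightarrow> y \<in> {0..1} \<Longrightarrow> \<exists>s\<in>{0..1}. snd (\<gamma> s) = y"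
  unfolding strand_ok_def bij_betw_def by (metis comp_apply imageE)

lemma strand_ok_mono:
  assumes "strand_ok n \<gamma>" "0 \<le> s" "s < t" "t \<le> 1"
  shows "snd (\<gamma> s) < snd (\<gamma> t)"
proof -
  have "(snd \<circ> \<gamma>) s < (snd \<circ> \<gamma>) t"
  proof (rule increasing_on_unit[of "snd \<circ> \<gamma>"])
    show "continuous_on {0..1} (snd \<circ> \<gamma>)"
      using assms(1) unfolding strand_ok_def comp_def by (intro continuous_intros) auto
    show "inj_on (snd \<circ> \<gamma>) {0..1}" using assms(1) unfolding strand_ok_def bij_betw_def by blast
    show "(snd \<circ> \<gamma>) 0 = 0" using assms(1) unfolding strand_ok_def by auto
    show "0 \<le> (snd \<circ> \<gamma>) s" if "s \<in> {0..1}" for s using strand_ok_height[OF assms(1) that] by simp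
  qed (use assms in auto)
  then show ?thesis by simp
qed

lemma strand_x_iff:
  assumes "strand_ok n (D i)" "y \<in> {0..1}"
  shows "(x, y) \<in> strand D i \<longleftrightarrow> x = strand_x D i y"
proof -
  obtain s where s: "s \<in> {0..1}" "snd (D i s) = y" using strand_ok_surj assms by blast
  have uniq: "x = fst (D i s)" if x: "(x, y) \<in> strand D i" for x
  proof -
    obtain t where t: "t \<in> {0..1}" "(x, y) = D i t" using x unfolding strand_def by blast
    then have "t = s" using strand_ok_inj[OF assms(1) t(1) s(1)] s(2) by (metis snd_conv)
    then show ?thesis using t(2) by (metis fst_conv)
  qed
  have mem: "(fst (D i s), y) \<in> strand D i" using s unfolding strand_def by (metis imageI prod.collapse)
  have "strand_x D i y = fst (D i s)"
    unfolding strand_x_def using mem uniq by (rule the_equality)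
  then show ?thesis using mem uniq[of x] by metis
qed

lemma strand_height:
  assumes "strand_ok n (D i)" "p \<in> strand D i"
  shows "snd p \<in> {0..1}"
  using assms strand_ok_height unfolding strand_def by fastforce

lemma strand_eq_graph:
  assumes "strand_ok n (D i)"
  shows "strand D i = arc_graph 0 1 (strand_x D i)"
proof (intro Set.set_eqI iffI)
  fix p assume p: "p \<in> strand D i"
  have "snd p \<in> {0..1}" using strand_height[OF assms p] .
  then show "p \<in> arc_graph 0 1 (strand_x D i)"
    using strand_x_iff[of n D i, OF assms, of "snd p" "fst p"] p unfolding arc_graph_def
    by (metis (no_types, lifting) imageI prod.collapse)
next
  fix p assume "p \<in> arc_graph 0 1 (strand_x D i)"
  then show "p \<in> strand D i" using strand_x_iff[of n D i, OF assms] unfolding arc_graph_def by auto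
qed

lemma strand_xI:
  assumes "strand D i = arc_graph 0 1 g" "y \<in> {0..1}"
  shows "strand_x D i y = g y"
  unfolding strand_x_def assms(1) using assms(2) by (intro the_equality) (auto simp: arc_graph_def)

lemma strand_x_param:
  assumes "strand_ok n (D i)" "s \<in> {0..1}"
  shows "strand_x D i (snd (D i s)) = fst (D i s)"
proof -
  have "(fst (D i s), snd (D i s)) \<in> strand D i" using assms(2) by (simp add: strand_def)
  then show ?thesis using strand_x_iff[of n D i, OF assms(1) strand_ok_height[OF assms]] by metis
qed

lemma strand_x_endpoints:
  assumes "strand_ok n (D i)"
  shows "strand_x D i 0 = fst (D i 0)" "strand_x D i 1 = fst (D i 1)"
    "D i 0 = (strand_x D i 0, 0)" "D i 1 = (strand_x D i 1, 1)"
proof -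
  have h: "snd (D i 0) = 0" "snd (D i 1) = 1" using assms unfolding strand_ok_def by auto
  show e: "strand_x D i 0 = fst (D i 0)" "strand_x D i 1 = fst (D i 1)"
    using strand_x_param[of n D i, OF assms, of 0] strand_x_param[of n D i, OF assms, of 1] h by auto
  show "D i 0 = (strand_x D i 0, 0)" "D i 1 = (strand_x D i 1, 1)"
    using h e by (simp_all add: prod_eq_iff)
qed

text \<open>The height along the strand is a continuous bijection of a compact interval, so its
  inverse is continuous; \<open>strand_x\<close> is the abscissa composed with this inverse.\<close>

lemma continuous_strand_x:
  assumes "strand_ok n (D i)"
  shows "continuous_on {0..1} (strand_x D i)"
proof -
  define q where "q = inv_into {0..1} (snd \<circ> D i)"
  have bij: "bij_betw (snd \<circ> D i) {0..1} {0..1}" and cD: "continuous_on {0..1} (D i)"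
    using assms unfolding strand_ok_def by auto
  have "continuous_on ((snd \<circ> D i) ` {0..1}) q"
  proof (rule continuous_on_inv)
    show "continuous_on {0..1} (snd \<circ> D i)" unfolding comp_def by (intro continuous_intros cD)
    show "\<forall>x\<in>{0..1}. q ((snd \<circ> D i) x) = x"
      unfolding q_def using bij_betw_inv_into_left[OF bij] by blast
  qed simp
  then have cq: "continuous_on {0..1} q" using bij by (simp add: bij_betw_def)
  have q: "q y \<in> {0..1}" "snd (D i (q y)) = y" if "y \<in> {0..1}" for y
  proof -
    have "y \<in> (snd \<circ> D i) ` {0..1}" using that bij unfolding bij_betw_def by blast
    then show "q y \<in> {0..1}" "snd (D i (q y)) = y"
      unfolding q_def using inv_into_into[of y "snd \<circ> D i" "{0..1}"] f_inv_into_f[of y "snd \<circ> D i" "{0..1}"]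
      by simp_all
  qed
  have "continuous_on {0..1} (\<lambda>y. fst (D i (q y)))"
    by (intro continuous_on_fst continuous_on_compose2[OF cD cq] image_subsetI q(1))
  then show ?thesis
  proof (rule continuous_on_eq)
    fix y :: real assume y: "y \<in> {0..1}"
    show "fst (D i (q y)) = strand_x D i y"
      using strand_x_param[of n D i, OF assms q(1)[OF y]] q(2)[OF y] by simp
  qed
qed

text \<open>The conditions of \<open>ndiagram\<close> on several strands involve only the functions
  \<open>strand_x D i\<close>. Stating them for arbitrary families allows strands to be renumbered
  and transformed without constructing parametrizations.\<close>

definition crossing_family :: "nat \<Rightarrow> (nat \<Rightarrow> real \<Rightarrow> real) \<Rightarrow> bool" where
  "crossing_family n f \<longleftrightarrow>
     finite {y\<in>{0..1}. \<exists>i\<in>{1..n+1}. \<exists>j\<in>{1..n+1}. i \<noteq> j \<and> f i y = f j y} \<and>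
     (\<forall>i\<in>{1..n+1}. \<forall>j\<in>{1..n+1}. \<forall>y\<in>{0..1}. i \<noteq> j \<longrightarrow> f i y = f j y \<longrightarrow>
        0 < y \<and> y < 1 \<and> crosses_at (f i) (f j) y \<and> (\<forall>k\<in>{1..n+1}. f k y = f i y \<longrightarrow> k = i \<or> k = j))"

lemma double_points_iff:
  assumes "\<forall>i\<in>{1..n+1}. strand_ok n (D i)"
  shows "(x, y) \<in> double_points n D \<longleftrightarrow> y \<in> {0..1} \<and>
    (\<exists>i\<in>{1..n+1}. \<exists>j\<in>{1..n+1}. i \<noteq> j \<and> x = strand_x D i y \<and> strand_x D i y = strand_x D j y)"
proof -
  have *: "(x, y) \<in> strand D i \<longleftrightarrow> y \<in> {0..1} \<and> x = strand_x D i y" if "i \<in> {1..n+1}" for i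
  proof (cases "y \<in> {0..1}")
    case True
    then show ?thesis using strand_x_iff[of n D i y x] assms that by simp
  next
    case False
    then show ?thesis using strand_height[of n D i "(x, y)"] assms that by auto
  qed
  show ?thesis unfolding double_points_def using * by auto
qed

lemma ndiagram_iff:
  "ndiagram n D \<longleftrightarrow> (\<forall>i\<in>{1..n+1}. strand_ok n (D i)) \<and> crossing_family n (strand_x D)"
proof (cases "\<forall>i\<in>{1..n+1}. strand_ok n (D i)")
  case False
  then show ?thesis unfolding ndiagram_def strand_ok_def by blast
next
  case ok: True
  let ?N = "{1..n+1}" and ?f = "strand_x D"
  let ?Y = "{y\<in>{0..1}. \<exists>i\<in>?N. \<exists>j\<in>?N. i \<noteq> j \<and> ?f i y = ?f j y}"
  note dp = double_points_iff[OF ok]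
  have fin: "finite (double_points n D) \<longleftrightarrow> finite ?Y"
  proof
    assume "finite (double_points n D)"
    moreover have "?Y \<subseteq> snd ` double_points n D"
    proof
      fix y assume "y \<in> ?Y"
      then obtain i j where "y \<in> {0..1}" "i \<in> ?N" "j \<in> ?N" "i \<noteq> j" "?f i y = ?f j y" by auto
      then have "(?f i y, y) \<in> double_points n D" unfolding dp by blast
      then show "y \<in> snd ` double_points n D" by (metis imageI snd_conv)
    qed
    ultimately show "finite ?Y" by (meson finite_imageI finite_subset)
  next
    assume Y: "finite ?Y"
    have "double_points n D \<subseteq> (\<Union>i\<in>?N. (\<lambda>y. (?f i y, y)) ` ?Y)"
    proof (intro subsetI)
      fix p assume p: "p \<in> double_points n D"
      obtain x y where xy: "p = (x, y)" by force
      show "p \<in> (\<Union>i\<in>?N. (\<lambda>y. (?f i y, y)) ` ?Y)" using p unfolding xy dp by blast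
    qed
    moreover have "finite (\<Union>i\<in>?N. (\<lambda>y. (?f i y, y)) ` ?Y)" using Y by (intro finite_UN_I) auto
    ultimately show "finite (double_points n D)" by (rule finite_subset)
  qed
  have str: "p \<in> strand D k \<longleftrightarrow> fst p = ?f k (snd p)" if "k \<in> ?N" "snd p \<in> {0..1}" for k p
    using strand_x_iff[of n D k "snd p" "fst p"] that ok by simp
  have dps: "(\<forall>p\<in>double_points n D. 0 < snd p \<and> snd p < 1 \<and> card {i\<in>?N. p \<in> strand D i} = 2) \<longleftrightarrow>
    (\<forall>i\<in>?N. \<forall>j\<in>?N. \<forall>y\<in>{0..1}. i \<noteq> j \<longrightarrow> ?f i y = ?f j y \<longrightarrow>
        0 < y \<and> y < 1 \<and> (\<forall>k\<in>?N. ?f k y = ?f i y \<longrightarrow> k = i \<or> k = j))" (is "?A \<longleftrightarrow> ?B")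
  proof
    assume A: ?A
    show ?B
    proof (intro ballI impI)
      fix i j y assume ij: "i \<in> ?N" "j \<in> ?N" "y \<in> {0..1}" "i \<noteq> j" "?f i y = ?f j y"
      have "(?f i y, y) \<in> double_points n D" unfolding dp using ij by blast
      with A have A': "0 < y" "y < 1" "card {k\<in>?N. (?f i y, y) \<in> strand D k} = 2" by auto
      have S: "{k\<in>?N. (?f i y, y) \<in> strand D k} = {k\<in>?N. ?f k y = ?f i y}"
        using str[of _ "(?f i y, y)"] ij(3) by auto
      have "{i, j} = {k\<in>?N. ?f k y = ?f i y}"
        using A'(3) ij unfolding S by (intro card_subset_eq) auto
      then show "0 < y \<and> y < 1 \<and> (\<forall>k\<in>?N. ?f k y = ?f i y \<longrightarrow> k = i \<or> k = j)" using A' by blast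
    qed
  next
    assume B: ?B
    show ?A
    proof
      fix p assume p: "p \<in> double_points n D"
      obtain x y where xy: "p = (x, y)" by force
      obtain i j where ij: "y \<in> {0..1}" "i \<in> ?N" "j \<in> ?N" "i \<noteq> j" "x = ?f i y" "?f i y = ?f j y"
        using p unfolding xy dp by blast
      have B': "0 < y" "y < 1" "\<And>k. k \<in> ?N \<Longrightarrow> ?f k y = ?f i y \<Longrightarrow> k = i \<or> k = j"
        using B ij by blast+
      have "{k\<in>?N. p \<in> strand D k} = {k\<in>?N. ?f k y = ?f i y}"
        using str[of _ p] ij xy by auto
      also have "\<dots> = {i, j}" using B' ij by auto
      finally show "0 < snd p \<and> snd p < 1 \<and> card {k\<in>?N. p \<in> strand D k} = 2"
        using B' ij xy by simp
    qed
  qed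
  show ?thesis unfolding ndiagram_def crossing_family_def fin dps using ok unfolding strand_ok_def
    by blast
qed

lemma crossing_family_relabel:
  assumes "crossing_family n f" "inj_on \<sigma> {1..n+1}" "\<sigma> ` {1..n+1} \<subseteq> {1..n+1}"
    and eq: "\<And>i y. i \<in> {1..n+1} \<Longrightarrow> y \<in> {0..1} \<Longrightarrow> f' i y = f (\<sigma> i) y"
  shows "crossing_family n f'"
  unfolding crossing_family_def
proof (intro conjI ballI impI)
  let ?N = "{1..n+1}"
  have "{y\<in>{0..1}. \<exists>i\<in>?N. \<exists>j\<in>?N. i \<noteq> j \<and> f' i y = f' j y} \<subseteq>
     {y\<in>{0..1}. \<exists>i\<in>?N. \<exists>j\<in>?N. i \<noteq> j \<and> f i y = f j y}"
  proof
    fix y assume "y \<in> {y\<in>{0..1}. \<exists>i\<in>?N. \<exists>j\<in>?N. i \<noteq> j \<and> f' i y = f' j y}"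
    then obtain i j where ij: "y \<in> {0..1}" "i \<in> ?N" "j \<in> ?N" "i \<noteq> j" "f' i y = f' j y" by blast
    have "\<sigma> i \<in> ?N" "\<sigma> j \<in> ?N" using assms(3) ij(2,3) by blast+
    moreover have "\<sigma> i \<noteq> \<sigma> j" using ij assms(2) inj_onD by metis
    moreover have "f (\<sigma> i) y = f (\<sigma> j) y" using ij eq[of i y] eq[of j y] by simp
    ultimately show "y \<in> {y\<in>{0..1}. \<exists>i\<in>?N. \<exists>j\<in>?N. i \<noteq> j \<and> f i y = f j y}"
      using ij(1) by blast
  qed
  then show "finite {y\<in>{0..1}. \<exists>i\<in>?N. \<exists>j\<in>?N. i \<noteq> j \<and> f' i y = f' j y}"
    using assms(1) unfolding crossing_family_def by (meson finite_subset)
  fix i j and y :: real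
  assume ij: "i \<in> ?N" "j \<in> ?N" "y \<in> {0..1}" "i \<noteq> j" "f' i y = f' j y"
  have s: "\<sigma> i \<in> ?N" "\<sigma> j \<in> ?N" using assms(3) ij(1,2) by blast+
  have ne: "\<sigma> i \<noteq> \<sigma> j" using ij assms(2) inj_onD by metis
  have "f (\<sigma> i) y = f (\<sigma> j) y" using ij eq[of i y] eq[of j y] by simp
  then have c: "0 < y" "y < 1" "crosses_at (f (\<sigma> i)) (f (\<sigma> j)) y"
    "\<And>k. k \<in> ?N \<Longrightarrow> f k y = f (\<sigma> i) y \<Longrightarrow> k = \<sigma> i \<or> k = \<sigma> j"
    using assms(1) s ne ij(3) unfolding crossing_family_def by blast+
  show "0 < y" "y < 1" by fact+
  show "crosses_at (f' i) (f' j) y"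
  proof (rule crosses_at_transfer[of _ _ "\<lambda>u. u"])
    show "crosses_at (f (\<sigma> i)) (f (\<sigma> j)) y" by fact
    show "sgn (f' i u - f' j u) = sgn (f (\<sigma> i) u - f (\<sigma> j) u)" if "0 < u" "u < 1" for u
      using eq[of i u] eq[of j u] ij that by simp
  qed (use c in auto)
  fix k assume k: "k \<in> ?N" "f' k y = f' i y"
  then have "f (\<sigma> k) y = f (\<sigma> i) y" using eq[of k y] eq[of i y] ij by auto
  moreover have "\<sigma> k \<in> ?N" using assms(3) k(1) by blast
  ultimately have "\<sigma> k = \<sigma> i \<or> \<sigma> k = \<sigma> j" using c(4) by blast
  then show "k = i \<or> k = j" using k ij assms(2) inj_onD by metis
qed

lemma crossing_family_cong:
  assumes "crossing_family n f" "\<And>i y. i \<in> {1..n+1} \<Longrightarrow> y \<in> {0..1} \<Longrightarrow> f' i y = f i y"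
  shows "crossing_family n f'"
  using crossing_family_relabel[of n f id f'] assms by simp

lemma crossing_familyD:
  assumes "crossing_family n f" "i \<in> {1..n+1}" "j \<in> {1..n+1}" "y \<in> {0..1}" "i \<noteq> j" "f i y = f j y"
  shows "0 < y" "y < 1" "crosses_at (f i) (f j) y"
    "\<And>k. k \<in> {1..n+1} \<Longrightarrow> f k y = f i y \<Longrightarrow> k = i \<or> k = j"
  using assms unfolding crossing_family_def by blast+

lemma ndiagramD:
  assumes "ndiagram n D"
  shows "i \<in> {1..n+1} \<Longrightarrow> strand_ok n (D i)" "crossing_family n (strand_x D)"
  using assms unfolding ndiagram_iff by auto

lemma diagram_image_iff:
  assumes "\<forall>i\<in>{1..n+1}. strand_ok n (D i)"
  shows "(x, y) \<in> diagram_image n D \<longleftrightarrow> y \<in> {0..1} \<and> (\<exists>i\<in>{1..n+1}. x = strand_x D i y)"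
proof -
  have *: "(x, y) \<in> strand D i \<longleftrightarrow> y \<in> {0..1} \<and> x = strand_x D i y" if "i \<in> {1..n+1}" for i
  proof (cases "y \<in> {0..1}")
    case True
    then show ?thesis using strand_x_iff[of n D i y x] assms that by simp
  next
    case False
    then show ?thesis using strand_height[of n D i "(x, y)"] assms that by auto
  qed
  show ?thesis unfolding diagram_image_def using * by auto
qed

lemma ndiagram_image_iff:
  "ndiagram n D \<Longrightarrow> (x, y) \<in> diagram_image n D \<longleftrightarrow> y \<in> {0..1} \<and> (\<exists>i\<in>{1..n+1}. x = strand_x D i y)"
  using diagram_image_iff[of n D x y] unfolding ndiagram_iff by blast

lemma strand_cong: "(\<And>s. s \<in> {0..1} \<Longrightarrow> D i s = D' i s) \<Longrightarrow> strand D i = strand D' i"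
  unfolding strand_def by (rule image_cong) auto

lemma strand_x_cong: "strand D i = strand D' j \<Longrightarrow> strand_x D i = strand_x D' j"
  unfolding strand_x_def by simp

lemma strand_ok_cong:
  assumes "strand_ok n \<gamma>" "\<And>s. s \<in> {0..1} \<Longrightarrow> \<gamma>' s = \<gamma> s"
  shows "strand_ok n \<gamma>'"
proof -
  have "continuous_on {0..1} \<gamma>' \<longleftrightarrow> continuous_on {0..1} \<gamma>"
    using assms(2) by (intro continuous_on_cong) auto
  moreover have "bij_betw (snd \<circ> \<gamma>') {0..1} {0..1} \<longleftrightarrow> bij_betw (snd \<circ> \<gamma>) {0..1} {0..1}"
    using assms(2) by (intro bij_betw_cong) auto
  ultimately show ?thesis using assms unfolding strand_ok_def by simp
qed

lemma ndiagram_cong: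
  assumes "ndiagram n D" "\<And>i s. i \<in> {1..n+1} \<Longrightarrow> s \<in> {0..1} \<Longrightarrow> D' i s = D i s"
  shows "ndiagram n D'"
  unfolding ndiagram_iff
proof
  show "\<forall>i\<in>{1..n+1}. strand_ok n (D' i)"
    using ndiagramD(1)[OF assms(1)] assms(2) strand_ok_cong by blast
  have "strand_x D' i = strand_x D i" if "i \<in> {1..n+1}" for i
    using assms(2) that by (intro strand_x_cong strand_cong) auto
  then show "crossing_family n (strand_x D')"
    using crossing_family_cong[OF ndiagramD(2)[OF assms(1)]] by simp
qed

lemma diagram_image_compose: "diagram_image n (\<lambda>i s. K (D i s)) = K ` diagram_image n D"
  unfolding diagram_image_def strand_def by (simp add: image_UN image_image)

lemma diagram_image_strip: "ndiagram n D \<Longrightarrow> diagram_image n D \<subseteq> strip"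
  using ndiagram_image_iff[of n D] unfolding strip_def by fastforce

lemma ndiagram_strip: "ndiagram n D \<Longrightarrow> i \<in> {1..n+1} \<Longrightarrow> s \<in> {0..1} \<Longrightarrow> D i s \<in> strip"
  using strand_ok_height[OF ndiagramD(1), of n D i s] unfolding strip_def by (simp add: mem_Times_iff)

section \<open>The image determines the strands\<close>

text \<open>The sets on which \<open>f\<close> agrees with one of the \<open>g j\<close> are closed
  in \<open>I\<close>, finite in number, pairwise disjoint and cover \<open>I\<close>; connectedness
  leaves only one of them.\<close>

lemma selection_constant_index:
  fixes f :: "real \<Rightarrow> real"
  assumes "connected I" "finite J" "continuous_on I f" "\<And>j. j \<in> J \<Longrightarrow> continuous_on I (g j)"
    and sel: "\<And>u. u \<in> I \<Longrightarrow> \<exists>j\<in>J. f u = g j u"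
    and dist: "\<And>u i j. u \<in> I \<Longrightarrow> i \<in> J \<Longrightarrow> j \<in> J \<Longrightarrow> i \<noteq> j \<Longrightarrow> g i u \<noteq> g j u"
    and u0: "u0 \<in> I" "j0 \<in> J" "f u0 = g j0 u0"
    and u: "u \<in> I"
  shows "f u = g j0 u"
proof -
  have cl: "closedin (top_of_set I) {u\<in>I. f u = g j u}" if "j \<in> J" for j
  proof -
    have "closedin (top_of_set I) (I \<inter> (\<lambda>u. f u - g j u) -` {0})"
      using assms(3,4) that by (intro continuous_closedin_preimage continuous_intros) auto
    moreover have "I \<inter> (\<lambda>u. f u - g j u) -` {0} = {u\<in>I. f u = g j u}" by auto
    ultimately show ?thesis by simp
  qed
  let ?A = "{u\<in>I. f u = g j0 u}" and ?B = "\<Union>j\<in>J - {j0}. {u\<in>I. f u = g j u}"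
  have 1: "closedin (top_of_set I) ?A" using cl u0 by blast
  have 2: "closedin (top_of_set I) ?B" using cl assms(2) by (intro closedin_Union) auto
  have 3: "I \<subseteq> ?A \<union> ?B" using sel by blast
  have 4: "?A \<inter> ?B = {}"
  proof -
    { fix u j assume "u \<in> I" "f u = g j0 u" "j \<in> J" "j \<noteq> j0" "f u = g j u"
      then have False using dist[of u j j0] u0(2) by simp }
    then show ?thesis by blast
  qed
  have 5: "?A \<noteq> {}" using u0 by blast
  have "?B = {}"
  proof (rule ccontr)
    assume 6: "?B \<noteq> {}"
    show False
      by (rule connected_closedin[THEN iffD1, OF assms(1), THEN notE])
        (intro exI[of _ ?A] exI[of _ ?B] conjI 1 2 3 4 5 6)
  qed
  then show ?thesis using sel[OF u] u by blast
qed

lemma eq_on_closure_real: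
  fixes f g :: "real \<Rightarrow> real"
  assumes "continuous_on (closure S) f" "continuous_on (closure S) g" "\<And>u. u \<in> S \<Longrightarrow> f u = g u" "x \<in> closure S"
  shows "f x = g x"
proof -
  have "f x - g x = 0"
    by (rule continuous_constant_on_closure[of S "\<lambda>u. f u - g u"])
      (use assms in \<open>auto intro: continuous_intros\<close>)
  then show ?thesis by simp
qed

text \<open>Agreement is propagated upwards by subdivision of the interval. Between crossings an
  index cannot change, so the only danger is that \<open>f\<close> and \<open>g\<close> continue
  differently through a crossing; there transversality of both families decides.\<close>

lemma crossing_families_eq:
  assumes cf: "crossing_family n f" "crossing_family n g"
    and cont: "\<And>i. i \<in> {1..n+1} \<Longrightarrow> continuous_on {0..1} (f i)" "\<And>i. i \<in> {1..n+1} \<Longrightarrow> continuous_on {0..1} (g i)"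
    and sel: "\<And>i y. i \<in> {1..n+1} \<Longrightarrow> y \<in> {0..1} \<Longrightarrow> \<exists>j\<in>{1..n+1}. f i y = g j y"
    and start: "\<And>i. i \<in> {1..n+1} \<Longrightarrow> f i 0 = g i 0"
  shows "\<forall>i\<in>{1..n+1}. \<forall>y\<in>{0..1}. f i y = g i y"
proof -
  let ?N = "{1..n+1}"
  \<comment> \<open>The implication from agreement up to \<open>a\<close> to agreement up to
    \<open>b\<close> is transitive over adjacent intervals, and so can be checked locally.\<close>
  define P where "P a b \<longleftrightarrow> (0 \<le> a \<longrightarrow> b \<le> 1 \<longrightarrow> (\<forall>i\<in>?N. \<forall>u\<in>{0..a}. f i u = g i u) \<longrightarrow>
    (\<forall>i\<in>?N. \<forall>u\<in>{0..b}. f i u = g i u))" for a b :: real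
  have "P 0 1"
  proof (rule Bolzano)
    show "P a c" if "P a b" "P b c" "a \<le> b" "b \<le> c" for a b c
      using that unfolding P_def by (meson order_trans)
  next
    fix x :: real assume x: "0 \<le> x" "x \<le> 1"
    define Y where "Y = {y\<in>{0..1}. \<exists>i\<in>?N. \<exists>j\<in>?N. i \<noteq> j \<and> f i y = f j y} \<union>
      {y\<in>{0..1}. \<exists>i\<in>?N. \<exists>j\<in>?N. i \<noteq> j \<and> g i y = g j y}"
    have "finite Y" using cf unfolding Y_def crossing_family_def by blast
    from finite_set_avoid[OF this, of x] obtain d where d: "d > 0" "\<forall>y\<in>Y. y \<noteq> x \<longrightarrow> d \<le> dist x y" by blast
    have dist: "f i u \<noteq> f j u" "g i u \<noteq> g j u"
      if "i \<in> ?N" "j \<in> ?N" "i \<noteq> j" "u \<in> {0..1}" "u \<noteq> x" "\<bar>u - x\<bar> < d" for i j u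
    proof -
      have "u \<notin> Y" using d(2) that(5,6) by (force simp: dist_real_def abs_minus_commute)
      then show "f i u \<noteq> f j u" "g i u \<noteq> g j u" using that unfolding Y_def by blast+
    qed
    show "\<exists>d>0. \<forall>a b. a \<le> x \<and> x \<le> b \<and> b - a < d \<longrightarrow> P a b"
    proof (intro exI[of _ d] conjI allI impI)
      fix a b assume ab: "a \<le> x \<and> x \<le> b \<and> b - a < d"
      show "P a b" unfolding P_def
      proof (intro impI)
        assume a0: "0 \<le> a" and b1: "b \<le> 1" and H: "\<forall>i\<in>?N. \<forall>u\<in>{0..a}. f i u = g i u"
        have left: "f i u = g i u" if i: "i \<in> ?N" and u: "u \<in> {0..x}" for i u
        proof (cases "u \<le> a")
          case True
          then show ?thesis using H i u by auto
        next
          case False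
          then have "a < x" using u by auto
          have I: "w \<in> {0..1}" "w \<noteq> x" "\<bar>w - x\<bar> < d" if "w \<in> {a..<x}" for w
            using that ab a0 x by auto
          have eq: "f i w = g i w" if w: "w \<in> {a..<x}" for w
          proof (rule selection_constant_index[where I = "{a..<x}" and J = ?N and g = g])
            show "continuous_on {a..<x} (f i)" "\<And>j. j \<in> ?N \<Longrightarrow> continuous_on {a..<x} (g j)"
              using I(1) cont i by (meson continuous_on_subset subsetI)+
            show "\<exists>j\<in>?N. f i w = g j w" if "w \<in> {a..<x}" for w using sel[OF i I(1)[OF that]] .
            show "g j w \<noteq> g k w" if "w \<in> {a..<x}" "j \<in> ?N" "k \<in> ?N" "j \<noteq> k" for w j k
              using dist(2)[OF that(2,3,4) I[OF that(1)]] .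
            show "a \<in> {a..<x}" using \<open>a < x\<close> by simp
            show "f i a = g i a" using H i a0 by simp
          qed (use i w in auto)
          have "closure {a..<x} = {a..x}" using \<open>a < x\<close> by simp
          moreover have "continuous_on {a..x} (f i)" "continuous_on {a..x} (g i)"
            using cont[OF i] a0 x by (auto intro: continuous_on_subset)
          ultimately show ?thesis
            using eq_on_closure_real[of "{a..<x}" "f i" "g i" u, OF _ _ eq] False u by auto
        qed
        show "\<forall>i\<in>?N. \<forall>u\<in>{0..b}. f i u = g i u"
        proof (intro ballI)
          fix i u assume i: "i \<in> ?N" and u: "u \<in> {0..b}"
          show "f i u = g i u"
          proof (cases "u \<le> x")
            case True
            then show ?thesis using left[OF i, of u] u by auto
          next
            case False
            then have xb: "x < b" using u by auto
            have I: "w \<in> {0..1}" "w \<noteq> x" "\<bar>w - x\<bar> < d" if "w \<in> {x<..b}" for w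
              using that ab b1 x by auto
            have "\<exists>j\<in>?N. \<forall>w\<in>{x<..b}. f i w = g j w" if i: "i \<in> ?N" for i
            proof -
              obtain j where j: "j \<in> ?N" "f i b = g j b" using sel[OF i, of b] I(1)[of b] xb by auto
              have "f i w = g j w" if w: "w \<in> {x<..b}" for w
              proof (rule selection_constant_index[where I = "{x<..b}" and J = ?N and g = g])
                show "continuous_on {x<..b} (f i)" "\<And>j. j \<in> ?N \<Longrightarrow> continuous_on {x<..b} (g j)"
                  using I(1) cont i by (meson continuous_on_subset subsetI)+
                show "\<exists>j\<in>?N. f i w = g j w" if "w \<in> {x<..b}" for w using sel[OF i I(1)[OF that]] .
                show "g j w \<noteq> g k w" if "w \<in> {x<..b}" "j \<in> ?N" "k \<in> ?N" "j \<noteq> k" for w j k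
                  using dist(2)[OF that(2,3,4) I[OF that(1)]] .
                show "b \<in> {x<..b}" using xb by simp
              qed (use j w in auto)
              then show ?thesis using j by blast
            qed
            then obtain \<tau> where \<tau>: "\<And>i. i \<in> ?N \<Longrightarrow> \<tau> i \<in> ?N"
              "\<And>i w. i \<in> ?N \<Longrightarrow> w \<in> {x<..b} \<Longrightarrow> f i w = g (\<tau> i) w" by metis
            have \<tau>x: "f i x = g (\<tau> i) x" if i: "i \<in> ?N" for i
            proof -
              have "closure {x<..b} = {x..b}" using xb by simp
              moreover have "continuous_on {x..b} (f i)" "continuous_on {x..b} (g (\<tau> i))"
                using cont(1)[OF i] cont(2)[OF \<tau>(1)[OF i]] b1 x by (auto intro: continuous_on_subset)
              ultimately show ?thesis
                using eq_on_closure_real[of "{x<..b}" "f i" "g (\<tau> i)" x, OF _ _ \<tau>(2)[OF i]] xb by auto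
            qed
            \<comment> \<open>If the indices changed at \<open>x\<close>, two strands would meet
              there and \<open>\<tau>\<close> would exchange them. But then \<open>f i\<close> and
              \<open>f j\<close> exchange sides exactly if \<open>g i\<close> and \<open>g j\<close>
              do not, whereas both pairs cross.\<close>
            have "\<tau> i = i"
            proof (rule ccontr)
              assume ne: "\<tau> i \<noteq> i"
              define j where "j = \<tau> i"
              have j: "j \<in> ?N" "j \<noteq> i" using \<tau>(1)[OF i] ne by (auto simp: j_def)
              have xI: "x \<in> {0..1}" using x by simp
              have fx: "f i x = g i x" "f j x = g j x" using left[of i x] left[of j x] i j x by auto
              have gij: "g i x = g j x" using fx(1) \<tau>x[OF i] by (simp add: j_def)
              have fij: "f i x = f j x" using gij fx by simp
              note cg = crossing_familyD[OF cf(2) i j(1) xI j(2)[symmetric] gij]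
              note cf' = crossing_familyD[OF cf(1) i j(1) xI j(2)[symmetric] fij]
              have "g (\<tau> j) x = g i x" using \<tau>x[OF j(1)] fx gij by simp
              then have "\<tau> j = i \<or> \<tau> j = j" using cg(4) \<tau>(1)[OF j(1)] by blast
              moreover have "\<tau> j \<noteq> j"
              proof
                assume "\<tau> j = j"
                then have "f i b = f j b" using \<tau>(2)[OF i, of b] \<tau>(2)[OF j(1), of b] xb by (simp add: j_def)
                then show False using dist(1)[OF i j(1) j(2)[symmetric] I[of b]] xb by simp
              qed
              ultimately have \<tau>j: "\<tau> j = i" by blast
              obtain e1 where e1: "e1 > 0" "\<And>u v. u \<in> {x - e1<..<x} \<Longrightarrow> v \<in> {x<..<x + e1} \<Longrightarrow>
                (f i u - f j u) * (f i v - f j v) < 0" using cf'(3) unfolding crosses_at_def by blast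
              obtain e2 where e2: "e2 > 0" "\<And>u v. u \<in> {x - e2<..<x} \<Longrightarrow> v \<in> {x<..<x + e2} \<Longrightarrow>
                (g i u - g j u) * (g i v - g j v) < 0" using cg(3) unfolding crosses_at_def by blast
              \<comment> \<open>Small enough that both \<open>x - e\<close> and \<open>x + e\<close>
                lie in both sign neighbourhoods, the former above 0 and the latter below
                \<open>b\<close>.\<close>
              define e where "e = min (min e1 e2) (min x (b - x)) / 2"
              have e: "e > 0" "e < e1" "e < e2" "e < x" "e < b - x"
                using e1(1) e2(1) cg(1) xb by (auto simp: e_def min_def)
              have "f i (x - e) = g i (x - e)" "f j (x - e) = g j (x - e)"
                using left[of i "x - e"] left[of j "x - e"] i j e by auto
              moreover have "f i (x + e) = g j (x + e)" "f j (x + e) = g i (x + e)"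
                using \<tau>(2)[OF i, of "x + e"] \<tau>(2)[OF j(1), of "x + e"] e \<tau>j by (auto simp: j_def)
              ultimately have "(g i (x - e) - g j (x - e)) * (g j (x + e) - g i (x + e)) < 0"
                using e1(2)[of "x - e" "x + e"] e by simp
              moreover have "(g i (x - e) - g j (x - e)) * (g i (x + e) - g j (x + e)) < 0"
                using e2(2)[of "x - e" "x + e"] e by simp
              ultimately show False by (simp add: algebra_simps)
            qed
            then show ?thesis using \<tau>(2)[OF i, of u] False u by simp
          qed
        qed
      qed
    qed (use d in simp)
  qed simp
  then show ?thesis using start unfolding P_def by simp
qed

lemma ndiagram_start_distinct:
  assumes "ndiagram n D" "i \<in> {1..n+1}" "j \<in> {1..n+1}" "i \<noteq> j"
  shows "strand_x D i 0 \<noteq> strand_x D j 0" "strand_x D i 1 \<noteq> strand_x D j 1"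
  using crossing_familyD(1)[OF ndiagramD(2)[OF assms(1)] assms(2,3), of 0]
    crossing_familyD(2)[OF ndiagramD(2)[OF assms(1)] assms(2,3), of 1] assms(4) by auto

text \<open>Strands are matched by their lower endpoints, which are distinct because double points
  are interior; equality of the images then forces matched strands to agree all the way up.\<close>

lemma same_image_same_strands:
  assumes D: "ndiagram n D" and E: "ndiagram n E" and im: "diagram_image n D = diagram_image n E"
  shows "\<exists>\<sigma>. bij_betw \<sigma> {1..n+1} {1..n+1} \<and> (\<forall>i\<in>{1..n+1}. strand D i = strand E (\<sigma> i))"
proof -
  let ?N = "{1..n+1}"
  have sel: "\<exists>j\<in>?N. strand_x D i y = strand_x E j y" if "i \<in> ?N" "y \<in> {0..1}" for i y
  proof -
    have "(strand_x D i y, y) \<in> diagram_image n D" using ndiagram_image_iff[OF D] that by blast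
    then show ?thesis using ndiagram_image_iff[OF E] im by blast
  qed
  have "\<forall>i\<in>?N. \<exists>j\<in>?N. strand_x D i 0 = strand_x E j 0" using sel by simp
  then obtain \<sigma> where \<sigma>': "\<forall>i\<in>?N. \<sigma> i \<in> ?N \<and> strand_x D i 0 = strand_x E (\<sigma> i) 0" by metis
  then have \<sigma>: "\<And>i. i \<in> ?N \<Longrightarrow> \<sigma> i \<in> ?N" "\<And>i. i \<in> ?N \<Longrightarrow> strand_x D i 0 = strand_x E (\<sigma> i) 0"
    by blast+
  have inj: "inj_on \<sigma> ?N"
    using \<sigma>(2) ndiagram_start_distinct(1)[OF D] by (metis inj_onI)
  have bij: "bij_betw \<sigma> ?N ?N"
    unfolding bij_betw_def using inj by (intro conjI endo_inj_surj image_subsetI \<sigma>(1)) auto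
  have eq: "\<forall>i\<in>?N. \<forall>y\<in>{0..1}. strand_x D i y = strand_x E (\<sigma> i) y"
  proof (rule crossing_families_eq)
    show "crossing_family n (strand_x D)" using ndiagramD[OF D] by blast
    show "crossing_family n (\<lambda>i. strand_x E (\<sigma> i))"
      by (intro crossing_family_relabel[OF ndiagramD(2)[OF E] inj] image_subsetI \<sigma>(1)) simp_all
    show "continuous_on {0..1} (strand_x D i)" if "i \<in> ?N" for i
      using continuous_strand_x[of n D i] ndiagramD(1)[OF D that] by blast
    show "continuous_on {0..1} (strand_x E (\<sigma> i))" if "i \<in> ?N" for i
      using continuous_strand_x[of n E "\<sigma> i"] ndiagramD(1)[OF E] \<sigma>(1)[OF that] by blast
    show "\<exists>j\<in>?N. strand_x D i y = strand_x E (\<sigma> j) y" if iy: "i \<in> ?N" "y \<in> {0..1}" for i y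
    proof -
      obtain j where j: "j \<in> ?N" "strand_x D i y = strand_x E j y" using sel[OF iy] by blast
      obtain j' where "j' \<in> ?N" "\<sigma> j' = j" using bij j(1) by (metis bij_betw_imp_surj_on imageE)
      then show ?thesis using j(2) by blast
    qed
  qed (use \<sigma> in auto)
  have "strand D i = strand E (\<sigma> i)" if i: "i \<in> ?N" for i
    using strand_eq_graph[of n D i, OF ndiagramD(1)[OF D i]]
      strand_eq_graph[of n E "\<sigma> i", OF ndiagramD(1)[OF E \<sigma>(1)[OF i]]] eq i
    by (simp add: arc_graph_def)
  then show ?thesis using bij by blast
qed

lemma strand_reparametrization:
  assumes ok: "strand_ok n \<gamma>" "strand_ok n \<delta>" and im: "\<gamma> ` {0..1} = \<delta> ` {0..1}"
  shows "\<exists>\<phi>. continuous_on {0..1} \<phi> \<and> bij_betw \<phi> {0..1} {0..1} \<and> \<phi> 0 = 0 \<and> \<phi> 1 = 1 \<and>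
     (\<forall>s\<in>{0..1}. \<gamma> s = \<delta> (\<phi> s))"
proof -
  define q where "q = inv_into {0..1} (snd \<circ> \<delta>)"
  define \<phi> where "\<phi> s = q (snd (\<gamma> s))" for s
  have bij: "bij_betw (snd \<circ> \<delta>) {0..1} {0..1}" "bij_betw (snd \<circ> \<gamma>) {0..1} {0..1}"
    and c: "continuous_on {0..1} \<delta>" "continuous_on {0..1} \<gamma>"
    using ok unfolding strand_ok_def by auto
  have qq: "q (snd (\<delta> t)) = t" if "t \<in> {0..1}" for t
    unfolding q_def using bij(1) that by (metis bij_betw_inv_into_left comp_apply)
  have "continuous_on ((snd \<circ> \<delta>) ` {0..1}) q"
  proof (rule continuous_on_inv)
    show "continuous_on {0..1} (snd \<circ> \<delta>)" unfolding comp_def by (intro continuous_intros c)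
  qed (use qq in auto)
  then have cq: "continuous_on {0..1} q" using bij by (simp add: bij_betw_def)
  have eq: "\<phi> s \<in> {0..1} \<and> \<gamma> s = \<delta> (\<phi> s)" if s: "s \<in> {0..1}" for s
  proof -
    obtain t where t: "t \<in> {0..1}" "\<gamma> s = \<delta> t" using im s by (metis imageE imageI)
    then show ?thesis using qq[OF t(1)] by (simp add: \<phi>_def)
  qed
  have "continuous_on {0..1} \<phi>" unfolding \<phi>_def
    by (intro continuous_on_compose2[OF cq] continuous_intros c image_subsetI strand_ok_height[OF ok(1)])
  moreover have "bij_betw \<phi> {0..1} {0..1}"
  proof -
    have "bij_betw (q \<circ> (snd \<circ> \<gamma>)) {0..1} {0..1}"
      unfolding q_def by (rule bij_betw_trans[OF bij(2) bij_betw_inv_into[OF bij(1)]])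
    moreover have "q \<circ> (snd \<circ> \<gamma>) = \<phi>" by (auto simp: \<phi>_def)
    ultimately show ?thesis by simp
  qed
  moreover have "snd (\<gamma> 0) = snd (\<delta> 0)" "snd (\<gamma> 1) = snd (\<delta> 1)" using ok unfolding strand_ok_def by auto
  then have "\<phi> 0 = 0" "\<phi> 1 = 1" using qq[of 0] qq[of 1] by (auto simp: \<phi>_def)
  ultimately show ?thesis using eq by blast
qed

text \<open>An isotopy ends at a diagram only up to numbering and parametrization. To continue or to
  reverse it, the property that a motion \<open>K\<close> yields a diagram has to depend on the
  image alone.\<close>

lemma ndiagram_same_image_compose:
  assumes D: "ndiagram n D" and E: "ndiagram n E" and im: "diagram_image n D = diagram_image n E"
    and K: "ndiagram n (\<lambda>i s. K (E i s))"
  shows "ndiagram n (\<lambda>i s. K (D i s))"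
proof -
  let ?N = "{1..n+1}"
  obtain \<sigma> where \<sigma>: "bij_betw \<sigma> ?N ?N" "\<And>i. i \<in> ?N \<Longrightarrow> strand D i = strand E (\<sigma> i)"
    using same_image_same_strands[OF D E im] by blast
  have \<sigma>N: "\<sigma> i \<in> ?N" if "i \<in> ?N" for i using \<sigma>(1) that by (auto simp: bij_betw_def)
  show ?thesis unfolding ndiagram_iff
  proof
    show "\<forall>i\<in>?N. strand_ok n (\<lambda>s. K (D i s))"
    proof
      fix i assume i: "i \<in> ?N"
      obtain \<phi> where \<phi>: "continuous_on {0..1} \<phi>" "bij_betw \<phi> {0..1} {0..1}" "\<phi> 0 = 0" "\<phi> 1 = 1"
        "\<And>s. s \<in> {0..1} \<Longrightarrow> D i s = E (\<sigma> i) (\<phi> s)"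
        using strand_reparametrization[OF ndiagramD(1)[OF D i] ndiagramD(1)[OF E \<sigma>N[OF i]]] \<sigma>(2)[OF i]
        unfolding strand_def by blast
      have K': "strand_ok n (\<lambda>s. K (E (\<sigma> i) s))" using ndiagramD(1)[OF K \<sigma>N[OF i]] .
      have "strand_ok n (\<lambda>s. K (E (\<sigma> i) (\<phi> s)))"
        unfolding strand_ok_def
      proof (intro conjI)
        show "continuous_on {0..1} (\<lambda>s. K (E (\<sigma> i) (\<phi> s)))"
        proof (rule continuous_on_compose2[of "{0..1}" "\<lambda>s. K (E (\<sigma> i) s)"])
          show "\<phi> ` {0..1} \<subseteq> {0..1}" using \<phi>(2) by (auto simp: bij_betw_def)
        qed (use K' \<phi>(1) in \<open>auto simp: strand_ok_def\<close>)
        have "bij_betw ((snd \<circ> (\<lambda>s. K (E (\<sigma> i) s))) \<circ> \<phi>) {0..1} {0..1}"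
          using K' by (intro bij_betw_trans[OF \<phi>(2)]) (auto simp: strand_ok_def)
        then show "bij_betw (snd \<circ> (\<lambda>s. K (E (\<sigma> i) (\<phi> s)))) {0..1} {0..1}" by (simp add: comp_def)
        show "\<exists>k\<in>?N. \<exists>l\<in>?N. K (E (\<sigma> i) (\<phi> 0)) = (real k, 0) \<and> K (E (\<sigma> i) (\<phi> 1)) = (real l, 1)"
          using K' \<phi>(3,4) unfolding strand_ok_def by simp
      qed
      then show "strand_ok n (\<lambda>s. K (D i s))" by (rule strand_ok_cong) (use \<phi>(5) in auto)
    qed
    have "strand_x (\<lambda>i s. K (D i s)) i = strand_x (\<lambda>i s. K (E i s)) (\<sigma> i)" if "i \<in> ?N" for i
      using \<sigma>(2)[OF that] unfolding strand_def by (intro strand_x_cong) (simp add: strand_def flip: image_image)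
    then show "crossing_family n (strand_x (\<lambda>i s. K (D i s)))"
      using \<sigma>(1) by (intro crossing_family_relabel[OF ndiagramD(2)[OF K], of \<sigma>]) (auto simp: bij_betw_def)
  qed
qed

section \<open>Isotopy is an equivalence relation\<close>

definition isotopy_via ::
    "nat \<Rightarrow> diagram \<Rightarrow> diagram \<Rightarrow> (real \<Rightarrow> real \<times> real \<Rightarrow> real \<times> real) \<Rightarrow> bool" where
  "isotopy_via n D E H \<longleftrightarrow> ndiagram n D \<and> ndiagram n E \<and>
     continuous_on ({0..1} \<times> strip) (\<lambda>(t, p). H t p) \<and>
     (\<forall>p\<in>strip. H 0 p = p) \<and>
     (\<forall>t\<in>{0..1}. (\<exists>G. homeomorphism strip strip (H t) G) \<and>
        (\<forall>p\<in>UNIV \<times> {0, 1}. H t p = p) \<and> ndiagram n (\<lambda>i s. H t (D i s))) \<and>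
     diagram_image n (\<lambda>i s. H 1 (D i s)) = diagram_image n E"

lemma isotopic_iff: "isotopic n D E \<longleftrightarrow> (\<exists>H. isotopy_via n D E H)"
  unfolding isotopic_def isotopy_via_def by blast

lemma isotopy_viaD:
  assumes "isotopy_via n D E H"
  shows "ndiagram n D" "ndiagram n E" "continuous_on ({0..1} \<times> strip) (\<lambda>(t, p). H t p)"
    "\<And>p. p \<in> strip \<Longrightarrow> H 0 p = p"
    "\<And>t. t \<in> {0..1} \<Longrightarrow> \<exists>G. homeomorphism strip strip (H t) G"
    "\<And>t p. t \<in> {0..1} \<Longrightarrow> p \<in> UNIV \<times> {0, 1} \<Longrightarrow> H t p = p"
    "\<And>t. t \<in> {0..1} \<Longrightarrow> ndiagram n (\<lambda>i s. H t (D i s))"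
    "diagram_image n (\<lambda>i s. H 1 (D i s)) = diagram_image n E"
  using assms unfolding isotopy_via_def by blast+

lemma isotopic_refl:
  assumes "ndiagram n D"
  shows "isotopic n D D"
  unfolding isotopic_def
proof (intro conjI exI[of _ "\<lambda>t p. p"] ballI)
  show "continuous_on ({0..1} \<times> strip) (\<lambda>(t, p). p)"
    by (simp add: case_prod_unfold) (intro continuous_intros)
  show "\<exists>G. homeomorphism strip strip (\<lambda>p. p) G" using homeomorphism_ident by blast
qed (use assms in auto)

text \<open>With \<open>G\<close> the inverse of \<open>H 1\<close>, the reversed isotopy is
  \<open>H (1 - t) \<circ> G\<close>: it is the identity at time 0 and carries the image of
  \<open>E\<close> back to that of \<open>D\<close> at time 1.\<close>

lemma isotopic_sym:
  assumes "isotopic n D E"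
  shows "isotopic n E D"
proof -
  obtain H where viaH: "isotopy_via n D E H" using assms isotopic_iff by blast
  note D = isotopy_viaD(1)[OF viaH]
  note E = isotopy_viaD(2)[OF viaH]
  note cont = isotopy_viaD(3)[OF viaH]
  note H0 = isotopy_viaD(4)[OF viaH]
  note homeo = isotopy_viaD(5)[OF viaH]
  note bd = isotopy_viaD(6)[OF viaH]
  note nd = isotopy_viaD(7)[OF viaH]
  note im = isotopy_viaD(8)[OF viaH]
  obtain G where G: "homeomorphism strip strip (H 1) G" using homeo[of 1] by force
  have GH: "G (H 1 p) = p" if "p \<in> strip" for p using G that by (simp add: homeomorphism_def)
  have HG: "H 1 (G p) = p" "G p \<in> strip" if "p \<in> strip" for p
    using G that by (auto simp: homeomorphism_def)
  have cG: "continuous_on strip G" using G by (simp add: homeomorphism_def)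
  show ?thesis
    unfolding isotopic_def
  proof (intro conjI exI[of _ "\<lambda>t p. H (1 - t) (G p)"] ballI)
    have "continuous_on ({0..1} \<times> strip) (\<lambda>x. (\<lambda>(t, p). H t p) (1 - fst x, G (snd x)))"
      by (rule continuous_on_compose2[OF cont])
        (use HG(2) in \<open>auto intro!: continuous_intros continuous_on_compose2[OF cG]\<close>)
    then show "continuous_on ({0..1} \<times> strip) (\<lambda>(t, p). H (1 - t) (G p))"
      by (simp add: case_prod_unfold)
    show "H (1 - 0) (G p) = p" if "p \<in> strip" for p using HG that by simp
    fix t :: real assume t: "t \<in> {0..1}"
    then have t': "1 - t \<in> {0..1}" by auto
    obtain G' where "homeomorphism strip strip (H (1 - t)) G'" using homeo[OF t'] by blast
    from homeomorphism_compose[OF homeomorphism_symD[OF G] this]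
    show "\<exists>G'. homeomorphism strip strip (\<lambda>p. H (1 - t) (G p)) G'" by (auto simp: comp_def)
    show "H (1 - t) (G p) = p" if "p \<in> UNIV \<times> {0, 1}" for p
    proof -
      have "p \<in> strip" using that by (auto simp: strip_def)
      then have "G p = p" using GH[of p] bd[of 1 p] that by simp
      then show ?thesis using bd[OF t' that] by simp
    qed
    show "ndiagram n (\<lambda>i s. H (1 - t) (G (E i s)))"
    proof (rule ndiagram_same_image_compose[OF E _ im[symmetric]])
      show "ndiagram n (\<lambda>i s. H 1 (D i s))" using nd by simp
      show "ndiagram n (\<lambda>i s. H (1 - t) (G (H 1 (D i s))))"
        using GH ndiagram_strip[OF D] by (intro ndiagram_cong[OF nd[OF t']]) simp
    qed
  next
    have "diagram_image n (\<lambda>i s. H (1 - 1) (G (E i s))) = (\<lambda>p. H 0 (G p)) ` diagram_image n E"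
      using diagram_image_compose[of n "\<lambda>p. H 0 (G p)" E] by simp
    also have "\<dots> = (\<lambda>p. H 0 (G (H 1 p))) ` diagram_image n D"
      unfolding im[symmetric] diagram_image_compose[of n "H 1" D] image_image ..
    also have "\<dots> = (\<lambda>p. p) ` diagram_image n D"
      using diagram_image_strip[OF D] GH H0 by (intro image_cong) auto
    finally show "diagram_image n (\<lambda>i s. H (1 - 1) (G (E i s))) = diagram_image n D" by simp
  qed (use D E in auto)
qed

lemma isotopic_trans:
  assumes "isotopic n C D" "isotopic n D E"
  shows "isotopic n C E"
proof -
  obtain H where viaH: "isotopy_via n C D H" using assms(1) isotopic_iff by blast
  note C = isotopy_viaD(1)[OF viaH]
  note D = isotopy_viaD(2)[OF viaH]
  note cH = isotopy_viaD(3)[OF viaH]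
  note H0 = isotopy_viaD(4)[OF viaH]
  note homeoH = isotopy_viaD(5)[OF viaH]
  note bdH = isotopy_viaD(6)[OF viaH]
  note ndH = isotopy_viaD(7)[OF viaH]
  note imH = isotopy_viaD(8)[OF viaH]
  obtain K where viaK: "isotopy_via n D E K" using assms(2) isotopic_iff by blast
  note E = isotopy_viaD(2)[OF viaK]
  note cK = isotopy_viaD(3)[OF viaK]
  note K0 = isotopy_viaD(4)[OF viaK]
  note homeoK = isotopy_viaD(5)[OF viaK]
  note bdK = isotopy_viaD(6)[OF viaK]
  note ndK = isotopy_viaD(7)[OF viaK]
  note imK = isotopy_viaD(8)[OF viaK]
  obtain G1 where G1: "homeomorphism strip strip (H 1) G1" using homeoH[of 1] by force
  have H1: "H 1 p \<in> strip" if "p \<in> strip" for p using G1 that by (auto simp: homeomorphism_def)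
  have cH1: "continuous_on strip (H 1)" using G1 by (simp add: homeomorphism_def)
  \<comment> \<open>The second isotopy acts after the completed first one; at time
    \<open>1/2\<close> both branches equal \<open>H 1\<close>, because \<open>K 0\<close> is the
    identity.\<close>
  define M where "M t p = (if t \<le> 1/2 then H (2 * t) p else K (2 * t - 1) (H 1 p))" for t p
  show ?thesis
    unfolding isotopic_def
  proof (intro conjI exI[of _ M] ballI)
    have "continuous_on ({0..1} \<times> strip)
      (\<lambda>x. if fst x \<le> 1/2 then H (2 * fst x) (snd x) else K (2 * fst x - 1) (H 1 (snd x)))"
    proof (rule continuous_on_cases_le)
      have "continuous_on {x \<in> {0..1} \<times> strip. fst x \<le> 1/2} (\<lambda>x. (\<lambda>(t, p). H t p) (2 * fst x, snd x))"
        by (rule continuous_on_compose2[OF cH]) (auto intro!: continuous_intros)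
      then show "continuous_on {x \<in> {0..1} \<times> strip. fst x \<le> 1/2} (\<lambda>x. H (2 * fst x) (snd x))" by simp
      have "continuous_on {x \<in> {0..1} \<times> strip. 1/2 \<le> fst x}
          (\<lambda>x. (\<lambda>(t, p). K t p) (2 * fst x - 1, H 1 (snd x)))"
        by (rule continuous_on_compose2[OF cK])
          (use H1 in \<open>auto intro!: continuous_intros continuous_on_compose2[OF cH1]\<close>)
      then show "continuous_on {x \<in> {0..1} \<times> strip. 1/2 \<le> fst x} (\<lambda>x. K (2 * fst x - 1) (H 1 (snd x)))" by simp
      show "H (2 * fst x) (snd x) = K (2 * fst x - 1) (H 1 (snd x))"
        if x: "x \<in> {0..1} \<times> strip" "fst x = 1/2" for x :: "real \<times> real \<times> real"
      proof -
        have "2 * fst x = 1" "H 1 (snd x) \<in> strip" using H1 x by auto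
        then show "H (2 * fst x) (snd x) = K (2 * fst x - 1) (H 1 (snd x))" using K0 by simp
      qed
    qed (auto intro!: continuous_intros)
    then show "continuous_on ({0..1} \<times> strip) (\<lambda>(t, p). M t p)"
      unfolding M_def by (simp add: case_prod_unfold)
    show "M 0 p = p" if "p \<in> strip" for p using H0 that by (simp add: M_def)
    fix t :: real assume t: "t \<in> {0..1}"
    show "\<exists>G. homeomorphism strip strip (M t) G"
    proof (cases "t \<le> 1/2")
      case True
      then show ?thesis using homeoH[of "2 * t"] t unfolding M_def by simp
    next
      case False
      then obtain G2 where "homeomorphism strip strip (K (2 * t - 1)) G2" using homeoK[of "2 * t - 1"] t by auto
      from homeomorphism_compose[OF G1 this] show ?thesis using False unfolding M_def by (auto simp: comp_def)
    qed
    show "M t p = p" if "p \<in> UNIV \<times> {0, 1}" for p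
      using bdH[of "2 * t" p] bdH[of 1 p] bdK[of "2 * t - 1" p] that t unfolding M_def by auto
    show "ndiagram n (\<lambda>i s. M t (C i s))"
    proof (cases "t \<le> 1/2")
      case True
      then show ?thesis using ndH[of "2 * t"] t unfolding M_def by simp
    next
      case False
      have "ndiagram n (\<lambda>i s. K (2 * t - 1) (H 1 (C i s)))"
        by (rule ndiagram_same_image_compose[OF _ D imH]) (use ndH[of 1] ndK[of "2 * t - 1"] False t in auto)
      then show ?thesis using False unfolding M_def by simp
    qed
  next
    have "diagram_image n (\<lambda>i s. M 1 (C i s)) = K 1 ` (H 1 ` diagram_image n C)"
      unfolding diagram_image_compose[of n "M 1"] by (simp add: M_def image_image)
    also have "\<dots> = diagram_image n E"
      using imH imK unfolding diagram_image_compose by simp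
    finally show "diagram_image n (\<lambda>i s. M 1 (C i s)) = diagram_image n E" .
  qed (use C E in auto)
qed

section \<open>What an isotopy does to strands\<close>

definition strand_map :: "nat \<Rightarrow> diagram \<Rightarrow> diagram \<Rightarrow> (real \<times> real \<Rightarrow> real \<times> real) \<Rightarrow> (nat \<Rightarrow> nat) \<Rightarrow> bool" where
  "strand_map n D E h \<sigma> \<longleftrightarrow> ndiagram n D \<and> ndiagram n E \<and> homeomorphism strip strip h (inv_into strip h) \<and>
     (\<forall>p\<in>UNIV \<times> {0, 1}. h p = p) \<and> bij_betw \<sigma> {1..n+1} {1..n+1} \<and>
     ndiagram n (\<lambda>i s. h (D i s)) \<and> diagram_image n (\<lambda>i s. h (D i s)) = diagram_image n E \<and>
     (\<forall>i\<in>{1..n+1}. strand E i = h ` strand D (\<sigma> i))"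

text \<open>The end map of an isotopy carries the image of \<open>D\<close> to that of
  \<open>E\<close>; since the image determines the strands, it carries strands to strands, and
  \<open>\<sigma>\<close> records which. The invariants of isotopy are derived from this
  data.\<close>

lemma isotopic_strands:
  assumes "isotopic n D E"
  shows "\<exists>h \<sigma>. strand_map n D E h \<sigma>"
proof -
  obtain H where viaH: "isotopy_via n D E H" using assms isotopic_iff by blast
  note D = isotopy_viaD(1)[OF viaH]
  note E = isotopy_viaD(2)[OF viaH]
  note homeo = isotopy_viaD(5)[OF viaH]
  note bd = isotopy_viaD(6)[OF viaH]
  note nd = isotopy_viaD(7)[OF viaH]
  note im = isotopy_viaD(8)[OF viaH]
  have 1: "1 \<in> {0..1::real}" by simp
  obtain G where G: "homeomorphism strip strip (H 1) G" using homeo[OF 1] by blast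
  have "inj_on (H 1) strip" using G by (metis homeomorphism_def inj_on_inverseI)
  have "homeomorphism strip strip (H 1) (inv_into strip (H 1))"
  proof (rule homeomorphism_cong[OF G])
    fix p assume p: "p \<in> strip"
    then have "p = H 1 (G p)" "G p \<in> strip" using G by (auto simp: homeomorphism_def)
    then show "inv_into strip (H 1) p = G p" using \<open>inj_on (H 1) strip\<close> by (metis inv_into_f_f)
  qed simp_all
  moreover obtain \<sigma> where \<sigma>: "bij_betw \<sigma> {1..n+1} {1..n+1}"
    "\<forall>i\<in>{1..n+1}. strand E i = strand (\<lambda>i s. H 1 (D i s)) (\<sigma> i)"
    using same_image_same_strands[OF E nd[OF 1] im[symmetric]] by blast
  moreover have "strand (\<lambda>i s. H 1 (D i s)) j = H 1 ` strand D j" for j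
    by (simp add: strand_def image_image)
  ultimately have "strand_map n D E (H 1) \<sigma>"
    unfolding strand_map_def using D E bd[OF 1] nd[OF 1] im by simp
  then show ?thesis by blast
qed

lemma endpoint_permI:
  assumes D: "ndiagram n D" and i: "i \<in> {1..n+1}" "D i 0 = (real k, 0)" "D i 1 = (real l, 1)"
  shows "endpoint_perm n D k = l"
proof -
  have sx: "strand_x D i 0 = real k" using strand_x_endpoints(1)[of n D i, OF ndiagramD(1)[OF D i(1)]] i by simp
  have kN: "k \<in> {1..n+1}" using ndiagramD(1)[OF D i(1)] i(2) unfolding strand_ok_def by auto
  have "l' = l" if l': "\<exists>j\<in>{1..n+1}. D j 0 = (real k, 0) \<and> D j 1 = (real l', 1)" for l'
  proof -
    obtain j where j: "j \<in> {1..n+1}" "D j 0 = (real k, 0)" "D j 1 = (real l', 1)" using l' by blast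
    have "strand_x D j 0 = real k" using strand_x_endpoints(1)[of n D j, OF ndiagramD(1)[OF D j(1)]] j by simp
    then have "i = j" using ndiagram_start_distinct(1)[OF D i(1) j(1)] sx by auto
    then show ?thesis using i j by simp
  qed
  then have "(THE l. \<exists>i\<in>{1..n+1}. D i 0 = (real k, 0) \<and> D i 1 = (real l, 1)) = l"
    using i by (intro the_equality) blast+
  then show ?thesis unfolding endpoint_perm_def using kN by simp
qed

text \<open>The \<open>n + 1\<close> strands have distinct lower endpoints among
  \<open>n + 1\<close> places, so every place is used.\<close>

lemma ndiagram_strand_from:
  assumes D: "ndiagram n D" and k: "k \<in> {1..n+1}"
  shows "\<exists>i\<in>{1..n+1}. \<exists>l\<in>{1..n+1}. D i 0 = (real k, 0) \<and> D i 1 = (real l, 1)"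
proof -
  let ?N = "{1..n+1}"
  have "\<exists>k\<in>?N. \<exists>l\<in>?N. D i 0 = (real k, 0) \<and> D i 1 = (real l, 1)" if "i \<in> ?N" for i
    using ndiagramD(1)[OF D that] unfolding strand_ok_def by blast
  then obtain a b where ab: "\<And>i. i \<in> ?N \<Longrightarrow> a i \<in> ?N" "\<And>i. i \<in> ?N \<Longrightarrow> b i \<in> ?N"
    "\<And>i. i \<in> ?N \<Longrightarrow> D i 0 = (real (a i), 0) \<and> D i 1 = (real (b i), 1)" by metis
  have "inj_on a ?N"
  proof (rule inj_onI)
    fix i j assume ij: "i \<in> ?N" "j \<in> ?N" "a i = a j"
    then have "strand_x D i 0 = strand_x D j 0"
      using strand_x_endpoints(1)[of n D i, OF ndiagramD(1)[OF D ij(1)]]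
        strand_x_endpoints(1)[of n D j, OF ndiagramD(1)[OF D ij(2)]] ab(3) by simp
    then show "i = j" using ndiagram_start_distinct(1)[OF D ij(1,2)] by blast
  qed
  then have "a ` ?N = ?N" by (intro endo_inj_surj image_subsetI ab(1)) auto
  then obtain i where "i \<in> ?N" "a i = k" using k by (metis imageE)
  then show ?thesis using ab by blast
qed

lemma endpoint_perm_isotopic:
  assumes "isotopic n D E"
  shows "endpoint_perm n E = endpoint_perm n D"
proof
  fix k
  let ?N = "{1..n+1}"
  obtain h \<sigma> where "strand_map n D E h \<sigma>" using isotopic_strands[OF assms] by blast
  then have D: "ndiagram n D" and E: "ndiagram n E"
    and h: "\<And>p. p \<in> UNIV \<times> {0, 1} \<Longrightarrow> h p = p" "bij_betw \<sigma> ?N ?N"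
    and hs: "\<And>i. i \<in> ?N \<Longrightarrow> strand E i = h ` strand D (\<sigma> i)"
    unfolding strand_map_def by blast+
  show "endpoint_perm n E k = endpoint_perm n D k"
  proof (cases "k \<in> ?N")
    case True
    obtain j l where j: "j \<in> ?N" "D j 0 = (real k, 0)" "D j 1 = (real l, 1)"
      using ndiagram_strand_from[OF D True] by blast
    obtain i where i: "i \<in> ?N" "\<sigma> i = j" using h(2) j(1) by (metis bij_betw_imp_surj_on imageE)
    have "D j 0 \<in> strand D j" "D j 1 \<in> strand D j" by (auto simp: strand_def)
    then have "(real k, 0) \<in> strand E i" "(real l, 1) \<in> strand E i"
      using h(1)[of "(real k, 0)"] h(1)[of "(real l, 1)"] j hs[OF i(1)] i(2) by force+
    then have "E i 0 = (real k, 0)" "E i 1 = (real l, 1)"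
      using strand_x_iff[of n E i, OF ndiagramD(1)[OF E i(1)]]
        strand_x_endpoints(3,4)[of n E i, OF ndiagramD(1)[OF E i(1)]] by auto
    then show ?thesis using endpoint_permI[OF E i(1)] endpoint_permI[OF D j] by simp
  next
    case False
    then show ?thesis by (auto simp: endpoint_perm_def)
  qed
qed

lemma nweb_isotopic:
  assumes "isotopic n D E" "nweb n D"
  shows "nweb n E"
proof -
  let ?N = "{1..n+1}"
  obtain h \<sigma> where "strand_map n D E h \<sigma>" using isotopic_strands[OF assms(1)] by blast
  then have D: "ndiagram n D" and E: "ndiagram n E"
    and hh: "homeomorphism strip strip h (inv_into strip h)" and h2: "bij_betw \<sigma> ?N ?N"
    and h3: "\<And>i. i \<in> ?N \<Longrightarrow> strand E i = h ` strand D (\<sigma> i)"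
    unfolding strand_map_def by blast+
  have "inj_on h strip" using hh by (metis homeomorphism_def inj_on_inverseI)
  note h = this h2 h3
  have \<sigma>: "\<sigma> i \<in> ?N" "i \<noteq> j \<longrightarrow> \<sigma> i \<noteq> \<sigma> j" if "i \<in> ?N" "j \<in> ?N" for i j
    using h(2) that by (auto simp: bij_betw_def inj_on_def)
  have sub: "strand D i \<subseteq> strip" if "i \<in> ?N" for i
    using ndiagram_strip[OF D that] by (auto simp: strand_def)
  have int: "strand E i \<inter> strand E j = h ` (strand D (\<sigma> i) \<inter> strand D (\<sigma> j))" if "i \<in> ?N" "j \<in> ?N" for i j
    using inj_on_image_Int[OF h(1) sub[OF \<sigma>(1)] sub[OF \<sigma>(1)]] h(3) that by metis
  have card: "card (strand E i \<inter> strand E j) = card (strand D (\<sigma> i) \<inter> strand D (\<sigma> j))"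
    if "i \<in> ?N" "j \<in> ?N" for i j
    unfolding int[OF that] using sub[OF \<sigma>(1)[OF that]] by (intro card_image inj_on_subset[OF h(1)]) auto
  have ne: "strand E i \<inter> strand E j \<noteq> {} \<longleftrightarrow> strand D (\<sigma> i) \<inter> strand D (\<sigma> j) \<noteq> {}"
    if "i \<in> ?N" "j \<in> ?N" for i j using int[OF that] by simp
  have w1: "\<And>i j. i \<in> ?N \<Longrightarrow> j \<in> ?N \<Longrightarrow> i \<noteq> j \<Longrightarrow> card (strand D i \<inter> strand D j) \<le> 1"
    and w2: "\<not> (\<exists>i\<in>?N. \<exists>j\<in>?N. \<exists>k\<in>?N. i \<noteq> j \<and> i \<noteq> k \<and> j \<noteq> k \<and>
          strand D i \<inter> strand D j \<noteq> {} \<and> strand D i \<inter> strand D k \<noteq> {} \<and> strand D j \<inter> strand D k \<noteq> {})"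
    using assms(2) unfolding nweb_def by blast+
  show ?thesis unfolding nweb_def
  proof (intro conjI ballI impI notI)
    show "card (strand E i \<inter> strand E j) \<le> 1" if "i \<in> ?N" "j \<in> ?N" "i \<noteq> j" for i j
      using card[OF that(1,2)] w1 \<sigma>[OF that(1,2)] \<sigma>[OF that(2,1)] that(3) by metis
    assume "\<exists>i\<in>?N. \<exists>j\<in>?N. \<exists>k\<in>?N. i \<noteq> j \<and> i \<noteq> k \<and> j \<noteq> k \<and>
          strand E i \<inter> strand E j \<noteq> {} \<and> strand E i \<inter> strand E k \<noteq> {} \<and> strand E j \<inter> strand E k \<noteq> {}"
    then obtain i j k where "i \<in> ?N" "j \<in> ?N" "k \<in> ?N" "i \<noteq> j" "i \<noteq> k" "j \<noteq> k"
      "strand E i \<inter> strand E j \<noteq> {}" "strand E i \<inter> strand E k \<noteq> {}" "strand E j \<inter> strand E k \<noteq> {}" by blast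
    then show False using w2 \<sigma> ne by meson
  qed (fact E)
qed

section \<open>Level systems\<close>

text \<open>A pair \<open>(y, k)\<close> is a crossing at height \<open>y\<close> between the
  strands in the places \<open>k\<close> and \<open>k + 1\<close> counted from the left;
  \<open>k\<close> becomes the letter.\<close>

definition coincidences :: "nat \<Rightarrow> (nat \<Rightarrow> real \<Rightarrow> real) \<Rightarrow> (real \<times> nat) set" where
  "coincidences n h = {(y, k). y \<in> {0..1} \<and> k \<in> {1..n} \<and> h k y = h (k + 1) y}"

text \<open>Levels touch where strands cross. The last clause rules out three consecutive levels
  meeting in one point; that the strands exchange sides at a coincidence is carried by
  \<open>ndiagram\<close> in \<open>has_levels\<close>.\<close>

definition level_system :: "nat \<Rightarrow> (nat \<Rightarrow> real \<Rightarrow> real) \<Rightarrow> bool" where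
  "level_system n h \<longleftrightarrow>
     (\<forall>k\<in>{1..n+1}. continuous_on {0..1} (h k) \<and> h k 0 = real k \<and> h k 1 = real k) \<and>
     (\<forall>k\<in>{1..n}. \<forall>y\<in>{0..1}. h k y \<le> h (k + 1) y) \<and>
     finite (coincidences n h) \<and>
     (\<forall>y k. \<not> ((y, k) \<in> coincidences n h \<and> (y, k + 1) \<in> coincidences n h))"

definition has_levels :: "nat \<Rightarrow> diagram \<Rightarrow> (nat \<Rightarrow> real \<Rightarrow> real) \<Rightarrow> bool" where
  "has_levels n D h \<longleftrightarrow> ndiagram n D \<and> level_system n h \<and>
     diagram_image n D = (\<Union>k\<in>{1..n+1}. arc_graph 0 1 (h k))"

lemma level_systemD:
  assumes "level_system n h"
  shows "\<And>k. k \<in> {1..n+1} \<Longrightarrow> continuous_on {0..1} (h k)"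
    "\<And>k. k \<in> {1..n+1} \<Longrightarrow> h k 0 = real k" "\<And>k. k \<in> {1..n+1} \<Longrightarrow> h k 1 = real k"
    "\<And>k y. k \<in> {1..n} \<Longrightarrow> y \<in> {0..1} \<Longrightarrow> h k y \<le> h (k + 1) y"
    "finite (coincidences n h)"
    "\<And>y k. (y, k) \<in> coincidences n h \<Longrightarrow> (y, k + 1) \<notin> coincidences n h"
  using assms unfolding level_system_def by blast+

lemma coincidences_interior:
  assumes "level_system n h" "(y, k) \<in> coincidences n h"
  shows "0 < y" "y < 1" "k \<in> {1..n}"
proof -
  have y: "y \<in> {0..1}" and k: "k \<in> {1..n}" and eq: "h k y = h (k + 1) y"
    using assms(2) by (auto simp: coincidences_def)
  have "k \<in> {1..n+1}" "k + 1 \<in> {1..n+1}" using k by auto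
  then have "h k 0 \<noteq> h (k + 1) 0" "h k 1 \<noteq> h (k + 1) 1"
    using level_systemD(2,3)[OF assms(1)] by simp_all
  then have "y \<noteq> 0" "y \<noteq> 1" using eq by metis+
  then show "0 < y" "y < 1" "k \<in> {1..n}" using y k by auto
qed

text \<open>The levels of a diagram are the order statistics of its strands.\<close>

lemma order_statistic_exists:
  fixes f :: "'a \<Rightarrow> real"
  assumes "finite N" "1 \<le> k" "k \<le> card N"
  shows "\<exists>x. card {i\<in>N. f i < x} < k \<and> k \<le> card {i\<in>N. f i \<le> x}"
proof -
  let ?S = "{x \<in> f ` N. k \<le> card {i\<in>N. f i \<le> x}}"
  have ne: "N \<noteq> {}" using assms by auto
  have "{i\<in>N. f i \<le> Max (f ` N)} = N" using assms(1) by auto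
  then have "Max (f ` N) \<in> ?S" using assms ne by auto
  then have S: "?S \<noteq> {}" "finite ?S" using assms(1) by auto
  define x where "x = Min ?S"
  have xS: "x \<in> ?S" unfolding x_def using S by (intro Min_in)
  have "card {i\<in>N. f i < x} < k"
  proof (rule ccontr)
    assume "\<not> card {i\<in>N. f i < x} < k"
    then have k: "k \<le> card {i\<in>N. f i < x}" by simp
    then have ne': "{i\<in>N. f i < x} \<noteq> {}" using assms(2) by (metis card.empty not_one_le_zero order_trans)
    define x' where "x' = Max (f ` {i\<in>N. f i < x})"
    have "x' \<in> f ` {i\<in>N. f i < x}" unfolding x'_def using assms(1) ne' by (intro Max_in) auto
    then have x': "x' < x" "x' \<in> f ` N" by auto
    have "{i\<in>N. f i < x} \<subseteq> {i\<in>N. f i \<le> x'}" unfolding x'_def using assms(1) by auto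
    then have "card {i\<in>N. f i < x} \<le> card {i\<in>N. f i \<le> x'}" using assms(1) by (intro card_mono) auto
    then have "x' \<in> ?S" using k x'(2) by simp
    then have "x \<le> x'" unfolding x_def using S by (intro Min_le)
    then show False using x'(1) by simp
  qed
  then show ?thesis using xS by blast
qed

lemma order_statistic_mono:
  fixes f :: "'a \<Rightarrow> real"
  assumes "finite N" "card {i\<in>N. f i < x} < k" "k \<le> card {i\<in>N. f i \<le> x'}"
  shows "x \<le> x'"
proof (rule ccontr)
  assume "\<not> x \<le> x'"
  then have "card {i\<in>N. f i \<le> x'} \<le> card {i\<in>N. f i < x}" using assms(1) by (intro card_mono) auto
  then show False using assms(2,3) by simp
qed

lemma card_le_eq_less:
  fixes f :: "'a \<Rightarrow> real"
  assumes "finite N"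
  shows "card {i\<in>N. f i \<le> x} = card {i\<in>N. f i < x} + card {i\<in>N. f i = x}"
proof -
  have "{i\<in>N. f i \<le> x} = {i\<in>N. f i < x} \<union> {i\<in>N. f i = x}" by auto
  then show ?thesis using assms by (simp add: card_Un_disjoint disjoint_iff)
qed

lemma has_levels_exists:
  assumes D: "ndiagram n D"
  shows "\<exists>h. has_levels n D h"
proof -
  let ?N = "{1..n+1}"
  define f where "f = strand_x D"
  have cf: "crossing_family n f" using ndiagramD(2)[OF D] by (simp add: f_def)
  have contf: "continuous_on {0..1} (f i)" if "i \<in> ?N" for i
    using continuous_strand_x[of n D i] ndiagramD(1)[OF D that] by (simp add: f_def)
  \<comment> \<open>The \<open>k\<close>-th smallest of the values \<open>f i y\<close>,
    characterized by counting the smaller and the not larger values; \<open>hI\<close> below shows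
    that these counts determine it.\<close>
  define h where "h k y = (SOME x. card {i\<in>?N. f i y < x} < k \<and> k \<le> card {i\<in>?N. f i y \<le> x})" for k y
  have h: "card {i\<in>?N. f i y < h k y} < k" "k \<le> card {i\<in>?N. f i y \<le> h k y}" if "k \<in> ?N" for k y
  proof -
    have "\<exists>x. card {i\<in>?N. f i y < x} < k \<and> k \<le> card {i\<in>?N. f i y \<le> x}"
      using that by (intro order_statistic_exists) auto
    from someI_ex[OF this] show "card {i\<in>?N. f i y < h k y} < k" "k \<le> card {i\<in>?N. f i y \<le> h k y}"
      unfolding h_def by blast+
  qed
  have hI: "h k y = x" if "k \<in> ?N" "card {i\<in>?N. f i y < x} < k" "k \<le> card {i\<in>?N. f i y \<le> x}" for k y x
    using order_statistic_mono[of ?N "\<lambda>i. f i y" "h k y" k x]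
      order_statistic_mono[of ?N "\<lambda>i. f i y" x k "h k y"] h[OF that(1), of y] that by auto
  have mono: "h k y \<le> h (k + 1) y" if "k \<in> {1..n}" for k y
  proof -
    have kk: "k \<in> ?N" "k + 1 \<in> ?N" using that by auto
    show ?thesis
      using h(1)[OF kk(1), of y] h(2)[OF kk(2), of y]
      by (intro order_statistic_mono[of ?N "\<lambda>i. f i y" _ k]) auto
  qed
  \<comment> \<open>Coinciding levels mean coinciding strands: two equal levels give a double point,
    and three equal levels would give a triple point, which \<open>no3\<close> excludes.\<close>
  have mult: "m + 1 \<le> card {i\<in>?N. f i y = h k y}" if "k \<in> ?N" "k + m \<in> ?N" "h k y = h (k + m) y" for k m y
    using h(1)[OF that(1), of y] h(2)[OF that(2), of y] card_le_eq_less[of ?N "\<lambda>i. f i y" "h k y"] that(3)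
    by simp
  have two: "\<exists>i\<in>?N. \<exists>j\<in>?N. i \<noteq> j \<and> f i y = x \<and> f j y = x" if c2: "2 \<le> card {i\<in>?N. f i y = x}" for x y
  proof -
    obtain S where S: "S \<subseteq> {i\<in>?N. f i y = x}" "card S = 2" using c2 obtain_subset_with_card_n by meson
    obtain i j where ij: "S = {i, j}" "i \<noteq> j" using S(2) unfolding card_2_iff by blast
    have "i \<in> {i\<in>?N. f i y = x}" "j \<in> {i\<in>?N. f i y = x}" using S(1) ij(1) by blast+
    then show ?thesis using ij(2) by blast
  qed
  have no3: "\<not> 3 \<le> card {i\<in>?N. f i y = x}" if "y \<in> {0..1}" for x y
  proof
    assume "3 \<le> card {i\<in>?N. f i y = x}"
    then obtain S where S: "S \<subseteq> {i\<in>?N. f i y = x}" "card S = 3" using obtain_subset_with_card_n by meson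
    obtain i j k where ijk: "S = {i, j, k}" "i \<noteq> j" "j \<noteq> k" "i \<noteq> k" using S(2) unfolding card_3_iff by blast
    then have "i \<in> {i\<in>?N. f i y = x}" "j \<in> {i\<in>?N. f i y = x}" "k \<in> {i\<in>?N. f i y = x}" using S(1) by blast+
    then have "i \<in> ?N" "j \<in> ?N" "k \<in> ?N" "f i y = x" "f j y = x" "f k y = x" by blast+
    with ijk show False using crossing_familyD(4)[OF cf _ _ \<open>y \<in> {0..1}\<close>, of i j k] by metis
  qed
  have coinc: "coincidences n h \<subseteq> {y\<in>{0..1}. \<exists>i\<in>?N. \<exists>j\<in>?N. i \<noteq> j \<and> f i y = f j y} \<times> {1..n}"
  proof clarify
    fix y k assume "(y, k) \<in> coincidences n h"
    then have yk: "y \<in> {0..1}" "k \<in> {1..n}" "h k y = h (k + 1) y" unfolding coincidences_def by auto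
    then have "2 \<le> card {i\<in>?N. f i y = h k y}" using mult[of k 1 y] by simp
    then show "y \<in> {y\<in>{0..1}. \<exists>i\<in>?N. \<exists>j\<in>?N. i \<noteq> j \<and> f i y = f j y} \<and> k \<in> {1..n}"
    proof -
      obtain i j where "i \<in> ?N" "j \<in> ?N" "i \<noteq> j" "f i y = f j y"
        using two[OF \<open>2 \<le> card _\<close>] by metis
      then show ?thesis using yk(1,2) by blast
    qed
  qed
  have im1: "\<exists>i\<in>?N. f i y = h k y" if "k \<in> ?N" for k y
  proof -
    have "1 \<le> card {i\<in>?N. f i y = h k y}" using mult[of k 0 y] that by simp
    then have "{i\<in>?N. f i y = h k y} \<noteq> {}" by (metis card.empty not_one_le_zero)
    then show ?thesis by blast
  qed
  have im2: "\<exists>k\<in>?N. h k y = f i y" if "i \<in> ?N" for i y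
  proof -
    let ?k = "card {j\<in>?N. f j y \<le> f i y}"
    have "?k \<le> card ?N" by (intro card_mono) auto
    moreover have "1 \<le> card {j\<in>?N. f j y = f i y}"
    proof -
      have "{i} \<subseteq> {j\<in>?N. f j y = f i y}" using that by blast
      then have "card {i} \<le> card {j\<in>?N. f j y = f i y}" by (intro card_mono) auto
      then show ?thesis by simp
    qed
    ultimately have "?k \<in> ?N" "card {j\<in>?N. f j y < f i y} < ?k"
      using card_le_eq_less[of ?N "\<lambda>j. f j y" "f i y"] by auto
    then show ?thesis using hI[of ?k y "f i y"] by blast
  qed
  \<comment> \<open>At the boundary the strands occupy exactly the abscissae \<open>1\<close> to
    \<open>n + 1\<close>, so counting strands amounts to counting integers.\<close>
  have endp: "h k y = real k" if k: "k \<in> ?N" and y: "y = 0 \<or> y = 1" for k y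
  proof -
    have inj: "inj_on (\<lambda>i. f i y) ?N"
      using ndiagram_start_distinct[OF D] y unfolding f_def inj_on_def by blast
    have "\<exists>a\<in>?N. f i y = real a" if "i \<in> ?N" for i
      using ndiagramD(1)[OF D that] strand_x_endpoints(1,2)[of n D i] y unfolding f_def strand_ok_def by force
    then have sub: "(\<lambda>i. f i y) ` ?N \<subseteq> real ` ?N" by blast
    have im: "(\<lambda>i. f i y) ` ?N = real ` ?N"
      using inj by (intro card_subset_eq sub) (auto simp: card_image inj_on_def)
    have c: "card {i\<in>?N. P (f i y)} = card {a\<in>?N. P (real a)}" for P
    proof -
      have "card {i\<in>?N. P (f i y)} = card ((\<lambda>i. f i y) ` {i\<in>?N. P (f i y)})"
        using inj by (intro card_image[symmetric]) (auto simp: inj_on_def)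
      also have "(\<lambda>i. f i y) ` {i\<in>?N. P (f i y)} = real ` {a\<in>?N. P (real a)}"
      proof -
        have "(\<lambda>i. f i y) ` {i\<in>?N. P (f i y)} = {x \<in> (\<lambda>i. f i y) ` ?N. P x}" by blast
        also have "\<dots> = {x \<in> real ` ?N. P x}" unfolding im ..
        also have "\<dots> = real ` {a\<in>?N. P (real a)}" by blast
        finally show ?thesis .
      qed
      also have "card \<dots> = card {a\<in>?N. P (real a)}" by (intro card_image) (auto simp: inj_on_def)
      finally show ?thesis .
    qed
    have "{a\<in>?N. real a < real k} = {1..<k}" "{a\<in>?N. real a \<le> real k} = {1..k}" using k by auto
    then have "card {i\<in>?N. f i y < real k} < k" "k \<le> card {i\<in>?N. f i y \<le> real k}"
      using c[of "\<lambda>x. x < real k"] c[of "\<lambda>x. x \<le> real k"] k by auto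
    then show ?thesis using hI[OF k] by blast
  qed
  \<comment> \<open>If every strand moves by less than \<open>e\<close>, then so does every order
    statistic: a larger jump would make one of the counts at \<open>u\<close> incompatible with
    those at \<open>y\<close>.\<close>
  have conth: "continuous_on {0..1} (h k)" if k: "k \<in> ?N" for k
    unfolding continuous_on_iff
  proof (intro ballI allI impI)
    fix y e :: real assume y: "y \<in> {0..1}" and e: "e > 0"
    have "\<forall>i\<in>?N. \<exists>d>0. \<forall>u\<in>{0..1}. dist u y < d \<longrightarrow> dist (f i u) (f i y) < e"
      using contf y e unfolding continuous_on_iff by blast
    then obtain d where d: "\<And>i. i \<in> ?N \<Longrightarrow> d i > 0"
      "\<And>i u. i \<in> ?N \<Longrightarrow> u \<in> {0..1} \<Longrightarrow> dist u y < d i \<Longrightarrow> dist (f i u) (f i y) < e" by metis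
    define d' where "d' = Min (d ` ?N)"
    have d': "d' > 0" unfolding d'_def using d(1) by (subst Min_gr_iff) auto
    have d'i: "d' \<le> d i" if "i \<in> ?N" for i unfolding d'_def using that by (intro Min_le) auto
    show "\<exists>d>0. \<forall>u\<in>{0..1}. dist u y < d \<longrightarrow> dist (h k u) (h k y) < e"
    proof (intro exI[of _ d'] conjI ballI impI d')
      fix u :: real assume u: "u \<in> {0..1}" "dist u y < d'"
      have near: "\<bar>f i u - f i y\<bar> < e" if "i \<in> ?N" for i
        using d(2)[OF that u(1)] d'i[OF that] u(2) by (simp add: dist_real_def)
      have "h k y - e < h k u"
      proof (rule ccontr)
        assume "\<not> h k y - e < h k u"
        then have "{i\<in>?N. f i u \<le> h k u} \<subseteq> {i\<in>?N. f i y < h k y}" using near by fastforce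
        then have "card {i\<in>?N. f i u \<le> h k u} \<le> card {i\<in>?N. f i y < h k y}" by (intro card_mono) auto
        then show False using h(1)[OF k, of y] h(2)[OF k, of u] by simp
      qed
      moreover have "h k u < h k y + e"
      proof (rule ccontr)
        assume "\<not> h k u < h k y + e"
        then have "{i\<in>?N. f i y \<le> h k y} \<subseteq> {i\<in>?N. f i u < h k u}" using near by fastforce
        then have "card {i\<in>?N. f i y \<le> h k y} \<le> card {i\<in>?N. f i u < h k u}" by (intro card_mono) auto
        then show False using h(1)[OF k, of u] h(2)[OF k, of y] by simp
      qed
      ultimately show "dist (h k u) (h k y) < e" by (simp add: dist_real_def abs_less_iff)
    qed
  qed
  have "level_system n h" unfolding level_system_def
  proof (intro conjI ballI allI notI)
    have "finite ({y\<in>{0..1}. \<exists>i\<in>?N. \<exists>j\<in>?N. i \<noteq> j \<and> f i y = f j y} \<times> {1..n})"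
      using cf unfolding crossing_family_def by blast
    then show "finite (coincidences n h)" using coinc by (rule finite_subset[rotated])
    fix y k assume "(y, k) \<in> coincidences n h \<and> (y, k + 1) \<in> coincidences n h"
    then have "y \<in> {0..1}" "k \<in> ?N" "k + 2 \<in> ?N" "h k y = h (k + 2) y" unfolding coincidences_def by auto
    then show False using mult[of k 2 y] no3[of y "h k y"] by simp
  qed (use conth endp mono in auto)
  moreover have "diagram_image n D = (\<Union>k\<in>?N. arc_graph 0 1 (h k))"
  proof (intro Set.set_eqI)
    fix p :: "real \<times> real"
    obtain x y where p: "p = (x, y)" by force
    have "p \<in> diagram_image n D \<longleftrightarrow> y \<in> {0..1} \<and> (\<exists>i\<in>?N. x = f i y)"
      unfolding p f_def by (rule ndiagram_image_iff[OF D])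
    also have "\<dots> \<longleftrightarrow> y \<in> {0..1} \<and> (\<exists>k\<in>?N. x = h k y)" using im1[of _ y] im2[of _ y] by metis
    also have "\<dots> \<longleftrightarrow> p \<in> (\<Union>k\<in>?N. arc_graph 0 1 (h k))" unfolding p arc_graph_def by blast
    finally show "p \<in> diagram_image n D \<longleftrightarrow> p \<in> (\<Union>k\<in>?N. arc_graph 0 1 (h k))" .
  qed
  ultimately show ?thesis using D unfolding has_levels_def by blast
qed

section \<open>Horizontal isotopies\<close>

text \<open>The piecewise linear map of the line that carries \<open>h k\<close> to \<open>g k\<close>.\<close>

fun pl_map :: "nat \<Rightarrow> (nat \<Rightarrow> real) \<Rightarrow> (nat \<Rightarrow> real) \<Rightarrow> real \<Rightarrow> real" where
  "pl_map 0 h g x = g 1 + (x - h 1)"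
| "pl_map (Suc n) h g x =
     (if x \<le> h (n + 1) then pl_map n h g x
      else if x \<le> h (n + 2) then g (n + 1) + (x - h (n + 1)) * (g (n + 2) - g (n + 1)) / (h (n + 2) - h (n + 1))
      else g (n + 2) + (x - h (n + 2)))"

text \<open>An interval between nodes may degenerate only together with its counterpart; then the
  maps for \<open>(h, g)\<close> and \<open>(g, h)\<close> are mutually inverse and strictly
  increasing.\<close>

definition same_gaps :: "nat \<Rightarrow> (nat \<Rightarrow> real) \<Rightarrow> (nat \<Rightarrow> real) \<Rightarrow> bool" where
  "same_gaps n h g \<longleftrightarrow> (\<forall>k\<in>{1..n}. h k \<le> h (k + 1) \<and> g k \<le> g (k + 1) \<and> (h k = h (k + 1) \<longleftrightarrow> g k = g (k + 1)))"

lemma same_gaps_Suc: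
  "same_gaps (Suc n) h g \<longleftrightarrow> same_gaps n h g \<and> h (n + 1) \<le> h (n + 2) \<and> g (n + 1) \<le> g (n + 2) \<and>
     (h (n + 1) = h (n + 2) \<longleftrightarrow> g (n + 1) = g (n + 2))"
  unfolding same_gaps_def by (auto simp: le_Suc_eq)

lemma same_gaps_sym: "same_gaps n h g \<Longrightarrow> same_gaps n g h"
  unfolding same_gaps_def by blast

lemma pl_map_above: "same_gaps n h g \<Longrightarrow> h (n + 1) \<le> x \<Longrightarrow> pl_map n h g x = g (n + 1) + (x - h (n + 1))"
proof (induction n)
  case (Suc n)
  then have sg: "same_gaps n h g" "h (n + 1) \<le> h (n + 2)" "h (n + 1) = h (n + 2) \<longleftrightarrow> g (n + 1) = g (n + 2)"
    unfolding same_gaps_Suc by auto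
  show ?case
  proof (cases "x \<le> h (n + 1)")
    case True
    then have "x = h (n + 1)" "h (n + 1) = h (n + 2)" using Suc.prems sg(2) by auto
    then show ?thesis using Suc.IH[OF sg(1)] sg(3) by simp
  next
    case False
    then show ?thesis using Suc.prems by (cases "x \<le> h (n + 2)") auto
  qed
qed simp

lemma pl_map_segment:
  fixes a b p q x :: real
  assumes "a < x" "x \<le> b" "p \<le> q" "a = b \<longleftrightarrow> p = q"
  shows "p < p + (x - a) * (q - p) / (b - a)" "p + (x - a) * (q - p) / (b - a) \<le> q"
    "(p + (x - a) * (q - p) / (b - a) - p) * (b - a) / (q - p) = x - a"
proof -
  have pq: "p < q" "a < b" using assms by auto
  then show "p < p + (x - a) * (q - p) / (b - a)" using assms by simp
  have "(x - a) * (q - p) \<le> (b - a) * (q - p)" using assms pq by (intro mult_right_mono) auto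
  then have "(x - a) * (q - p) / (b - a) \<le> q - p" using pq by (simp add: divide_le_eq mult.commute)
  then show "p + (x - a) * (q - p) / (b - a) \<le> q" by simp
  show "(p + (x - a) * (q - p) / (b - a) - p) * (b - a) / (q - p) = x - a" using pq by simp
qed

lemma pl_map_below: "same_gaps n h g \<Longrightarrow> x \<le> h (n + 1) \<Longrightarrow> pl_map n h g x \<le> g (n + 1)"
proof (induction n)
  case (Suc n)
  then have sg: "same_gaps n h g" "h (n + 1) \<le> h (n + 2)" "g (n + 1) \<le> g (n + 2)"
    "h (n + 1) = h (n + 2) \<longleftrightarrow> g (n + 1) = g (n + 2)" unfolding same_gaps_Suc by auto
  show ?case
  proof (cases "x \<le> h (n + 1)")
    case True
    then show ?thesis using Suc.IH[OF sg(1) True] sg(3) by simp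
  next
    case False
    then show ?thesis
      using pl_map_segment(2)[of "h (n + 1)" x "h (n + 2)" "g (n + 1)" "g (n + 2)"] sg Suc.prems by simp
  qed
qed simp

lemma pl_map_inverse: "same_gaps n h g \<Longrightarrow> pl_map n g h (pl_map n h g x) = x"
proof (induction n)
  case (Suc n)
  then have sg: "same_gaps n h g" "h (n + 1) \<le> h (n + 2)" "g (n + 1) \<le> g (n + 2)"
    "h (n + 1) = h (n + 2) \<longleftrightarrow> g (n + 1) = g (n + 2)" unfolding same_gaps_Suc by auto
  consider "x \<le> h (n + 1)" | "h (n + 1) < x" "x \<le> h (n + 2)" | "h (n + 1) < x" "h (n + 2) < x" by linarith
  then show ?case
  proof cases
    case 1
    then show ?thesis using pl_map_below[OF sg(1) 1] Suc.IH[OF sg(1)] by simp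
  next
    case 2
    let ?z = "g (n + 1) + (x - h (n + 1)) * (g (n + 2) - g (n + 1)) / (h (n + 2) - h (n + 1))"
    note s = pl_map_segment[OF 2 sg(3,4)]
    have e: "pl_map (Suc n) h g x = ?z" using 2 by simp
    have "pl_map (Suc n) g h ?z = h (n + 1) + (?z - g (n + 1)) * (h (n + 2) - h (n + 1)) / (g (n + 2) - g (n + 1))"
      using s(1,2) by (simp only: pl_map.simps if_False not_le if_True) simp
    then show ?thesis unfolding e using s(3) by simp
  next
    case 3
    then show ?thesis using sg by simp
  qed
qed simp

lemma pl_map_mono: "same_gaps n h g \<Longrightarrow> x < x' \<Longrightarrow> pl_map n h g x < pl_map n h g x'"
proof (induction n)
  case (Suc n)
  then have sg: "same_gaps n h g" "h (n + 1) \<le> h (n + 2)" "g (n + 1) \<le> g (n + 2)"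
    "h (n + 1) = h (n + 2) \<longleftrightarrow> g (n + 1) = g (n + 2)" unfolding same_gaps_Suc by auto
  have up: "g (n + 1) < pl_map (Suc n) h g x'" if "h (n + 1) < x'"
    using that sg pl_map_segment(1)[of "h (n + 1)" x' "h (n + 2)" "g (n + 1)" "g (n + 2)"]
    by (cases "x' \<le> h (n + 2)") auto
  consider "x' \<le> h (n + 1)" | "x \<le> h (n + 1)" "h (n + 1) < x'" | "h (n + 1) < x" "x' \<le> h (n + 2)"
    | "h (n + 1) < x" "x \<le> h (n + 2)" "h (n + 2) < x'" | "h (n + 1) < x" "h (n + 2) < x" by linarith
  then show ?case
  proof cases
    case 1
    then show ?thesis using Suc.IH[OF sg(1) Suc.prems(2)] Suc.prems(2) by simp
  next
    case 2
    then show ?thesis using up pl_map_below[OF sg(1) 2(1)] by (simp del: pl_map.simps(2) add: pl_map.simps(2)[of n h g x])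
  next
    case 3
    then have "h (n + 1) < h (n + 2)" "g (n + 1) < g (n + 2)" using sg Suc.prems(2) by auto
    then show ?thesis using 3 Suc.prems(2) by (simp add: divide_strict_right_mono)
  next
    case 4
    then show ?thesis using pl_map_segment(2)[OF 4(1,2) sg(3,4)] by simp
  next
    case 5
    then show ?thesis using Suc.prems(2) by simp
  qed
qed simp

lemma pl_map_node: "same_gaps n h g \<Longrightarrow> j \<in> {1..n+1} \<Longrightarrow> pl_map n h g (h j) = g j"
proof (induction n)
  case (Suc n)
  then have sg: "same_gaps n h g" "h (n + 1) \<le> h (n + 2)" unfolding same_gaps_Suc by auto
  show ?case
  proof (cases "j = n + 2")
    case True
    then show ?thesis using pl_map_above[OF Suc.prems(1), of "h j"] by simp
  next
    case False
    then have j: "j \<in> {1..n+1}" using Suc.prems(2) by auto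
    have chain: "h i \<le> h (n + 1)" if "i \<in> {1..n+1}" for i
    proof -
      have "i \<le> n + 1" "1 \<le> i" using that by auto
      then show ?thesis
      proof (induction rule: inc_induct)
        case (step m)
        then have "h m \<le> h (m + 1)" using sg(1) unfolding same_gaps_def by simp
        then show ?case using step by simp
      qed simp
    qed
    show ?thesis using Suc.IH[OF sg(1) j] chain[OF j] by simp
  qed
qed simp

lemma pl_map_id: "(\<And>k. k \<in> {1..n+1} \<Longrightarrow> g k = h k) \<Longrightarrow> pl_map n h g x = x"
proof (induction n)
  case (Suc n)
  have "pl_map n h g x = x" using Suc.prems by (intro Suc.IH) auto
  moreover have "g (n + 1) = h (n + 1)" "g (n + 2) = h (n + 2)" using Suc.prems by auto
  ultimately show ?case by simp
qed simp

text \<open>The problem is a parameter at which the source interval shrinks to a point. The linear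
  term there is of the form 0/0, but it is bounded by \<open>q - p\<close>, which tends to 0 as the
  target interval shrinks as well.\<close>

lemma continuous_on_segment_map:
  fixes a b p q X :: "'s::topological_space \<Rightarrow> real"
  assumes "continuous_on T a" "continuous_on T b" "continuous_on T p" "continuous_on T q" "continuous_on T X"
    and ab: "\<And>s. s \<in> T \<Longrightarrow> a s \<le> X s \<and> X s \<le> b s \<and> p s \<le> q s \<and> (a s = b s \<longleftrightarrow> p s = q s)"
  shows "continuous_on T (\<lambda>s. p s + (X s - a s) * (q s - p s) / (b s - a s))"
  unfolding continuous_on_def
proof
  fix s0 assume s0: "s0 \<in> T"
  have lim: "(a \<longlongrightarrow> a s0) (at s0 within T)" "(b \<longlongrightarrow> b s0) (at s0 within T)" "(p \<longlongrightarrow> p s0) (at s0 within T)"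
    "(q \<longlongrightarrow> q s0) (at s0 within T)" "(X \<longlongrightarrow> X s0) (at s0 within T)"
    using assms(1-5) s0 unfolding continuous_on_def by blast+
  show "((\<lambda>s. p s + (X s - a s) * (q s - p s) / (b s - a s)) \<longlongrightarrow>
      p s0 + (X s0 - a s0) * (q s0 - p s0) / (b s0 - a s0)) (at s0 within T)"
  proof (cases "a s0 = b s0")
    case False
    then show ?thesis by (intro tendsto_intros lim) auto
  next
    case True
    then have pq: "p s0 = q s0" using ab[OF s0] by blast
    have bound: "\<bar>(X s - a s) * (q s - p s) / (b s - a s)\<bar> \<le> q s - p s" if s: "s \<in> T" for s
    proof (cases "a s = b s")
      case True
      then show ?thesis using ab[OF s] by simp
    next
      case False
      then have "a s < b s" "0 \<le> X s - a s" "X s - a s \<le> b s - a s" "0 \<le> q s - p s" using ab[OF s] by auto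
      then have "0 \<le> (X s - a s) * (q s - p s)" "(X s - a s) * (q s - p s) \<le> (b s - a s) * (q s - p s)"
        by (auto intro: mult_right_mono)
      then show ?thesis using \<open>a s < b s\<close> by (simp add: abs_of_nonneg divide_le_eq mult.commute)
    qed
    have "((\<lambda>s. (X s - a s) * (q s - p s) / (b s - a s)) \<longlongrightarrow> 0) (at s0 within T)"
    proof (rule Lim_null_comparison[where g = "\<lambda>s. q s - p s"])
      show "\<forall>\<^sub>F s in at s0 within T. norm ((X s - a s) * (q s - p s) / (b s - a s)) \<le> q s - p s"
        unfolding eventually_at_topological using bound by (intro exI[of _ UNIV]) auto
      have "((\<lambda>s. q s - p s) \<longlongrightarrow> q s0 - p s0) (at s0 within T)" by (intro tendsto_intros lim)
      then show "((\<lambda>s. q s - p s) \<longlongrightarrow> 0) (at s0 within T)" using pq by simp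
    qed
    from tendsto_add[OF lim(3) this] show ?thesis using True by simp
  qed
qed

lemma continuous_on_pl_map:
  fixes h g :: "nat \<Rightarrow> 's::topological_space \<Rightarrow> real"
  assumes "\<And>k. k \<in> {1..n+1} \<Longrightarrow> continuous_on T (h k)" "\<And>k. k \<in> {1..n+1} \<Longrightarrow> continuous_on T (g k)"
    and "continuous_on T X" and "\<And>s. s \<in> T \<Longrightarrow> same_gaps n (\<lambda>k. h k s) (\<lambda>k. g k s)"
  shows "continuous_on T (\<lambda>s. pl_map n (\<lambda>k. h k s) (\<lambda>k. g k s) (X s))"
  using assms
proof (induction n arbitrary: T)
  case 0
  then show ?case by (auto intro!: continuous_intros)
next
  case (Suc n)
  have c: "continuous_on T (h (n + 1))" "continuous_on T (h (n + 2))" "continuous_on T (g (n + 1))"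
    "continuous_on T (g (n + 2))" using Suc.prems(1,2) by auto
  have sg: "same_gaps n (\<lambda>k. h k s) (\<lambda>k. g k s)" "h (n + 1) s \<le> h (n + 2) s" "g (n + 1) s \<le> g (n + 2) s"
    "h (n + 1) s = h (n + 2) s \<longleftrightarrow> g (n + 1) s = g (n + 2) s" if "s \<in> T" for s
    using Suc.prems(4)[OF that] unfolding same_gaps_Suc by auto
  define seg where "seg s = g (n + 1) s + (X s - h (n + 1) s) * (g (n + 2) s - g (n + 1) s) / (h (n + 2) s - h (n + 1) s)" for s
  let ?T1 = "{s\<in>T. X s - h (n + 1) s \<le> 0}" and ?T2 = "{s\<in>T. 0 \<le> X s - h (n + 1) s}"
  let ?T3 = "{s\<in>?T2. X s - h (n + 2) s \<le> 0}" and ?T4 = "{s\<in>?T2. 0 \<le> X s - h (n + 2) s}"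
  have upper: "continuous_on ?T2 (\<lambda>s. if X s - h (n + 2) s \<le> 0 then seg s else g (n + 2) s + (X s - h (n + 2) s))"
  proof (rule continuous_on_cases_le)
    have sub: "?T3 \<subseteq> T" by blast
    show "continuous_on ?T3 seg" unfolding seg_def
    proof (rule continuous_on_segment_map)
      show "h (n + 1) s \<le> X s \<and> X s \<le> h (n + 2) s \<and> g (n + 1) s \<le> g (n + 2) s \<and>
        (h (n + 1) s = h (n + 2) s \<longleftrightarrow> g (n + 1) s = g (n + 2) s)" if "s \<in> ?T3" for s
        using sg[of s] that by auto
    qed (intro continuous_on_subset[OF _ sub] c Suc.prems(3))+
    show "continuous_on ?T4 (\<lambda>s. g (n + 2) s + (X s - h (n + 2) s))"
      by (rule continuous_on_subset[of T]) (use c Suc.prems(3) in \<open>auto intro!: continuous_intros\<close>)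
    show "continuous_on ?T2 (\<lambda>s. X s - h (n + 2) s)"
      by (rule continuous_on_subset[of T]) (use c Suc.prems(3) in \<open>auto intro!: continuous_intros\<close>)
    show "seg s = g (n + 2) s + (X s - h (n + 2) s)" if "s \<in> ?T2" "X s - h (n + 2) s = 0" for s
      using sg[of s] that unfolding seg_def by (cases "h (n + 1) s = h (n + 2) s") auto
  qed
  have "continuous_on T (\<lambda>s. if X s - h (n + 1) s \<le> 0 then pl_map n (\<lambda>k. h k s) (\<lambda>k. g k s) (X s)
     else if X s - h (n + 2) s \<le> 0 then seg s else g (n + 2) s + (X s - h (n + 2) s))"
  proof (rule continuous_on_cases_le)
    show "continuous_on ?T1 (\<lambda>s. pl_map n (\<lambda>k. h k s) (\<lambda>k. g k s) (X s))"
    proof (rule Suc.IH)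
      show "continuous_on ?T1 (h k)" "continuous_on ?T1 (g k)" if "k \<in> {1..n+1}" for k
        using Suc.prems(1,2)[of k] that by (auto intro: continuous_on_subset)
      show "continuous_on ?T1 X" using Suc.prems(3) by (rule continuous_on_subset) auto
    qed (use sg in auto)
    show "continuous_on T (\<lambda>s. X s - h (n + 1) s)" using c Suc.prems(3) by (intro continuous_intros)
    show "pl_map n (\<lambda>k. h k s) (\<lambda>k. g k s) (X s) =
        (if X s - h (n + 2) s \<le> 0 then seg s else g (n + 2) s + (X s - h (n + 2) s))"
      if s: "s \<in> T" "X s - h (n + 1) s = 0" for s
      using pl_map_above[OF sg(1)[OF s(1)], of "X s"] sg(2)[OF s(1)] s(2) unfolding seg_def by simp
  qed (fact upper)
  then show ?case unfolding seg_def by (simp only: pl_map.simps diff_le_0_iff_le)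
qed

text \<open>A motion that is strictly increasing on every horizontal line keeps the equalities and
  the signs of differences between strands, hence all crossings.\<close>

lemma ndiagram_horizontal:
  assumes D: "ndiagram n D" and cont: "continuous_on strip (\<lambda>p. (\<kappa> (fst p) (snd p), snd p))"
    and mono: "\<And>x x' y. y \<in> {0..1} \<Longrightarrow> x < x' \<Longrightarrow> \<kappa> x y < \<kappa> x' y"
    and bd: "\<And>x. \<kappa> x 0 = x" "\<And>x. \<kappa> x 1 = x"
  shows "ndiagram n (\<lambda>i s. (\<kappa> (fst (D i s)) (snd (D i s)), snd (D i s)))" (is "ndiagram n ?E")
proof -
  let ?N = "{1..n+1}" and ?f = "strand_x D"
  have ok: "strand_ok n (?E i)" if i: "i \<in> ?N" for i
  proof -
    have oki: "strand_ok n (D i)" using ndiagramD(1)[OF D i] .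
    have "continuous_on {0..1} (\<lambda>s. (\<lambda>p. (\<kappa> (fst p) (snd p), snd p)) (D i s))"
      by (rule continuous_on_compose2[OF cont])
        (use oki ndiagram_strip[OF D i] in \<open>auto simp: strand_ok_def\<close>)
    moreover have "snd \<circ> ?E i = snd \<circ> D i" by auto
    moreover have "?E i 0 = D i 0" "?E i 1 = D i 1"
      using strand_x_endpoints(3,4)[of n D i, OF oki] bd by (simp_all add: prod_eq_iff)
    ultimately show ?thesis using oki unfolding strand_ok_def by simp
  qed
  have x: "strand_x ?E i y = \<kappa> (?f i y) y" if i: "i \<in> ?N" and y: "y \<in> {0..1}" for i y
  proof (rule strand_xI[OF _ y])
    have "strand ?E i = (\<lambda>p. (\<kappa> (fst p) (snd p), snd p)) ` strand D i"
      by (simp add: strand_def image_image)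
    then show "strand ?E i = arc_graph 0 1 (\<lambda>y. \<kappa> (?f i y) y)"
      unfolding strand_eq_graph[of n D i, OF ndiagramD(1)[OF D i]] arc_graph_def by (simp add: image_image)
  qed
  have eqiff: "\<kappa> a y = \<kappa> b y \<longleftrightarrow> a = b" if "y \<in> {0..1}" for a b y
    using mono[OF that, of a b] mono[OF that, of b a] by (cases a b rule: linorder_cases) auto
  have sg: "sgn (\<kappa> a y - \<kappa> b y) = sgn (a - b)" if "y \<in> {0..1}" for a b y
    using mono[OF that, of a b] mono[OF that, of b a] by (cases a b rule: linorder_cases) auto
  note cf = ndiagramD(2)[OF D]
  have "crossing_family n (\<lambda>i y. \<kappa> (?f i y) y)"
    unfolding crossing_family_def
  proof (intro conjI ballI impI)
    have "{y\<in>{0..1}. \<exists>i\<in>?N. \<exists>j\<in>?N. i \<noteq> j \<and> \<kappa> (?f i y) y = \<kappa> (?f j y) y} =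
      {y\<in>{0..1}. \<exists>i\<in>?N. \<exists>j\<in>?N. i \<noteq> j \<and> ?f i y = ?f j y}" using eqiff by blast
    then show "finite {y\<in>{0..1}. \<exists>i\<in>?N. \<exists>j\<in>?N. i \<noteq> j \<and> \<kappa> (?f i y) y = \<kappa> (?f j y) y}"
      using cf unfolding crossing_family_def by simp
    fix i j and y :: real
    assume ij: "i \<in> ?N" "j \<in> ?N" "y \<in> {0..1}" "i \<noteq> j" "\<kappa> (?f i y) y = \<kappa> (?f j y) y"
    then have "?f i y = ?f j y" using eqiff by blast
    note c = crossing_familyD[OF cf ij(1-4) this]
    show "0 < y" "y < 1" using c by auto
    show "crosses_at (\<lambda>y. \<kappa> (?f i y) y) (\<lambda>y. \<kappa> (?f j y) y) y"
      by (rule crosses_at_transfer[of "?f i" "?f j" "\<lambda>u. u" y 0 1]) (use c sg in auto)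
    show "k = i \<or> k = j" if "k \<in> ?N" "\<kappa> (?f k y) y = \<kappa> (?f i y) y" for k
      using c(4) that eqiff ij(3) by blast
  qed
  then have "crossing_family n (strand_x ?E)" by (rule crossing_family_cong) (use x in auto)
  then show ?thesis using ok unfolding ndiagram_iff by blast
qed

text \<open>Interpolating linearly between level systems with the same coincidences creates none and
  destroys none, since a convex combination of strict inequalities is strict.\<close>

lemma coincidences_same_gaps:
  assumes "level_system n h" "level_system n g" "coincidences n g = coincidences n h" "y \<in> {0..1}"
    and "t \<in> {0..1}"
  shows "same_gaps n (\<lambda>k. h k y) (\<lambda>k. (1 - t) * h k y + t * g k y)"
  unfolding same_gaps_def
proof (intro ballI conjI)
  fix k assume k: "k \<in> {1..n}"
  have le: "h k y \<le> h (k + 1) y" "g k y \<le> g (k + 1) y" using level_systemD(4) assms k by blast+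
  have "(h k y = h (k + 1) y) = ((y, k) \<in> coincidences n h)" using k assms(4) by (auto simp: coincidences_def)
  moreover have "(g k y = g (k + 1) y) = ((y, k) \<in> coincidences n g)" using k assms(4) by (auto simp: coincidences_def)
  ultimately have iff: "h k y = h (k + 1) y \<longleftrightarrow> g k y = g (k + 1) y" using assms(3) by simp
  show "h k y \<le> h (k + 1) y" by fact
  have t: "0 \<le> t" "0 \<le> 1 - t" using assms(5) by auto
  show "(1 - t) * h k y + t * g k y \<le> (1 - t) * h (k + 1) y + t * g (k + 1) y"
    using le t by (intro add_mono mult_left_mono)
  show "(h k y = h (k + 1) y) = ((1 - t) * h k y + t * g k y = (1 - t) * h (k + 1) y + t * g (k + 1) y)"
  proof
    assume "h k y = h (k + 1) y"
    then show "(1 - t) * h k y + t * g k y = (1 - t) * h (k + 1) y + t * g (k + 1) y" using iff by simp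
  next
    assume eq: "(1 - t) * h k y + t * g k y = (1 - t) * h (k + 1) y + t * g (k + 1) y"
    show "h k y = h (k + 1) y"
    proof (rule ccontr)
      assume ne: "h k y \<noteq> h (k + 1) y"
      then have lt: "h k y < h (k + 1) y" "g k y < g (k + 1) y" using le iff by auto
      have "(1 - t) * h k y \<le> (1 - t) * h (k + 1) y" "t * g k y \<le> t * g (k + 1) y"
        using le t by (auto intro: mult_left_mono)
      then have "(1 - t) * h k y = (1 - t) * h (k + 1) y" "t * g k y = t * g (k + 1) y" using eq by linarith+
      then show False using lt by auto
    qed
  qed
qed

text \<open>The levels move along straight lines from \<open>h\<close> to \<open>g\<close>, and each
  horizontal line follows by \<open>pl_map\<close>. Since an isotopy only has to reach the right
  image, its end serves for every diagram with levels \<open>g\<close>.\<close>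

lemma horizontal_isotopy:
  assumes D: "has_levels n D h" and g: "level_system n g" and coin: "coincidences n g = coincidences n h"
  shows "\<exists>E. has_levels n E g" "has_levels n E g \<Longrightarrow> isotopic n D E"
proof -
  let ?N = "{1..n+1}"
  have nd: "ndiagram n D" and h: "level_system n h"
    and im: "diagram_image n D = (\<Union>k\<in>?N. arc_graph 0 1 (h k))" using D unfolding has_levels_def by auto
  define w where "w t k y = (1 - t) * h k y + t * g k y" for t k y
  define \<kappa> where "\<kappa> t x y = pl_map n (\<lambda>k. h k y) (\<lambda>k. w t k y) x" for t x y
  define H where "H t p = (\<kappa> t (fst p) (snd p), snd p)" for t p
  define G where "G t p = (pl_map n (\<lambda>k. w t k (snd p)) (\<lambda>k. h k (snd p)) (fst p), snd p)" for t and p :: "real \<times> real"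
  have sg: "same_gaps n (\<lambda>k. h k y) (\<lambda>k. w t k y)" if "y \<in> {0..1}" "t \<in> {0..1}" for y t
    unfolding w_def by (rule coincidences_same_gaps[OF h g coin that])
  have contk: "continuous_on {0..1} (h k)" "continuous_on {0..1} (g k)" if "k \<in> ?N" for k
    using level_systemD(1)[OF h that] level_systemD(1)[OF g that] .
  have stripI: "snd p \<in> {0..1}" if "p \<in> strip" for p using that by (auto simp: strip_def)
  have contH: "continuous_on ({0..1} \<times> strip) (\<lambda>(t, p). H t p)"
  proof -
    have "continuous_on ({0..1} \<times> strip)
      (\<lambda>s. pl_map n (\<lambda>k. h k (snd (snd s))) (\<lambda>k. w (fst s) k (snd (snd s))) (fst (snd s)))"
    proof (rule continuous_on_pl_map[where h = "\<lambda>k s. h k (snd (snd s))" and g = "\<lambda>k s. w (fst s) k (snd (snd s))"])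
      fix k assume k: "k \<in> ?N"
      have 1: "continuous_on ({0..1} \<times> strip) (\<lambda>s::real \<times> real \<times> real. h k (snd (snd s)))"
        by (rule continuous_on_compose2[OF contk(1)[OF k]]) (auto intro!: continuous_intros simp: strip_def)
      have 2: "continuous_on ({0..1} \<times> strip) (\<lambda>s::real \<times> real \<times> real. g k (snd (snd s)))"
        by (rule continuous_on_compose2[OF contk(2)[OF k]]) (auto intro!: continuous_intros simp: strip_def)
      show "continuous_on ({0..1} \<times> strip) (\<lambda>s::real \<times> real \<times> real. h k (snd (snd s)))" by fact
      show "continuous_on ({0..1} \<times> strip) (\<lambda>s. w (fst s) k (snd (snd s)))"
        unfolding w_def by (intro continuous_intros 1 2)
    qed (use sg stripI in \<open>auto intro!: continuous_intros\<close>)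
    then have "continuous_on ({0..1} \<times> strip) (\<lambda>s. H (fst s) (snd s))"
      unfolding H_def \<kappa>_def by (intro continuous_intros)
    then show ?thesis by (simp add: case_prod_unfold)
  qed
  have contHt: "continuous_on strip (H t)" if "t \<in> {0..1}" for t
  proof -
    have "continuous_on strip (\<lambda>p. (\<lambda>(t, p). H t p) (t, p))"
      by (rule continuous_on_compose2[OF contH]) (use that in \<open>auto intro!: continuous_intros\<close>)
    then show ?thesis by simp
  qed
  have contGt: "continuous_on strip (G t)" if t: "t \<in> {0..1}" for t
  proof -
    have "continuous_on strip (\<lambda>p. pl_map n (\<lambda>k. w t k (snd p)) (\<lambda>k. h k (snd p)) (fst p))"
    proof (rule continuous_on_pl_map[where h = "\<lambda>k p. w t k (snd p)" and g = "\<lambda>k p. h k (snd p)"])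
      fix k assume k: "k \<in> ?N"
      have 1: "continuous_on strip (\<lambda>p::real \<times> real. h k (snd p))"
        by (rule continuous_on_compose2[OF contk(1)[OF k]]) (auto intro!: continuous_intros simp: strip_def)
      have 2: "continuous_on strip (\<lambda>p::real \<times> real. g k (snd p))"
        by (rule continuous_on_compose2[OF contk(2)[OF k]]) (auto intro!: continuous_intros simp: strip_def)
      show "continuous_on strip (\<lambda>p::real \<times> real. h k (snd p))" by fact
      show "continuous_on strip (\<lambda>p::real \<times> real. w t k (snd p))"
        unfolding w_def by (intro continuous_intros 1 2)
    next
      show "same_gaps n (\<lambda>k. w t k (snd p)) (\<lambda>k. h k (snd p))" if "p \<in> strip" for p
        using same_gaps_sym[OF sg[OF stripI[OF that] t]] .
    qed (auto intro!: continuous_intros)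
    then show ?thesis unfolding G_def by (intro continuous_intros)
  qed
  have wbd: "w t k 0 = h k 0" "w t k 1 = h k 1" if "k \<in> ?N" for t k
    using level_systemD(2,3)[OF h that] level_systemD(2,3)[OF g that] by (simp_all add: w_def algebra_simps)
  have \<kappa>bd: "\<kappa> t x 0 = x" "\<kappa> t x 1 = x" for t x
    unfolding \<kappa>_def using wbd by (auto intro: pl_map_id)
  have homeo: "homeomorphism strip strip (H t) (G t)" if t: "t \<in> {0..1}" for t
  proof (rule homeomorphismI)
    show "continuous_on strip (H t)" "continuous_on strip (G t)" using contHt contGt t by auto
    show "H t ` strip \<subseteq> strip" "G t ` strip \<subseteq> strip" by (auto simp: H_def G_def strip_def)
    show "G t (H t p) = p" if "p \<in> strip" for p
      using pl_map_inverse[OF sg[OF stripI[OF that] t]] by (simp add: H_def G_def \<kappa>_def prod_eq_iff)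
    show "H t (G t p) = p" if "p \<in> strip" for p
      using pl_map_inverse[OF same_gaps_sym[OF sg[OF stripI[OF that] t]]] by (simp add: H_def G_def \<kappa>_def prod_eq_iff)
  qed
  have ndH: "ndiagram n (\<lambda>i s. H t (D i s))" if t: "t \<in> {0..1}" for t
    unfolding H_def
  proof (rule ndiagram_horizontal[OF nd])
    show "continuous_on strip (\<lambda>p. (\<kappa> t (fst p) (snd p), snd p))" using contHt[OF t] by (simp add: H_def)
    show "\<kappa> t x y < \<kappa> t x' y" if "y \<in> {0..1}" "x < x'" for x x' y
      unfolding \<kappa>_def using pl_map_mono[OF sg[OF that(1) t] that(2)] .
  qed (use \<kappa>bd in auto)
  have w1: "w 1 k y = g k y" for k y by (simp add: w_def)
  have imH: "diagram_image n (\<lambda>i s. H 1 (D i s)) = (\<Union>k\<in>?N. arc_graph 0 1 (g k))"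
  proof -
    have "H 1 (h k y, y) = (g k y, y)" if "k \<in> ?N" "y \<in> {0..1}" for k y
      using pl_map_node[OF sg[OF that(2), of 1] that(1)] w1 by (simp add: H_def \<kappa>_def)
    then have "H 1 ` arc_graph 0 1 (h k) = arc_graph 0 1 (g k)" if "k \<in> ?N" for k
      unfolding arc_graph_def image_image using that by (intro image_cong) auto
    then have "(\<Union>k\<in>?N. H 1 ` arc_graph 0 1 (h k)) = (\<Union>k\<in>?N. arc_graph 0 1 (g k))" by simp
    then show ?thesis unfolding diagram_image_compose im image_UN .
  qed
  have w0: "w 0 k y = h k y" for k y by (simp add: w_def)
  have H0: "H 0 p = p" for p
    using pl_map_id[of n "\<lambda>k. w 0 k (snd p)" "\<lambda>k. h k (snd p)" "fst p"] w0 by (simp add: H_def \<kappa>_def)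
  have Hbd: "H t p = p" if "p \<in> UNIV \<times> {0, 1}" for t p
    using that \<kappa>bd by (auto simp: H_def)
  show "isotopic n D E" if "has_levels n E g"
  proof -
    have "ndiagram n E" "diagram_image n E = (\<Union>k\<in>?N. arc_graph 0 1 (g k))"
      using that unfolding has_levels_def by blast+
    then have "isotopy_via n D E H" unfolding isotopy_via_def using nd contH homeo ndH imH H0 Hbd by metis
    then show ?thesis using isotopic_iff by blast
  qed
  show "\<exists>E. has_levels n E g" unfolding has_levels_def using ndH[of 1] imH g by auto
qed

section \<open>Moving a single crossing vertically\<close>

text \<open>Piecewise linear hat with peak 1 at \<open>p\<close>, vanishing outside
  \<open>{c..d}\<close>; written with \<open>max\<close> and \<open>min\<close> so that continuity
  in all parameters is immediate.\<close>

definition tent :: "real \<Rightarrow> real \<Rightarrow> real \<Rightarrow> real \<Rightarrow> real" where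
  "tent c d p y = max 0 (min ((y - c) / (p - c)) ((d - y) / (d - p)))"

text \<open>For \<open>p\<close> and \<open>q\<close> between \<open>c\<close> and \<open>d\<close>
  this is the piecewise linear homeomorphism of the line that is linear on both sides of
  \<open>p\<close>, carries \<open>p\<close> to \<open>q\<close> and is the identity outside
  \<open>{c..d}\<close>; exchanging \<open>p\<close> and \<open>q\<close> inverts it.\<close>

definition vshift :: "real \<Rightarrow> real \<Rightarrow> real \<Rightarrow> real \<Rightarrow> real \<Rightarrow> real" where
  "vshift c d p q y = y + (q - p) * tent c d p y"

lemma vshift_outside: "c < p \<Longrightarrow> p < d \<Longrightarrow> y \<le> c \<or> d \<le> y \<Longrightarrow> vshift c d p q y = y"
proof -
  assume "c < p" "p < d" "y \<le> c \<or> d \<le> y"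
  then have "(y - c) / (p - c) \<le> 0 \<or> (d - y) / (d - p) \<le> 0" by (auto simp: divide_le_0_iff)
  then have "tent c d p y = 0" unfolding tent_def by linarith
  then show ?thesis by (simp add: vshift_def)
qed

lemma vshift_lower:
  assumes "c < p" "p < d" "c \<le> y" "y \<le> p"
  shows "vshift c d p q y = c + (y - c) * (q - c) / (p - c)"
proof -
  have "(y - c) / (p - c) \<le> 1" "1 \<le> (d - y) / (d - p)" "0 \<le> (y - c) / (p - c)" using assms by auto
  then have "tent c d p y = (y - c) / (p - c)" unfolding tent_def by simp
  then show ?thesis unfolding vshift_def using assms by (simp only:) (simp add: field_simps)
qed

lemma vshift_upper:
  assumes "c < p" "p < d" "p \<le> y" "y \<le> d"
  shows "vshift c d p q y = d - (d - y) * (d - q) / (d - p)"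
proof -
  have "(d - y) / (d - p) \<le> 1" "1 \<le> (y - c) / (p - c)" "0 \<le> (d - y) / (d - p)" using assms by auto
  then have "tent c d p y = (d - y) / (d - p)" unfolding tent_def by simp
  then show ?thesis unfolding vshift_def using assms by (simp only:) (simp add: field_simps)
qed

lemma vshift_inverse:
  assumes p: "c < p" "p < d" and q: "c < q" "q < d"
  shows "vshift c d q p (vshift c d p q y) = y"
proof -
  consider "y \<le> c \<or> d \<le> y" | "c \<le> y" "y \<le> p" | "p \<le> y" "y \<le> d" by linarith
  then show ?thesis
  proof cases
    case 1
    then show ?thesis using vshift_outside p q by simp
  next
    case 2
    let ?z = "c + (y - c) * (q - c) / (p - c)"
    have "0 \<le> (y - c) * (q - c) / (p - c)" using 2 p q by simp
    moreover have "(y - c) * (q - c) / (p - c) \<le> q - c"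
    proof -
      have "(y - c) * (q - c) \<le> (p - c) * (q - c)" using 2 q by (intro mult_right_mono) auto
      then show ?thesis using p by (simp add: divide_le_eq mult.commute)
    qed
    ultimately have "c \<le> ?z" "?z \<le> q" by auto
    then have "vshift c d q p ?z = c + (?z - c) * (p - c) / (q - c)" using q by (intro vshift_lower)
    also have "\<dots> = y" using p q by simp
    finally show ?thesis using vshift_lower[OF p 2] by simp
  next
    case 3
    let ?z = "d - (d - y) * (d - q) / (d - p)"
    have "0 \<le> (d - y) * (d - q) / (d - p)" using 3 p q by simp
    moreover have "(d - y) * (d - q) / (d - p) \<le> d - q"
    proof -
      have "(d - y) * (d - q) \<le> (d - p) * (d - q)" using 3 q by (intro mult_right_mono) auto
      then show ?thesis using p by (simp add: divide_le_eq mult.commute)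
    qed
    ultimately have "q \<le> ?z" "?z \<le> d" by auto
    then have "vshift c d q p ?z = d - (d - ?z) * (d - p) / (d - q)" using q by (intro vshift_upper)
    also have "\<dots> = y" using p q by simp
    finally show ?thesis using vshift_upper[OF p 3] by simp
  qed
qed

lemma vshift_in:
  assumes p: "c < p" "p < d" and q: "c < q" "q < d"
  shows "vshift c d p q y \<in> {c..d} \<longleftrightarrow> y \<in> {c..d}"
proof -
  have *: "vshift c d p q y \<in> {c..d}" if "c < p" "p < d" "c < q" "q < d" "y \<in> {c..d}" for p q y
  proof (cases "y \<le> p")
    case True
    have "(y - c) * (q - c) \<le> (p - c) * (q - c)" using that True by (intro mult_right_mono) auto
    then have "(y - c) * (q - c) / (p - c) \<le> q - c" using that by (simp add: divide_le_eq mult.commute)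
    moreover have "0 \<le> (y - c) * (q - c) / (p - c)" using that by simp
    ultimately show ?thesis using vshift_lower[of c p d y q] that True by auto
  next
    case False
    have "(d - y) * (d - q) \<le> (d - p) * (d - q)" using that False by (intro mult_right_mono) auto
    then have "(d - y) * (d - q) / (d - p) \<le> d - q" using that by (simp add: divide_le_eq mult.commute)
    moreover have "0 \<le> (d - y) * (d - q) / (d - p)" using that by simp
    ultimately show ?thesis using vshift_upper[of c p d y q] that False by auto
  qed
  show ?thesis using *[OF p q, of y] *[OF q p, of "vshift c d p q y"] vshift_inverse[OF p q, of y] by metis
qed

lemma vshift_node: "c < p \<Longrightarrow> p < d \<Longrightarrow> vshift c d p q p = q"
  using vshift_lower[of c p d p q] by simp

lemma vshift_id: "vshift c d p p y = y"
  by (simp add: vshift_def)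

lemma continuous_on_vshift:
  fixes p q y :: "'s::topological_space \<Rightarrow> real"
  assumes "continuous_on T p" "continuous_on T q" "continuous_on T y" "\<And>s. s \<in> T \<Longrightarrow> c < p s \<and> p s < d"
  shows "continuous_on T (\<lambda>s. vshift c d (p s) (q s) (y s))"
proof -
  have "\<forall>s\<in>T. p s - c \<noteq> 0" "\<forall>s\<in>T. d - p s \<noteq> 0" using assms(4) by force+
  then show ?thesis unfolding vshift_def tent_def by (intro continuous_intros assms(1-3)) auto
qed

text \<open>Strands in \<open>S\<close> are shifted along their graphs by \<open>\<phi>\<close>, the
  others stay. Within the window a strand in \<open>S\<close> and a strand outside \<open>S\<close>
  have different abscissae even at different heights, so the relative shift creates no intersection;
  outside the window nothing moves.\<close>

lemma ndiagram_vertical: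
  assumes D: "ndiagram n D" and K: "continuous_on strip K"
    and \<phi>: "continuous_on {0..1} \<phi>" "continuous_on {0..1} \<psi>"
      "\<And>y. y \<in> {0..1} \<Longrightarrow> \<phi> y \<in> {0..1} \<and> \<psi> y \<in> {0..1} \<and> \<phi> (\<psi> y) = y \<and> \<psi> (\<phi> y) = y"
    and cd: "0 < c" "d < 1" "\<And>y. y \<notin> {c..d} \<Longrightarrow> \<phi> y = y \<and> \<psi> y = y" "\<And>y. y \<in> {c..d} \<Longrightarrow> \<psi> y \<in> {c..d}"
    and KD: "\<And>i y. i \<in> {1..n+1} \<Longrightarrow> y \<in> {0..1} \<Longrightarrow>
      K (strand_x D i y, y) = (strand_x D i y, if i \<in> S then \<phi> y else y)"
    and sep: "\<And>i j y y'. i \<in> {1..n+1} \<Longrightarrow> j \<in> {1..n+1} \<Longrightarrow> i \<in> S \<Longrightarrow> j \<notin> S \<Longrightarrow> y \<in> {c..d} \<Longrightarrow> y' \<in> {c..d} \<Longrightarrow>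
      strand_x D i y \<noteq> strand_x D j y'"
  shows "ndiagram n (\<lambda>i s. K (D i s))"
proof -
  let ?N = "{1..n+1}" and ?f = "strand_x D" and ?E = "\<lambda>i s. K (D i s)"
  define \<phi>' where "\<phi>' i y = (if i \<in> S then \<phi> y else y)" for i :: nat and y
  define \<psi>' where "\<psi>' i y = (if i \<in> S then \<psi> y else y)" for i :: nat and y
  have \<phi>': "\<phi>' i y \<in> {0..1}" "\<psi>' i y \<in> {0..1}" "\<phi>' i (\<psi>' i y) = y" "\<psi>' i (\<phi>' i y) = y" if "y \<in> {0..1}" for i y
    using \<phi>(3)[OF that] that by (auto simp: \<phi>'_def \<psi>'_def)
  have bij: "bij_betw (\<phi>' i) {0..1} {0..1}" for i
    by (rule bij_betw_byWitness[of _ "\<psi>' i"]) (use \<phi>' in blast)+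
  have KD': "K (?f i y, y) = (?f i y, \<phi>' i y)" if "i \<in> ?N" "y \<in> {0..1}" for i y
    using KD[OF that] by (simp add: \<phi>'_def)
  have KDs: "K (D i s) = (fst (D i s), \<phi>' i (snd (D i s)))" if "i \<in> ?N" "s \<in> {0..1}" for i s
  proof -
    have ok: "strand_ok n (D i)" using ndiagramD(1)[OF D that(1)] .
    have "D i s = (?f i (snd (D i s)), snd (D i s))"
      using strand_x_param[of n D i, OF ok that(2)] by simp
    then show ?thesis using KD'[OF that(1) strand_ok_height[OF ok that(2)]] by (metis fst_conv)
  qed
  have end01: "\<phi> 0 = 0" "\<phi> 1 = 1" using cd(3)[of 0] cd(3)[of 1] cd(1,2) by auto
  have ok: "strand_ok n (?E i)" if i: "i \<in> ?N" for i
  proof -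
    have oki: "strand_ok n (D i)" using ndiagramD(1)[OF D i] .
    then have cD: "continuous_on {0..1} (D i)" unfolding strand_ok_def by blast
    have "continuous_on {0..1} (\<lambda>s. K (D i s))"
      by (rule continuous_on_compose2[OF K cD]) (use ndiagram_strip[OF D i] in blast)
    moreover have "bij_betw (snd \<circ> ?E i) {0..1} {0..1}"
    proof -
      have "bij_betw (\<phi>' i \<circ> (snd \<circ> D i)) {0..1} {0..1}"
        using oki by (intro bij_betw_trans[OF _ bij]) (simp add: strand_ok_def)
      moreover have "(\<phi>' i \<circ> (snd \<circ> D i)) s = (snd \<circ> ?E i) s" if "s \<in> {0..1}" for s
        using KDs[OF i that] by simp
      ultimately show ?thesis
        using bij_betw_cong[of "{0..1}" "\<phi>' i \<circ> (snd \<circ> D i)" "snd \<circ> ?E i" "{0..1}"] by blast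
    qed
    moreover have "?E i 0 = D i 0" "?E i 1 = D i 1"
    proof -
      have "\<phi>' i (snd (D i 0)) = snd (D i 0)" "\<phi>' i (snd (D i 1)) = snd (D i 1)"
        using oki end01 unfolding strand_ok_def \<phi>'_def by auto
      then show "?E i 0 = D i 0" "?E i 1 = D i 1"
        using KDs[OF i, of 0] KDs[OF i, of 1] by simp_all
    qed
    ultimately show ?thesis using oki unfolding strand_ok_def by simp
  qed
  have x: "strand_x ?E i y = ?f i (\<psi>' i y)" if i: "i \<in> ?N" and y: "y \<in> {0..1}" for i y
  proof (rule strand_xI[OF _ y])
    have "strand ?E i = K ` arc_graph 0 1 (?f i)"
      unfolding strand_eq_graph[of n D i, OF ndiagramD(1)[OF D i], symmetric] by (simp add: strand_def image_image)
    also have "\<dots> = (\<lambda>y. (?f i y, \<phi>' i y)) ` {0..1}"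
      unfolding arc_graph_def image_image using KD'[OF i] by (intro image_cong) auto
    also have "\<dots> = (\<lambda>y. (?f i (\<psi>' i y), y)) ` (\<phi>' i ` {0..1})"
      unfolding image_image using \<phi>'(4) by (intro image_cong) auto
    also have "\<phi>' i ` {0..1} = {0..1}" using bij by (simp add: bij_betw_def)
    finally show "strand ?E i = arc_graph 0 1 (\<lambda>y. ?f i (\<psi>' i y))" by (simp add: arc_graph_def)
  qed
  note cf = ndiagramD(2)[OF D]
  have \<psi>out: "\<psi>' i y = y" if "y \<notin> {c..d}" for i y using cd(3)[OF that] by (simp add: \<psi>'_def)
  have \<psi>in: "\<psi>' i y \<in> {c..d}" if "y \<in> {c..d}" for i y using cd(4)[OF that] that by (simp add: \<psi>'_def)
  have same: "y \<in> {c..d} \<Longrightarrow> i \<in> S \<longleftrightarrow> j \<in> S"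
    if "i \<in> ?N" "j \<in> ?N" "?f i (\<psi>' i y) = ?f j (\<psi>' j y)" for i j y
    using sep[OF that(1,2) _ _ \<psi>in \<psi>in, of y y i j] sep[OF that(2,1) _ _ \<psi>in \<psi>in, of y y j i] that(3) by metis
  \<comment> \<open>Strands that meet after the shift were shifted alike: in the window they are
    both in \<open>S\<close> or both outside, elsewhere \<open>\<psi>'\<close> is the identity.
    Hence every new meeting comes from an old one.\<close>
  have same': "\<psi>' i y = \<psi>' j y" if "i \<in> ?N" "j \<in> ?N" "?f i (\<psi>' i y) = ?f j (\<psi>' j y)" for i j y
    using same[OF that] \<psi>out[of y] by (cases "y \<in> {c..d}") (simp_all add: \<psi>'_def)
  have \<psi>mono: "\<psi> u < \<psi> v" if "0 < u" "u < v" "v < 1" for u v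
  proof (rule increasing_on_unit[OF \<phi>(2)])
    show "inj_on \<psi> {0..1}" using \<phi>(3) by (metis inj_on_inverseI)
    show "\<psi> 0 = 0" using cd(3)[of 0] cd(1) by auto
    show "0 \<le> \<psi> s" if "s \<in> {0..1}" for s using \<phi>(3)[OF that] by simp
  qed (use that in auto)
  have "crossing_family n (\<lambda>i y. ?f i (\<psi>' i y))"
    unfolding crossing_family_def
  proof (intro conjI ballI impI)
    let ?Y = "{y\<in>{0..1}. \<exists>i\<in>?N. \<exists>j\<in>?N. i \<noteq> j \<and> ?f i y = ?f j y}"
    have "{y\<in>{0..1}. \<exists>i\<in>?N. \<exists>j\<in>?N. i \<noteq> j \<and> ?f i (\<psi>' i y) = ?f j (\<psi>' j y)} \<subseteq> ?Y \<union> \<phi> ` ?Y"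
    proof
      fix y assume "y \<in> {y\<in>{0..1}. \<exists>i\<in>?N. \<exists>j\<in>?N. i \<noteq> j \<and> ?f i (\<psi>' i y) = ?f j (\<psi>' j y)}"
      then obtain i j where ij: "y \<in> {0..1}" "i \<in> ?N" "j \<in> ?N" "i \<noteq> j" "?f i (\<psi>' i y) = ?f j (\<psi>' j y)" by blast
      have "?f i (\<psi>' i y) = ?f j (\<psi>' i y)" using ij(5) same'[OF ij(2,3,5)] by simp
      then have "\<psi>' i y \<in> ?Y" using ij(2-4) \<phi>'(2)[OF ij(1), of i] by blast
      moreover have "y = \<psi>' i y \<or> y = \<phi> (\<psi>' i y)" using \<phi>(3)[OF ij(1)] by (auto simp: \<psi>'_def)
      ultimately show "y \<in> ?Y \<union> \<phi> ` ?Y" by (metis (lifting) UnI1 UnI2 imageI)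
    qed
    moreover have "finite ?Y" using cf unfolding crossing_family_def by blast
    ultimately show "finite {y\<in>{0..1}. \<exists>i\<in>?N. \<exists>j\<in>?N. i \<noteq> j \<and> ?f i (\<psi>' i y) = ?f j (\<psi>' j y)}"
      by (meson finite_UnI finite_imageI finite_subset)
    fix i j and y :: real
    assume ij: "i \<in> ?N" "j \<in> ?N" "y \<in> {0..1}" "i \<noteq> j" and eq: "?f i (\<psi>' i y) = ?f j (\<psi>' j y)"
    define z where "z = \<psi>' i y"
    have zj: "\<psi>' j y = z" using same'[OF ij(1,2) eq] by (simp add: z_def)
    have z: "z \<in> {0..1}" using \<phi>'(2)[OF ij(3)] by (simp add: z_def)
    have "?f i z = ?f j z" using eq zj by (simp add: z_def)
    note cr = crossing_familyD[OF cf ij(1,2) z ij(4) this]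
    have y: "\<phi>' i z = y" using \<phi>'(3)[OF ij(3)] by (simp add: z_def)
    have y01: "y \<noteq> 0" "y \<noteq> 1"
      using cr(1,2) \<psi>out[of y i] cd(1,2) by (auto simp: z_def)
    then show y0: "0 < y" and y1: "y < 1" using ij(3) by auto
    show "crosses_at (\<lambda>y. ?f i (\<psi>' i y)) (\<lambda>y. ?f j (\<psi>' j y)) y"
    proof (cases "y \<in> {c..d}")
      case True
      then have ijS: "i \<in> S \<longleftrightarrow> j \<in> S" using same[OF ij(1,2) eq] by blast
      show ?thesis
      proof (rule crosses_at_transfer[of "?f i" "?f j" "\<psi>' i" y 0 1])
        show "crosses_at (?f i) (?f j) (\<psi>' i y)" using cr(3) by (simp add: z_def)
        show "continuous_on {0<..<1} (\<psi>' i)"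
        proof (rule continuous_on_subset)
          show "continuous_on {0..1} (\<psi>' i)" unfolding \<psi>'_def using \<phi>(2) by (cases "i \<in> S") simp_all
        qed auto
        show "\<psi>' i u < \<psi>' i v" if "0 < u" "u < v" "v < 1" for u v
          using \<psi>mono[OF that] that by (simp add: \<psi>'_def)
        show "sgn (?f i (\<psi>' i u) - ?f j (\<psi>' j u)) = sgn (?f i (\<psi>' i u) - ?f j (\<psi>' i u))" for u
          using ijS by (simp add: \<psi>'_def)
      qed (use y0 y1 in auto)
    next
      case False
      \<comment> \<open>\<open>l\<close> and \<open>r\<close> bound the part of the complement of
        the window, within the open unit interval, that contains \<open>y\<close>; there no strand
        is shifted.\<close>
      define l where "l = (if y < c then 0 else d)"
      define r where "r = (if y < c then c else 1)"
      have lr: "l < y" "y < r" "\<And>u. l < u \<Longrightarrow> u < r \<Longrightarrow> u \<notin> {c..d}"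
        using False y0 y1 by (auto simp: l_def r_def)
      show ?thesis
      proof (rule crosses_at_transfer[of "?f i" "?f j" "\<lambda>u. u" y l r])
        show "crosses_at (?f i) (?f j) y" using cr(3) \<psi>out[OF False] by (simp add: z_def)
        show "sgn (?f i (\<psi>' i u) - ?f j (\<psi>' j u)) = sgn (?f i u - ?f j u)" if "l < u" "u < r" for u
          using \<psi>out[OF lr(3)[OF that]] by simp
      qed (use lr in auto)
    qed
    show "k = i \<or> k = j" if k: "k \<in> ?N" "?f k (\<psi>' k y) = ?f i (\<psi>' i y)" for k
      using same'[OF k(1) ij(1) k(2)] k cr(4)[OF k(1)] by (simp add: z_def)
  qed
  then have "crossing_family n (strand_x ?E)" by (rule crossing_family_cong) (use x in auto)
  then show ?thesis using ok unfolding ndiagram_iff by blast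
qed

text \<open>Strands \<open>j\<close> and \<open>j + 1\<close> are pulled together by bumps of width \<open>\<delta>\<close> around the crossings in
  column \<open>j\<close>. In the window \<open>{c..d}\<close> the two strands of column \<open>k\<close> then stay in the vertical band
  between \<open>k\<close> and \<open>k + 1\<close>, and all others stay at distance at least \<open>1\<close> from it.\<close>

lemma canonical_levels:
  assumes fin: "finite Z" and Z: "\<And>y k. (y, k) \<in> Z \<Longrightarrow> 0 < y \<and> y < 1 \<and> k \<in> {1..n}"
    and adj: "\<And>y k. (y, k) \<in> Z \<Longrightarrow> (y, k + 1) \<notin> Z"
    and win: "\<And>y j. (y, j) \<in> Z \<Longrightarrow> y \<in> {c..d} \<Longrightarrow> j + 1 \<noteq> k \<and> j \<noteq> k + 1"
  shows "\<exists>g. level_system n g \<and> coincidences n g = Z \<and>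
    (\<forall>y\<in>{c..d}. \<forall>j. (j < k \<longrightarrow> g j y \<le> real k - 1) \<and> (j = k \<longrightarrow> real k \<le> g j y) \<and>
       (j = k + 1 \<longrightarrow> g j y \<le> real k + 1) \<and> (k + 1 < j \<longrightarrow> real k + 2 \<le> g j y))"
proof -
  \<comment> \<open>The ends 0 and 1 keep the bumps off the boundary; \<open>c\<close> and
    \<open>d\<close> keep bumps centred outside the window from reaching into it.\<close>
  define Y where "Y = fst ` Z \<union> {0, 1, c, d}"
  have finY: "finite Y" using fin by (simp add: Y_def)
  have "\<exists>\<delta>>0. \<forall>u\<in>Y. \<forall>v\<in>Y. u \<noteq> v \<longrightarrow> \<delta> \<le> \<bar>u - v\<bar>"
  proof -
    let ?S = "insert 1 ((\<lambda>(u, v). \<bar>u - v\<bar>) ` {(u, v). (u, v) \<in> Y \<times> Y \<and> u \<noteq> v})"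
    have "finite {(u, v). (u, v) \<in> Y \<times> Y \<and> u \<noteq> v}" by (rule finite_subset[of _ "Y \<times> Y"]) (use finY in auto)
    then have fS: "finite ?S" by blast
    have "Min ?S > 0" using fS by (subst Min_gr_iff) auto
    moreover have "Min ?S \<le> \<bar>u - v\<bar>" if "u \<in> Y" "v \<in> Y" "u \<noteq> v" for u v
      using that by (intro Min_le[OF fS]) auto
    ultimately show ?thesis by blast
  qed
  then obtain \<delta> where \<delta>: "\<delta> > 0" "\<And>u v. u \<in> Y \<Longrightarrow> v \<in> Y \<Longrightarrow> u \<noteq> v \<Longrightarrow> \<delta> \<le> \<bar>u - v\<bar>" by blast
  \<comment> \<open>A product of truncated distances: it vanishes exactly at the crossings of column
    \<open>j\<close> and equals 1 at distance at least \<open>\<delta>\<close> from all of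
    them.\<close>
  define p where "p j y = (\<Prod>z\<in>{u. (u, j) \<in> Z}. min 1 (\<bar>y - z\<bar> / \<delta>))" for j y
  \<comment> \<open>Each bump of column \<open>j\<close> is shared: level \<open>j\<close> is
    displaced to the right and level \<open>j + 1\<close> to the left by half of it, so the gap
    closes exactly where \<open>p j\<close> is 0. Level 1 refers to column 0, where \<open>p\<close>
    is constantly 1.\<close>
  define g where "g j y = real j + (1 - p j y) / 2 - (1 - p (j - 1) y) / 2" for j y
  have finZ: "finite {u. (u, j) \<in> Z}" for j
    by (rule finite_subset[of _ "fst ` Z"]) (use fin in \<open>auto intro: rev_image_eqI\<close>)
  have p01: "0 \<le> p j y" "p j y \<le> 1" for j y
    unfolding p_def using \<delta>(1) by (auto intro!: prod_nonneg prod_le_1)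
  have p0: "p j y = 0 \<longleftrightarrow> (y, j) \<in> Z" for j y
  proof -
    have "p j y = 0 \<longleftrightarrow> (\<exists>z\<in>{u. (u, j) \<in> Z}. min 1 (\<bar>y - z\<bar> / \<delta>) = 0)"
      unfolding p_def by (rule prod_zero_iff[OF finZ])
    also have "\<dots> \<longleftrightarrow> (\<exists>z\<in>{u. (u, j) \<in> Z}. y = z)"
    proof -
      have "min 1 (\<bar>y - z\<bar> / \<delta>) = 0 \<longleftrightarrow> y = z" for z using \<delta>(1) by (auto simp: min_def split: if_splits)
      then show ?thesis by simp
    qed
    also have "\<dots> \<longleftrightarrow> (y, j) \<in> Z" by blast
    finally show ?thesis .
  qed
  have p1: "p j y = 1" if far: "\<And>z. (z, j) \<in> Z \<Longrightarrow> \<delta> \<le> \<bar>y - z\<bar>" for j y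
    unfolding p_def
  proof (rule prod.neutral, rule)
    fix z assume "z \<in> {u. (u, j) \<in> Z}"
    then have "1 \<le> \<bar>y - z\<bar> / \<delta>" using far[of z] \<delta>(1) by (simp add: pos_le_divide_eq)
    then show "min 1 (\<bar>y - z\<bar> / \<delta>) = 1" by simp
  qed
  have pZ0: "p 0 y = 1" for y by (rule p1) (use Z in force)
  have contp: "continuous_on {0..1} (p j)" for j
    unfolding p_def using \<delta>(1) by (intro continuous_intros) auto
  have pend: "p j 0 = 1" "p j 1 = 1" for j
  proof -
    have "\<delta> \<le> \<bar>e - z\<bar>" if "(z, j) \<in> Z" "e = 0 \<or> e = 1" for z e
    proof -
      have "z \<in> Y" "e \<in> Y" using that by (auto simp: Y_def intro: rev_image_eqI)
      moreover have "e \<noteq> z" using Z[OF that(1)] that(2) by auto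
      ultimately show ?thesis using \<delta>(2) by blast
    qed
    then show "p j 0 = 1" "p j 1 = 1" by (auto intro!: p1)
  qed
  have gap: "g (j + 1) y - g j y = p j y + (1 - p (j + 1) y) / 2 + (1 - p (j - 1) y) / 2" for j y
    unfolding g_def by (simp add: field_simps)
  have near: "p j y = 1" if "(y, i) \<in> Z" "j = i + 1 \<or> i = j + 1" for i j y
  proof (rule p1)
    fix z assume z: "(z, j) \<in> Z"
    have "y \<noteq> z" using that z adj by auto
    moreover have "y \<in> Y" "z \<in> Y" using that(1) z by (auto simp: Y_def intro: rev_image_eqI)
    ultimately show "\<delta> \<le> \<bar>y - z\<bar>" using \<delta>(2) by blast
  qed
  have coin: "coincidences n g = Z"
  proof (intro Set.set_eqI iffI)
    fix x assume "x \<in> coincidences n g"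
    then obtain y j where x: "x = (y, j)" "g j y = g (j + 1) y" unfolding coincidences_def by blast
    then have "p j y + (1 - p (j + 1) y) / 2 + (1 - p (j - 1) y) / 2 = 0" using gap[of j y] by simp
    moreover have "u = 0" if "u + (1 - v) / 2 + (1 - w) / 2 = 0" "0 \<le> u" "v \<le> 1" "w \<le> 1" for u v w :: real
    proof -
      have "0 \<le> (1 - v) / 2" "0 \<le> (1 - w) / 2" using that by auto
      then show ?thesis using that(1,2) by linarith
    qed
    ultimately have "p j y = 0" using p01 by blast
    then show "x \<in> Z" using p0 x by simp
  next
    fix x assume xZ: "x \<in> Z"
    obtain y j where x: "x = (y, j)" by force
    have yj: "0 < y" "y < 1" "j \<in> {1..n}" using Z xZ x by auto
    have "p (j + 1) y = 1" "p (j - 1) y = 1" using near[of y j] xZ x yj by auto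
    then have "g (j + 1) y = g j y" using gap[of j y] p0[of j y] xZ x by simp
    then show "x \<in> coincidences n g" using yj x unfolding coincidences_def by simp
  qed
  have "level_system n g" unfolding level_system_def
  proof (intro conjI ballI allI)
    show "continuous_on {0..1} (g j)" for j unfolding g_def using contp by (intro continuous_intros) auto
    show "g j 0 = real j" "g j 1 = real j" for j using pend by (simp_all add: g_def)
    show "g j y \<le> g (j + 1) y" for j y
    proof -
      have "0 \<le> g (j + 1) y - g j y" unfolding gap using p01[of j y] p01[of "j + 1" y] p01[of "j - 1" y] by simp
      then show ?thesis by simp
    qed
    show "finite (coincidences n g)" using fin coin by simp
    show "\<not> ((y, j) \<in> coincidences n g \<and> (y, j + 1) \<in> coincidences n g)" for y j
      unfolding coin using adj by blast
  qed
  moreover have "(j < k \<longrightarrow> g j y \<le> real k - 1) \<and> (j = k \<longrightarrow> real k \<le> g j y) \<and>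
       (j = k + 1 \<longrightarrow> g j y \<le> real k + 1) \<and> (k + 1 < j \<longrightarrow> real k + 2 \<le> g j y)" if y: "y \<in> {c..d}" for y j
  proof -
    \<comment> \<open>The columns next to \<open>k\<close> have no crossing in the window, and those
      outside it are at distance at least \<open>\<delta>\<close> from \<open>c\<close> and
      \<open>d\<close>; so their bumps vanish on the window.\<close>
    have one: "p i y = 1" if "i + 1 = k \<or> i = k + 1" for i
    proof (rule p1)
      fix z assume z: "(z, i) \<in> Z"
      have "z \<notin> {c..d}" using win[OF z] that by blast
      moreover have "z \<in> Y" "c \<in> Y" "d \<in> Y" using z by (auto simp: Y_def intro: rev_image_eqI)
      ultimately show "\<delta> \<le> \<bar>y - z\<bar>" using \<delta>(2)[of c z] \<delta>(2)[of d z] y by fastforce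
    qed
    have one': "p (k - 1) y = 1" using one[of "k - 1"] pZ0[of y] by (cases k) auto
    show ?thesis
    proof (intro conjI impI)
      assume "j < k"
      then consider "j + 1 = k" | "j + 2 \<le> k" by linarith
      then show "g j y \<le> real k - 1"
      proof cases
        case 1
        then show ?thesis using one[of j] p01[of "j - 1" y] by (auto simp: g_def)
      next
        case 2
        then have "real j + 2 \<le> real k" by linarith
        then show ?thesis using p01[of j y] p01[of "j - 1" y] by (simp add: g_def field_simps)
      qed
    next
      assume "j = k"
      then show "real k \<le> g j y" using one' p01[of k y] by (simp add: g_def)
    next
      assume "j = k + 1"
      then show "g j y \<le> real k + 1" using one[of "k + 1"] p01[of k y] by (simp add: g_def)
    next
      assume "k + 1 < j"
      then consider "j = k + 2" | "k + 3 \<le> j" by linarith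
      then show "real k + 2 \<le> g j y"
      proof cases
        case 1
        then show ?thesis using one[of "k + 1"] p01[of j y] by (simp add: g_def)
      next
        case 2
        then have "real k + 3 \<le> real j" by linarith
        then show ?thesis using p01[of j y] p01[of "j - 1" y] by (simp add: g_def field_simps)
      qed
    qed
  qed
  ultimately show ?thesis using coin by blast
qed

lemma avoid_value:
  fixes f :: "real \<Rightarrow> real"
  assumes "continuous_on {c..d} f" "\<And>y. y \<in> {c..d} \<Longrightarrow> f y \<noteq> v" "y \<in> {c..d}" "y' \<in> {c..d}" "f y < v"
  shows "f y' < v"
proof (rule ccontr)
  assume "\<not> f y' < v"
  have "connected (f ` {c..d})" by (rule connected_continuous_image[OF assms(1)]) simp
  then have "v \<in> f ` {c..d}"
    using connectedD_interval[of "f ` {c..d}" "f y" "f y'" v] assms(3-5) \<open>\<not> f y' < v\<close> by auto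
  then show False using assms(2) by blast
qed

text \<open>Once the levels have canonical form, the two strands of column \<open>k\<close> stay in
  a band of width 1 throughout the window and all other strands stay at distance 1 from the band. A
  vertical shift that acts fully on the band and fades out in the empty margins moves this one
  crossing and leaves the other strands fixed.\<close>

lemma shift_crossing:
  assumes D: "has_levels n D h" and y0: "(y0, k) \<in> coincidences n h"
    and cd: "0 < c" "c < y0" "y0 < d" "d < 1" "c < y1" "y1 < d"
    and win: "\<And>u j. (u, j) \<in> coincidences n h \<Longrightarrow> u \<in> {c..d} \<Longrightarrow> j + 1 = k \<or> j = k \<or> j = k + 1 \<Longrightarrow> u = y0 \<and> j = k"
  shows "\<exists>E g. isotopic n D E \<and> has_levels n E g \<and>
     coincidences n g = insert (y1, k) (coincidences n h - {(y0, k)})"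
proof -
  let ?N = "{1..n+1}"
  have hl: "level_system n h" using D by (simp add: has_levels_def)
  have kn: "k \<in> {1..n}" using y0 by (simp add: coincidences_def)
  have win': "j + 1 \<noteq> k \<and> j \<noteq> k + 1" if "(y, j) \<in> coincidences n h" "y \<in> {c..d}" for y j
    using win[OF that] by auto
  obtain g where g: "level_system n g" "coincidences n g = coincidences n h" and
    gw: "\<And>y j. y \<in> {c..d} \<Longrightarrow> (j < k \<longrightarrow> g j y \<le> real k - 1) \<and> (j = k \<longrightarrow> real k \<le> g j y) \<and>
       (j = k + 1 \<longrightarrow> g j y \<le> real k + 1) \<and> (k + 1 < j \<longrightarrow> real k + 2 \<le> g j y)"
  proof -
    have "\<exists>g. level_system n g \<and> coincidences n g = coincidences n h \<and>
      (\<forall>y\<in>{c..d}. \<forall>j. (j < k \<longrightarrow> g j y \<le> real k - 1) \<and> (j = k \<longrightarrow> real k \<le> g j y) \<and>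
       (j = k + 1 \<longrightarrow> g j y \<le> real k + 1) \<and> (k + 1 < j \<longrightarrow> real k + 2 \<le> g j y))"
    proof (rule canonical_levels)
      show "0 < y \<and> y < 1 \<and> j \<in> {1..n}" if "(y, j) \<in> coincidences n h" for y j
        using coincidences_interior[OF hl that] by blast
    qed (fact level_systemD(5)[OF hl], fact level_systemD(6)[OF hl], fact win')
    then show thesis using that by blast
  qed
  have gord: "g k y \<le> g (k + 1) y" if "y \<in> {0..1}" for y using level_systemD(4)[OF g(1) kn that] .
  obtain D1 where D1: "has_levels n D1 g" and iso1: "isotopic n D D1"
    using horizontal_isotopy[OF D g] by blast
  have nd1: "ndiagram n D1" and im1: "diagram_image n D1 = (\<Union>j\<in>?N. arc_graph 0 1 (g j))"
    using D1 by (auto simp: has_levels_def)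
  let ?f = "strand_x D1"
  have fg: "\<exists>j\<in>?N. ?f i y = g j y" if "i \<in> ?N" "y \<in> {0..1}" for i y
  proof -
    have "(?f i y, y) \<in> (\<Union>j\<in>?N. arc_graph 0 1 (g j))"
      using ndiagram_image_iff[OF nd1, of "?f i y" y] that im1 by blast
    then show ?thesis by (auto simp: arc_graph_def)
  qed
  have sub01: "y \<in> {0..1}" if "y \<in> {c..d}" for y using that cd by auto
  have gtri: "g j y \<le> real k - 1 \<or> (real k \<le> g j y \<and> g j y \<le> real k + 1) \<or> real k + 2 \<le> g j y" if y: "y \<in> {c..d}" for j y
  proof -
    consider "j < k" | "j = k" | "j = k + 1" | "k + 1 < j" by linarith
    then show ?thesis
      using gw[OF y, of j] gw[OF y, of k] gw[OF y, of "k + 1"] gord[OF sub01[OF y]] by cases auto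
  qed
  \<comment> \<open>The strands in the band. The thresholds are the middles of the empty margins, so
    membership can be tested at the single height \<open>c\<close>.\<close>
  define S where "S = {i. real k - 1/2 < ?f i c \<and> ?f i c < real k + 3/2}"
  have ftri: "?f i y \<le> real k - 1 \<or> (real k \<le> ?f i y \<and> ?f i y \<le> real k + 1) \<or> real k + 2 \<le> ?f i y"
    if "i \<in> ?N" "y \<in> {c..d}" for i y
    using fg[OF that(1) sub01[OF that(2)]] gtri[OF that(2)] by metis
  have cf: "continuous_on {c..d} (?f i)" if "i \<in> ?N" for i
    using continuous_strand_x[of n D1 i, OF ndiagramD(1)[OF nd1 that]] sub01 by (meson continuous_on_subset subsetI)
  have cin: "c \<in> {c..d}" using cd by auto
  have low: "?f i y < real k - 1/2 \<longleftrightarrow> ?f i c < real k - 1/2" and up: "?f i y < real k + 3/2 \<longleftrightarrow> ?f i c < real k + 3/2"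
    if i: "i \<in> ?N" and y: "y \<in> {c..d}" for i y
  proof -
    have ne: "?f i u \<noteq> real k - 1/2" "?f i u \<noteq> real k + 3/2" if "u \<in> {c..d}" for u using ftri[OF i that] by auto
    show "?f i y < real k - 1/2 \<longleftrightarrow> ?f i c < real k - 1/2"
      using avoid_value[OF cf[OF i] ne(1)] y cin by blast
    show "?f i y < real k + 3/2 \<longleftrightarrow> ?f i c < real k + 3/2"
      using avoid_value[OF cf[OF i] ne(2)] y cin by blast
  qed
  have inS: "real k \<le> ?f i y \<and> ?f i y \<le> real k + 1" if "i \<in> ?N" "i \<in> S" "y \<in> {c..d}" for i y
    using low[OF that(1,3)] up[OF that(1,3)] ftri[OF that(1,3)] that(2) by (auto simp: S_def)
  have outS: "?f i y \<le> real k - 1 \<or> real k + 2 \<le> ?f i y" if "i \<in> ?N" "i \<notin> S" "y \<in> {c..d}" for i y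
    using low[OF that(1,3)] up[OF that(1,3)] ftri[OF that(1,3)] ftri[OF that(1) cin] that(2) by (auto simp: S_def)
  \<comment> \<open>Cut-off function: 1 on the band, 0 beyond the margins, linear in
    between.\<close>
  define lam where "lam x = max 0 (min 1 (min (x - (real k - 1)) (real k + 2 - x)))" for x :: real
  have lam01: "0 \<le> lam x" "lam x \<le> 1" for x by (auto simp: lam_def)
  have lam1: "lam x = 1" if "real k \<le> x" "x \<le> real k + 1" for x using that by (simp add: lam_def)
  have lam0: "lam x = 0" if "x \<le> real k - 1 \<or> real k + 2 \<le> x" for x using that by (auto simp: lam_def)
  \<comment> \<open>Height to which \<open>y0\<close> is moved at time \<open>t\<close> on the
    vertical line with abscissa \<open>x\<close>. Vertical lines are preserved, so the motion can be
    inverted line by line.\<close>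
  define q where "q t x = y0 + t * lam x * (y1 - y0)" for t x
  have q: "c < q t x \<and> q t x < d" if "t \<in> {0..1}" for t x
  proof -
    have s: "0 \<le> t * lam x" "t * lam x \<le> 1" using that lam01[of x] by (auto intro: mult_le_one)
    have "q t x = (1 - t * lam x) * y0 + (t * lam x) * y1" by (simp add: q_def algebra_simps)
    moreover have "convex {c<..<d}" by simp
    ultimately show ?thesis using convexD_alt[of "{c<..<d}" y0 y1 "t * lam x"] s cd by simp
  qed
  define H where "H t p = (fst p, vshift c d y0 (q t (fst p)) (snd p))" for t p
  define G where "G t p = (fst p, vshift c d (q t (fst p)) y0 (snd p))" for t and p :: "real \<times> real"
  have vs01: "vshift c d a b y \<in> {0..1} \<longleftrightarrow> y \<in> {0..1}" if "c < a" "a < d" "c < b" "b < d" for a b y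
  proof (cases "y \<in> {c..d}")
    case True
    then show ?thesis using vshift_in[OF that, of y] cd by auto
  next
    case False
    then show ?thesis using vshift_outside[OF that(1,2), of y b] by auto
  qed
  have contq: "continuous_on T (\<lambda>s. q (a s) (b s))" if "continuous_on T a" "continuous_on T b"
    for T :: "'s::topological_space set" and a b
    unfolding q_def lam_def using that by (intro continuous_intros)
  have contH: "continuous_on ({0..1} \<times> strip) (\<lambda>(t, p). H t p)"
  proof -
    have "continuous_on ({0..1} \<times> strip) (\<lambda>s. H (fst s) (snd s))"
      unfolding H_def using cd by (intro continuous_intros continuous_on_vshift contq) auto
    then show ?thesis by (simp add: case_prod_unfold)
  qed
  have contHt: "continuous_on strip (H t)" for t
    unfolding H_def using cd by (intro continuous_intros continuous_on_vshift contq) auto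
  have contGt: "continuous_on strip (G t)" if "t \<in> {0..1}" for t
    unfolding G_def using q[OF that] by (intro continuous_intros continuous_on_vshift contq)
  have homeo: "homeomorphism strip strip (H t) (G t)" if t: "t \<in> {0..1}" for t
  proof (rule homeomorphismI)
    have qq: "c < q t x" "q t x < d" for x using q[OF t] by auto
    show "continuous_on strip (H t)" "continuous_on strip (G t)" using contHt contGt t by auto
    show "H t ` strip \<subseteq> strip" "G t ` strip \<subseteq> strip"
      using vs01[OF cd(2,3) qq] vs01[OF qq cd(2,3)] by (auto simp: H_def G_def strip_def)
    show "G t (H t p) = p" for p using vshift_inverse[OF cd(2,3) qq] by (simp add: H_def G_def)
    show "H t (G t p) = p" for p using vshift_inverse[OF qq cd(2,3)] by (simp add: H_def G_def)
  qed
  have H0: "H 0 p = p" for p by (simp add: H_def q_def vshift_id)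
  have Hbd: "H t p = p" if "p \<in> UNIV \<times> {0, 1}" for t p
  proof -
    have "snd p \<le> c \<or> d \<le> snd p" using that cd by auto
    then show ?thesis using vshift_outside[OF cd(2,3)] by (simp add: H_def)
  qed
  define yt where "yt t = y0 + t * (y1 - y0)" for t
  have Hin: "H t (x, y) = (x, vshift c d y0 (yt t) y)" if "real k \<le> x \<and> x \<le> real k + 1 \<or> y \<notin> {c..d}" for t x y
    using that
  proof
    assume "real k \<le> x \<and> x \<le> real k + 1"
    then show ?thesis using lam1[of x] by (simp add: H_def q_def yt_def)
  next
    assume "y \<notin> {c..d}"
    then have "y \<le> c \<or> d \<le> y" by auto
    then show ?thesis using vshift_outside[OF cd(2,3)] by (simp add: H_def)
  qed
  have Hout: "H t (x, y) = (x, y)" if "x \<le> real k - 1 \<or> real k + 2 \<le> x \<or> y \<notin> {c..d}" for t x y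
  proof (cases "y \<in> {c..d}")
    case True
    then have "lam x = 0" using that lam0 by blast
    then show ?thesis by (simp add: H_def q_def vshift_id)
  next
    case False
    then have "y \<le> c \<or> d \<le> y" by auto
    then show ?thesis using vshift_outside[OF cd(2,3)] by (simp add: H_def)
  qed
  have yt: "c < yt t" "yt t < d" if "t \<in> {0..1}" for t
    using q[OF that, of "real k"] lam1[of "real k"] by (auto simp: q_def yt_def)
  have ndH: "ndiagram n (\<lambda>i s. H t (D1 i s))" if t: "t \<in> {0..1}" for t
  proof (rule ndiagram_vertical[OF nd1 contHt, where \<phi> = "vshift c d y0 (yt t)" and \<psi> = "vshift c d (yt t) y0"
        and c = c and d = d and S = S])
    note v = vshift_inverse[OF cd(2,3) yt[OF t]] vshift_inverse[OF yt[OF t] cd(2,3)]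
    show "continuous_on {0..1} (vshift c d y0 (yt t))" "continuous_on {0..1} (vshift c d (yt t) y0)"
      using cd yt[OF t] by (auto intro!: continuous_on_vshift continuous_intros)
    show "vshift c d y0 (yt t) y \<in> {0..1} \<and> vshift c d (yt t) y0 y \<in> {0..1} \<and>
      vshift c d y0 (yt t) (vshift c d (yt t) y0 y) = y \<and> vshift c d (yt t) y0 (vshift c d y0 (yt t) y) = y"
      if "y \<in> {0..1}" for y
      using v vs01[OF cd(2,3) yt[OF t]] vs01[OF yt[OF t] cd(2,3)] that by blast
    show "vshift c d y0 (yt t) y = y \<and> vshift c d (yt t) y0 y = y" if "y \<notin> {c..d}" for y
      using vshift_outside[OF cd(2,3)] vshift_outside[OF yt[OF t]] that by auto
    show "vshift c d (yt t) y0 y \<in> {c..d}" if "y \<in> {c..d}" for y using vshift_in[OF yt[OF t] cd(2,3)] that by blast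
    show "H t (?f i y, y) = (?f i y, if i \<in> S then vshift c d y0 (yt t) y else y)" if "i \<in> ?N" "y \<in> {0..1}" for i y
    proof (cases "i \<in> S")
      case True
      then show ?thesis using Hin[of "?f i y" y t] inS[OF that(1) True] by auto
    next
      case False
      then show ?thesis using Hout[of "?f i y" y t] outS[OF that(1) False] by auto
    qed
    show "?f i y \<noteq> ?f j y'" if "i \<in> ?N" "j \<in> ?N" "i \<in> S" "j \<notin> S" "y \<in> {c..d}" "y' \<in> {c..d}" for i j y y'
      using inS[OF that(1,3,5)] outS[OF that(2,4,6)] by auto
  qed (use cd in auto)
  have yt1: "yt 1 = y1" by (simp add: yt_def)
  define \<psi> where "\<psi> = vshift c d y1 y0"
  \<comment> \<open>Only the two levels of column \<open>k\<close> are shifted; as graphs over the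
    height they are composed with the inverse shift \<open>\<psi>\<close>.\<close>
  define g' where "g' j y = (if j = k \<or> j = k + 1 then g j (\<psi> y) else g j y)" for j y
  have \<psi>in: "\<psi> y \<in> {c..d} \<longleftrightarrow> y \<in> {c..d}" for y unfolding \<psi>_def by (rule vshift_in[OF cd(5,6,2,3)])
  have \<psi>out: "\<psi> y = y" if "y \<notin> {c..d}" for y unfolding \<psi>_def using vshift_outside[OF cd(5,6)] that by auto
  have \<psi>01: "\<psi> y \<in> {0..1}" if "y \<in> {0..1}" for y unfolding \<psi>_def using vs01[OF cd(5,6,2,3)] that by blast
  have \<psi>y: "\<psi> y = y0 \<longleftrightarrow> y = y1" for y
    unfolding \<psi>_def using vshift_node[OF cd(5,6)] vshift_node[OF cd(2,3)] vshift_inverse[OF cd(5,6,2,3)] by metis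
  have g'out: "g' j y = g j y" if "y \<notin> {c..d}" for j y using \<psi>out[OF that] by (simp add: g'_def)
  have coin': "coincidences n g' = insert (y1, k) (coincidences n h - {(y0, k)})"
  proof (intro Set.set_eqI)
    fix x :: "real \<times> nat"
    obtain y j where x: "x = (y, j)" by force
    show "x \<in> coincidences n g' \<longleftrightarrow> x \<in> insert (y1, k) (coincidences n h - {(y0, k)})"
    proof (cases "y \<in> {c..d}")
      case False
      then have "y \<noteq> y1" "y \<noteq> y0" using cd by auto
      then show ?thesis using g'out[OF False] unfolding x g(2)[symmetric] unfolding coincidences_def by auto
    next
      case True
      have y01: "y \<in> {0..1}" using sub01[OF True] .
      have cg: "(u, i) \<in> coincidences n g \<longleftrightarrow> i \<in> {1..n} \<and> g i u = g (i + 1) u" if "u \<in> {0..1}" for u i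
        using that by (auto simp: coincidences_def)
      consider "j = k" | "j + 1 = k" | "j = k + 1" | "j + 1 < k" | "k + 1 < j" by linarith
      then show ?thesis
      proof cases
        case 1
        have "(\<psi> y, k) \<in> coincidences n g \<longleftrightarrow> \<psi> y = y0"
          using win[of "\<psi> y" k] y0 g(2) \<psi>in True by auto
        moreover have "x \<in> coincidences n g' \<longleftrightarrow> (\<psi> y, k) \<in> coincidences n g"
          using cg[OF \<psi>01[OF y01]] y01 1 unfolding x by (simp add: coincidences_def g'_def)
        moreover have "(y, k) \<in> coincidences n h \<longrightarrow> y = y0" using win[of y k] True by blast
        ultimately show ?thesis using \<psi>y 1 unfolding x by auto
      next
        case 2
        have "g j y \<le> real k - 1" "real k \<le> g k (\<psi> y)"
          using gw[OF True, of j] gw[of "\<psi> y" k] \<psi>in True 2 by auto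
        then have "x \<notin> coincidences n g'" using 2 unfolding x coincidences_def g'_def by auto
        moreover have "x \<notin> coincidences n h" using win'[of y j] True 2 x by auto
        ultimately show ?thesis using 2 x by auto
      next
        case 3
        have "g (k + 1) (\<psi> y) \<le> real k + 1" "real k + 2 \<le> g (k + 2) y"
          using gw[OF True, of "k + 2"] gw[of "\<psi> y" "k + 1"] \<psi>in True by auto
        then have "x \<notin> coincidences n g'" using 3 unfolding x coincidences_def g'_def by auto
        moreover have "x \<notin> coincidences n h" using win'[of y j] True 3 x by auto
        ultimately show ?thesis using 3 x by auto
      next
        case 4
        then show ?thesis unfolding x g(2)[symmetric] unfolding coincidences_def g'_def by auto
      next
        case 5
        then show ?thesis unfolding x g(2)[symmetric] unfolding coincidences_def g'_def by auto
      qed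
    qed
  qed
  have "level_system n g'" unfolding level_system_def
  proof (intro conjI ballI allI)
    fix j assume j: "j \<in> ?N"
    have cg: "continuous_on {0..1} (g j)" using level_systemD(1)[OF g(1) j] .
    have "continuous_on {0..1} \<psi>" unfolding \<psi>_def using cd by (auto intro!: continuous_on_vshift continuous_intros)
    then have "continuous_on {0..1} (\<lambda>y. g j (\<psi> y))"
      by (rule continuous_on_compose2[OF cg]) (use \<psi>01 in blast)
    then show "continuous_on {0..1} (g' j)" using cg unfolding g'_def by (cases "j = k \<or> j = k + 1") auto
    show "g' j 0 = real j" "g' j 1 = real j"
      using g'out[of 0] g'out[of 1] cd level_systemD(2,3)[OF g(1) j] by auto
  next
    fix j y assume j: "j \<in> {1..n}" and y: "y \<in> {0..1::real}"
    show "g' j y \<le> g' (j + 1) y"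
    proof (cases "y \<in> {c..d}")
      case False
      then show ?thesis using g'out[OF False] level_systemD(4)[OF g(1) j y] by simp
    next
      case True
      consider "j = k" | "j + 1 = k" | "j = k + 1" | "j + 1 < k" | "k + 1 < j" by linarith
      then show ?thesis
      proof cases
        case 1
        then show ?thesis using gord[OF \<psi>01[OF y]] by (simp add: g'_def)
      next
        case 2
        have "g j y \<le> real k - 1" "real k \<le> g k (\<psi> y)"
          using gw[OF True, of j] gw[of "\<psi> y" k] \<psi>in True 2 by auto
        then show ?thesis using 2 by (auto simp: g'_def)
      next
        case 3
        have "g (k + 1) (\<psi> y) \<le> real k + 1" "real k + 2 \<le> g (k + 2) y"
          using gw[OF True, of "k + 2"] gw[of "\<psi> y" "k + 1"] \<psi>in True by auto
        then show ?thesis using 3 by (simp add: g'_def)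
      next
        case 4
        then show ?thesis using level_systemD(4)[OF g(1) j y] by (simp add: g'_def)
      next
        case 5
        then show ?thesis using level_systemD(4)[OF g(1) j y] by (simp add: g'_def)
      qed
    qed
  next
    show "finite (coincidences n g')" unfolding coin' using level_systemD(5)[OF hl] by simp
    show "\<not> ((y, j) \<in> coincidences n g' \<and> (y, j + 1) \<in> coincidences n g')" for y j
    proof
      assume a: "(y, j) \<in> coincidences n g' \<and> (y, j + 1) \<in> coincidences n g'"
      have b: "y1 \<in> {c..d}" using cd by auto
      show False using a level_systemD(6)[OF hl, of y j] win'[OF _ b, of j] win'[OF _ b, of "j + 1"]
        unfolding coin' by auto
    qed
  qed
  moreover have "diagram_image n (\<lambda>i s. H 1 (D1 i s)) = (\<Union>j\<in>?N. arc_graph 0 1 (g' j))"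
  proof -
    have "H 1 ` arc_graph 0 1 (g j) = arc_graph 0 1 (g' j)" if j: "j \<in> ?N" for j
    proof (cases "j = k \<or> j = k + 1")
      case True
      let ?\<phi> = "vshift c d y0 y1"
      have inv: "\<psi> (?\<phi> y) = y" "?\<phi> (\<psi> y) = y" for y unfolding \<psi>_def
        by (rule vshift_inverse[OF cd(2,3,5,6)], rule vshift_inverse[OF cd(5,6,2,3)])
      have "H 1 (g j y, y) = (g j y, ?\<phi> y)" if y: "y \<in> {0..1}" for y
      proof -
        have "real k \<le> g j y \<and> g j y \<le> real k + 1 \<or> y \<notin> {c..d}"
          using True gw[of y k] gw[of y "k + 1"] gord[OF y] by auto
        from Hin[OF this] show ?thesis by (simp add: yt1)
      qed
      then have "H 1 ` arc_graph 0 1 (g j) = (\<lambda>y. (g j y, ?\<phi> y)) ` {0..1}"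
        unfolding arc_graph_def image_image by (intro image_cong) auto
      also have "\<dots> = (\<lambda>y. (g j (\<psi> y), y)) ` (?\<phi> ` {0..1})"
        unfolding image_image using inv by simp
      also have "?\<phi> ` {0..1} = {0..1}"
      proof -
        have "?\<phi> y \<in> {0..1}" if "y \<in> {0..1}" for y using vs01[OF cd(2,3,5,6)] that by blast
        moreover have "y \<in> ?\<phi> ` {0..1}" if "y \<in> {0..1}" for y using inv(2)[of y] \<psi>01[OF that] by (metis imageI)
        ultimately show ?thesis by blast
      qed
      finally show ?thesis using True by (auto simp: arc_graph_def g'_def)
    next
      case False
      have "H 1 (g j y, y) = (g' j y, y)" if y: "y \<in> {0..1}" for y
      proof -
        have "g j y \<le> real k - 1 \<or> real k + 2 \<le> g j y \<or> y \<notin> {c..d}"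
          using False gw[of y j] by (cases "j < k") auto
        from Hout[OF this] show ?thesis using False by (simp add: g'_def)
      qed
      then show ?thesis unfolding arc_graph_def image_image by (intro image_cong) auto
    qed
    then have "(\<Union>j\<in>?N. H 1 ` arc_graph 0 1 (g j)) = (\<Union>j\<in>?N. arc_graph 0 1 (g' j))" by simp
    then show ?thesis unfolding diagram_image_compose[of n "H 1"] im1 image_UN .
  qed
  ultimately have lev: "has_levels n (\<lambda>i s. H 1 (D1 i s)) g'"
    unfolding has_levels_def using ndH[of 1] by simp
  have "isotopy_via n D1 (\<lambda>i s. H 1 (D1 i s)) H"
    
  proof -
    have 1: "1 \<in> {0..1::real}" by simp
    show ?thesis unfolding isotopy_via_def
      using nd1 ndH[OF 1] contH homeo ndH H0 Hbd by metis
  qed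
  then have "isotopic n D (\<lambda>i s. H 1 (D1 i s))" using iso1 isotopic_trans isotopic_iff by blast
  then show ?thesis using lev coin' by blast
qed

section \<open>Words of diagrams\<close>

text \<open>Crossings at the same height may be listed in any order: this is how commutations of letters
  are realized.\<close>

definition has_config :: "nat \<Rightarrow> diagram \<Rightarrow> (real \<times> nat) list \<Rightarrow> bool" where
  "has_config n D L \<longleftrightarrow> distinct L \<and> sorted (map fst L) \<and>
     (\<exists>h. has_levels n D h \<and> set L = coincidences n h)"

definition has_word :: "nat \<Rightarrow> diagram \<Rightarrow> nat list \<Rightarrow> bool" where
  "has_word n D w \<longleftrightarrow> (\<exists>L. has_config n D L \<and> map snd L = w)"

lemma has_configD:
  assumes "has_config n D L"
  shows "ndiagram n D" "distinct L" "sorted (map fst L)"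
    "\<And>y k. (y, k) \<in> set L \<Longrightarrow> 0 < y \<and> y < 1 \<and> k \<in> {1..n}"
    "\<And>y k. (y, k) \<in> set L \<Longrightarrow> (y, k + 1) \<notin> set L"
proof -
  obtain h where h: "has_levels n D h" "set L = coincidences n h" using assms unfolding has_config_def by blast
  have l: "level_system n h" using h by (simp add: has_levels_def)
  show "ndiagram n D" "distinct L" "sorted (map fst L)" using assms h unfolding has_config_def has_levels_def by auto
  show "0 < y \<and> y < 1 \<and> k \<in> {1..n}" if "(y, k) \<in> set L" for y k
    using coincidences_interior[OF l] that h(2) by blast
  show "(y, k + 1) \<notin> set L" if "(y, k) \<in> set L" for y k using level_systemD(6)[OF l] that h(2) by blast
qed

lemma has_word_set: "has_word n D w \<Longrightarrow> set w \<subseteq> {1..n}"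
  unfolding has_word_def using has_configD(4) by fastforce

lemma has_word_ndiagram: "has_word n D w \<Longrightarrow> ndiagram n D"
  unfolding has_word_def using has_configD(1) by blast

lemma has_word_exists:
  assumes "ndiagram n D"
  shows "\<exists>w. has_word n D w"
proof -
  obtain h where h: "has_levels n D h" using has_levels_exists[OF assms] by blast
  then have "finite (coincidences n h)" using level_systemD(5) by (auto simp: has_levels_def)
  then obtain xs where xs: "set xs = coincidences n h" "distinct xs" using finite_distinct_list by blast
  have "has_config n D (sort_key fst xs)" unfolding has_config_def using h xs by auto
  then show ?thesis unfolding has_word_def by blast
qed

text \<open>The window ends halfway to the nearest occupied height below \<open>y\<close> and above
  \<open>y'\<close>, or halfway to the boundary. Other crossings in it have heights between
  \<open>y\<close> and \<open>y'\<close>: those at height \<open>y\<close> in \<open>M\<close> are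
  not in adjacent columns because triple points are excluded, and those of \<open>R\<close> sit at
  \<open>y'\<close> and commute by assumption.\<close>

lemma shift_config_up:
  assumes cfg: "has_config n D (M @ [(y, k)] @ R)" and y: "y < y'" "y' < 1"
    and R: "\<And>u j. (u, j) \<in> set R \<Longrightarrow> y' < u \<or> y' = u \<and> \<bar>int k - int j\<bar> > 1"
  shows "\<exists>E. isotopic n D E \<and> has_config n E (M @ [(y', k)] @ R)"
proof -
  let ?L = "M @ [(y, k)] @ R"
  obtain h where h: "has_levels n D h" "set ?L = coincidences n h" using cfg unfolding has_config_def by blast
  note L = has_configD[OF cfg]
  have hl: "level_system n h" using h by (simp add: has_levels_def)
  have M: "u \<le> y" if "(u, j) \<in> set M" for u j using L(3) that by (force simp: sorted_append)
  have y01: "0 < y" using L(4)[of y k] by simp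
  define A where "A = insert 0 {u \<in> fst ` set ?L. u < y}"
  define B where "B = insert 1 {u \<in> fst ` set ?L. y' < u}"
  have AB: "finite A" "finite B" "A \<noteq> {}" "B \<noteq> {}" by (auto simp: A_def B_def)
  define c where "c = (Max A + y) / 2"
  define d where "d = (Min B + y') / 2"
  have "Max A < y" using AB y01 by (subst Max_less_iff) (auto simp: A_def)
  moreover have "0 \<le> Max A" using AB by (intro Max_ge) (auto simp: A_def)
  ultimately have c: "0 < c" "c < y" "\<And>u. u \<in> A \<Longrightarrow> u < c"
    using y01 Max_ge[OF AB(1)] by (auto simp: c_def) fastforce
  have "y' < Min B" using AB y by (subst Min_gr_iff) (auto simp: B_def)
  moreover have "Min B \<le> 1" using AB by (intro Min_le) (auto simp: B_def)
  ultimately have d: "y' < d" "d < 1" "\<And>u. u \<in> B \<Longrightarrow> d < u"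
    using y Min_le[OF AB(2)] by (auto simp: d_def) fastforce
  have "\<exists>E g. isotopic n D E \<and> has_levels n E g \<and>
      coincidences n g = insert (y', k) (coincidences n h - {(y, k)})"
  proof (rule shift_crossing[OF h(1)])
    show "(y, k) \<in> coincidences n h" using h(2) by auto
    show "0 < c" "c < y" "y < d" "d < 1" "c < y'" "y' < d" using c d y by auto
    fix u j assume uj: "(u, j) \<in> coincidences n h" "u \<in> {c..d}" "j + 1 = k \<or> j = k \<or> j = k + 1"
    have mem: "(u, j) \<in> set ?L" using uj(1) h(2) by simp
    then have uf: "u \<in> fst ` set ?L" by force
    have "y \<le> u" using c(3)[of u] uf uj(2) by (force simp: A_def)
    have "u \<le> y'" using d(3)[of u] uf uj(2) by (force simp: B_def)
    show "u = y \<and> j = k"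
    proof (cases "(u, j) \<in> set M")
      case True
      then have "u = y" using M \<open>y \<le> u\<close> by force
      moreover have "j = k"
        using uj(3) L(5)[of y j] L(5)[of y k] True \<open>u = y\<close> by auto
      ultimately show ?thesis by simp
    next
      case False
      then consider "(u, j) = (y, k)" | "(u, j) \<in> set R" using mem by auto
      then show ?thesis
      proof cases
        case 2
        then have "\<bar>int k - int j\<bar> > 1" using R[OF 2] \<open>u \<le> y'\<close> by auto
        then show ?thesis using uj(3) by auto
      qed simp
    qed
  qed
  then obtain E g where E: "isotopic n D E" "has_levels n E g"
    "coincidences n g = insert (y', k) (coincidences n h - {(y, k)})" by blast
  have nM: "(y', k) \<notin> set M" using M y by force
  have nR: "(y', k) \<notin> set R" using R[of y' k] by auto
  have "has_config n E (M @ [(y', k)] @ R)" unfolding has_config_def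
  proof (intro conjI exI[of _ g])
    show "distinct (M @ [(y', k)] @ R)" using L(2) nM nR by auto
    have "sorted (map fst M)" "sorted (map fst R)" "\<forall>a\<in>fst ` set M. \<forall>b\<in>fst ` set R. a \<le> b"
      using L(3) by (auto simp: sorted_append)
    moreover have "\<forall>a\<in>fst ` set M. a \<le> y'" using M y by force
    moreover have "\<forall>b\<in>fst ` set R. y' \<le> b" using R by force
    ultimately show "sorted (map fst (M @ [(y', k)] @ R))" by (auto simp: sorted_append)
    show "set (M @ [(y', k)] @ R) = coincidences n g" using E(3) h(2) L(2) by auto
  qed (fact E(2))
  then show ?thesis using E(1) by blast
qed

text \<open>Starting from the top, each crossing is moved above all old heights; it never passes another one.\<close>

lemma lift_config:
  assumes "has_config n D (L @ R)" "map snd L' = map snd L" "sorted_wrt (<) (map fst L')"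
    "\<And>u v. u \<in> fst ` set L \<Longrightarrow> v \<in> fst ` set L' \<Longrightarrow> u < v"
    "\<And>u v. u \<in> fst ` set L' \<Longrightarrow> v \<in> fst ` set R \<Longrightarrow> u < v" "\<And>u. u \<in> fst ` set L' \<Longrightarrow> u < 1"
  shows "\<exists>E. isotopic n D E \<and> has_config n E (L' @ R)"
  using assms
proof (induction L arbitrary: D L' R rule: rev_induct)
  case Nil
  then have "L' = []" by simp
  then show ?case using Nil isotopic_refl[OF has_configD(1)[OF Nil(1)]] by auto
next
  case (snoc x L)
  obtain y k where x: "x = (y, k)" by force
  obtain L'' x' where L': "L' = L'' @ [x']"
    using snoc.prems(2) by (metis map_is_Nil_conv rev_exhaust snoc_eq_iff_butlast)
  obtain y' k' where x': "x' = (y', k')" by force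
  have k': "k' = k" and sn: "map snd L'' = map snd L" using snoc.prems(2) L' x x' by auto
  have "\<exists>E. isotopic n D E \<and> has_config n E (L @ [(y', k)] @ R)"
  proof (rule shift_config_up)
    show "has_config n D (L @ [(y, k)] @ R)" using snoc.prems(1) x by simp
    show "y < y'" using snoc.prems(4)[of y y'] L' x x' by simp
    show "y' < 1" using snoc.prems(6)[of y'] L' x' by simp
    show "y' < u \<or> y' = u \<and> \<bar>int k - int j\<bar> > 1" if uj: "(u, j) \<in> set R" for u j
    proof -
      have "u \<in> fst ` set R" using uj by force
      then show ?thesis using snoc.prems(5)[of y' u] L' x' by simp
    qed
  qed
  then obtain E where E: "isotopic n D E" "has_config n E (L @ (y', k) # R)" by auto
  have "\<exists>F. isotopic n E F \<and> has_config n F (L'' @ (y', k) # R)"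
  proof (rule snoc.IH[OF E(2) sn])
    show "sorted_wrt (<) (map fst L'')" using snoc.prems(3) L' by (simp add: sorted_wrt_append)
    show "u < v" if "u \<in> fst ` set L" "v \<in> fst ` set L''" for u v using snoc.prems(4)[of u v] that L' by simp
    show "u < v" if "u \<in> fst ` set L''" "v \<in> fst ` set ((y', k) # R)" for u v
      using snoc.prems(5)[of u v] snoc.prems(3) that L' x' by (auto simp: sorted_wrt_append)
    show "u < 1" if "u \<in> fst ` set L''" for u using snoc.prems(6)[of u] that L' by simp
  qed
  then obtain F where F: "isotopic n E F" "has_config n F (L'' @ (y', k) # R)" by blast
  have "L' @ R = L'' @ (y', k) # R" using L' x' k' by simp
  then show ?case using isotopic_trans[OF E(1) F(1)] F(2) by metis
qed

lemma lifted_config_exists: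
  fixes L :: "(real \<times> nat) list" and m :: real
  assumes "m < 1"
  shows "\<exists>L'. map snd L' = map snd L \<and> sorted_wrt (<) (map fst L') \<and>
     (\<forall>v\<in>fst ` set L'. m < v \<and> v < 1)"
proof -
  \<comment> \<open>A sequence increasing to 1; the summand 2 makes already \<open>z 0\<close>
    strictly larger than \<open>m\<close>.\<close>
  define z where "z j = 1 - (1 - m) / (real j + 2)" for j :: nat
  have z: "m < z j" "z j < 1" for j
  proof -
    have "(1 - m) / (real j + 2) < (1 - m) / 1" using assms by (intro divide_strict_left_mono) auto
    then show "m < z j" "z j < 1" using assms by (auto simp: z_def)
  qed
  have zm: "z i < z j" if "i < j" for i j
    unfolding z_def using assms that by (simp add: divide_strict_left_mono)
  let ?L = "zip (map z [0..<length L]) (map snd L)"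
  have "map fst ?L = map z [0..<length L]" "map snd ?L = map snd L" by simp_all
  moreover have "sorted_wrt (<) (map z [0..<length L])"
    using zm by (simp add: sorted_wrt_iff_nth_less)
  moreover have "\<forall>v\<in>fst ` set ?L. m < v \<and> v < 1" using z by (auto simp: in_set_zip)
  ultimately show ?thesis by metis
qed

lemma config_isotopic:
  assumes "has_config n D L" "has_config n E L"
  shows "isotopic n D E"
proof -
  obtain h g where "has_levels n D h" "set L = coincidences n h" "has_levels n E g" "set L = coincidences n g"
    using assms unfolding has_config_def by blast
  then show ?thesis using horizontal_isotopy(2)[of n D h g E] by (auto simp: has_levels_def)
qed

text \<open>Both lists of crossings are lifted to one common list of heights above all crossings of
  either diagram; after that the coincidences agree and a horizontal isotopy suffices.\<close>

lemma same_word_isotopic: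
  assumes "has_word n D w" "has_word n E w"
  shows "isotopic n D E"
proof -
  obtain L1 L2 where L: "has_config n D L1" "has_config n E L2" "map snd L1 = w" "map snd L2 = w"
    using assms unfolding has_word_def by blast
  define m where "m = Max (insert 0 (fst ` set L1 \<union> fst ` set L2))"
  have "m < 1" unfolding m_def using has_configD(4)[OF L(1)] has_configD(4)[OF L(2)]
    by (subst Max_less_iff) auto
  then obtain L' where L': "map snd L' = w" "sorted_wrt (<) (map fst L')" "\<forall>v\<in>fst ` set L'. m < v \<and> v < 1"
    using lifted_config_exists[of m L1] L(3) by auto
  have m: "u \<le> m" if "u \<in> fst ` set L1 \<union> fst ` set L2" for u
    unfolding m_def using that by (intro Max_ge) auto
  obtain D' where D': "isotopic n D D'" "has_config n D' L'"
    using lift_config[of n D L1 "[]" L'] L L' m by fastforce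
  obtain E' where E': "isotopic n E E'" "has_config n E' L'"
    using lift_config[of n E L2 "[]" L'] L L' m by fastforce
  show ?thesis using D' E' config_isotopic isotopic_trans isotopic_sym by metis
qed

text \<open>After a lift to distinct heights the two crossings are neighbours in the list, so the
  lower one can be raised to exactly the height of the upper one; there their order in the list is
  free.\<close>

lemma comm_word_isotopic:
  assumes "has_word n D (u @ [i, j] @ v)" "\<bar>int i - int j\<bar> > 1"
  shows "\<exists>E. isotopic n D E \<and> has_word n E (u @ [j, i] @ v)"
proof -
  obtain L where L: "has_config n D L" "map snd L = u @ [i, j] @ v" using assms(1) unfolding has_word_def by blast
  define m where "m = Max (insert 0 (fst ` set L))"
  have "m < 1" unfolding m_def using has_configD(4)[OF L(1)] by (subst Max_less_iff) auto
  then obtain L' where L': "map snd L' = map snd L" "sorted_wrt (<) (map fst L')" "\<forall>v\<in>fst ` set L'. m < v \<and> v < 1"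
    using lifted_config_exists[of m L] by blast
  have m: "u \<le> m" if "u \<in> fst ` set L" for u unfolding m_def using that by (intro Max_ge) auto
  obtain D' where D': "isotopic n D D'" "has_config n D' L'"
    using lift_config[of n D L "[]" L'] L L' m by fastforce
  obtain M R1 where MR: "L' = M @ R1" "map snd M = u" "map snd R1 = [i, j] @ v"
    using L'(1) L(2) by (metis map_eq_append_conv)
  obtain y1 y2 R where R: "R1 = [(y1, i), (y2, j)] @ R" "map snd R = v"
    using MR(3) by (auto simp: map_eq_Cons_conv)
  have y12: "y1 < y2" and gt: "\<And>u k. (u, k) \<in> set R \<Longrightarrow> y2 < u" and "y2 < 1"
    using L'(2,3) MR(1) R(1) by (force simp: sorted_wrt_append)+
  have "\<exists>E. isotopic n D' E \<and> has_config n E (M @ [(y2, i)] @ ((y2, j) # R))"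
  proof (rule shift_config_up)
    show "has_config n D' (M @ [(y1, i)] @ (y2, j) # R)" using D'(2) MR R by simp
    show "y2 < u \<or> y2 = u \<and> \<bar>int i - int k\<bar> > 1" if "(u, k) \<in> set ((y2, j) # R)" for u k
      using that gt assms(2) by auto
  qed fact+
  then obtain E where E: "isotopic n D' E" "has_config n E (M @ [(y2, i)] @ ((y2, j) # R))" by blast
  \<comment> \<open>Same diagram, same set of crossings: at equal heights both orders are
    sorted.\<close>
  then have "has_config n E (M @ [(y2, j), (y2, i)] @ R)"
    unfolding has_config_def by (auto simp: insert_commute sorted_append)
  then have "has_word n E (u @ [j, i] @ v)" unfolding has_word_def using MR(2) R(2) by force
  then show ?thesis using D'(1) E(1) isotopic_trans by blast
qed

lemma comm_eq_isotopic:
  assumes "comm_eq w w'" "has_word n D w"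
  shows "\<exists>E. isotopic n D E \<and> has_word n E w'"
  using assms
proof (induction rule: rtranclp_induct)
  case base
  then show ?case using isotopic_refl[OF has_word_ndiagram] by blast
next
  case (step y z)
  then obtain E where E: "isotopic n D E" "has_word n E y" by blast
  obtain u v i j where "\<bar>int i - int j\<bar> > 1" "y = u @ [i, j] @ v" "z = u @ [j, i] @ v"
    using step(2) unfolding comm_step_def by blast
  then show ?case using comm_word_isotopic[of n E u i j v] E isotopic_trans by blast
qed

section \<open>Stacking\<close>

lemma strand_okI:
  assumes c: "continuous_on {0..1} \<gamma>" and m: "\<And>u v. 0 \<le> u \<Longrightarrow> u < v \<Longrightarrow> v \<le> 1 \<Longrightarrow> snd (\<gamma> u) < snd (\<gamma> v)"
    and e: "k \<in> {1..n+1}" "l \<in> {1..n+1}" "\<gamma> 0 = (real k, 0)" "\<gamma> 1 = (real l, 1)"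
  shows "strand_ok n \<gamma>"
proof -
  have "inj_on (snd \<circ> \<gamma>) {0..1}"
  proof (rule inj_onI)
    fix u v :: real assume uv: "u \<in> {0..1}" "v \<in> {0..1}" "(snd \<circ> \<gamma>) u = (snd \<circ> \<gamma>) v"
    show "u = v" using m[of u v] m[of v u] uv by (cases u v rule: linorder_cases) auto
  qed
  moreover have "(snd \<circ> \<gamma>) ` {0..1} = {0..1}"
  proof
    show "(snd \<circ> \<gamma>) ` {0..1} \<subseteq> {0..1}"
    proof (rule image_subsetI)
      fix u :: real assume u: "u \<in> {0..1}"
      have "0 \<le> snd (\<gamma> u)" using m[of 0 u] u e by (cases "u = 0") auto
      moreover have "snd (\<gamma> u) \<le> 1" using m[of u 1] u e by (cases "u = 1") auto
      ultimately show "(snd \<circ> \<gamma>) u \<in> {0..1}" by simp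
    qed
    show "{0..1} \<subseteq> (snd \<circ> \<gamma>) ` {0..1}"
    proof
      fix y :: real assume y: "y \<in> {0..1}"
      have "continuous_on {0..1} (\<lambda>s. snd (\<gamma> s))" using c by (intro continuous_intros)
      then have "\<exists>x. 0 \<le> x \<and> x \<le> 1 \<and> snd (\<gamma> x) = y" using y e by (intro IVT') auto
      then show "y \<in> (snd \<circ> \<gamma>) ` {0..1}" by auto
    qed
  qed
  ultimately show ?thesis unfolding strand_ok_def bij_betw_def using c e by blast
qed

definition lower_half :: "real \<times> real \<Rightarrow> real \<times> real" where
  "lower_half p = (fst p, snd p / 2)"

definition upper_half :: "real \<times> real \<Rightarrow> real \<times> real" where
  "upper_half p = (fst p, (1 + snd p) / 2)"

lemma inj_halves: "inj lower_half" "inj upper_half"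
  by (auto simp: inj_def lower_half_def upper_half_def prod_eq_iff)

text \<open>Copies are numbered independently of their endpoints, so the strand of \<open>D\<close>
  that continues strand \<open>i\<close> of \<open>E\<close> has to be found through the common
  endpoint.\<close>

definition stack_next :: "nat \<Rightarrow> diagram \<Rightarrow> diagram \<Rightarrow> nat \<Rightarrow> nat" where
  "stack_next n D E i = (THE j. j \<in> {1..n+1} \<and> fst (D j 0) = fst (E i 1))"

lemma stack_eq:
  "stack n D E i s = (if s \<le> 1/2 then lower_half (E i (2 * s)) else upper_half (D (stack_next n D E i) (2 * s - 1)))"
  unfolding stack_def stack_next_def lower_half_def upper_half_def by (simp add: Let_def)

lemma stack_next:
  assumes D: "ndiagram n D" and E: "ndiagram n E" and i: "i \<in> {1..n+1}"
  shows "stack_next n D E i \<in> {1..n+1}" "D (stack_next n D E i) 0 = (fst (E i 1), 0)"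
    "strand_x D (stack_next n D E i) 0 = strand_x E i 1"
proof -
  let ?N = "{1..n+1}"
  obtain l where l: "l \<in> ?N" "E i 1 = (real l, 1)" using ndiagramD(1)[OF E i] unfolding strand_ok_def by blast
  obtain j where j: "j \<in> ?N" "D j 0 = (real l, 0)" using ndiagram_strand_from[OF D l(1)] by blast
  have "stack_next n D E i = j" unfolding stack_next_def
  proof (rule the_equality)
    show "j \<in> ?N \<and> fst (D j 0) = fst (E i 1)" using j l by simp
    fix j' assume j': "j' \<in> ?N \<and> fst (D j' 0) = fst (E i 1)"
    show "j' = j"
      using ndiagram_start_distinct(1)[OF D, of j' j] j' j l
        strand_x_endpoints(1)[of n D j, OF ndiagramD(1)[OF D j(1)]]
        strand_x_endpoints(1)[of n D j', OF ndiagramD(1)[OF D]] by auto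
  qed
  then show s: "stack_next n D E i \<in> ?N" "D (stack_next n D E i) 0 = (fst (E i 1), 0)" using j l by auto
  show "strand_x D (stack_next n D E i) 0 = strand_x E i 1"
    using strand_x_endpoints(1)[of n D "stack_next n D E i", OF ndiagramD(1)[OF D s(1)]]
      strand_x_endpoints(2)[of n E i, OF ndiagramD(1)[OF E i]] s(2) by simp
qed

lemma stack_next_inj:
  assumes D: "ndiagram n D" and E: "ndiagram n E" and "i \<in> {1..n+1}" "j \<in> {1..n+1}" "i \<noteq> j"
  shows "stack_next n D E i \<noteq> stack_next n D E j"
  using stack_next(3)[OF D E assms(3)] stack_next(3)[OF D E assms(4)] ndiagram_start_distinct(2)[OF E assms(3-5)] by metis

lemma stack_next_surj:
  assumes D: "ndiagram n D" and E: "ndiagram n E"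
  shows "stack_next n D E ` {1..n+1} = {1..n+1}"
proof (rule endo_inj_surj)
  show "stack_next n D E ` {1..n+1} \<subseteq> {1..n+1}" by (intro image_subsetI stack_next(1)[OF D E])
  show "inj_on (stack_next n D E) {1..n+1}" using stack_next_inj[OF D E] by (meson inj_onI)
qed simp

lemma split_unit: "{0..1::real} = {0..1/2} \<union> {1/2<..1}" "(\<lambda>s. 2 * s) ` {0..1/2} = {0..1::real}"
  "(\<lambda>s. 2 * s - 1) ` {1/2<..1} = {0<..1::real}"
proof -
  show "{0..1::real} = {0..1/2} \<union> {1/2<..1}" by auto
  show "(\<lambda>s. 2 * s) ` {0..1/2} = {0..1::real}"
  proof (intro Set.set_eqI iffI)
    fix y :: real assume "y \<in> {0..1}"
    then show "y \<in> (\<lambda>s. 2 * s) ` {0..1/2}" by (intro rev_image_eqI[of "y / 2"]) auto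
  qed auto
  show "(\<lambda>s. 2 * s - 1) ` {1/2<..1} = {0<..1::real}"
  proof (intro Set.set_eqI iffI)
    fix y :: real assume "y \<in> {0<..1}"
    then show "y \<in> (\<lambda>s. 2 * s - 1) ` {1/2<..1}" by (intro rev_image_eqI[of "(1 + y) / 2"]) (auto simp: field_simps)
  qed auto
qed

lemma image_split_unit:
  assumes "upper_half (\<delta> 0) = lower_half (\<gamma> 1)"
  shows "(\<lambda>s. if s \<le> 1/2 then lower_half (\<gamma> (2 * s)) else upper_half (\<delta> (2 * s - 1))) ` {0..1::real} =
    lower_half ` \<gamma> ` {0..1} \<union> upper_half ` \<delta> ` {0..1}" (is "?f ` _ = _")
proof -
  have "?f ` {0..1} = ?f ` {0..1/2} \<union> ?f ` {1/2<..1}" by (subst split_unit(1)) (simp only: image_Un)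
  also have "?f ` {0..1/2} = (\<lambda>s. lower_half (\<gamma> (2 * s))) ` {0..1/2}" by (intro image_cong) auto
  also have "\<dots> = (\<lambda>s. lower_half (\<gamma> s)) ` (\<lambda>s. 2 * s) ` {0..1/2}" by (simp only: image_image)
  also have "\<dots> = lower_half ` \<gamma> ` {0..1}" unfolding split_unit(2) by (simp only: image_image)
  also have "?f ` {1/2<..1} = (\<lambda>s. upper_half (\<delta> (2 * s - 1))) ` {1/2<..1}" by (intro image_cong) auto
  also have "\<dots> = (\<lambda>s. upper_half (\<delta> s)) ` (\<lambda>s. 2 * s - 1) ` {1/2<..1}" by (simp only: image_image)
  also have "\<dots> = upper_half ` \<delta> ` {0<..1}" unfolding split_unit(3) by (simp only: image_image)
  \<comment> \<open>The parameter \<open>1/2\<close> belongs to the lower branch, so the upper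
    branch misses its initial point; the assumption supplies it as the end of the lower one.\<close>
  also have "lower_half ` \<gamma> ` {0..1} \<union> upper_half ` \<delta> ` {0<..1} = lower_half ` \<gamma> ` {0..1} \<union> upper_half ` \<delta> ` {0..1}"
  proof -
    have "{0..1::real} = insert 0 {0<..1}" by auto
    then have "upper_half ` \<delta> ` {0..1} = insert (upper_half (\<delta> 0)) (upper_half ` \<delta> ` {0<..1})" by (simp only: image_insert)
    moreover have "lower_half (\<gamma> 1) \<in> lower_half ` \<gamma> ` {0..1}" by (intro imageI) simp
    ultimately show ?thesis using assms by auto
  qed
  finally show ?thesis .
qed

lemma finite_strand_inter:
  assumes F: "ndiagram n F" "i \<in> {1..n+1}" "j \<in> {1..n+1}" "i \<noteq> j"
  shows "finite (strand F i \<inter> strand F j)"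
proof (rule finite_subset)
  show "strand F i \<inter> strand F j \<subseteq> double_points n F" using F(2-4) unfolding double_points_def by blast
  show "finite (double_points n F)" using F(1) unfolding ndiagram_def by blast
qed

context
  fixes n :: nat and D E :: diagram
  assumes D: "ndiagram n D" and E: "ndiagram n E"
begin

abbreviation "nxt \<equiv> stack_next n D E"

lemma stack_seam:
  assumes "i \<in> {1..n+1}"
  shows "upper_half (D (nxt i) 0) = lower_half (E i 1)"
  using stack_next(2)[OF D E assms] strand_x_endpoints(4)[of n E i, OF ndiagramD(1)[OF E assms]]
  by (simp add: upper_half_def lower_half_def prod_eq_iff)

lemma strand_stack:
  assumes "i \<in> {1..n+1}"
  shows "strand (stack n D E) i = lower_half ` strand E i \<union> upper_half ` strand D (nxt i)"
  unfolding strand_def stack_eq using image_split_unit[of "D (nxt i)" "E i", OF stack_seam[OF assms]] .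

lemma strand_x_stack:
  assumes i: "i \<in> {1..n+1}" and y: "y \<in> {0..1}"
  shows "strand_x (stack n D E) i y =
    (if y \<le> 1/2 then strand_x E i (2 * y) else strand_x D (nxt i) (2 * y - 1))"
proof (rule strand_xI[OF _ y])
  note okE = ndiagramD(1)[OF E i]
  note okD = ndiagramD(1)[OF D stack_next(1)[OF D E i]]
  let ?g = "\<lambda>y. if y \<le> 1/2 then strand_x E i (2 * y) else strand_x D (nxt i) (2 * y - 1)"
  have "arc_graph 0 1 ?g = (\<lambda>s. if s \<le> 1/2 then lower_half ((\<lambda>y. (strand_x E i y, y)) (2 * s))
      else upper_half ((\<lambda>y. (strand_x D (nxt i) y, y)) (2 * s - 1))) ` {0..1}"
    unfolding arc_graph_def by (intro image_cong) (auto simp: lower_half_def upper_half_def)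
  also have "\<dots> = lower_half ` arc_graph 0 1 (strand_x E i) \<union> upper_half ` arc_graph 0 1 (strand_x D (nxt i))"
    unfolding arc_graph_def
    by (rule image_split_unit) (simp add: lower_half_def upper_half_def stack_next(3)[OF D E i])
  also have "\<dots> = strand (stack n D E) i"
    unfolding strand_stack[OF i] strand_eq_graph[of n E i, OF okE] strand_eq_graph[of n D "nxt i", OF okD] ..
  finally show "strand (stack n D E) i = arc_graph 0 1 ?g" by simp
qed

lemma diagram_image_stack:
  "diagram_image n (stack n D E) = lower_half ` diagram_image n E \<union> upper_half ` diagram_image n D"
proof -
  have "diagram_image n (stack n D E) =
    (\<Union>i\<in>{1..n+1}. lower_half ` strand E i) \<union> (\<Union>i\<in>{1..n+1}. upper_half ` strand D (nxt i))"
    unfolding diagram_image_def using strand_stack by auto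
  also have "(\<Union>i\<in>{1..n+1}. upper_half ` strand D (nxt i)) = (\<Union>j\<in>nxt ` {1..n+1}. upper_half ` strand D j)" by simp
  finally show ?thesis unfolding stack_next_surj[OF D E] diagram_image_def by (simp add: image_UN)
qed

lemma ndiagram_stack: "ndiagram n (stack n D E)"
  unfolding ndiagram_iff
proof
  let ?N = "{1..n+1}" and ?S = "stack n D E"
  show "\<forall>i\<in>?N. strand_ok n (?S i)"
  proof
    fix i assume i: "i \<in> ?N"
    note okE = ndiagramD(1)[OF E i]
    note okD = ndiagramD(1)[OF D stack_next(1)[OF D E i]]
    let ?j = "nxt i"
    obtain k l where kl: "k \<in> ?N" "E i 0 = (real k, 0)" "l \<in> ?N" "D ?j 1 = (real l, 1)"
      using okE okD unfolding strand_ok_def by blast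
    have D0: "snd (D ?j 0) = 0" and E1: "snd (E i 1) = 1"
      using strand_x_endpoints(3)[of n D ?j, OF okD] strand_x_endpoints(4)[of n E i, OF okE] by (metis snd_conv)+
    have cE: "continuous_on {0..1} (E i)" and cD: "continuous_on {0..1} (D ?j)"
      using okE okD unfolding strand_ok_def by blast+
    show "strand_ok n (?S i)"
    proof (rule strand_okI[OF _ _ kl(1,3)])
      have "continuous_on {0..1} (\<lambda>s. if s \<le> 1/2 then lower_half (E i (2 * s)) else upper_half (D ?j (2 * s - 1)))"
      proof (rule continuous_on_cases_le)
        have "continuous_on {s\<in>{0..1}. s \<le> 1/2} (\<lambda>s. E i (2 * s))"
          by (rule continuous_on_compose2[OF cE]) (auto intro!: continuous_intros)
        then show "continuous_on {s\<in>{0..1}. s \<le> 1/2} (\<lambda>s. lower_half (E i (2 * s)))"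
          unfolding lower_half_def by (intro continuous_intros) auto
        have "continuous_on {s\<in>{0..1}. 1/2 \<le> s} (\<lambda>s. D ?j (2 * s - 1))"
          by (rule continuous_on_compose2[OF cD]) (auto intro!: continuous_intros)
        then show "continuous_on {s\<in>{0..1}. 1/2 \<le> s} (\<lambda>s. upper_half (D ?j (2 * s - 1)))"
          unfolding upper_half_def by (intro continuous_intros) auto
        show "lower_half (E i (2 * s)) = upper_half (D ?j (2 * s - 1))" if "s \<in> {0..1}" "s = 1/2" for s
          using stack_seam[OF i] by (simp add: that(2))
      qed (auto intro!: continuous_intros)
      then show "continuous_on {0..1} (?S i)" by (simp only: stack_eq[abs_def])
      show "snd (?S i u) < snd (?S i v)" if uv: "0 \<le> u" "u < v" "v \<le> 1" for u v
      proof -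
        consider "v \<le> 1/2" | "1/2 < u" | "u \<le> 1/2" "1/2 < v" by linarith
        then show ?thesis
        proof cases
          case 1
          then show ?thesis using strand_ok_mono[OF okE, of "2 * u" "2 * v"] uv
            by (simp add: stack_eq lower_half_def)
        next
          case 2
          then show ?thesis using strand_ok_mono[OF okD, of "2 * u - 1" "2 * v - 1"] uv
            by (simp add: stack_eq upper_half_def)
        next
          case 3
          have "snd (E i (2 * u)) \<le> 1" using strand_ok_height[OF okE, of "2 * u"] 3 uv by auto
          moreover have "0 < snd (D ?j (2 * v - 1))" using strand_ok_mono[OF okD, of 0 "2 * v - 1"] D0 3 uv by simp
          ultimately show ?thesis using 3 by (simp add: stack_eq lower_half_def upper_half_def)
        qed
      qed
      show "?S i 0 = (real k, 0)" "?S i 1 = (real l, 1)"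
        using kl by (simp_all add: stack_eq lower_half_def upper_half_def)
    qed
  qed
  let ?e = "strand_x E" and ?d = "strand_x D"
  define f where "f i y = (if y \<le> 1/2 then ?e i (2 * y) else ?d (nxt i) (2 * y - 1))" for i y
  note cE = ndiagramD(2)[OF E] and cD = ndiagramD(2)[OF D]
  let ?YE = "{y\<in>{0..1}. \<exists>i\<in>?N. \<exists>j\<in>?N. i \<noteq> j \<and> ?e i y = ?e j y}"
  let ?YD = "{y\<in>{0..1}. \<exists>i\<in>?N. \<exists>j\<in>?N. i \<noteq> j \<and> ?d i y = ?d j y}"
  have "crossing_family n f" unfolding crossing_family_def
  proof (intro conjI ballI impI)
    have "{y\<in>{0..1}. \<exists>i\<in>?N. \<exists>j\<in>?N. i \<noteq> j \<and> f i y = f j y} \<subseteq> (\<lambda>y. y / 2) ` ?YE \<union> (\<lambda>y. (1 + y) / 2) ` ?YD"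
    proof
      fix y assume "y \<in> {y\<in>{0..1}. \<exists>i\<in>?N. \<exists>j\<in>?N. i \<noteq> j \<and> f i y = f j y}"
      then obtain i j where ij: "y \<in> {0..1}" "i \<in> ?N" "j \<in> ?N" "i \<noteq> j" "f i y = f j y" by blast
      show "y \<in> (\<lambda>y. y / 2) ` ?YE \<union> (\<lambda>y. (1 + y) / 2) ` ?YD"
      proof (cases "y \<le> 1/2")
        case True
        have "2 * y \<in> {0..1}" "?e i (2 * y) = ?e j (2 * y)" using True ij by (auto simp: f_def)
        then have "2 * y \<in> ?YE" using ij(2-4) by blast
        then have "(2 * y) / 2 \<in> (\<lambda>y. y / 2) ` ?YE" by (rule imageI)
        then show ?thesis by simp
      next
        case False
        have "2 * y - 1 \<in> {0..1}" "?d (nxt i) (2 * y - 1) = ?d (nxt j) (2 * y - 1)" using False ij by (auto simp: f_def)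
        then have "2 * y - 1 \<in> ?YD"
          using ij(2-4) stack_next(1)[OF D E] stack_next_inj[OF D E ij(2-4)] by blast
        then have "(1 + (2 * y - 1)) / 2 \<in> (\<lambda>y. (1 + y) / 2) ` ?YD" by (rule imageI)
        then show ?thesis by simp
      qed
    qed
    moreover have "finite ?YE" "finite ?YD" using cE cD unfolding crossing_family_def by blast+
    ultimately show "finite {y\<in>{0..1}. \<exists>i\<in>?N. \<exists>j\<in>?N. i \<noteq> j \<and> f i y = f j y}"
      by (meson finite_UnI finite_imageI finite_subset)
    fix i j and y :: real
    assume ij: "i \<in> ?N" "j \<in> ?N" "y \<in> {0..1}" "i \<noteq> j" "f i y = f j y"
    have "0 < y \<and> y < 1 \<and> crosses_at (f i) (f j) y \<and> (\<forall>k\<in>?N. f k y = f i y \<longrightarrow> k = i \<or> k = j)"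
    proof (cases "y \<le> 1/2")
      case True
      have y2: "2 * y \<in> {0..1}" and eq: "?e i (2 * y) = ?e j (2 * y)" using True ij by (auto simp: f_def)
      \<comment> \<open>Double points of a factor lie strictly inside it, so \<open>y < 1/2\<close>:
        no crossing sits on the seam.\<close>
      note c = crossing_familyD[OF cE ij(1,2) y2 ij(4) eq]
      have "crosses_at (f i) (f j) y"
        by (rule crosses_at_transfer[of "?e i" "?e j" "\<lambda>u. 2 * u" y 0 "1/2"])
          (use c in \<open>auto intro!: continuous_intros simp: f_def\<close>)
      then show ?thesis using c True by (auto simp: f_def)
    next
      case False
      have y2: "2 * y - 1 \<in> {0..1}" and eq: "?d (nxt i) (2 * y - 1) = ?d (nxt j) (2 * y - 1)"
        using False ij by (auto simp: f_def)
      note nx = stack_next(1)[OF D E]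
      note c = crossing_familyD[OF cD nx[OF ij(1)] nx[OF ij(2)] y2 stack_next_inj[OF D E ij(1,2,4)] eq]
      have cr: "crosses_at (f i) (f j) y"
        by (rule crosses_at_transfer[of "?d (nxt i)" "?d (nxt j)" "\<lambda>u. 2 * u - 1" y "1/2" 1])
          (use c in \<open>auto intro!: continuous_intros simp: f_def\<close>)
      have "k = i \<or> k = j" if k: "k \<in> ?N" "f k y = f i y" for k
      proof -
        have "nxt k = nxt i \<or> nxt k = nxt j" using c(4)[OF nx[OF k(1)]] k(2) False by (simp add: f_def)
        then show ?thesis using stack_next_inj[OF D E k(1) ij(1)] stack_next_inj[OF D E k(1) ij(2)] by blast
      qed
      then show ?thesis using c(1,2) cr by auto
    qed
    then show "0 < y" "y < 1" "crosses_at (f i) (f j) y" "\<And>k. k \<in> ?N \<Longrightarrow> f k y = f i y \<Longrightarrow> k = i \<or> k = j" by blast+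
  qed
  then show "crossing_family n (strand_x ?S)"
    by (rule crossing_family_cong) (simp add: strand_x_stack f_def)
qed

lemma has_levels_stack:
  assumes ge: "has_levels n E ge" and gd: "has_levels n D gd"
  defines "hs \<equiv> \<lambda>k y. if y \<le> 1/2 then ge k (2 * y) else gd k (2 * y - 1)"
  shows "has_levels n (stack n D E) hs"
    "coincidences n hs = (\<lambda>(y, k). (y / 2, k)) ` coincidences n ge \<union> (\<lambda>(y, k). ((1 + y) / 2, k)) ` coincidences n gd"
proof -
  let ?N = "{1..n+1}"
  have le: "level_system n ge" and ld: "level_system n gd" using ge gd by (auto simp: has_levels_def)
  show coin: "coincidences n hs =
    (\<lambda>(y, k). (y / 2, k)) ` coincidences n ge \<union> (\<lambda>(y, k). ((1 + y) / 2, k)) ` coincidences n gd" (is "_ = ?A \<union> ?B")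
  proof (intro Set.set_eqI iffI)
    fix x assume x: "x \<in> coincidences n hs"
    obtain y k where xy: "x = (y, k)" by force
    have yk: "y \<in> {0..1}" "k \<in> {1..n}" "hs k y = hs (k + 1) y" using x xy by (auto simp: coincidences_def)
    show "x \<in> ?A \<union> ?B"
    proof (cases "y \<le> 1/2")
      case True
      then have "(2 * y, k) \<in> coincidences n ge" using yk by (auto simp: coincidences_def hs_def)
      then show ?thesis unfolding xy by (intro UnI1 rev_image_eqI[of "(2 * y, k)"]) auto
    next
      case False
      then have "(2 * y - 1, k) \<in> coincidences n gd" using yk by (auto simp: coincidences_def hs_def)
      then show ?thesis unfolding xy by (intro UnI2 rev_image_eqI[of "(2 * y - 1, k)"]) auto
    qed
  next
    fix x assume "x \<in> ?A \<union> ?B"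
    then consider y k where "x = (y / 2, k)" "(y, k) \<in> coincidences n ge"
      | y k where "x = ((1 + y) / 2, k)" "(y, k) \<in> coincidences n gd" by auto
    then show "x \<in> coincidences n hs"
    proof cases
      case 1
      then show ?thesis by (auto simp: coincidences_def hs_def)
    next
      case 2
      have "2 * ((1 + y) / 2) - 1 = y" by (simp add: field_simps)
      then show ?thesis using coincidences_interior[OF ld 2(2)] 2 by (simp add: coincidences_def hs_def)
    qed
  qed
  have "level_system n hs" unfolding level_system_def
  proof (intro conjI ballI allI notI)
    fix k assume k: "k \<in> ?N"
    have ce: "continuous_on {0..1} (ge k)" "continuous_on {0..1} (gd k)"
      using level_systemD(1)[OF le k] level_systemD(1)[OF ld k] .
    show "continuous_on {0..1} (hs k)" unfolding hs_def
    proof (rule continuous_on_cases_le)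
      show "continuous_on {s\<in>{0..1}. s \<le> 1/2} (\<lambda>s. ge k (2 * s))"
        by (rule continuous_on_compose2[OF ce(1)]) (auto intro!: continuous_intros)
      show "continuous_on {s\<in>{0..1}. 1/2 \<le> s} (\<lambda>s. gd k (2 * s - 1))"
        by (rule continuous_on_compose2[OF ce(2)]) (auto intro!: continuous_intros)
      show "ge k (2 * s) = gd k (2 * s - 1)" if "s \<in> {0..1}" "s = 1/2" for s
        using level_systemD(3)[OF le k] level_systemD(2)[OF ld k] by (simp add: that(2))
    qed (auto intro!: continuous_intros)
    show "hs k 0 = real k" "hs k 1 = real k"
      using level_systemD(2)[OF le k] level_systemD(3)[OF ld k] by (simp_all add: hs_def)
  next
    fix k y assume "k \<in> {1..n}" "y \<in> {0..1::real}"
    then show "hs k y \<le> hs (k + 1) y"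
      using level_systemD(4)[OF le, of k "2 * y"] level_systemD(4)[OF ld, of k "2 * y - 1"]
      by (cases "y \<le> 1/2") (auto simp: hs_def)
  next
    show "finite (coincidences n hs)" unfolding coin
      using level_systemD(5)[OF le] level_systemD(5)[OF ld] by blast
    fix y k assume a: "(y, k) \<in> coincidences n hs \<and> (y, k + 1) \<in> coincidences n hs"
    show False
    proof (cases "y \<le> 1/2")
      case True
      then have "(2 * y, k) \<in> coincidences n ge" "(2 * y, k + 1) \<in> coincidences n ge"
        using a by (auto simp: coincidences_def hs_def)
      then show False using level_systemD(6)[OF le] by blast
    next
      case False
      then have "(2 * y - 1, k) \<in> coincidences n gd" "(2 * y - 1, k + 1) \<in> coincidences n gd"
        using a by (auto simp: coincidences_def hs_def)
      then show False using level_systemD(6)[OF ld] by blast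
    qed
  qed
  moreover have "diagram_image n (stack n D E) = (\<Union>k\<in>?N. arc_graph 0 1 (hs k))"
  proof -
    have "arc_graph 0 1 (hs k) = lower_half ` arc_graph 0 1 (ge k) \<union> upper_half ` arc_graph 0 1 (gd k)" if k: "k \<in> ?N" for k
    proof -
      have "arc_graph 0 1 (hs k) = (\<lambda>s. if s \<le> 1/2 then lower_half ((\<lambda>y. (ge k y, y)) (2 * s))
          else upper_half ((\<lambda>y. (gd k y, y)) (2 * s - 1))) ` {0..1}"
        unfolding arc_graph_def hs_def by (intro image_cong) (auto simp: lower_half_def upper_half_def)
      also have "\<dots> = lower_half ` arc_graph 0 1 (ge k) \<union> upper_half ` arc_graph 0 1 (gd k)"
        unfolding arc_graph_def
        by (rule image_split_unit)
          (simp add: lower_half_def upper_half_def level_systemD(3)[OF le k] level_systemD(2)[OF ld k])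
      finally show ?thesis .
    qed
    then have "(\<Union>k\<in>?N. arc_graph 0 1 (hs k)) =
      (\<Union>k\<in>?N. lower_half ` arc_graph 0 1 (ge k)) \<union> (\<Union>k\<in>?N. upper_half ` arc_graph 0 1 (gd k))" by auto
    moreover have "diagram_image n E = (\<Union>k\<in>?N. arc_graph 0 1 (ge k))" "diagram_image n D = (\<Union>k\<in>?N. arc_graph 0 1 (gd k))"
      using ge gd by (auto simp: has_levels_def)
    ultimately show ?thesis unfolding diagram_image_stack by (simp only: image_UN)
  qed
  ultimately show "has_levels n (stack n D E) hs" unfolding has_levels_def using ndiagram_stack by blast
qed

text \<open>The two halves can only share points on the seam, and there different strands have
  different abscissae; so intersections of different strands simply add up.\<close>

lemma card_strand_stack:
  assumes i: "i \<in> {1..n+1}" and j: "j \<in> {1..n+1}" and ne: "i \<noteq> j"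
  shows "card (strand (stack n D E) i \<inter> strand (stack n D E) j) =
    card (strand E i \<inter> strand E j) + card (strand D (nxt i) \<inter> strand D (nxt j))"
proof -
  have cross: "lower_half p \<noteq> upper_half q" if "p \<in> strand E a" "q \<in> strand D (nxt b)" "a \<in> {1..n+1}" "b \<in> {1..n+1}" "a \<noteq> b" for a b p q
  proof
    note okE = ndiagramD(1)[OF E that(3)]
    note okD = ndiagramD(1)[OF D stack_next(1)[OF D E that(4)]]
    assume "lower_half p = upper_half q"
    then have *: "fst p = fst q" "snd p = 1 + snd q" by (auto simp: lower_half_def upper_half_def)
    have "snd p \<in> {0..1}" "snd q \<in> {0..1}"
      using strand_height[of n E a, OF okE that(1)] strand_height[of n D "nxt b", OF okD that(2)] by auto
    then have pq: "p = (fst p, 1)" "q = (fst p, 0)" using * by (auto simp: prod_eq_iff)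
    have "fst p = strand_x E a 1" "fst p = strand_x D (nxt b) 0"
      using strand_x_iff[of n E a 1 "fst p", OF okE] strand_x_iff[of n D "nxt b" 0 "fst p", OF okD] pq that(1,2) by auto
    then have "strand_x E a 1 = strand_x E b 1" using stack_next(3)[OF D E that(4)] by simp
    then show False using ndiagram_start_distinct(2)[OF E that(3-5)] by blast
  qed
  have "strand (stack n D E) i \<inter> strand (stack n D E) j =
    lower_half ` (strand E i \<inter> strand E j) \<union> upper_half ` (strand D (nxt i) \<inter> strand D (nxt j))"
    unfolding strand_stack[OF i] strand_stack[OF j] image_Int[OF inj_halves(1)] image_Int[OF inj_halves(2)]
  proof -
    have "lower_half ` strand E i \<inter> upper_half ` strand D (nxt j) = {}"
      "lower_half ` strand E j \<inter> upper_half ` strand D (nxt i) = {}"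
      using cross[OF _ _ i j ne] cross[OF _ _ j i ne[symmetric]] by blast+
    then show "(lower_half ` strand E i \<union> upper_half ` strand D (nxt i)) \<inter>
        (lower_half ` strand E j \<union> upper_half ` strand D (nxt j)) =
      lower_half ` strand E i \<inter> lower_half ` strand E j \<union> upper_half ` strand D (nxt i) \<inter> upper_half ` strand D (nxt j)"
      by blast
  qed
  moreover have "lower_half ` (strand E i \<inter> strand E j) \<inter> upper_half ` (strand D (nxt i) \<inter> strand D (nxt j)) = {}"
    using cross[OF _ _ i j ne] by blast
  moreover have "card (lower_half ` (strand E i \<inter> strand E j)) = card (strand E i \<inter> strand E j)"
    "card (upper_half ` (strand D (nxt i) \<inter> strand D (nxt j))) = card (strand D (nxt i) \<inter> strand D (nxt j))"
    using inj_halves by (auto intro!: card_image intro: inj_on_subset)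
  moreover have "finite (strand E i \<inter> strand E j)" "finite (strand D (nxt i) \<inter> strand D (nxt j))"
    using finite_strand_inter[OF E i j ne]
      finite_strand_inter[OF D stack_next(1)[OF D E i] stack_next(1)[OF D E j] stack_next_inj[OF D E i j ne]] .
  ultimately show ?thesis by (simp add: card_Un_disjoint)
qed

end

section \<open>Word diagrams\<close>

lemma graph_diagram_strand:
  assumes "\<And>s. s \<in> {0..1} \<Longrightarrow> D j s = (f j s, s)"
  shows "strand D j = arc_graph 0 1 (f j)" "y \<in> {0..1} \<Longrightarrow> strand_x D j y = f j y"
proof -
  show *: "strand D j = arc_graph 0 1 (f j)"
    unfolding strand_def arc_graph_def using assms by (intro image_cong) auto
  show "y \<in> {0..1} \<Longrightarrow> strand_x D j y = f j y" by (rule strand_xI[OF *])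
qed

lemma has_levels_identity: "has_levels n identity_diagram (\<lambda>k y. real k)"
  and coincidences_identity: "coincidences n (\<lambda>k y. real k) = {}"
proof -
  let ?N = "{1..n+1}"
  have sx: "strand identity_diagram j = arc_graph 0 1 (\<lambda>y. real j)"
    "y \<in> {0..1} \<Longrightarrow> strand_x identity_diagram j y = real j" for j y
    using graph_diagram_strand[of identity_diagram j "\<lambda>j y. real j"] by (auto simp: identity_diagram_def)
  have "strand_ok n (identity_diagram j)" if "j \<in> ?N" for j
    by (rule strand_okI[of _ j _ j]) (use that in \<open>auto simp: identity_diagram_def intro!: continuous_intros\<close>)
  moreover have "crossing_family n (strand_x identity_diagram)"
  proof (rule crossing_family_cong)
    show "crossing_family n (\<lambda>j y. real j)" unfolding crossing_family_def by auto
  qed (use sx in auto)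
  ultimately have nd: "ndiagram n identity_diagram" unfolding ndiagram_iff by blast
  show c: "coincidences n (\<lambda>k y. real k) = {}" by (auto simp: coincidences_def)
  have "level_system n (\<lambda>k y. real k)" unfolding level_system_def c by (auto intro: continuous_intros)
  then show "has_levels n identity_diagram (\<lambda>k y. real k)"
    unfolding has_levels_def diagram_image_def using nd sx by simp
qed

definition elementary_x :: "nat \<Rightarrow> nat \<Rightarrow> real \<Rightarrow> real" where
  "elementary_x i j y = (if j = i then real i + y else if j = i + 1 then real (i + 1) - y else real j)"

lemma elementary_eq: "elementary i j s = (elementary_x i j s, s)"
  by (simp add: elementary_def elementary_x_def)

lemma elementary_strand:
  "strand (elementary i) j = arc_graph 0 1 (elementary_x i j)"
  "y \<in> {0..1} \<Longrightarrow> strand_x (elementary i) j y = elementary_x i j y"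
  using graph_diagram_strand[of "elementary i" j "elementary_x i"] by (auto simp: elementary_eq)

lemma elementary_x_eq:
  assumes "y \<in> {0..1}" "j \<noteq> k"
  shows "elementary_x i j y = elementary_x i k y \<longleftrightarrow> {j, k} = {i, i + 1} \<and> y = 1/2"
proof -
  consider "j = i" "k = i + 1" | "j = i + 1" "k = i" | "j = i" "k \<noteq> i" "k \<noteq> i + 1" | "j = i + 1" "k \<noteq> i" "k \<noteq> i + 1"
    | "k = i" "j \<noteq> i" "j \<noteq> i + 1" | "k = i + 1" "j \<noteq> i" "j \<noteq> i + 1"
    | "j \<noteq> i" "j \<noteq> i + 1" "k \<noteq> i" "k \<noteq> i + 1" using assms(2) by metis
  then show ?thesis
  proof cases
    case 3
    have "real k < real i \<or> real i + 1 < real k" using 3 by linarith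
    then show ?thesis using 3 assms by (auto simp: elementary_x_def doubleton_eq_iff)
  next
    case 4
    have "real k < real i \<or> real i + 1 < real k" using 4 by linarith
    then show ?thesis using 4 assms by (auto simp: elementary_x_def doubleton_eq_iff)
  next
    case 5
    have "real j < real i \<or> real i + 1 < real j" using 5 by linarith
    then show ?thesis using 5 assms by (auto simp: elementary_x_def doubleton_eq_iff)
  next
    case 6
    have "real j < real i \<or> real i + 1 < real j" using 6 by linarith
    then show ?thesis using 6 assms by (auto simp: elementary_x_def doubleton_eq_iff)
  qed (use assms in \<open>auto simp: elementary_x_def doubleton_eq_iff\<close>)
qed

lemma ndiagram_elementary:
  assumes i: "i \<in> {1..n}"
  shows "ndiagram n (elementary i)"
  unfolding ndiagram_iff
proof
  let ?N = "{1..n+1}"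
  show "\<forall>j\<in>?N. strand_ok n (elementary i j)"
  proof
    fix j assume j: "j \<in> ?N"
    show "strand_ok n (elementary i j)"
    proof (rule strand_okI[of _ j _ "swap_at i j"])
      show "continuous_on {0..1} (elementary i j)"
        unfolding elementary_eq[abs_def] elementary_x_def
        by (cases "j = i"; cases "j = i + 1") (auto intro!: continuous_intros)
      show "swap_at i j \<in> ?N" using swap_at_in[OF i] j by blast
    qed (use j in \<open>auto simp: elementary_eq elementary_x_def swap_at_def\<close>)
  qed
  have "crossing_family n (elementary_x i)" unfolding crossing_family_def
  proof (intro conjI ballI impI)
    have "{y\<in>{0..1}. \<exists>j\<in>?N. \<exists>k\<in>?N. j \<noteq> k \<and> elementary_x i j y = elementary_x i k y} \<subseteq> {1/2}"
      using elementary_x_eq by blast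
    then show "finite {y\<in>{0..1}. \<exists>j\<in>?N. \<exists>k\<in>?N. j \<noteq> k \<and> elementary_x i j y = elementary_x i k y}"
      using finite_subset by blast
    fix j k and y :: real
    assume jk: "j \<in> ?N" "k \<in> ?N" "y \<in> {0..1}" "j \<noteq> k" "elementary_x i j y = elementary_x i k y"
    then have jk': "{j, k} = {i, i + 1}" and y: "y = 1/2" using elementary_x_eq by blast+
    show "0 < y" "y < 1" using y by auto
    have prod_neg: "(elementary_x i j u - elementary_x i k u) * (elementary_x i j v - elementary_x i k v) < 0"
      if "u < 1/2" "1/2 < v" for u v
    proof -
      have "j = i \<and> k = i + 1 \<or> j = i + 1 \<and> k = i" using jk' by (auto simp: doubleton_eq_iff)
      then show ?thesis
        using that by (auto simp: elementary_x_def mult_less_0_iff)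
    qed
    show "crosses_at (elementary_x i j) (elementary_x i k) y"
      unfolding crosses_at_def
    proof (intro conjI exI[of _ 1] ballI)
      fix u v assume "u \<in> {y - 1<..<y}" "v \<in> {y<..<y + 1}"
      then show "(elementary_x i j u - elementary_x i k u) * (elementary_x i j v - elementary_x i k v) < 0"
        using prod_neg[of u v] unfolding y by auto
    qed (use jk(5) in auto)
    show "l = j \<or> l = k" if "l \<in> ?N" "elementary_x i l y = elementary_x i j y" for l
    proof (rule ccontr)
      assume l: "\<not> (l = j \<or> l = k)"
      then have "{l, j} = {i, i + 1}" using elementary_x_eq[OF jk(3), of l j i] that by blast
      then show False using jk' l jk(4) by (auto simp: doubleton_eq_iff)
    qed
  qed
  then show "crossing_family n (strand_x (elementary i))"
    by (rule crossing_family_cong) (use elementary_strand in auto)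
qed

lemma has_word_identity: "has_word n identity_diagram []"
  unfolding has_word_def has_config_def using has_levels_identity coincidences_identity
  by (auto intro!: exI[of _ "\<lambda>k y. real k"])

lemma has_word_elementary:
  assumes i: "i \<in> {1..n}"
  shows "has_word n (elementary i) [i]"
proof -
  let ?N = "{1..n+1}"
  \<comment> \<open>The two moving strands sorted by position: the minimum and the maximum of
    \<open>i + y\<close> and \<open>i + 1 - y\<close>, equal at \<open>y = 1/2\<close> only.\<close>
  define h where "h j y = (if j = i then min (real i + y) (real i + 1 - y)
    else if j = i + 1 then max (real i + y) (real i + 1 - y) else real j)" for j :: nat and y :: real
  have coin: "coincidences n h = {(1/2, i)}"
  proof (intro Set.set_eqI iffI)
    fix x assume "x \<in> coincidences n h"
    then obtain y k where x: "x = (y, k)" "y \<in> {0..1}" "k \<in> {1..n}" "h k y = h (k + 1) y"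
      by (auto simp: coincidences_def)
    have "k = i"
    proof (rule ccontr)
      assume "k \<noteq> i"
      then consider "k + 1 < i" | "k + 1 = i" | "k = i + 1" | "i + 1 < k" by linarith
      then show False using x(2,4) by cases (auto simp: h_def min_def max_def split: if_splits)
    qed
    then show "x \<in> {(1/2, i)}" using x by (auto simp: h_def min_def max_def split: if_splits)
  qed (use i in \<open>auto simp: coincidences_def h_def\<close>)
  have "level_system n h" unfolding level_system_def
  proof (intro conjI ballI allI)
    fix k assume "k \<in> ?N"
    show "continuous_on {0..1} (h k)" unfolding h_def
      by (cases "k = i"; cases "k = i + 1") (auto intro!: continuous_intros)
    show "h k 0 = real k" "h k 1 = real k" by (auto simp: h_def)
  next
    fix k y assume "k \<in> {1..n}" and y: "y \<in> {0..1::real}"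
    consider "k = i" | "k + 1 < i" | "k + 1 = i" | "k = i + 1" | "i + 1 < k" by linarith
    then show "h k y \<le> h (k + 1) y"
    proof cases
      case 2
      then show ?thesis by (simp add: h_def)
    next
      case 5
      then show ?thesis by (simp add: h_def)
    qed (use y in \<open>auto simp: h_def min_def max_def\<close>)
  qed (auto simp: coin)
  moreover have "diagram_image n (elementary i) = (\<Union>k\<in>?N. arc_graph 0 1 (h k))"
  proof -
    have ii: "i \<in> ?N" "i + 1 \<in> ?N" using i by auto
    have un: "(\<Union>k\<in>?N. A k) = A i \<union> A (i + 1) \<union> (\<Union>k\<in>?N - {i, i + 1}. A k)" for A :: "nat \<Rightarrow> (real \<times> real) set"
      using ii by blast
    have "arc_graph 0 1 (h i) \<union> arc_graph 0 1 (h (i + 1)) = strand (elementary i) i \<union> strand (elementary i) (i + 1)"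
    proof -
      have "{h i y, h (i + 1) y} = {elementary_x i i y, elementary_x i (i + 1) y}" for y
        by (auto simp: h_def elementary_x_def min_def max_def)
      then have "h i y = elementary_x i i y \<and> h (i + 1) y = elementary_x i (i + 1) y \<or>
        h i y = elementary_x i (i + 1) y \<and> h (i + 1) y = elementary_x i i y" for y
        by (simp add: doubleton_eq_iff)
      then show ?thesis unfolding elementary_strand arc_graph_def by (auto simp: image_iff) metis+
    qed
    moreover have "arc_graph 0 1 (h k) = strand (elementary i) k" if "k \<in> ?N - {i, i + 1}" for k
      unfolding elementary_strand arc_graph_def using that by (auto simp: h_def elementary_x_def)
    ultimately show ?thesis unfolding diagram_image_def un[of "strand (elementary i)"] un[of "\<lambda>k. arc_graph 0 1 (h k)"]
      by simp
  qed
  ultimately have "has_levels n (elementary i) h"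
    unfolding has_levels_def using ndiagram_elementary[OF i] by blast
  then have "has_config n (elementary i) [(1/2, i)]" unfolding has_config_def using coin by auto
  then show ?thesis unfolding has_word_def by force
qed

text \<open>\<open>E\<close> is the lower diagram and its crossings are read before those of
  \<open>D\<close>; hence \<open>w @ v\<close> in this order.\<close>

lemma has_word_stack:
  assumes "has_word n D v" "has_word n E w"
  shows "has_word n (stack n D E) (w @ v)"
proof -
  obtain LD gd where D: "distinct LD" "sorted (map fst LD)" "has_levels n D gd" "set LD = coincidences n gd" "map snd LD = v"
    using assms(1) unfolding has_word_def has_config_def by blast
  obtain LE ge where E: "distinct LE" "sorted (map fst LE)" "has_levels n E ge" "set LE = coincidences n ge" "map snd LE = w"
    using assms(2) unfolding has_word_def has_config_def by blast
  have nd: "ndiagram n D" "ndiagram n E" using D(3) E(3) by (auto simp: has_levels_def)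
  have ls: "level_system n gd" "level_system n ge" using D(3) E(3) by (auto simp: has_levels_def)
  let ?a = "\<lambda>(y::real, k::nat). (y / 2, k)" and ?b = "\<lambda>(y::real, k::nat). ((1 + y) / 2, k)"
  let ?L = "map ?a LE @ map ?b LD"
  note st = has_levels_stack[OF nd E(3) D(3)]
  have hE: "fst x < 1" if "x \<in> set LE" for x
    using coincidences_interior(2)[OF ls(2), of "fst x" "snd x"] that E(4) by simp
  have hD: "0 < fst x" if "x \<in> set LD" for x
    using coincidences_interior(1)[OF ls(1), of "fst x" "snd x"] that D(4) by simp
  have "has_config n (stack n D E) ?L" unfolding has_config_def
  proof (intro conjI exI)
    have "?a x \<noteq> ?b z" if "x \<in> set LE" "z \<in> set LD" for x z
      using hE[OF that(1)] hD[OF that(2)] by (auto simp: case_prod_unfold)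
    moreover have "inj ?a" "inj ?b" by (auto simp: inj_def)
    ultimately show "distinct ?L" using D(1) E(1)
      by (fastforce simp: distinct_map intro: inj_on_subset)
    have "sorted (map (fst \<circ> ?a) LE)" "sorted (map (fst \<circ> ?b) LD)"
      using E(2) D(2) by (auto simp: sorted_iff_nth_mono case_prod_unfold)
    moreover have "fst (?a x) \<le> fst (?b z)" if "x \<in> set LE" "z \<in> set LD" for x z
      using hE[OF that(1)] hD[OF that(2)] by (auto simp: case_prod_unfold)
    ultimately show "sorted (map fst ?L)" by (auto simp: sorted_append)
    show "has_levels n (stack n D E) (\<lambda>k y. if y \<le> 1/2 then ge k (2 * y) else gd k (2 * y - 1))" by (fact st(1))
    show "set ?L = coincidences n (\<lambda>k y. if y \<le> 1/2 then ge k (2 * y) else gd k (2 * y - 1))"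
      unfolding st(2) using D(4) E(4) by simp
  qed
  moreover have "map snd ?L = w @ v"
  proof -
    have "snd \<circ> ?a = snd" "snd \<circ> ?b = snd" by auto
    then show ?thesis using D(5) E(5) by simp
  qed
  ultimately show ?thesis unfolding has_word_def by blast
qed

text \<open>The head letter is stacked below the rest, so strands keep the numbers of their lower
  endpoints and letters are read upwards.\<close>

fun word_diagram :: "nat \<Rightarrow> nat list \<Rightarrow> diagram" where
  "word_diagram n [] = identity_diagram"
| "word_diagram n (i # w) = stack n (word_diagram n w) (elementary i)"

lemma has_word_word_diagram: "set w \<subseteq> {1..n} \<Longrightarrow> has_word n (word_diagram n w) w"
proof (induction w)
  case (Cons i w)
  then show ?case using has_word_stack[of n "word_diagram n w" w "elementary i" "[i]"] has_word_elementary[of i n] by simp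
qed (simp add: has_word_identity)

lemma ndiagram_word_diagram: "set w \<subseteq> {1..n} \<Longrightarrow> ndiagram n (word_diagram n w)"
  using has_word_word_diagram has_word_ndiagram by blast

lemma word_diagram_start: "word_diagram n w j 0 = (real j, 0)"
  by (cases w) (auto simp: identity_diagram_def stack_eq lower_half_def elementary_eq elementary_x_def)

lemma word_diagram_next:
  assumes "set (i # w) \<subseteq> {1..n}" "j \<in> {1..n+1}"
  shows "stack_next n (word_diagram n w) (elementary i) j = swap_at i j"
  unfolding stack_next_def
proof (rule the_equality)
  have e: "fst (elementary i j 1) = real (swap_at i j)" by (auto simp: elementary_eq elementary_x_def swap_at_def)
  have "i \<in> {1..n}" using assms(1) by simp
  then have "swap_at i j \<in> {1..n+1}" using swap_at_in assms(2) by blast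
  then show "swap_at i j \<in> {1..n+1} \<and> fst (word_diagram n w (swap_at i j) 0) = fst (elementary i j 1)"
    using e word_diagram_start by simp
  show "j' = swap_at i j" if "j' \<in> {1..n+1} \<and> fst (word_diagram n w j' 0) = fst (elementary i j 1)" for j'
    using that e word_diagram_start by simp
qed

lemma word_diagram_end:
  "set w \<subseteq> {1..n} \<Longrightarrow> j \<in> {1..n+1} \<Longrightarrow> word_diagram n w j 1 = (real (word_perm w j), 1)"
proof (induction w arbitrary: j)
  case (Cons i w)
  then have "i \<in> {1..n}" by simp
  then have s: "swap_at i j \<in> {1..n+1}" using swap_at_in[of i n j] Cons.prems(2) by blast
  have "set w \<subseteq> {1..n}" using Cons.prems(1) by simp
  from Cons.IH[OF this s] show ?case
    using word_diagram_next[OF Cons.prems] by (simp add: stack_eq upper_half_def)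
qed (simp add: identity_diagram_def)

lemma endpoint_perm_word_diagram:
  assumes "set w \<subseteq> {1..n}" "j \<in> {1..n+1}"
  shows "endpoint_perm n (word_diagram n w) j = word_perm w j"
  using endpoint_permI[OF ndiagram_word_diagram[OF assms(1)] assms(2) word_diagram_start word_diagram_end[OF assms]] .

lemma card_strand_word_diagram:
  "set w \<subseteq> {1..n} \<Longrightarrow> k \<in> {1..n+1} \<Longrightarrow> l \<in> {1..n+1} \<Longrightarrow> k \<noteq> l \<Longrightarrow>
     card (strand (word_diagram n w) k \<inter> strand (word_diagram n w) l) = word_cross w k l"
proof (induction w arbitrary: k l)
  case Nil
  have "strand identity_diagram j = arc_graph 0 1 (\<lambda>y. real j)" for j
    using graph_diagram_strand(1)[of identity_diagram j "\<lambda>j y. real j"] by (auto simp: identity_diagram_def)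
  then have "strand identity_diagram k \<inter> strand identity_diagram l = {}" using Nil by (auto simp: arc_graph_def)
  then show ?case by simp
next
  case (Cons i w)
  have i: "i \<in> {1..n}" and w: "set w \<subseteq> {1..n}" using Cons.prems(1) by auto
  have s: "swap_at i k \<in> {1..n+1}" "swap_at i l \<in> {1..n+1}" "swap_at i k \<noteq> swap_at i l"
    using swap_at_in[OF i] inj_swap_at Cons.prems by blast+
  have "strand (elementary i) k \<inter> strand (elementary i) l =
    (if {k, l} = {i, i + 1} then {(real i + 1/2, 1/2)} else {})"
  proof (intro Set.set_eqI)
    fix p :: "real \<times> real"
    obtain x y where p: "p = (x, y)" by force
    have "p \<in> strand (elementary i) k \<inter> strand (elementary i) l \<longleftrightarrow>
      y \<in> {0..1} \<and> x = elementary_x i k y \<and> elementary_x i k y = elementary_x i l y"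
      unfolding elementary_strand arc_graph_def p by auto
    also have "\<dots> \<longleftrightarrow> y \<in> {0..1} \<and> x = elementary_x i k y \<and> {k, l} = {i, i + 1} \<and> y = 1/2"
      using elementary_x_eq[of y k l i] Cons.prems(4) by blast
    also have "\<dots> \<longleftrightarrow> p \<in> (if {k, l} = {i, i + 1} then {(real i + 1/2, 1/2)} else {})"
      unfolding p by (auto simp: elementary_x_def doubleton_eq_iff)
    finally show "p \<in> strand (elementary i) k \<inter> strand (elementary i) l \<longleftrightarrow>
      p \<in> (if {k, l} = {i, i + 1} then {(real i + 1/2, 1/2)} else {})" .
  qed
  then have "card (strand (elementary i) k \<inter> strand (elementary i) l) = (if {k, l} = {i, i + 1} then 1 else 0)" by simp
  then show ?case
    using card_strand_stack[OF ndiagram_word_diagram[OF w] ndiagram_elementary[OF i] Cons.prems(2-4)]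
      word_diagram_next[OF Cons.prems(1)] Cons.prems(2,3) Cons.IH[OF w s] by simp
qed

section \<open>Webs among the word diagrams\<close>

lemma nweb_word_diagram_iff:
  assumes w: "set w \<subseteq> {1..n}"
  shows "nweb n (word_diagram n w) \<longleftrightarrow>
    (\<forall>k\<in>{1..n+1}. \<forall>l\<in>{1..n+1}. k \<noteq> l \<longrightarrow> word_cross w k l \<le> 1) \<and>
    \<not> (\<exists>j\<in>{1..n+1}. \<exists>k\<in>{1..n+1}. \<exists>l\<in>{1..n+1}. j \<noteq> k \<and> j \<noteq> l \<and> k \<noteq> l \<and>
       word_cross w j k \<noteq> 0 \<and> word_cross w j l \<noteq> 0 \<and> word_cross w k l \<noteq> 0)"
proof -
  let ?N = "{1..n+1}" and ?W = "word_diagram n w"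
  note c = card_strand_word_diagram[OF w]
  have ne: "strand ?W k \<inter> strand ?W l \<noteq> {} \<longleftrightarrow> word_cross w k l \<noteq> 0" if "k \<in> ?N" "l \<in> ?N" "k \<noteq> l" for k l
    using c[OF that] finite_strand_inter[OF ndiagram_word_diagram[OF w] that] by (metis card_eq_0_iff)
  have c1: "(\<forall>k\<in>?N. \<forall>l\<in>?N. k \<noteq> l \<longrightarrow> card (strand ?W k \<inter> strand ?W l) \<le> 1) \<longleftrightarrow>
    (\<forall>k\<in>?N. \<forall>l\<in>?N. k \<noteq> l \<longrightarrow> word_cross w k l \<le> 1)" using c by (intro ball_cong refl imp_cong) metis
  have c2: "(\<exists>i\<in>?N. \<exists>j\<in>?N. \<exists>k\<in>?N. i \<noteq> j \<and> i \<noteq> k \<and> j \<noteq> k \<and>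
          strand ?W i \<inter> strand ?W j \<noteq> {} \<and> strand ?W i \<inter> strand ?W k \<noteq> {} \<and> strand ?W j \<inter> strand ?W k \<noteq> {}) \<longleftrightarrow>
    (\<exists>j\<in>?N. \<exists>k\<in>?N. \<exists>l\<in>?N. j \<noteq> k \<and> j \<noteq> l \<and> k \<noteq> l \<and>
       word_cross w j k \<noteq> 0 \<and> word_cross w j l \<noteq> 0 \<and> word_cross w k l \<noteq> 0)"
    using ne by (intro bex_cong conj_cong refl) auto
  show ?thesis unfolding nweb_def c1 c2 using ndiagram_word_diagram[OF w] by blast
qed

text \<open>Of three strands two have the same colour in the sense of \<open>word_cross_nf\<close>,
  and these do not cross.\<close>

lemma nweb_nf_word:
  assumes nb: "nf_blocks n bl"
  shows "nweb n (word_diagram n (nf_word bl))"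
  unfolding nweb_word_diagram_iff[OF nf_word_set[OF nb]]
proof (intro conjI ballI impI notI)
  show "word_cross (nf_word bl) k l \<le> 1" if "k \<noteq> l" for k l using word_cross_nf[OF nb that] by blast
  assume "\<exists>j\<in>{1..n+1}. \<exists>k\<in>{1..n+1}. \<exists>l\<in>{1..n+1}. j \<noteq> k \<and> j \<noteq> l \<and> k \<noteq> l \<and>
     word_cross (nf_word bl) j k \<noteq> 0 \<and> word_cross (nf_word bl) j l \<noteq> 0 \<and> word_cross (nf_word bl) k l \<noteq> 0"
  then obtain j k l where "j \<noteq> k" "j \<noteq> l" "k \<noteq> l" "word_cross (nf_word bl) j k \<noteq> 0"
    "word_cross (nf_word bl) j l \<noteq> 0" "word_cross (nf_word bl) k l \<noteq> 0" by blast
  then show False using word_cross_nf[OF nb, of j k] word_cross_nf[OF nb, of j l] word_cross_nf[OF nb, of k l] by metis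
qed

text \<open>The factor \<open>i i\<close> makes the strands arriving at the places \<open>i\<close>
  and \<open>i + 1\<close> cross twice; a factor of length three makes those arriving at
  \<open>i\<close>, \<open>i + 1\<close>, \<open>i + 2\<close> cross pairwise. Each violates one of
  the conditions on webs.\<close>

lemma nweb_no_reducible_factor:
  assumes w: "set (u @ l @ v) \<subseteq> {1..n}" and web: "nweb n (word_diagram n (u @ l @ v))"
  shows "\<not> reducible_factor l"
proof
  assume "reducible_factor l"
  then obtain i where l: "l = [i, i] \<or> l = [i, i + 1, i] \<or> l = [i + 1, i, i + 1]"
    unfolding reducible_factor_def by blast
  let ?N = "{1..n+1}"
  have su: "set u \<subseteq> {1..n}" using w by simp
  have c: "word_cross l (word_perm u j) (word_perm u k) \<le> word_cross (u @ l @ v) j k" for j k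
    by (simp add: word_cross_append)
  note web' = web[unfolded nweb_word_diagram_iff[OF w]]
  have i: "i \<in> ?N" "i + 1 \<in> ?N" using l w by auto
  obtain a where a: "a \<in> ?N" "word_perm u a = i" using word_perm_surj[OF su i(1)] by blast
  obtain b where b: "b \<in> ?N" "word_perm u b = i + 1" using word_perm_surj[OF su i(2)] by blast
  have ab: "a \<noteq> b" using a b by auto
  show False
  proof (cases "l = [i, i]")
    case True
    then have "word_cross l i (i + 1) = 2" by (auto simp: swap_at_def doubleton_eq_iff)
    then have "2 \<le> word_cross (u @ l @ v) a b" using c[of a b] a b by simp
    moreover have "word_cross (u @ l @ v) a b \<le> 1" using web' a(1) b(1) ab by blast
    ultimately show False by simp
  next
    case False
    then have l': "l = [i, i + 1, i] \<or> l = [i + 1, i, i + 1]" using l by blast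
    then have "i + 2 \<in> ?N" using w by auto
    then obtain e where e: "e \<in> ?N" "word_perm u e = i + 2" using word_perm_surj[OF su] by blast
    have ne: "a \<noteq> e" "b \<noteq> e" using a b e by auto
    have "word_cross l i (i + 1) \<noteq> 0" "word_cross l i (i + 2) \<noteq> 0" "word_cross l (i + 1) (i + 2) \<noteq> 0"
      using l' by (auto simp: swap_at_def doubleton_eq_iff)
    then have "word_cross (u @ l @ v) a b \<noteq> 0" "word_cross (u @ l @ v) a e \<noteq> 0" "word_cross (u @ l @ v) b e \<noteq> 0"
      using c[of a b] c[of a e] c[of b e] a b e by auto
    then show False using web' a(1) b(1) e(1) ab ne by blast
  qed
qed

lemma nweb_normal_form:
  assumes "nweb n D"
  shows "\<exists>bl. nf_blocks n bl \<and> isotopic n D (word_diagram n (nf_word bl))"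
proof -
  have nd: "ndiagram n D" using assms by (simp add: nweb_def)
  obtain w where w: "has_word n D w" using has_word_exists[OF nd] by blast
  have sw: "set w \<subseteq> {1..n}" using has_word_set[OF w] .
  \<comment> \<open>Being a web is invariant under isotopy, so it passes from \<open>D\<close> to
    the diagram of every word commutation equivalent to \<open>w\<close>.\<close>
  have "irred w" unfolding irred_def
  proof (intro allI impI)
    fix u l v assume ce: "comm_eq w (u @ l @ v)"
    obtain E where E: "isotopic n D E" "has_word n E (u @ l @ v)" using comm_eq_isotopic[OF ce w] by blast
    have s: "set (u @ l @ v) \<subseteq> {1..n}" using has_word_set[OF E(2)] .
    have "isotopic n D (word_diagram n (u @ l @ v))"
      using isotopic_trans[OF E(1) same_word_isotopic[OF E(2) has_word_word_diagram[OF s]]] .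
    from nweb_isotopic[OF this assms] show "\<not> reducible_factor l" by (rule nweb_no_reducible_factor[OF s])
  qed
  then obtain bl where bl: "nf_blocks n bl" "comm_eq w (nf_word bl)" using irred_normal_form sw by blast
  obtain E where E: "isotopic n D E" "has_word n E (nf_word bl)" using comm_eq_isotopic[OF bl(2) w] by blast
  show ?thesis
    using isotopic_trans[OF E(1) same_word_isotopic[OF E(2) has_word_word_diagram[OF nf_word_set[OF bl(1)]]]] bl(1) by blast
qed

section \<open>Moves inside stacks\<close>

text \<open>Both halves of a stack in one formula, with offset 0 or \<open>1/2\<close>, so that each
  move is transported by a single argument.\<close>

definition half_at :: "real \<Rightarrow> real \<times> real \<Rightarrow> real \<times> real" where
  "half_at e p = (fst p, snd p / 2 + e)"

lemma half_at_eq: "lower_half = half_at 0" "upper_half = half_at (1/2)"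
  by (auto simp: fun_eq_iff half_at_def lower_half_def upper_half_def field_simps)

lemma half_at_box: "half_at e p \<in> {a..b} \<times> {c / 2 + e..d / 2 + e} \<longleftrightarrow> p \<in> {a..b} \<times> {c..d}"
  by (cases p) (auto simp: half_at_def)

lemma image_Int_Diff_iff:
  assumes "\<And>p. h p \<in> B' \<longleftrightarrow> p \<in> B"
  shows "h ` I \<inter> B' = h ` (I \<inter> B)" "h ` I - B' = h ` (I - B)"
  using assms by blast+

lemma arcs_cross_half:
  assumes "arcs_cross c d f g m"
  shows "arcs_cross (c / 2 + e) (d / 2 + e) (\<lambda>u. f (2 * (u - e))) (\<lambda>u. g (2 * (u - e))) m"
proof -
  let ?S = "{y\<in>{c..d}. f y = g y}" and ?T = "{u\<in>{c / 2 + e..d / 2 + e}. f (2 * (u - e)) = g (2 * (u - e))}"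
  have T: "?T = (\<lambda>y. y / 2 + e) ` ?S"
  proof (intro Set.set_eqI iffI)
    fix u assume "u \<in> ?T"
    then have "2 * (u - e) \<in> ?S" by auto
    then have "(2 * (u - e)) / 2 + e \<in> (\<lambda>y. y / 2 + e) ` ?S" by (rule imageI)
    moreover have "(2 * (u - e)) / 2 + e = u" by (simp add: field_simps)
    ultimately show "u \<in> (\<lambda>y. y / 2 + e) ` ?S" by metis
  qed auto
  have fin: "finite ?S" and cd: "card ?S = m" and cr: "\<And>y. y \<in> ?S \<Longrightarrow> crosses_at f g y"
    using assms unfolding arcs_cross_def by auto
  have "card ?T = m" unfolding T using cd by (subst card_image) (auto simp: inj_on_def)
  moreover have "crosses_at (\<lambda>u. f (2 * (u - e))) (\<lambda>u. g (2 * (u - e))) u" if "u \<in> ?T" for u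
  proof (rule crosses_at_transfer[of f g "\<lambda>u. 2 * (u - e)" u "u - 1" "u + 1"])
    show "crosses_at f g (2 * (u - e))" using that by (intro cr) auto
  qed (auto intro!: continuous_intros)
  ultimately show ?thesis unfolding arcs_cross_def using fin T by auto
qed

text \<open>\<open>R\<close> is the image of the other factor of the stack. It meets the half strip
  of \<open>D\<close> at most along the seam, in points that already belong to the image of
  \<open>D\<close>, so it does not disturb the picture in the rectangle.\<close>

lemma local_picture_half:
  assumes lp: "local_picture n D a b c d F" and cd: "0 \<le> c" "d \<le> 1"
    and im: "diagram_image n D2 = half_at e ` diagram_image n D \<union> R"
    and R: "R \<inter> (UNIV \<times> {e..e + 1/2}) \<subseteq> half_at e ` diagram_image n D"
  shows "local_picture n D2 a b (c / 2 + e) (d / 2 + e) ((\<lambda>f u. f (2 * (u - e))) ` F)"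
proof -
  let ?B = "{a..b} \<times> {c..d}" and ?B2 = "{a..b} \<times> {c / 2 + e..d / 2 + e}"
  have lpd: "diagram_image n D \<inter> ?B = (\<Union>f\<in>F. arc_graph c d f)" and
    lpf: "\<And>f. f \<in> F \<Longrightarrow> continuous_on {c..d} f \<and> f ` {c..d} \<subseteq> {a<..<b}"
    using lp unfolding local_picture_def by blast+
  have "?B2 \<subseteq> UNIV \<times> {e..e + 1/2}" using cd by auto
  then have "diagram_image n D2 \<inter> ?B2 = half_at e ` diagram_image n D \<inter> ?B2" using im R by blast
  also have "\<dots> = half_at e ` (diagram_image n D \<inter> ?B)" by (rule image_Int_Diff_iff(1)[OF half_at_box])
  also have "\<dots> = (\<Union>f\<in>F. half_at e ` arc_graph c d f)" unfolding lpd by (simp only: image_UN)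
  also have "\<dots> = (\<Union>f\<in>(\<lambda>f u. f (2 * (u - e))) ` F. arc_graph (c / 2 + e) (d / 2 + e) f)"
  proof -
    have "half_at e ` arc_graph c d f = arc_graph (c / 2 + e) (d / 2 + e) (\<lambda>u. f (2 * (u - e)))" for f
    proof -
      have iv: "{c / 2 + e..d / 2 + e} = (\<lambda>y. y / 2 + e) ` {c..d}"
      proof (intro Set.set_eqI iffI)
        fix u assume "u \<in> {c / 2 + e..d / 2 + e}"
        then have "2 * (u - e) \<in> {c..d}" by auto
        then have "(2 * (u - e)) / 2 + e \<in> (\<lambda>y. y / 2 + e) ` {c..d}" by (rule imageI)
        moreover have "(2 * (u - e)) / 2 + e = u" by (simp add: field_simps)
        ultimately show "u \<in> (\<lambda>y. y / 2 + e) ` {c..d}" by metis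
      qed auto
      show ?thesis unfolding arc_graph_def iv by (simp add: image_image half_at_def)
    qed
    then show ?thesis by simp
  qed
  finally have 1: "diagram_image n D2 \<inter> ?B2 = (\<Union>f\<in>(\<lambda>f u. f (2 * (u - e))) ` F. arc_graph (c / 2 + e) (d / 2 + e) f)" .
  have 2: "continuous_on {c / 2 + e..d / 2 + e} (\<lambda>u. f (2 * (u - e))) \<and>
      (\<lambda>u. f (2 * (u - e))) ` {c / 2 + e..d / 2 + e} \<subseteq> {a<..<b}" if f: "f \<in> F" for f
  proof
    have sub: "(\<lambda>u. 2 * (u - e)) ` {c / 2 + e..d / 2 + e} \<subseteq> {c..d}" by auto
    have "continuous_on {c..d} f" using lpf[OF f] by blast
    then show "continuous_on {c / 2 + e..d / 2 + e} (\<lambda>u. f (2 * (u - e)))"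
      by (rule continuous_on_compose2[OF _ _ sub]) (intro continuous_intros)
    show "(\<lambda>u. f (2 * (u - e))) ` {c / 2 + e..d / 2 + e} \<subseteq> {a<..<b}"
    proof (rule image_subsetI)
      fix u assume "u \<in> {c / 2 + e..d / 2 + e}"
      then have "2 * (u - e) \<in> {c..d}" by auto
      then show "f (2 * (u - e)) \<in> {a<..<b}" using lpf[OF f] by blast
    qed
  qed
  show ?thesis unfolding local_picture_def using 1 2 by blast
qed

lemma outside_half:
  assumes "diagram_image n D - {a..b} \<times> {c..d} = diagram_image n D' - {a..b} \<times> {c..d}"
    and "diagram_image n D2 = half_at e ` diagram_image n D \<union> R"
    and "diagram_image n D2' = half_at e ` diagram_image n D' \<union> R"
  shows "diagram_image n D2 - {a..b} \<times> {c / 2 + e..d / 2 + e} =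
    diagram_image n D2' - {a..b} \<times> {c / 2 + e..d / 2 + e}"
proof -
  have "half_at e ` I - {a..b} \<times> {c / 2 + e..d / 2 + e} = half_at e ` (I - {a..b} \<times> {c..d})" for I
    by (rule image_Int_Diff_iff(2)[OF half_at_box])
  then show ?thesis unfolding assms(2,3) Un_Diff using assms(1) by metis
qed

lemma move2_half:
  assumes mv: "move2 n D D'" and nd: "ndiagram n D2" "ndiagram n D2'"
    and im: "diagram_image n D2 = half_at e ` diagram_image n D \<union> R"
      "diagram_image n D2' = half_at e ` diagram_image n D' \<union> R"
    and R: "R \<inter> (UNIV \<times> {e..e + 1/2}) \<subseteq> half_at e ` diagram_image n D"
      "R \<inter> (UNIV \<times> {e..e + 1/2}) \<subseteq> half_at e ` diagram_image n D'"
    and e: "e = 0 \<or> e = 1/2"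
  shows "move2 n D2 D2'"
proof -
  obtain a b c d f1 f2 g1 g2 B1 B2 T1 T2 where
    ab: "a < b" and cd: "0 \<le> c" "c < d" "d \<le> 1"
    and out: "diagram_image n D - {a..b} \<times> {c..d} = diagram_image n D' - {a..b} \<times> {c..d}"
    and lp: "local_picture n D a b c d {f1, f2}" "local_picture n D' a b c d {g1, g2}"
    and BT: "B1 < B2" "T1 < T2" "f1 c = B1" "f1 d = T1" "f2 c = B2" "f2 d = T2"
      "g1 c = B1" "g1 d = T2" "g2 c = B2" "g2 d = T1"
    and ac: "arcs_cross c d f1 f2 2" "arcs_cross c d g1 g2 1"
    using mv unfolding move2_def by (elim conjE exE) (rule that, assumption+)
  let ?h = "\<lambda>f u. f (2 * (u - e))"
  note lp' = local_picture_half[OF lp(1) cd(1,3) im(1) R(1)] local_picture_half[OF lp(2) cd(1,3) im(2) R(2)]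
  show ?thesis unfolding move2_def
  proof (intro conjI nd exI)
    show "a < b" by (fact ab)
    show "0 \<le> c / 2 + e" "c / 2 + e < d / 2 + e" "d / 2 + e \<le> 1" using cd e by auto
    show "diagram_image n D2 - {a..b} \<times> {c / 2 + e..d / 2 + e} = diagram_image n D2' - {a..b} \<times> {c / 2 + e..d / 2 + e}"
      by (rule outside_half[OF out im])
    show "local_picture n D2 a b (c / 2 + e) (d / 2 + e) {?h f1, ?h f2}" using lp'(1) by simp
    show "local_picture n D2' a b (c / 2 + e) (d / 2 + e) {?h g1, ?h g2}" using lp'(2) by simp
    show "arcs_cross (c / 2 + e) (d / 2 + e) (?h f1) (?h f2) 2" by (rule arcs_cross_half[OF ac(1)])
    show "arcs_cross (c / 2 + e) (d / 2 + e) (?h g1) (?h g2) 1" by (rule arcs_cross_half[OF ac(2)])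
  qed (use BT in auto)
qed

lemma move3_half:
  assumes mv: "move3 n D D'" and nd: "ndiagram n D2" "ndiagram n D2'"
    and im: "diagram_image n D2 = half_at e ` diagram_image n D \<union> R"
      "diagram_image n D2' = half_at e ` diagram_image n D' \<union> R"
    and R: "R \<inter> (UNIV \<times> {e..e + 1/2}) \<subseteq> half_at e ` diagram_image n D"
      "R \<inter> (UNIV \<times> {e..e + 1/2}) \<subseteq> half_at e ` diagram_image n D'"
    and e: "e = 0 \<or> e = 1/2"
  shows "move3 n D2 D2'"
proof -
  obtain a b c d f1 f2 f3 g1 g2 g3 B1 B2 B3 T1 T2 T3 where
    ab: "a < b" and cd: "0 \<le> c" "c < d" "d \<le> 1"
    and out: "diagram_image n D - {a..b} \<times> {c..d} = diagram_image n D' - {a..b} \<times> {c..d}"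
    and lp: "local_picture n D a b c d {f1, f2, f3}" "local_picture n D' a b c d {g1, g2, g3}"
    and BT: "B1 < B2" "B2 < B3" "T1 < T2" "T2 < T3" "f1 c = B1" "f1 d = T3" "f2 c = B2" "f2 d = T2" "f3 c = B3" "f3 d = T1"
      "g1 c = B1" "g1 d = T3" "g2 c = B2" "g2 d = T1" "g3 c = B3" "g3 d = T2"
    and ac: "arcs_cross c d f1 f2 1" "arcs_cross c d f1 f3 1" "arcs_cross c d f2 f3 1"
      "arcs_cross c d g1 g2 1" "arcs_cross c d g1 g3 1" "arcs_cross c d g2 g3 0"
    using mv unfolding move3_def by (elim conjE exE) (rule that, assumption+)
  let ?h = "\<lambda>f u. f (2 * (u - e))"
  note lp' = local_picture_half[OF lp(1) cd(1,3) im(1) R(1)] local_picture_half[OF lp(2) cd(1,3) im(2) R(2)]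
  show ?thesis unfolding move3_def
  proof (intro conjI nd exI)
    show "a < b" by (fact ab)
    show "0 \<le> c / 2 + e" "c / 2 + e < d / 2 + e" "d / 2 + e \<le> 1" using cd e by auto
    show "diagram_image n D2 - {a..b} \<times> {c / 2 + e..d / 2 + e} = diagram_image n D2' - {a..b} \<times> {c / 2 + e..d / 2 + e}"
      by (rule outside_half[OF out im])
    show "local_picture n D2 a b (c / 2 + e) (d / 2 + e) {?h f1, ?h f2, ?h f3}" using lp'(1) by simp
    show "local_picture n D2' a b (c / 2 + e) (d / 2 + e) {?h g1, ?h g2, ?h g3}" using lp'(2) by simp
    show "arcs_cross (c / 2 + e) (d / 2 + e) (?h f1) (?h f2) 1" by (rule arcs_cross_half[OF ac(1)])
    show "arcs_cross (c / 2 + e) (d / 2 + e) (?h f1) (?h f3) 1" by (rule arcs_cross_half[OF ac(2)])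
    show "arcs_cross (c / 2 + e) (d / 2 + e) (?h f2) (?h f3) 1" by (rule arcs_cross_half[OF ac(3)])
    show "arcs_cross (c / 2 + e) (d / 2 + e) (?h g1) (?h g2) 1" by (rule arcs_cross_half[OF ac(4)])
    show "arcs_cross (c / 2 + e) (d / 2 + e) (?h g1) (?h g3) 1" by (rule arcs_cross_half[OF ac(5)])
    show "arcs_cross (c / 2 + e) (d / 2 + e) (?h g2) (?h g3) 0" by (rule arcs_cross_half[OF ac(6)])
  qed (use BT in auto)
qed

lemma diagram_image_ends:
  assumes D: "ndiagram n D"
  shows "(x, 0) \<in> diagram_image n D \<longleftrightarrow> x \<in> real ` {1..n+1}" "(x, 1) \<in> diagram_image n D \<longleftrightarrow> x \<in> real ` {1..n+1}"
proof -
  obtain h where h: "level_system n h" "diagram_image n D = (\<Union>k\<in>{1..n+1}. arc_graph 0 1 (h k))"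
    using has_levels_exists[OF D] unfolding has_levels_def by blast
  have iff: "(x, y) \<in> diagram_image n D \<longleftrightarrow> y \<in> {0..1} \<and> (\<exists>k\<in>{1..n+1}. x = h k y)" for y
    unfolding h(2) arc_graph_def by blast
  show "(x, 0) \<in> diagram_image n D \<longleftrightarrow> x \<in> real ` {1..n+1}" "(x, 1) \<in> diagram_image n D \<longleftrightarrow> x \<in> real ` {1..n+1}"
  proof -
    have "(\<exists>k\<in>{1..n+1}. x = h k 0) \<longleftrightarrow> (\<exists>k\<in>{1..n+1}. x = real k)" "(\<exists>k\<in>{1..n+1}. x = h k 1) \<longleftrightarrow> (\<exists>k\<in>{1..n+1}. x = real k)"
      by (intro bex_cong refl, simp only: level_systemD(2,3)[OF h(1)])+
    then show "(x, 0) \<in> diagram_image n D \<longleftrightarrow> x \<in> real ` {1..n+1}" "(x, 1) \<in> diagram_image n D \<longleftrightarrow> x \<in> real ` {1..n+1}"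
      unfolding iff image_iff by simp_all
  qed
qed

text \<open>On the boundary lines every diagram has the same image, the integer points
  \<open>1\<close> to \<open>n + 1\<close>; this is all that the two halves have in common.\<close>

lemma stack_halves_overlap:
  assumes "ndiagram n A" "ndiagram n D"
  shows "upper_half ` diagram_image n A \<inter> (UNIV \<times> {0..0 + 1/2}) \<subseteq> half_at 0 ` diagram_image n D"
    "lower_half ` diagram_image n A \<inter> (UNIV \<times> {1/2..1/2 + 1/2}) \<subseteq> half_at (1/2) ` diagram_image n D"
proof -
  show "upper_half ` diagram_image n A \<inter> (UNIV \<times> {0..0 + 1/2}) \<subseteq> half_at 0 ` diagram_image n D"
  proof
    fix p assume "p \<in> upper_half ` diagram_image n A \<inter> (UNIV \<times> {0..0 + 1/2})"
    then obtain x y where xy: "(x, y) \<in> diagram_image n A" "p = (x, (1 + y) / 2)" "(1 + y) / 2 \<le> 1/2"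
      unfolding upper_half_def by auto
    then have "y = 0" using diagram_image_strip[OF assms(1)] by (force simp: strip_def)
    then have "(x, 1) \<in> diagram_image n D" using xy(1) diagram_image_ends assms by blast
    then have "half_at 0 (x, 1) \<in> half_at 0 ` diagram_image n D" by (rule imageI)
    then show "p \<in> half_at 0 ` diagram_image n D" using xy(2) \<open>y = 0\<close> by (simp add: half_at_def)
  qed
  show "lower_half ` diagram_image n A \<inter> (UNIV \<times> {1/2..1/2 + 1/2}) \<subseteq> half_at (1/2) ` diagram_image n D"
  proof
    fix p assume "p \<in> lower_half ` diagram_image n A \<inter> (UNIV \<times> {1/2..1/2 + 1/2})"
    then obtain x y where xy: "(x, y) \<in> diagram_image n A" "p = (x, y / 2)" "1/2 \<le> y / 2"
      unfolding lower_half_def by auto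
    then have "y = 1" using diagram_image_strip[OF assms(1)] by (force simp: strip_def)
    then have "(x, 0) \<in> diagram_image n D" using xy(1) diagram_image_ends assms by blast
    then have "half_at (1/2) (x, 0) \<in> half_at (1/2) ` diagram_image n D" by (rule imageI)
    then show "p \<in> half_at (1/2) ` diagram_image n D" using xy(2) \<open>y = 1\<close> by (simp add: half_at_def)
  qed
qed

lemma move_stack:
  assumes A: "ndiagram n A" and D: "ndiagram n D" and E: "ndiagram n E"
  shows "move2 n D E \<Longrightarrow> move2 n (stack n A D) (stack n A E)" "move2 n D E \<Longrightarrow> move2 n (stack n D A) (stack n E A)"
    "move3 n D E \<Longrightarrow> move3 n (stack n A D) (stack n A E)" "move3 n D E \<Longrightarrow> move3 n (stack n D A) (stack n E A)"
proof -
  note nd = ndiagram_stack[OF A D] ndiagram_stack[OF A E] ndiagram_stack[OF D A] ndiagram_stack[OF E A]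
  have im: "diagram_image n (stack n A D) = half_at 0 ` diagram_image n D \<union> upper_half ` diagram_image n A"
    "diagram_image n (stack n A E) = half_at 0 ` diagram_image n E \<union> upper_half ` diagram_image n A"
    "diagram_image n (stack n D A) = half_at (1/2) ` diagram_image n D \<union> lower_half ` diagram_image n A"
    "diagram_image n (stack n E A) = half_at (1/2) ` diagram_image n E \<union> lower_half ` diagram_image n A"
    unfolding diagram_image_stack[OF A D] diagram_image_stack[OF A E] diagram_image_stack[OF D A]
      diagram_image_stack[OF E A] half_at_eq by (simp_all only: Un_commute)
  note ov = stack_halves_overlap[OF A D] stack_halves_overlap[OF A E]
  show "move2 n D E \<Longrightarrow> move2 n (stack n A D) (stack n A E)"
    by (rule move2_half[OF _ nd(1,2) im(1,2) ov(1,3)]) auto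
  show "move2 n D E \<Longrightarrow> move2 n (stack n D A) (stack n E A)"
    by (rule move2_half[OF _ nd(3,4) im(3,4) ov(2,4)]) auto
  show "move3 n D E \<Longrightarrow> move3 n (stack n A D) (stack n A E)"
    by (rule move3_half[OF _ nd(1,2) im(1,2) ov(1,3)]) auto
  show "move3 n D E \<Longrightarrow> move3 n (stack n D A) (stack n E A)"
    by (rule move3_half[OF _ nd(3,4) im(3,4) ov(2,4)]) auto
qed

section \<open>The defining relations hold for diagrams\<close>

lemma word_diagram_confined:
  assumes "set w \<subseteq> {1..n}" "set w \<subseteq> {i..<i + m}" "j \<in> {1..n+1}" "s \<in> {0..1}"
  shows "(j \<notin> {i..i + m} \<longrightarrow> word_diagram n w j s = (real j, s)) \<and>
     (j \<in> {i..i + m} \<longrightarrow> real i \<le> fst (word_diagram n w j s) \<and> fst (word_diagram n w j s) \<le> real (i + m))"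
  using assms
proof (induction w arbitrary: j s)
  case (Cons x w)
  have x: "x \<in> {1..n}" "x \<in> {i..<i + m}" and w: "set w \<subseteq> {1..n}" "set w \<subseteq> {i..<i + m}" using Cons.prems by auto
  have sw: "swap_at x j \<in> {1..n+1}" using swap_at_in[OF x(1)] Cons.prems(3) by blast
  note nx = word_diagram_next[OF Cons.prems(1,3)]
  show ?case
  proof (cases "s \<le> 1/2")
    case True
    have "real i \<le> elementary_x x j (2 * s) \<and> elementary_x x j (2 * s) \<le> real (i + m)" if "j \<in> {i..i + m}"
      using that x(2) True Cons.prems(4) by (auto simp: elementary_x_def)
    moreover have "elementary_x x j (2 * s) = real j" if "j \<notin> {i..i + m}"
      using that x(2) by (auto simp: elementary_x_def)
    ultimately show ?thesis using True by (auto simp: stack_eq lower_half_def elementary_eq)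
  next
    case False
    have s2: "2 * s - 1 \<in> {0..1}" using False Cons.prems(4) by auto
    have "swap_at x j \<in> {i..i + m} \<longleftrightarrow> j \<in> {i..i + m}" "j \<notin> {i..i + m} \<longrightarrow> swap_at x j = j"
      using x(2) by (auto simp: swap_at_def)
    then show ?thesis using Cons.IH[OF w sw s2] False nx by (auto simp: stack_eq upper_half_def)
  qed
qed (auto simp: identity_diagram_def)

text \<open>Provides the rectangle for the moves: full height, with margins \<open>1/2\<close>
  beyond the columns touched by the word, so that the adjacent vertical strands stay outside. The
  picture outside depends only on \<open>i\<close> and \<open>m\<close>, hence is common to both
  words of a move.\<close>

lemma word_diagram_box:
  assumes w: "set w \<subseteq> {1..n}" "set w \<subseteq> {i..<i + m}" and im: "{i..i + m} \<subseteq> {1..n+1}"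
  defines "W \<equiv> word_diagram n w" and "B \<equiv> {real i - 1/2..real (i + m) + 1/2} \<times> {0..1::real}"
  shows "local_picture n W (real i - 1/2) (real (i + m) + 1/2) 0 1 (strand_x W ` {i..i + m})"
    "diagram_image n W - B = (\<Union>j\<in>{1..n+1} - {i..i + m}. {real j} \<times> {0..1})"
proof -
  let ?N = "{1..n+1}"
  have nd: "ndiagram n W" unfolding W_def by (rule ndiagram_word_diagram[OF w(1)])
  note conf = word_diagram_confined[OF w, folded W_def]
  have gr: "strand W j = arc_graph 0 1 (strand_x W j)" if "j \<in> ?N" for j
    using strand_eq_graph[of n W j, OF ndiagramD(1)[OF nd that]] .
  have out: "strand W j = {real j} \<times> {0..1}" if "j \<in> ?N" "j \<notin> {i..i + m}" for j
    using conf[OF that(1)] that(2) unfolding strand_def by (auto simp: image_iff)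
  have ins: "real i \<le> fst p \<and> fst p \<le> real (i + m)" if "j \<in> {i..i + m}" "p \<in> strand W j" for j p
    using conf[of j] that im unfolding strand_def by blast
  have inh: "snd p \<in> {0..1}" if "j \<in> ?N" "p \<in> strand W j" for j p
    using strand_height[of n W j, OF ndiagramD(1)[OF nd that(1)] that(2)] .
  have inB: "strand W j \<subseteq> B" if "j \<in> {i..i + m}" for j
  proof
    fix p assume p: "p \<in> strand W j"
    have "j \<in> ?N" using that im by blast
    then show "p \<in> B" using ins[OF that p] inh[OF _ p] unfolding B_def by (auto simp: mem_Times_iff)
  qed
  have outB: "strand W j \<inter> B = {}" if j: "j \<in> ?N" "j \<notin> {i..i + m}" for j
  proof -
    have "real j + 1 \<le> real i \<or> real (i + m) + 1 \<le> real j" using j(2) by (simp add: not_le) linarith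
    then show ?thesis unfolding out[OF j] B_def by auto
  qed
  have split: "diagram_image n W = (\<Union>j\<in>{i..i + m}. strand W j) \<union> (\<Union>j\<in>?N - {i..i + m}. strand W j)"
    unfolding diagram_image_def using im by blast
  have "diagram_image n W \<inter> B = (\<Union>j\<in>{i..i + m}. strand W j)"
    unfolding split using inB outB by blast
  also have "\<dots> = (\<Union>f\<in>strand_x W ` {i..i + m}. arc_graph 0 1 f)" using gr im by auto
  finally have 1: "diagram_image n W \<inter> B = (\<Union>f\<in>strand_x W ` {i..i + m}. arc_graph 0 1 f)" .
  have 2: "continuous_on {0..1} (strand_x W j) \<and> strand_x W j ` {0..1} \<subseteq> {real i - 1/2<..<real (i + m) + 1/2}"
    if j: "j \<in> {i..i + m}" for j
  proof
    have jN: "j \<in> ?N" using j im by blast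
    show "continuous_on {0..1} (strand_x W j)" by (rule continuous_strand_x[of n W j, OF ndiagramD(1)[OF nd jN]])
    show "strand_x W j ` {0..1} \<subseteq> {real i - 1/2<..<real (i + m) + 1/2}"
    proof (rule image_subsetI)
      fix y :: real assume "y \<in> {0..1}"
      then have "(strand_x W j y, y) \<in> strand W j" unfolding gr[OF jN] arc_graph_def by blast
      from ins[OF j this] show "strand_x W j y \<in> {real i - 1/2<..<real (i + m) + 1/2}" by auto
    qed
  qed
  show "local_picture n W (real i - 1/2) (real (i + m) + 1/2) 0 1 (strand_x W ` {i..i + m})"
    unfolding local_picture_def using 1 2 unfolding B_def by blast
  show "diagram_image n W - B = (\<Union>j\<in>?N - {i..i + m}. {real j} \<times> {0..1})"
  proof -
    have "(\<Union>j\<in>{i..i + m}. strand W j) - B = {}" using inB by blast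
    moreover have "(\<Union>j\<in>?N - {i..i + m}. strand W j) - B = (\<Union>j\<in>?N - {i..i + m}. strand W j)" using outB by blast
    moreover have "(\<Union>j\<in>?N - {i..i + m}. strand W j) = (\<Union>j\<in>?N - {i..i + m}. {real j} \<times> {0..1})"
      using out by (intro SUP_cong refl) blast
    ultimately show ?thesis unfolding split Un_Diff by (simp only: Un_empty_left)
  qed
qed

lemma word_diagram_arcs_cross:
  assumes w: "set w \<subseteq> {1..n}" and kl: "k \<in> {1..n+1}" "l \<in> {1..n+1}" "k \<noteq> l"
  shows "arcs_cross 0 1 (strand_x (word_diagram n w) k) (strand_x (word_diagram n w) l) (word_cross w k l)"
proof -
  let ?W = "word_diagram n w"
  have nd: "ndiagram n ?W" by (rule ndiagram_word_diagram[OF w])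
  let ?S = "{y\<in>{0..1}. strand_x ?W k y = strand_x ?W l y}"
  have eq: "strand ?W k \<inter> strand ?W l = (\<lambda>y. (strand_x ?W k y, y)) ` ?S"
    using strand_eq_graph[of n ?W k, OF ndiagramD(1)[OF nd kl(1)]] strand_eq_graph[of n ?W l, OF ndiagramD(1)[OF nd kl(2)]]
    unfolding arc_graph_def by (auto simp: image_iff)
  have inj: "inj_on (\<lambda>y. (strand_x ?W k y, y)) ?S" by (auto simp: inj_on_def)
  have "finite ?S" using finite_strand_inter[OF nd kl] unfolding eq by (rule finite_imageD[OF _ inj])
  moreover have "card ?S = word_cross w k l"
    using card_strand_word_diagram[OF w kl] unfolding eq card_image[OF inj] .
  moreover have "\<forall>y\<in>{0..1}. strand_x ?W k y = strand_x ?W l y \<longrightarrow> crosses_at (strand_x ?W k) (strand_x ?W l) y"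
    using crossing_familyD(3)[OF ndiagramD(2)[OF nd] kl(1,2) _ kl(3)] by blast
  ultimately show ?thesis unfolding arcs_cross_def by blast
qed

lemma word_diagram_strand_ends:
  assumes w: "set w \<subseteq> {1..n}" and j: "j \<in> {1..n+1}"
  shows "strand_x (word_diagram n w) j 0 = real j" "strand_x (word_diagram n w) j 1 = real (word_perm w j)"
  using strand_x_endpoints(1,2)[of n "word_diagram n w" j, OF ndiagramD(1)[OF ndiagram_word_diagram[OF w] j]]
    word_diagram_start word_diagram_end[OF w j] by simp_all

lemma move2_word_diagram:
  assumes i: "i \<in> {1..n}"
  shows "move2 n (word_diagram n [i, i]) (word_diagram n [i])"
proof -
  let ?W = "word_diagram n [i, i]" and ?V = "word_diagram n [i]"
  have w: "set [i, i] \<subseteq> {1..n}" "set [i, i] \<subseteq> {i..<i + 1}" and v: "set [i] \<subseteq> {1..n}" "set [i] \<subseteq> {i..<i + 1}"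
    and im: "{i..i + 1} \<subseteq> {1..n+1}" and N: "i \<in> {1..n+1}" "i + 1 \<in> {1..n+1}" "i \<noteq> i + 1" using i by auto
  note bw = word_diagram_box[OF w im] and bv = word_diagram_box[OF v im]
  note ew = word_diagram_strand_ends[OF w(1)] and ev = word_diagram_strand_ends[OF v(1)]
  have I: "{i..i + 1} = {i, i + 1}" by auto
  have cw: "word_cross [i, i] i (i + 1) = 2" "word_cross [i] i (i + 1) = 1"
    by (auto simp: swap_at_def doubleton_eq_iff)
  show ?thesis unfolding move2_def
  proof (intro conjI exI)
    show "ndiagram n ?W" "ndiagram n ?V" using ndiagram_word_diagram w v by blast+
    show "real i - 1/2 < real (i + 1) + 1/2" "(0::real) \<le> 0" "(0::real) < 1" "(1::real) \<le> 1" by auto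
    show "diagram_image n ?W - {real i - 1/2..real (i + 1) + 1/2} \<times> {0..1} =
      diagram_image n ?V - {real i - 1/2..real (i + 1) + 1/2} \<times> {0..1}" using bw(2) bv(2) by simp
    show "local_picture n ?W (real i - 1/2) (real (i + 1) + 1/2) 0 1 {strand_x ?W i, strand_x ?W (i + 1)}"
      using bw(1) unfolding I by simp
    show "local_picture n ?V (real i - 1/2) (real (i + 1) + 1/2) 0 1 {strand_x ?V i, strand_x ?V (i + 1)}"
      using bv(1) unfolding I by simp
    show "arcs_cross 0 1 (strand_x ?W i) (strand_x ?W (i + 1)) 2"
      using word_diagram_arcs_cross[OF w(1) N] unfolding cw .
    show "arcs_cross 0 1 (strand_x ?V i) (strand_x ?V (i + 1)) 1"
      using word_diagram_arcs_cross[OF v(1) N] unfolding cw .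
    show "strand_x ?W i 0 = real i" "strand_x ?W (i + 1) 0 = real (i + 1)" "strand_x ?V i 0 = real i"
      "strand_x ?V (i + 1) 0 = real (i + 1)" using ew(1) ev(1) N by blast+
    show "strand_x ?W i 1 = real i" "strand_x ?W (i + 1) 1 = real (i + 1)"
      using ew(2)[OF N(1)] ew(2)[OF N(2)] by (simp_all add: swap_at_def)
    show "strand_x ?V i 1 = real (i + 1)" "strand_x ?V (i + 1) 1 = real i"
      using ev(2)[OF N(1)] ev(2)[OF N(2)] by (simp_all add: swap_at_def)
  qed auto
qed

text \<open>Both words of length three give three strands crossing pairwise once, with the same
  endpoints; so a single picture serves for both braid relations. In \<open>[i, i + 1]\<close> only
  the strand from \<open>i\<close> crosses the other two, as the move requires.\<close>

lemma move3_word_diagram: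
  assumes i: "i \<in> {1..n}" "i + 1 \<in> {1..n}" and w: "w = [i, i + 1, i] \<or> w = [i + 1, i, i + 1]"
  shows "move3 n (word_diagram n w) (word_diagram n [i, i + 1])"
proof -
  let ?W = "word_diagram n w" and ?V = "word_diagram n [i, i + 1]"
  have w': "set w \<subseteq> {1..n}" "set w \<subseteq> {i..<i + 2}"
    and v: "set [i, i + 1] \<subseteq> {1..n}" "set [i, i + 1] \<subseteq> {i..<i + 2}"
    and im: "{i..i + 2} \<subseteq> {1..n+1}" and N: "i \<in> {1..n+1}" "i + 1 \<in> {1..n+1}" "i + 2 \<in> {1..n+1}" using i w by auto
  have ne: "i \<noteq> i + 1" "i \<noteq> i + 2" "i + 1 \<noteq> i + 2" by auto
  note bw = word_diagram_box[OF w' im] and bv = word_diagram_box[OF v im]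
  note ew = word_diagram_strand_ends[OF w'(1)] and ev = word_diagram_strand_ends[OF v(1)]
  have I: "{i..i + 2} = {i, i + 1, i + 2}" by auto
  have cw: "word_cross w i (i + 1) = 1" "word_cross w i (i + 2) = 1" "word_cross w (i + 1) (i + 2) = 1"
    using w by (auto simp: swap_at_def doubleton_eq_iff)
  have cv: "word_cross [i, i + 1] i (i + 1) = 1" "word_cross [i, i + 1] i (i + 2) = 1" "word_cross [i, i + 1] (i + 1) (i + 2) = 0"
    by (auto simp: swap_at_def doubleton_eq_iff)
  have pw: "word_perm w i = i + 2" "word_perm w (i + 1) = i + 1" "word_perm w (i + 2) = i"
    using w by (auto simp: swap_at_def)
  have pv: "word_perm [i, i + 1] i = i + 2" "word_perm [i, i + 1] (i + 1) = i" "word_perm [i, i + 1] (i + 2) = i + 1"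
    by (auto simp: swap_at_def)
  show ?thesis unfolding move3_def
  proof (intro conjI exI)
    show "ndiagram n ?W" "ndiagram n ?V" using ndiagram_word_diagram w' v by blast+
    show "real i - 1/2 < real (i + 2) + 1/2" "(0::real) \<le> 0" "(0::real) < 1" "(1::real) \<le> 1" by auto
    show "diagram_image n ?W - {real i - 1/2..real (i + 2) + 1/2} \<times> {0..1} =
      diagram_image n ?V - {real i - 1/2..real (i + 2) + 1/2} \<times> {0..1}" using bw(2) bv(2) by simp
    show "local_picture n ?W (real i - 1/2) (real (i + 2) + 1/2) 0 1 {strand_x ?W i, strand_x ?W (i + 1), strand_x ?W (i + 2)}"
      using bw(1) unfolding I by simp
    show "local_picture n ?V (real i - 1/2) (real (i + 2) + 1/2) 0 1 {strand_x ?V i, strand_x ?V (i + 1), strand_x ?V (i + 2)}"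
      using bv(1) unfolding I by simp
    show "arcs_cross 0 1 (strand_x ?W i) (strand_x ?W (i + 1)) 1"
      using word_diagram_arcs_cross[OF w'(1) N(1,2) ne(1)] unfolding cw .
    show "arcs_cross 0 1 (strand_x ?W i) (strand_x ?W (i + 2)) 1"
      using word_diagram_arcs_cross[OF w'(1) N(1,3) ne(2)] unfolding cw .
    show "arcs_cross 0 1 (strand_x ?W (i + 1)) (strand_x ?W (i + 2)) 1"
      using word_diagram_arcs_cross[OF w'(1) N(2,3) ne(3)] unfolding cw .
    show "arcs_cross 0 1 (strand_x ?V i) (strand_x ?V (i + 1)) 1"
      using word_diagram_arcs_cross[OF v(1) N(1,2) ne(1)] unfolding cv .
    show "arcs_cross 0 1 (strand_x ?V i) (strand_x ?V (i + 2)) 1"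
      using word_diagram_arcs_cross[OF v(1) N(1,3) ne(2)] unfolding cv .
    show "arcs_cross 0 1 (strand_x ?V (i + 1)) (strand_x ?V (i + 2)) 0"
      using word_diagram_arcs_cross[OF v(1) N(2,3) ne(3)] unfolding cv .
    show "strand_x ?W i 0 = real i" "strand_x ?W (i + 1) 0 = real (i + 1)" "strand_x ?W (i + 2) 0 = real (i + 2)"
      "strand_x ?V i 0 = real i" "strand_x ?V (i + 1) 0 = real (i + 1)" "strand_x ?V (i + 2) 0 = real (i + 2)"
      using ew(1) ev(1) N by blast+
    show "strand_x ?W i 1 = real (i + 2)" "strand_x ?W (i + 1) 1 = real (i + 1)" "strand_x ?W (i + 2) 1 = real i"
      using ew(2)[OF N(1)] ew(2)[OF N(2)] ew(2)[OF N(3)] unfolding pw by auto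
    show "strand_x ?V i 1 = real (i + 2)" "strand_x ?V (i + 1) 1 = real i" "strand_x ?V (i + 2) 1 = real (i + 1)"
      using ev(2)[OF N(1)] ev(2)[OF N(2)] ev(2)[OF N(3)] unfolding pv by auto
  qed auto
qed

section \<open>Relations of words imply equivalence of diagrams\<close>

lemma DL_rel_equiv: "equiv UNIV (DL_rel n)"
  unfolding DL_rel_def
  by (intro equivI) (auto simp: refl_on_def sym_def trans_def intro: equivclp_sym equivclp_trans)

lemma DL_rel_trans: "(D, E) \<in> DL_rel n \<Longrightarrow> (E, F) \<in> DL_rel n \<Longrightarrow> (D, F) \<in> DL_rel n"
  using DL_rel_equiv by (meson equivE transD)

lemma DL_rel_sym: "(D, E) \<in> DL_rel n \<Longrightarrow> (E, D) \<in> DL_rel n"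
  using DL_rel_equiv by (meson equivE symD)

lemma DL_relI: "isotopic n D E \<or> move2 n D E \<or> move3 n D E \<Longrightarrow> (D, E) \<in> DL_rel n"
  unfolding DL_rel_def by (simp add: r_into_equivclp)

text \<open>To act on a factor, the diagram is replaced by a stack with the diagram of this factor
  as a separate piece. The heights differ from those of the word diagram, but the word is the same,
  so the two are isotopic.\<close>

lemma L_step_DL_rel:
  assumes "L_step n w w'" and w: "set w \<subseteq> {1..n}" "set w' \<subseteq> {1..n}"
  shows "(word_diagram n w, word_diagram n w') \<in> DL_rel n"
proof -
  obtain u v l r where lr: "L_relation n l r" and eq: "w = u @ l @ v" "w' = u @ r @ v"
    using assms(1) unfolding L_step_def by blast
  have s: "set u \<subseteq> {1..n}" "set l \<subseteq> {1..n}" "set r \<subseteq> {1..n}" "set v \<subseteq> {1..n}" using w eq by auto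
  let ?W = "word_diagram n"
  let ?C = "\<lambda>x. stack n (stack n (?W v) (?W x)) (?W u)"
  have iso: "isotopic n (?W (u @ x @ v)) (?C x)" if x: "set x \<subseteq> {1..n}" for x
  proof (rule same_word_isotopic)
    show "has_word n (?W (u @ x @ v)) (u @ x @ v)" using s x by (intro has_word_word_diagram) auto
    have "has_word n (?C x) (u @ (x @ v))"
      using s x by (intro has_word_stack has_word_word_diagram) auto
    then show "has_word n (?C x) (u @ x @ v)" by simp
  qed
  have mv: "(?W w, ?W w') \<in> DL_rel n" if m: "move2 n (?W l) (?W r) \<or> move3 n (?W l) (?W r)"
  proof -
    note nd = ndiagram_word_diagram[OF s(1)] ndiagram_word_diagram[OF s(2)] ndiagram_word_diagram[OF s(3)]
      ndiagram_word_diagram[OF s(4)]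
    have "move2 n (?C l) (?C r) \<or> move3 n (?C l) (?C r)"
      using m move_stack(1,3)[OF nd(4,2,3)]
        move_stack(2,4)[OF nd(1) ndiagram_stack[OF nd(4,2)] ndiagram_stack[OF nd(4,3)]] by blast
    then have "(?C l, ?C r) \<in> DL_rel n" by (intro DL_relI) blast
    moreover have "(?W w, ?C l) \<in> DL_rel n" "(?W w', ?C r) \<in> DL_rel n"
      using iso[OF s(2)] iso[OF s(3)] eq DL_relI by blast+
    ultimately show ?thesis using DL_rel_trans DL_rel_sym by blast
  qed
  from lr show ?thesis
  proof cases
    case (idem i)
    then show ?thesis using move2_word_diagram[of i n] mv by simp
  next
    case (comm i j)
    have "has_word n (?W w) (u @ [i, j] @ v)" using has_word_word_diagram[OF w(1)] eq comm by simp
    from comm_word_isotopic[OF this comm(5)] obtain E where E: "isotopic n (?W w) E" "has_word n E (u @ [j, i] @ v)" by blast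
    have "has_word n (?W w') (u @ [j, i] @ v)" using has_word_word_diagram[OF w(2)] eq comm by simp
    from isotopic_trans[OF E(1) same_word_isotopic[OF E(2) this]] show ?thesis by (intro DL_relI) blast
  next
    case (braid_left i)
    then show ?thesis using move3_word_diagram[of i n l] mv by auto
  next
    case (braid_right i)
    then show ?thesis using move3_word_diagram[of i n l] mv by auto
  qed
qed

lemma L_rel_DL_rel:
  assumes "(w, w') \<in> L_rel n" "set w \<subseteq> {1..n}"
  shows "(word_diagram n w, word_diagram n w') \<in> DL_rel n"
proof -
  have "equivclp (L_step n) w w'" using assms by (simp add: L_rel_def)
  then have "(word_diagram n w, word_diagram n w') \<in> DL_rel n \<and> set w' \<subseteq> {1..n}"
  proof (induction rule: equivclp_induct)
    case base
    then show ?case using assms(2) DL_rel_equiv by (simp add: equiv_def refl_on_def)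
  next
    case (step y z)
    then have z: "set z \<subseteq> {1..n}" using L_step_set[of n y z] L_step_set[of n z y] by blast
    have "(word_diagram n y, word_diagram n z) \<in> DL_rel n"
      using step L_step_DL_rel[of n y z] L_step_DL_rel[of n z y] z DL_rel_sym by blast
    then show ?case using step z DL_rel_trans by blast
  qed
  then show ?thesis by blast
qed

section \<open>The rightmost reachable endpoint\<close>

text \<open>A path going upwards in the diagram, as a graph over the height; continuity lets it
  change strands only where strands meet.\<close>

definition selection :: "nat \<Rightarrow> diagram \<Rightarrow> (real \<Rightarrow> real) \<Rightarrow> bool" where
  "selection n D g \<longleftrightarrow> continuous_on {0..1} g \<and> (\<forall>y\<in>{0..1}. (g y, y) \<in> diagram_image n D)"

definition reaches :: "nat \<Rightarrow> diagram \<Rightarrow> nat \<Rightarrow> nat \<Rightarrow> bool" where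
  "reaches n D k l \<longleftrightarrow> (\<exists>g. selection n D g \<and> g 0 = real k \<and> g 1 = real l)"

definition rightmost :: "nat \<Rightarrow> diagram \<Rightarrow> nat \<Rightarrow> nat" where
  "rightmost n D k = Max {l. reaches n D k l}"

lemma selection_strand: "ndiagram n D \<Longrightarrow> i \<in> {1..n+1} \<Longrightarrow> selection n D (strand_x D i)"
  unfolding selection_def
  using continuous_strand_x[of n D i] ndiagramD(1)[of n D i] ndiagram_image_iff[of n D] by blast

lemma selection_max: "selection n D f \<Longrightarrow> selection n D g \<Longrightarrow> selection n D (\<lambda>y. max (f y) (g y))"
  unfolding selection_def by (intro conjI continuous_intros ballI) (auto simp: max_def)

lemma selection_end:
  assumes "ndiagram n D" "selection n D g"
  shows "\<exists>k\<in>{1..n+1}. g 0 = real k" "\<exists>k\<in>{1..n+1}. g 1 = real k"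
proof -
  have "(g 0, 0) \<in> diagram_image n D" "(g 1, 1) \<in> diagram_image n D" using assms(2) unfolding selection_def by auto
  then show "\<exists>k\<in>{1..n+1}. g 0 = real k" "\<exists>k\<in>{1..n+1}. g 1 = real k"
    using diagram_image_ends[OF assms(1)] by blast+
qed

lemma reaches_in:
  assumes "ndiagram n D" "reaches n D k l"
  shows "k \<in> {1..n+1}" "l \<in> {1..n+1}"
proof -
  obtain g where g: "selection n D g" "g 0 = real k" "g 1 = real l" using assms(2) unfolding reaches_def by blast
  show "k \<in> {1..n+1}" "l \<in> {1..n+1}" using selection_end[OF assms(1) g(1)] g(2,3) by auto
qed

text \<open>The maximum of the given path and the strand from \<open>k'\<close> is again a path in
  the diagram, starts at \<open>k'\<close> and ends no further left.\<close>

lemma reaches_mono: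
  assumes D: "ndiagram n D" and "reaches n D k l" "k \<le> k'" "k' \<in> {1..n+1}"
  shows "\<exists>l'\<ge>l. reaches n D k' l'"
proof -
  obtain g where g: "selection n D g" "g 0 = real k" "g 1 = real l" using assms(2) unfolding reaches_def by blast
  obtain i where i: "i \<in> {1..n+1}" "D i 0 = (real k', 0)" using ndiagram_strand_from[OF D assms(4)] by blast
  let ?m = "\<lambda>y. max (g y) (strand_x D i y)"
  have m: "selection n D ?m" by (rule selection_max[OF g(1) selection_strand[OF D i(1)]])
  have "?m 0 = real k'" using strand_x_endpoints(1)[of n D i, OF ndiagramD(1)[OF D i(1)]] i(2) g(2) assms(3) by simp
  moreover obtain l' where l': "?m 1 = real l'" using selection_end(2)[OF D m] by blast
  moreover have "g 1 \<le> max (g 1) (strand_x D i 1)" by simp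
  then have "l \<le> l'" using l' g(3) by simp
  ultimately show ?thesis unfolding reaches_def using m by blast
qed

lemma rightmost:
  assumes D: "ndiagram n D" and k: "k \<in> {1..n+1}"
  shows "reaches n D k (rightmost n D k)" "reaches n D k l \<Longrightarrow> l \<le> rightmost n D k" "rightmost n D k \<in> {1..n+1}"
proof -
  have fin: "finite {l. reaches n D k l}"
    by (rule finite_subset[of _ "{1..n+1}"]) (use reaches_in(2)[OF D] in blast, simp)
  obtain i l0 where i: "i \<in> {1..n+1}" "D i 0 = (real k, 0)" "D i 1 = (real l0, 1)" using ndiagram_strand_from[OF D k] by blast
  have "reaches n D k l0" unfolding reaches_def
    using selection_strand[OF D i(1)] strand_x_endpoints(1,2)[of n D i, OF ndiagramD(1)[OF D i(1)]] i(2,3)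
    by (intro exI[of _ "strand_x D i"]) simp
  then have ne: "{l. reaches n D k l} \<noteq> {}" by blast
  show r: "reaches n D k (rightmost n D k)" using Max_in[OF fin ne] unfolding rightmost_def by blast
  show "reaches n D k l \<Longrightarrow> l \<le> rightmost n D k" unfolding rightmost_def using fin by (intro Max_ge) auto
  show "rightmost n D k \<in> {1..n+1}" using reaches_in(2)[OF D r] .
qed

lemma rightmost_eqI:
  assumes "ndiagram n D" "k \<in> {1..n+1}" "reaches n D k r" "\<And>l. reaches n D k l \<Longrightarrow> l \<le> r"
  shows "rightmost n D k = r"
  using rightmost[OF assms(1,2)] assms(3,4) by (meson le_antisym)

lemma rightmost_mono:
  assumes "ndiagram n D" "k \<le> k'" "k \<in> {1..n+1}" "k' \<in> {1..n+1}"
  shows "rightmost n D k \<le> rightmost n D k'"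
  using reaches_mono[OF assms(1) rightmost(1)[OF assms(1,3)] assms(2,4)] rightmost(2)[OF assms(1,4)] by (meson le_trans)

subsection \<open>Isotopy invariance\<close>

text \<open>An isotopy need not respect heights, but it carries strands to strands; so reachability is
  expressed by the parametrizations of the strands.\<close>

definition along_strand :: "nat \<Rightarrow> diagram \<Rightarrow> real \<times> real \<Rightarrow> real \<times> real \<Rightarrow> bool" where
  "along_strand n D p q \<longleftrightarrow> (\<exists>i\<in>{1..n+1}. \<exists>s t. 0 \<le> s \<and> s \<le> t \<and> t \<le> 1 \<and> p = D i s \<and> q = D i t)"

lemma along_strandI:
  assumes D: "ndiagram n D" and i: "i \<in> {1..n+1}" and ab: "0 \<le> a" "a \<le> b" "b \<le> 1"
  shows "along_strand n D (strand_x D i a, a) (strand_x D i b, b)"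
proof -
  note ok = ndiagramD(1)[OF D i]
  obtain s where s: "s \<in> {0..1}" "snd (D i s) = a" using strand_ok_surj[OF ok, of a] ab by auto
  obtain t where t: "t \<in> {0..1}" "snd (D i t) = b" using strand_ok_surj[OF ok, of b] ab by auto
  have "s \<le> t"
  proof (rule ccontr)
    assume "\<not> s \<le> t"
    then show False using strand_ok_mono[OF ok, of t s] s t ab by auto
  qed
  moreover have "D i s = (strand_x D i a, a)" "D i t = (strand_x D i b, b)"
    using strand_x_param[of n D i, OF ok s(1)] strand_x_param[of n D i, OF ok t(1)] s(2) t(2) by (auto simp: prod_eq_iff)
  ultimately show ?thesis unfolding along_strand_def using i s(1) t(1) by (metis atLeastAtMost_iff)
qed

text \<open>Close to a height \<open>x\<close> only strands through \<open>(g x, x)\<close> can meet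
  the graph of \<open>g\<close>. So the piece around \<open>x\<close> is replaced by one strand up
  to this point and one strand after it, and subdivision chains the pieces.\<close>

lemma selection_along_strands:
  assumes D: "ndiagram n D" and g: "selection n D g"
  shows "(along_strand n D)\<^sup>*\<^sup>* (g 0, 0) (g 1, 1)"
proof -
  let ?N = "{1..n+1}" and ?f = "strand_x D"
  define P where "P a b \<longleftrightarrow> (0 \<le> a \<longrightarrow> b \<le> 1 \<longrightarrow> (along_strand n D)\<^sup>*\<^sup>* (g a, a) (g b, b))" for a b :: real
  have cg: "continuous_on {0..1} g" using g unfolding selection_def by blast
  have "P 0 1"
  proof (rule Bolzano)
    show "P a c" if "P a b" "P b c" "a \<le> b" "b \<le> c" for a b c
      using that unfolding P_def by (meson order_trans rtranclp_trans)
  next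
    fix x :: real assume x: "0 \<le> x" "x \<le> 1"
    have "\<exists>d>0. \<forall>u\<in>{0..1}. \<bar>u - x\<bar> < d \<longrightarrow> ?f i u = g u \<longrightarrow> ?f i x = g x" if i: "i \<in> ?N" for i
    proof (cases "?f i x = g x")
      case True
      then show ?thesis by (intro exI[of _ 1]) auto
    next
      case False
      have "continuous_on {0..1} (\<lambda>u. ?f i u - g u)"
        using cg continuous_strand_x[of n D i, OF ndiagramD(1)[OF D i]] by (intro continuous_intros)
      moreover have "\<bar>?f i x - g x\<bar> > 0" "x \<in> {0..1}" using False x by auto
      ultimately obtain d where d: "d > 0" "\<And>u. u \<in> {0..1} \<Longrightarrow> dist u x < d \<Longrightarrow>
          dist (?f i u - g u) (?f i x - g x) < \<bar>?f i x - g x\<bar>"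
        unfolding continuous_on_iff by meson
      have "?f i u \<noteq> g u" if "u \<in> {0..1}" "\<bar>u - x\<bar> < d" for u
        using d(2)[OF that(1)] that(2) by (auto simp: dist_real_def)
      then show ?thesis using d(1) by blast
    qed
    then obtain d where d: "\<And>i. i \<in> ?N \<Longrightarrow> d i > 0"
      "\<And>i u. i \<in> ?N \<Longrightarrow> u \<in> {0..1} \<Longrightarrow> \<bar>u - x\<bar> < d i \<Longrightarrow> ?f i u = g u \<Longrightarrow> ?f i x = g x" by metis
    define e where "e = Min (d ` ?N)"
    have e: "e > 0" unfolding e_def using d(1) by (subst Min_gr_iff) auto
    have ei: "e \<le> d i" if "i \<in> ?N" for i unfolding e_def using that by (intro Min_le) auto
    have loc: "\<exists>i\<in>?N. ?f i u = g u \<and> ?f i x = g x" if u: "u \<in> {0..1}" "\<bar>u - x\<bar> < e" for u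
    proof -
      have "(g u, u) \<in> diagram_image n D" using g u(1) unfolding selection_def by blast
      then obtain i where "i \<in> ?N" "g u = ?f i u" using ndiagram_image_iff[OF D] by blast
      then show ?thesis using d(2)[of i u] ei[of i] u by force
    qed
    show "\<exists>d>0. \<forall>a b. a \<le> x \<and> x \<le> b \<and> b - a < d \<longrightarrow> P a b"
    proof (intro exI[of _ e] conjI allI impI e)
      fix a b assume ab: "a \<le> x \<and> x \<le> b \<and> b - a < e"
      show "P a b" unfolding P_def
      proof (intro impI)
        assume "0 \<le> a" "b \<le> 1"
        obtain i where i: "i \<in> ?N" "?f i a = g a" "?f i x = g x" using loc[of a] ab \<open>0 \<le> a\<close> x by auto
        obtain j where j: "j \<in> ?N" "?f j b = g b" "?f j x = g x" using loc[of b] ab \<open>b \<le> 1\<close> x by auto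
        have "along_strand n D (g a, a) (g x, x)" using along_strandI[OF D i(1), of a x] i ab \<open>0 \<le> a\<close> x by simp
        moreover have "along_strand n D (g x, x) (g b, b)" using along_strandI[OF D j(1), of x b] j ab \<open>b \<le> 1\<close> x by simp
        ultimately show "(along_strand n D)\<^sup>*\<^sup>* (g a, a) (g b, b)" by auto
      qed
    qed
  qed simp
  then show ?thesis unfolding P_def by simp
qed

text \<open>Each strand piece goes upwards, so successive pieces occupy consecutive height intervals
  and glue to the graph of one continuous function.\<close>

lemma along_strands_selection:
  assumes D: "ndiagram n D" and x0: "(x0, 0) \<in> diagram_image n D" and r: "(along_strand n D)\<^sup>*\<^sup>* (x0, 0) q"
  shows "snd q \<in> {0..1} \<and> (\<exists>g. continuous_on {0..snd q} g \<and> g 0 = x0 \<and> g (snd q) = fst q \<and>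
     (\<forall>y\<in>{0..snd q}. (g y, y) \<in> diagram_image n D))"
  using r
proof (induction rule: rtranclp_induct)
  case base
  then show ?case using x0 by (auto intro!: exI[of _ "\<lambda>y. x0"])
next
  case (step q r)
  then obtain g where q: "snd q \<in> {0..1}" and g: "continuous_on {0..snd q} g" "g 0 = x0" "g (snd q) = fst q"
    "\<And>y. y \<in> {0..snd q} \<Longrightarrow> (g y, y) \<in> diagram_image n D" by blast
  obtain i s t where i: "i \<in> {1..n+1}" and st: "0 \<le> s" "s \<le> t" "t \<le> 1" "q = D i s" "r = D i t"
    using step(2) unfolding along_strand_def by blast
  note ok = ndiagramD(1)[OF D i]
  have sx: "strand_x D i (snd q) = fst q" "strand_x D i (snd r) = fst r"
    using strand_x_param[of n D i, OF ok, of s] strand_x_param[of n D i, OF ok, of t] st by auto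
  have r01: "snd r \<in> {0..1}" using strand_ok_height[OF ok, of t] st by auto
  have qr: "snd q \<le> snd r" using strand_ok_mono[OF ok, of s t] st by (cases "s = t") auto
  let ?g = "\<lambda>y. if y \<le> snd q then g y else strand_x D i y"
  have "continuous_on {0..snd r} ?g"
  proof (rule continuous_on_cases_le)
    show "continuous_on {y\<in>{0..snd r}. y \<le> snd q} g" by (rule continuous_on_subset[OF g(1)]) auto
    show "continuous_on {y\<in>{0..snd r}. snd q \<le> y} (strand_x D i)"
      by (rule continuous_on_subset[OF continuous_strand_x[of n D i, OF ok]]) (use r01 in auto)
    show "g y = strand_x D i y" if "y \<in> {0..snd r}" "y = snd q" for y using that(2) g(3) sx(1) by simp
  qed (auto intro!: continuous_intros)
  moreover have "?g 0 = x0" using q g(2) by simp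
  moreover have "?g (snd r) = fst r" using qr sx g(3) by (cases "snd r = snd q") auto
  moreover have "(?g y, y) \<in> diagram_image n D" if "y \<in> {0..snd r}" for y
  proof (cases "y \<le> snd q")
    case True
    then show ?thesis using g(4)[of y] that by simp
  next
    case False
    have "y \<in> {0..1}" using that r01 by auto
    then show ?thesis using False ndiagram_image_iff[OF D, of "strand_x D i y" y] i by auto
  qed
  ultimately show ?case using r01 by blast
qed

text \<open>The moved strands \<open>h \<circ> D i\<close> form a diagram with the same parameters,
  so they are again traversed upwards, and a chain of strand pieces of \<open>D\<close> becomes such
  a chain for them. Its image is that of \<open>E\<close>, and selections see only the
  image.\<close>

lemma reaches_isotopic:
  assumes "isotopic n D E" "reaches n D k l"
  shows "reaches n E k l"
proof -
  obtain h \<sigma> where "strand_map n D E h \<sigma>" using isotopic_strands[OF assms(1)] by blast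
  then have D: "ndiagram n D" and h: "\<And>p. p \<in> UNIV \<times> {0, 1} \<Longrightarrow> h p = p"
    and hD: "ndiagram n (\<lambda>i s. h (D i s))" and im: "diagram_image n (\<lambda>i s. h (D i s)) = diagram_image n E"
    unfolding strand_map_def by blast+
  obtain g where g: "selection n D g" "g 0 = real k" "g 1 = real l" using assms(2) unfolding reaches_def by blast
  have "(along_strand n D)\<^sup>*\<^sup>* (real k, 0) (real l, 1)" using selection_along_strands[OF D g(1)] g by simp
  then have "(along_strand n (\<lambda>i s. h (D i s)))\<^sup>*\<^sup>* (h (real k, 0)) (h (real l, 1))"
  proof (induction rule: rtranclp_induct)
    case (step y z)
    have "along_strand n (\<lambda>i s. h (D i s)) (h y) (h z)" using step(2) unfolding along_strand_def by blast
    then show ?case using step by (meson rtranclp.rtrancl_into_rtrancl)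
  qed simp
  then have r: "(along_strand n (\<lambda>i s. h (D i s)))\<^sup>*\<^sup>* (real k, 0) (real l, 1)"
    using h[of "(real k, 0)"] h[of "(real l, 1)"] by simp
  have "k \<in> {1..n+1}" using reaches_in(1)[OF D assms(2)] .
  then have "(real k, 0) \<in> diagram_image n (\<lambda>i s. h (D i s))" using diagram_image_ends(1)[OF hD] by blast
  from along_strands_selection[OF hD this r] show ?thesis
    unfolding reaches_def selection_def im by auto
qed

lemma rightmost_isotopic:
  assumes "isotopic n D E"
  shows "rightmost n D k = rightmost n E k"
proof -
  have "reaches n D k l \<longleftrightarrow> reaches n E k l" for l
    using reaches_isotopic[OF assms] reaches_isotopic[OF isotopic_sym[OF assms]] by blast
  then show ?thesis by (simp add: rightmost_def)
qed

subsection \<open>Invariance under the moves\<close>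

text \<open>After the box, the maximum with the strand through the rightmost upper point of the box
  absorbs the choice made inside.\<close>

lemma selection_through_box:
  assumes D: "ndiagram n D" and E: "ndiagram n E" and cd: "0 \<le> c" "c < d" "d \<le> 1"
    and out: "diagram_image n D - {a..b} \<times> {c..d} = diagram_image n E - {a..b} \<times> {c..d}"
    and lp: "local_picture n D a b c d F"
    and T: "\<And>f. f \<in> F \<Longrightarrow> f d \<le> T"
    and ex: "\<And>f. f \<in> F \<Longrightarrow> \<exists>e. continuous_on {c..d} e \<and> e c = f c \<and> e d = T \<and> (\<forall>y\<in>{c..d}. (e y, y) \<in> diagram_image n E)"
    and g: "selection n D g" and ab: "a < b"
  shows "\<exists>g'. selection n E g' \<and> g' 0 = g 0 \<and> g 1 \<le> g' 1"
proof -
  let ?B = "{a..b} \<times> {c..d}"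
  have lpd: "diagram_image n D \<inter> ?B = (\<Union>f\<in>F. arc_graph c d f)" and
    lpf: "\<And>f. f \<in> F \<Longrightarrow> f ` {c..d} \<subseteq> {a<..<b}" using lp unfolding local_picture_def by blast+
  have cg: "continuous_on {0..1} g" and ig: "\<And>y. y \<in> {0..1} \<Longrightarrow> (g y, y) \<in> diagram_image n D"
    using g unfolding selection_def by blast+
  have cd01: "y \<in> {0..1}" if "y \<in> {c..d}" for y using that cd by auto
  have inarc: "\<exists>f\<in>F. g y = f y" if y: "y \<in> {c..d}" "g y \<in> {a..b}" for y
  proof -
    have "(g y, y) \<in> diagram_image n D \<inter> ?B" using ig[OF cd01[OF y(1)]] y by simp
    then show ?thesis unfolding lpd arc_graph_def by auto
  qed
  have strict: "g y \<in> {a<..<b}" if y: "y \<in> {c..d}" "g y \<in> {a..b}" for y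
  proof -
    obtain f where "f \<in> F" "g y = f y" using inarc[OF y] by blast
    then show ?thesis using lpf[of f] y(1) by (metis image_subset_iff)
  qed
  have outI: "(g y, y) \<in> diagram_image n E" if "y \<in> {0..1}" "y \<notin> {c..d} \<or> g y \<notin> {a..b}" for y
  proof -
    have "(g y, y) \<in> diagram_image n D - ?B" using ig[OF that(1)] that(2) by auto
    then show ?thesis unfolding out by blast
  qed
  show ?thesis
  proof (cases "\<exists>y\<in>{c..d}. g y \<in> {a..b}")
    case False
    then have "selection n E g" unfolding selection_def using cg outI by blast
    then show ?thesis by (intro exI[of _ g]) simp
  next
    case True
    then obtain y0 where y0: "y0 \<in> {c..d}" "g y0 \<in> {a..b}" by blast
    have cg': "continuous_on {c..d} g" by (rule continuous_on_subset[OF cg]) (use cd01 in blast)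
    have cg2: "continuous_on {c..d} (\<lambda>y. - g y)" using cg' by (intro continuous_intros)
    have na: "- g y \<noteq> - a" and nb: "g y \<noteq> b" if "y \<in> {c..d}" for y
    proof -
      have "g y \<noteq> a" "g y \<noteq> b" using strict[OF that] ab by auto
      then show "- g y \<noteq> - a" "g y \<noteq> b" by simp_all
    qed
    have s0: "a < g y0" "g y0 < b" using strict[OF y0] by auto
    \<comment> \<open>The arcs stay off the sides of the rectangle, so a path that is inside at one
      height of the box is inside at all of them.\<close>
    have all: "g y \<in> {a<..<b}" if y: "y \<in> {c..d}" for y
    proof -
      have "- g y < - a" by (rule avoid_value[OF cg2 na y0(1) y]) (use s0 in auto)
      moreover have "g y < b" by (rule avoid_value[OF cg' nb y0(1) y]) (use s0 in auto)
      ultimately show ?thesis by simp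
    qed
    have cI: "c \<in> {c..d}" "d \<in> {c..d}" using cd by auto
    have gab: "g y \<in> {a..b}" if "y \<in> {c..d}" for y using all[OF that] by simp
    obtain f where f: "f \<in> F" "g c = f c" using inarc[OF cI(1) gab[OF cI(1)]] by blast
    obtain f2 where f2: "f2 \<in> F" "g d = f2 d" using inarc[OF cI(2) gab[OF cI(2)]] by blast
    have gd: "g d \<le> T" using T[OF f2(1)] f2(2) by simp
    obtain e where e: "continuous_on {c..d} e" "e c = f c" "e d = T" "\<And>y. y \<in> {c..d} \<Longrightarrow> (e y, y) \<in> diagram_image n E"
      using ex[OF f(1)] by blast
    have "(T, d) \<in> diagram_image n E" using e(3,4) cI by metis
    then obtain i where i: "i \<in> {1..n+1}" "T = strand_x E i d" using ndiagram_image_iff[OF E] by blast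
    let ?r = "\<lambda>y. max (g y) (strand_x E i y)"
    have cr: "continuous_on {0..1} ?r"
      using cg continuous_strand_x[of n E i, OF ndiagramD(1)[OF E i(1)]] by (intro continuous_intros)
    \<comment> \<open>Below the box follow \<open>g\<close>, inside it go to its rightmost upper
      point \<open>T\<close>, and above it take the maximum of \<open>g\<close> and the strand of
      \<open>E\<close> through \<open>T\<close>; as \<open>g d \<le> T\<close>, the pieces fit at
      height \<open>d\<close>.\<close>
    define g' where "g' y = (if y \<le> d then (if y \<le> c then g y else e y) else ?r y)" for y
    have c0: "continuous_on {0..d} (\<lambda>y. if y \<le> c then g y else e y)"
    proof (rule continuous_on_cases_le)
      show "continuous_on {y\<in>{0..d}. y \<le> c} g" by (rule continuous_on_subset[OF cg]) (use cd in auto)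
      show "continuous_on {y\<in>{0..d}. c \<le> y} e" by (rule continuous_on_subset[OF e(1)]) auto
      show "g y = e y" if "y \<in> {0..d}" "y = c" for y using that(2) f(2) e(2) by simp
    qed (auto intro!: continuous_intros)
    have "continuous_on {0..1} g'" unfolding g'_def
    proof (rule continuous_on_cases_le)
      show "continuous_on {y\<in>{0..1}. y \<le> d} (\<lambda>y. if y \<le> c then g y else e y)"
        using c0 by (rule continuous_on_subset) auto
      show "continuous_on {y\<in>{0..1}. d \<le> y} ?r" by (rule continuous_on_subset[OF cr]) auto
      show "(if y \<le> c then g y else e y) = ?r y" if "y \<in> {0..1}" "y = d" for y
        using that(2) cd e(3) i(2) gd by simp
    qed (auto intro!: continuous_intros)
    moreover have "(g' y, y) \<in> diagram_image n E" if y: "y \<in> {0..1}" for y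
    proof -
      consider "y < c" | "y = c" | "c < y" "y \<le> d" | "d < y" by linarith
      then show ?thesis
      proof cases
        case 1
        then show ?thesis using outI[OF y] cd by (simp add: g'_def)
      next
        case 2
        then show ?thesis using e(2) e(4)[OF cI(1)] f(2) cd by (simp add: g'_def)
      next
        case 3
        then show ?thesis using e(4)[of y] by (simp add: g'_def)
      next
        case 4
        have "(g y, y) \<in> diagram_image n E" using outI[OF y] 4 by simp
        moreover have "(strand_x E i y, y) \<in> diagram_image n E" using ndiagram_image_iff[OF E] i(1) y by blast
        ultimately show ?thesis using 4 by (simp add: g'_def max_def)
      qed
    qed
    moreover have "g' 0 = g 0" using cd by (simp add: g'_def)
    moreover have "g 1 \<le> g' 1" using cd gd e(3) by (cases "d = 1") (auto simp: g'_def)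
    ultimately show ?thesis unfolding selection_def by blast
  qed
qed

lemma rightmost_leI:
  assumes D: "ndiagram n D" and E: "ndiagram n E" and k: "k \<in> {1..n+1}"
    and sel: "\<And>g. selection n D g \<Longrightarrow> \<exists>g'. selection n E g' \<and> g' 0 = g 0 \<and> g 1 \<le> g' 1"
  shows "rightmost n D k \<le> rightmost n E k"
proof -
  obtain g where g: "selection n D g" "g 0 = real k" "g 1 = real (rightmost n D k)"
    using rightmost(1)[OF D k] unfolding reaches_def by blast
  obtain g' where g': "selection n E g'" "g' 0 = g 0" "g 1 \<le> g' 1" using sel[OF g(1)] by blast
  obtain l where l: "g' 1 = real l" using selection_end(2)[OF E g'(1)] by blast
  have "reaches n E k l" unfolding reaches_def using g' g l by auto
  then have "l \<le> rightmost n E k" by (rule rightmost(2)[OF E k])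
  then show ?thesis using g(3) g'(3) l by linarith
qed

lemma local_picture_arc:
  assumes "local_picture n D a b c d F" "f \<in> F"
  shows "continuous_on {c..d} f" "\<And>y. y \<in> {c..d} \<Longrightarrow> (f y, y) \<in> diagram_image n D"
proof -
  show "continuous_on {c..d} f" using assms unfolding local_picture_def by blast
  fix y assume "y \<in> {c..d}"
  then have "(f y, y) \<in> (\<Union>f\<in>F. arc_graph c d f)" using assms(2) unfolding arc_graph_def by blast
  then show "(f y, y) \<in> diagram_image n D" using assms(1) unfolding local_picture_def by blast
qed

text \<open>The maximum of an arc that starts on the right and an arc that ends on the right joins
  the start of the former to the end of the latter.\<close>

lemma max_arc:
  assumes lp: "local_picture n D a b c d F" and fg: "f \<in> F" "g \<in> F"
    and "g c \<le> f c" "f d \<le> g d"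
  shows "\<exists>e. continuous_on {c..d} e \<and> e c = f c \<and> e d = g d \<and> (\<forall>y\<in>{c..d}. (e y, y) \<in> diagram_image n D)"
proof (intro exI[of _ "\<lambda>y. max (f y) (g y)"] conjI ballI)
  show "continuous_on {c..d} (\<lambda>y. max (f y) (g y))"
    using local_picture_arc(1)[OF lp fg(1)] local_picture_arc(1)[OF lp fg(2)] by (intro continuous_intros)
  show "(max (f y) (g y), y) \<in> diagram_image n D" if "y \<in> {c..d}" for y
    using local_picture_arc(2)[OF lp fg(1) that] local_picture_arc(2)[OF lp fg(2) that] by (simp add: max_def)
qed (use assms(4,5) in auto)

text \<open>\<open>T2\<close> can be reached from both lower points in both pictures, so replacing
  one by the other costs nothing in either direction.\<close>

lemma rightmost_move2:
  assumes mv: "move2 n D E" and k: "k \<in> {1..n+1}"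
  shows "rightmost n D k = rightmost n E k"
proof -
  have nd: "ndiagram n D" "ndiagram n E" using mv unfolding move2_def by blast+
  obtain a b c d f1 f2 g1 g2 B1 B2 T1 T2 where
    ab: "a < b" and cd: "0 \<le> c" "c < d" "d \<le> 1"
    and out: "diagram_image n D - {a..b} \<times> {c..d} = diagram_image n E - {a..b} \<times> {c..d}"
    and lp: "local_picture n D a b c d {f1, f2}" "local_picture n E a b c d {g1, g2}"
    and BT: "B1 < B2" "T1 < T2" "f1 c = B1" "f1 d = T1" "f2 c = B2" "f2 d = T2"
      "g1 c = B1" "g1 d = T2" "g2 c = B2" "g2 d = T1"
    and ac: "arcs_cross c d f1 f2 2" "arcs_cross c d g1 g2 1"
    using mv unfolding move2_def by (elim conjE exE) (rule that, assumption+)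
  \<comment> \<open>\<open>f1\<close> lies left of \<open>f2\<close> at both ends, so their maximum
    would start at the wrong point; the path changes from \<open>f1\<close> to \<open>f2\<close> at
    one of the crossings instead.\<close>
  have fD: "\<exists>e. continuous_on {c..d} e \<and> e c = B1 \<and> e d = T2 \<and> (\<forall>y\<in>{c..d}. (e y, y) \<in> diagram_image n D)"
  proof -
    have "{y\<in>{c..d}. f1 y = f2 y} \<noteq> {}" using ac(1) unfolding arcs_cross_def by (metis card.empty zero_neq_numeral)
    then obtain z where z: "z \<in> {c..d}" "f1 z = f2 z" by blast
    have zc: "z \<noteq> c" "z \<noteq> d" using z BT by auto
    note a1 = local_picture_arc[OF lp(1), of f1] and a2 = local_picture_arc[OF lp(1), of f2]
    let ?e = "\<lambda>y. if y \<le> z then f1 y else f2 y"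
    have "continuous_on {c..d} ?e"
    proof (rule continuous_on_cases_le)
      show "continuous_on {y\<in>{c..d}. y \<le> z} f1" by (rule continuous_on_subset[OF a1(1)]) auto
      show "continuous_on {y\<in>{c..d}. z \<le> y} f2" by (rule continuous_on_subset[OF a2(1)]) auto
    qed (use z in \<open>auto intro!: continuous_intros\<close>)
    moreover have "\<forall>y\<in>{c..d}. (?e y, y) \<in> diagram_image n D" using a1(2) a2(2) by auto
    ultimately show ?thesis using z zc BT by (intro exI[of _ ?e]) auto
  qed
  show ?thesis
  proof (rule antisym)
    show "rightmost n D k \<le> rightmost n E k"
    proof (rule rightmost_leI[OF nd k], rule selection_through_box[OF nd cd out lp(1), of T2, OF _ _ _ ab])
      show "f d \<le> T2" if "f \<in> {f1, f2}" for f using that BT by auto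
      show "\<exists>e. continuous_on {c..d} e \<and> e c = f c \<and> e d = T2 \<and> (\<forall>y\<in>{c..d}. (e y, y) \<in> diagram_image n E)"
        if "f \<in> {f1, f2}" for f
        using that max_arc[OF lp(2), of g1 g1] max_arc[OF lp(2), of g2 g1] BT by auto
    qed
    show "rightmost n E k \<le> rightmost n D k"
    proof (rule rightmost_leI[OF nd(2,1) k], rule selection_through_box[OF nd(2,1) cd out[symmetric] lp(2), of T2, OF _ _ _ ab])
      show "f d \<le> T2" if "f \<in> {g1, g2}" for f using that BT by auto
      show "\<exists>e. continuous_on {c..d} e \<and> e c = f c \<and> e d = T2 \<and> (\<forall>y\<in>{c..d}. (e y, y) \<in> diagram_image n D)"
        if "f \<in> {g1, g2}" for f
        using that fD max_arc[OF lp(1), of f2 f2] BT by auto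
    qed
  qed
qed

text \<open>In both pictures one arc runs from the leftmost lower to the rightmost upper point. Its
  maximum with any other arc leads from the start of that arc to \<open>T3\<close>.\<close>

lemma rightmost_move3:
  assumes mv: "move3 n D E" and k: "k \<in> {1..n+1}"
  shows "rightmost n D k = rightmost n E k"
proof -
  have nd: "ndiagram n D" "ndiagram n E" using mv unfolding move3_def by blast+
  obtain a b c d f1 f2 f3 g1 g2 g3 B1 B2 B3 T1 T2 T3 where
    ab: "a < b" and cd: "0 \<le> c" "c < d" "d \<le> 1"
    and out: "diagram_image n D - {a..b} \<times> {c..d} = diagram_image n E - {a..b} \<times> {c..d}"
    and lp: "local_picture n D a b c d {f1, f2, f3}" "local_picture n E a b c d {g1, g2, g3}"
    and BT: "B1 < B2" "B2 < B3" "T1 < T2" "T2 < T3" "f1 c = B1" "f1 d = T3" "f2 c = B2" "f2 d = T2" "f3 c = B3" "f3 d = T1"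
      "g1 c = B1" "g1 d = T3" "g2 c = B2" "g2 d = T1" "g3 c = B3" "g3 d = T2"
    and "arcs_cross c d f1 f2 1" "arcs_cross c d f1 f3 1" "arcs_cross c d f2 f3 1"
      "arcs_cross c d g1 g2 1" "arcs_cross c d g1 g3 1" "arcs_cross c d g2 g3 0"
    using mv unfolding move3_def by (elim conjE exE) (rule that, assumption+)
  show ?thesis
  proof (rule antisym)
    show "rightmost n D k \<le> rightmost n E k"
    proof (rule rightmost_leI[OF nd k], rule selection_through_box[OF nd cd out lp(1), of T3, OF _ _ _ ab])
      show "f d \<le> T3" if "f \<in> {f1, f2, f3}" for f using that BT by auto
      show "\<exists>e. continuous_on {c..d} e \<and> e c = f c \<and> e d = T3 \<and> (\<forall>y\<in>{c..d}. (e y, y) \<in> diagram_image n E)"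
        if "f \<in> {f1, f2, f3}" for f
        using that max_arc[OF lp(2), of g1 g1] max_arc[OF lp(2), of g2 g1] max_arc[OF lp(2), of g3 g1] BT by auto
    qed
    show "rightmost n E k \<le> rightmost n D k"
    proof (rule rightmost_leI[OF nd(2,1) k], rule selection_through_box[OF nd(2,1) cd out[symmetric] lp(2), of T3, OF _ _ _ ab])
      show "f d \<le> T3" if "f \<in> {g1, g2, g3}" for f using that BT by auto
      show "\<exists>e. continuous_on {c..d} e \<and> e c = f c \<and> e d = T3 \<and> (\<forall>y\<in>{c..d}. (e y, y) \<in> diagram_image n D)"
        if "f \<in> {g1, g2, g3}" for f
        using that max_arc[OF lp(1), of f1 f1] max_arc[OF lp(1), of f2 f1] max_arc[OF lp(1), of f3 f1] BT by auto
    qed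
  qed
qed

lemma rightmost_DL_rel:
  assumes "(D, E) \<in> DL_rel n" "ndiagram n D"
  shows "ndiagram n E" "k \<in> {1..n+1} \<Longrightarrow> rightmost n D k = rightmost n E k"
proof -
  let ?R = "\<lambda>E E'. isotopic n E E' \<or> move2 n E E' \<or> move3 n E E'"
  have st: "ndiagram n A \<and> ndiagram n B \<and> (\<forall>k\<in>{1..n+1}. rightmost n A k = rightmost n B k)" if "?R A B" for A B
  proof -
    have "ndiagram n A \<and> ndiagram n B" using that unfolding isotopic_def move2_def move3_def by blast
    then show ?thesis using that rightmost_isotopic rightmost_move2 rightmost_move3 by blast
  qed
  have "equivclp ?R D E" using assms(1) by (simp add: DL_rel_def)
  then have "ndiagram n E \<and> (\<forall>k\<in>{1..n+1}. rightmost n D k = rightmost n E k)"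
  proof (induction rule: equivclp_induct)
    case (step y z)
    then show ?case using st[of y z] st[of z y] by auto
  qed (use assms(2) in simp)
  then show "ndiagram n E" "k \<in> {1..n+1} \<Longrightarrow> rightmost n D k = rightmost n E k" by blast+
qed

subsection \<open>Stacks and word diagrams\<close>

text \<open>A path through the stack crosses the seam in a common endpoint \<open>m\<close>. A seam
  point found in the image of the wrong factor also belongs to the right one, as both have the same
  points there.\<close>

lemma reaches_stack_iff:
  assumes D: "ndiagram n D" and E: "ndiagram n E"
  shows "reaches n (stack n D E) k l \<longleftrightarrow> (\<exists>m. reaches n E k m \<and> reaches n D m l)"
proof
  assume "reaches n (stack n D E) k l"
  then obtain g where g: "continuous_on {0..1} g" "\<And>y. y \<in> {0..1} \<Longrightarrow> (g y, y) \<in> diagram_image n (stack n D E)"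
    "g 0 = real k" "g 1 = real l" unfolding reaches_def selection_def by blast
  have h: "y \<in> {0..1}" if "(x, y) \<in> diagram_image n D \<or> (x, y) \<in> diagram_image n E" for x y
    using that ndiagram_image_iff[OF D, of x y] ndiagram_image_iff[OF E, of x y] by blast
  have ends: "(x, 0) \<in> diagram_image n D \<longleftrightarrow> (x, 1) \<in> diagram_image n E" for x
    unfolding diagram_image_ends(1)[OF D] diagram_image_ends(2)[OF E] ..
  have sp: "\<exists>z. (g y, z) \<in> diagram_image n E \<and> y = z / 2 \<or> (g y, z) \<in> diagram_image n D \<and> y = (1 + z) / 2"
    if "y \<in> {0..1}" for y
  proof -
    have "(g y, y) \<in> lower_half ` diagram_image n E \<or> (g y, y) \<in> upper_half ` diagram_image n D"
      using g(2)[OF that] unfolding diagram_image_stack[OF D E] by blast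
    then show ?thesis
    proof
      assume "(g y, y) \<in> lower_half ` diagram_image n E"
      then obtain p where p: "p \<in> diagram_image n E" "(g y, y) = lower_half p" by blast
      then show ?thesis by (intro exI[of _ "snd p"]) (simp add: lower_half_def)
    next
      assume "(g y, y) \<in> upper_half ` diagram_image n D"
      then obtain p where p: "p \<in> diagram_image n D" "(g y, y) = upper_half p" by blast
      then show ?thesis by (intro exI[of _ "snd p"]) (simp add: upper_half_def)
    qed
  qed
  have lo: "(g (y / 2), y) \<in> diagram_image n E" if y: "y \<in> {0..1}" for y
  proof -
    obtain z where z: "(g (y / 2), z) \<in> diagram_image n E \<and> y / 2 = z / 2 \<or> (g (y / 2), z) \<in> diagram_image n D \<and> y / 2 = (1 + z) / 2"
      using sp[of "y / 2"] y by auto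
    then show ?thesis
    proof
      assume A: "(g (y / 2), z) \<in> diagram_image n D \<and> y / 2 = (1 + z) / 2"
      then have "z \<in> {0..1}" using h by blast
      then have "z = 0" "y = 1" "(g (y / 2), z) \<in> diagram_image n D" using A y by auto
      then show ?thesis using ends by simp
    qed auto
  qed
  have hi: "(g ((1 + y) / 2), y) \<in> diagram_image n D" if y: "y \<in> {0..1}" for y
  proof -
    obtain z where z: "(g ((1 + y) / 2), z) \<in> diagram_image n E \<and> (1 + y) / 2 = z / 2 \<or>
      (g ((1 + y) / 2), z) \<in> diagram_image n D \<and> (1 + y) / 2 = (1 + z) / 2"
      using sp[of "(1 + y) / 2"] y by auto
    then show ?thesis
    proof
      assume A: "(g ((1 + y) / 2), z) \<in> diagram_image n E \<and> (1 + y) / 2 = z / 2"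
      then have "z \<in> {0..1}" using h by blast
      then have "z = 1" "y = 0" "(g ((1 + y) / 2), z) \<in> diagram_image n E" using A y by auto
      then show ?thesis using ends by simp
    qed auto
  qed
  have c1: "continuous_on {0..1} (\<lambda>y. g (y / 2))"
    by (rule continuous_on_compose2[OF g(1)]) (auto intro!: continuous_intros)
  have c2: "continuous_on {0..1} (\<lambda>y. g ((1 + y) / 2))"
    by (rule continuous_on_compose2[OF g(1)]) (auto intro!: continuous_intros)
  have s1: "selection n E (\<lambda>y. g (y / 2))" and s2: "selection n D (\<lambda>y. g ((1 + y) / 2))"
    unfolding selection_def using c1 c2 lo hi by blast+
  obtain m where m: "g (1 / 2) = real m" using selection_end(2)[OF E s1] by auto
  have "reaches n E k m" "reaches n D m l" unfolding reaches_def using s1 s2 m g(3,4) by force+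
  then show "\<exists>m. reaches n E k m \<and> reaches n D m l" by blast
next
  assume "\<exists>m. reaches n E k m \<and> reaches n D m l"
  then obtain m e d where e: "selection n E e" "e 0 = real k" "e 1 = real m" and d: "selection n D d" "d 0 = real m" "d 1 = real l"
    unfolding reaches_def by blast
  let ?g = "\<lambda>y. if y \<le> 1/2 then e (2 * y) else d (2 * y - 1)"
  have ce: "continuous_on {0..1} e" and cd: "continuous_on {0..1} d" using e(1) d(1) unfolding selection_def by blast+
  have "continuous_on {0..1} ?g"
  proof (rule continuous_on_cases_le)
    show "continuous_on {s\<in>{0..1}. s \<le> 1/2} (\<lambda>s. e (2 * s))"
      by (rule continuous_on_compose2[OF ce]) (auto intro!: continuous_intros)
    show "continuous_on {s\<in>{0..1}. 1/2 \<le> s} (\<lambda>s. d (2 * s - 1))"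
      by (rule continuous_on_compose2[OF cd]) (auto intro!: continuous_intros)
    show "e (2 * s) = d (2 * s - 1)" if "s \<in> {0..1}" "s = 1/2" for s using e(3) d(2) by (simp add: that(2))
  qed (auto intro!: continuous_intros)
  moreover have "(?g y, y) \<in> diagram_image n (stack n D E)" if y: "y \<in> {0..1}" for y
  proof (cases "y \<le> 1/2")
    case True
    then have "(e (2 * y), 2 * y) \<in> diagram_image n E" using e(1) y unfolding selection_def by auto
    then have "lower_half (e (2 * y), 2 * y) \<in> lower_half ` diagram_image n E" by (rule imageI)
    then show ?thesis unfolding diagram_image_stack[OF D E] using True by (simp add: lower_half_def)
  next
    case False
    then have "(d (2 * y - 1), 2 * y - 1) \<in> diagram_image n D" using d(1) y unfolding selection_def by auto
    then have "upper_half (d (2 * y - 1), 2 * y - 1) \<in> upper_half ` diagram_image n D" by (rule imageI)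
    then show ?thesis unfolding diagram_image_stack[OF D E] using False by (simp add: upper_half_def)
  qed
  ultimately have "selection n (stack n D E) ?g" unfolding selection_def by blast
  then show "reaches n (stack n D E) k l" unfolding reaches_def using e(2) d(3) by (intro exI[of _ ?g]) simp
qed

text \<open>Going as far right as possible in the lower diagram is optimal for the whole stack,
  because the upper diagram acts monotonically.\<close>

lemma rightmost_stack:
  assumes D: "ndiagram n D" and E: "ndiagram n E" and k: "k \<in> {1..n+1}"
  shows "rightmost n (stack n D E) k = rightmost n D (rightmost n E k)"
proof (rule rightmost_eqI[OF ndiagram_stack[OF D E] k])
  note rE = rightmost[OF E k]
  note rD = rightmost[OF D rE(3)]
  show "reaches n (stack n D E) k (rightmost n D (rightmost n E k))"
    unfolding reaches_stack_iff[OF D E] using rE(1) rD(1) by blast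
  fix l assume "reaches n (stack n D E) k l"
  then obtain m where m: "reaches n E k m" "reaches n D m l" unfolding reaches_stack_iff[OF D E] by blast
  have mN: "m \<in> {1..n+1}" using reaches_in(1)[OF D m(2)] .
  have "l \<le> rightmost n D m" by (rule rightmost(2)[OF D mN m(2)])
  also have "\<dots> \<le> rightmost n D (rightmost n E k)" by (rule rightmost_mono[OF D rE(2)[OF m(1)] mN rE(3)])
  finally show "l \<le> rightmost n D (rightmost n E k)" .
qed

text \<open>A vertical line at a half-integer abscissa that misses the diagram cannot be passed by a
  continuous path; this gives the upper bounds for the identity and the elementary diagrams.\<close>

lemma reaches_barrier:
  assumes r: "reaches n D k l" and b: "\<And>x y. (x, y) \<in> diagram_image n D \<Longrightarrow> x \<noteq> real r + 1/2" and "k \<le> r"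
  shows "l \<le> r"
proof -
  obtain g where g: "continuous_on {0..1} g" "\<And>y. y \<in> {0..1} \<Longrightarrow> (g y, y) \<in> diagram_image n D"
    "g 0 = real k" "g 1 = real l" using r unfolding reaches_def selection_def by blast
  have "g 1 < real r + 1/2"
  proof (rule avoid_value[OF g(1), of _ 0])
    show "g y \<noteq> real r + 1/2" if "y \<in> {0..1}" for y using b[OF g(2)[OF that]] .
    show "g 0 < real r + 1/2" using g(3) assms(3) by simp
  qed auto
  then show ?thesis using g(4) by linarith
qed

lemma rightmost_identity:
  assumes k: "k \<in> {1..n+1}"
  shows "rightmost n identity_diagram k = k"
proof -
  have nd: "ndiagram n identity_diagram" using has_word_ndiagram[OF has_word_identity] .
  have im: "(x, y) \<in> diagram_image n identity_diagram \<longleftrightarrow> y \<in> {0..1} \<and> x \<in> real ` {1..n+1}" for x y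
    unfolding diagram_image_def strand_def identity_diagram_def by blast
  show ?thesis
  proof (rule rightmost_eqI[OF nd k])
    show "reaches n identity_diagram k k" unfolding reaches_def selection_def im using k
      by (intro exI[of _ "\<lambda>y. real k"]) auto
    show "l \<le> k" if "reaches n identity_diagram k l" for l
    proof (rule reaches_barrier[OF that])
      show "x \<noteq> real k + 1/2" if xy: "(x, y) \<in> diagram_image n identity_diagram" for x y
      proof
        assume x: "x = real k + 1/2"
        obtain j where "x = real j" using xy unfolding im by blast
        then have "2 * real j = 2 * real k + 1" using x by simp
        then have "2 * j = 2 * k + 1" by linarith
        then show False by presburger
      qed
    qed simp
  qed
qed

lemma rightmost_elementary:
  assumes i: "i \<in> {1..n}" and k: "k \<in> {1..n+1}"
  shows "rightmost n (elementary i) k = push_at i k"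
proof -
  have nd: "ndiagram n (elementary i)" by (rule ndiagram_elementary[OF i])
  have im: "(x, y) \<in> diagram_image n (elementary i) \<longleftrightarrow> y \<in> {0..1} \<and> (\<exists>j\<in>{1..n+1}. x = elementary_x i j y)" for x y
    unfolding diagram_image_def elementary_strand(1) arc_graph_def by blast
  have ii: "i \<in> {1..n+1}" "i + 1 \<in> {1..n+1}" using i by auto
  have sel: "selection n (elementary i) (elementary_x i j)" if "j \<in> {1..n+1}" for j
  proof -
    have "continuous_on {0..1} (elementary_x i j)"
      unfolding elementary_x_def by (cases "j = i"; cases "j = i + 1") (auto intro!: continuous_intros)
    then show ?thesis unfolding selection_def im using that by blast
  qed
  show ?thesis
  proof (rule rightmost_eqI[OF nd k])
    show "reaches n (elementary i) k (push_at i k)" unfolding reaches_def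
    proof (intro exI conjI)
      \<comment> \<open>For \<open>k = i + 1\<close> the maximum with strand \<open>i\<close>
        bounces back to the right at the crossing; in all other cases both arguments are strand
        \<open>k\<close> itself.\<close>
      show "selection n (elementary i) (\<lambda>y. max (elementary_x i k y) (elementary_x i (if k = i + 1 then i else k) y))"
        using k ii by (intro selection_max sel) auto
    qed (auto simp: elementary_x_def push_at_def)
    show "l \<le> push_at i k" if "reaches n (elementary i) k l" for l
    proof (rule reaches_barrier[OF that])
      show "k \<le> push_at i k" by (simp add: push_at_def)
      show "x \<noteq> real (push_at i k) + 1/2" if xy: "(x, y) \<in> diagram_image n (elementary i)" for x y
      proof
        assume x: "x = real (push_at i k) + 1/2"
        obtain j where j: "x = elementary_x i j y" and y: "y \<in> {0..1}" using xy im by blast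
        consider "j = i \<or> j = i + 1" | "j \<noteq> i" "j \<noteq> i + 1" by blast
        then show False
        proof cases
          case 1
          then have "real i \<le> x" "x \<le> real i + 1" using j y by (auto simp: elementary_x_def)
          \<comment> \<open>A half-integer between \<open>i\<close> and \<open>i + 1\<close> can
            only be \<open>i + 1/2\<close>, but \<open>push_at i\<close> never takes the value
            \<open>i\<close>.\<close>
          then have "2 * push_at i k + 1 \<le> 2 * i + 2" "2 * i \<le> 2 * push_at i k + 1" using x by linarith+
          then have "push_at i k = i" by presburger
          then show False by (simp add: push_at_def split: if_splits)
        next
          case 2
          then have "x = real j" using j by (simp add: elementary_x_def)
          then have "2 * real j = 2 * real (push_at i k) + 1" using x by simp
          then have "2 * j = 2 * push_at i k + 1" by linarith
          then show False by presburger
        qed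
      qed
    qed
  qed
qed

lemma rightmost_word_diagram:
  "set w \<subseteq> {1..n} \<Longrightarrow> k \<in> {1..n+1} \<Longrightarrow> rightmost n (word_diagram n w) k = word_map w k"
proof (induction w arbitrary: k)
  case (Cons i w)
  have i: "i \<in> {1..n}" and w: "set w \<subseteq> {1..n}" using Cons.prems by auto
  have p: "push_at i k \<in> {1..n+1}" using i Cons.prems(2) by (auto simp: push_at_def)
  show ?case
    using rightmost_stack[OF ndiagram_word_diagram[OF w] ndiagram_elementary[OF i] Cons.prems(2)]
      rightmost_elementary[OF i Cons.prems(2)] Cons.IH[OF w p] by simp
qed (simp add: rightmost_identity)

section \<open>The bijections\<close>

text \<open>Here the circle closes: equal rightmost maps give equal word maps, hence related words,
  hence diagrams joined by isotopies and moves.\<close>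

lemma DL_rel_iff_rightmost:
  assumes D: "ndiagram n D" and E: "ndiagram n E"
  shows "(D, E) \<in> DL_rel n \<longleftrightarrow> (\<forall>k\<in>{1..n+1}. rightmost n D k = rightmost n E k)"
proof
  assume "(D, E) \<in> DL_rel n"
  then show "\<forall>k\<in>{1..n+1}. rightmost n D k = rightmost n E k" using rightmost_DL_rel(2)[OF _ D] by blast
next
  assume eq: "\<forall>k\<in>{1..n+1}. rightmost n D k = rightmost n E k"
  obtain v w where v: "has_word n D v" and w: "has_word n E w" using has_word_exists D E by blast
  note sv = has_word_set[OF v] and sw = has_word_set[OF w]
  have isoD: "isotopic n D (word_diagram n v)" by (rule same_word_isotopic[OF v has_word_word_diagram[OF sv]])
  have isoE: "isotopic n E (word_diagram n w)" by (rule same_word_isotopic[OF w has_word_word_diagram[OF sw]])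
  have "word_map v k = word_map w k" if "k \<in> {1..n+1}" for k
    using rightmost_isotopic[OF isoD] rightmost_isotopic[OF isoE] rightmost_word_diagram[OF sv that]
      rightmost_word_diagram[OF sw that] eq that by metis
  then have "(v, w) \<in> L_rel n" using L_rel_iff[OF sv sw] by blast
  then have "(word_diagram n v, word_diagram n w) \<in> DL_rel n" using L_rel_DL_rel sv by blast
  then show "(D, E) \<in> DL_rel n"
    using DL_relI[of n D "word_diagram n v"] DL_relI[of n E "word_diagram n w"] isoD isoE DL_rel_trans DL_rel_sym by blast
qed

section \<open>The monoid of diagrams and its comparison with words\<close>

abbreviation DL_class :: "nat \<Rightarrow> diagram \<Rightarrow> diagram set" where
  "DL_class n D \<equiv> DL_rel n `` {D}"

lemma DL_class_eq_iff: "DL_class n D = DL_class n E \<longleftrightarrow> (D, E) \<in> DL_rel n"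
  using eq_equiv_class_iff[OF DL_rel_equiv, of D E n] by blast

lemma DL_class_self: "D \<in> DL_class n D"
  using DL_rel_equiv by (simp add: equiv_def refl_on_def)

text \<open>Independence of representatives follows from the invariant: the map of a stack is the
  composite of the maps of its factors, so no isotopies need to be stacked.\<close>

lemma DL_class_stack:
  assumes D: "ndiagram n D" and E: "ndiagram n E"
  shows "DL_class n D \<otimes>\<^bsub>DL_monoid n\<^esub> DL_class n E = DL_class n (stack n E D)"
proof -
  have "DL_class n (stack n E' D') = DL_class n (stack n E D)" if "D' \<in> DL_class n D" "E' \<in> DL_class n E" for D' E'
  proof -
    have D': "(D, D') \<in> DL_rel n" and E': "(E, E') \<in> DL_rel n" using that by auto
    note d = rightmost_DL_rel[OF D' D] and e = rightmost_DL_rel[OF E' E]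
    have "rightmost n (stack n E D) k = rightmost n (stack n E' D') k" if k: "k \<in> {1..n+1}" for k
      using rightmost_stack[OF E D k] rightmost_stack[OF e(1) d(1) k] d(2)[OF k] e(2)[OF rightmost(3)[OF D k]] by simp
    then have "(stack n E D, stack n E' D') \<in> DL_rel n"
      using DL_rel_iff_rightmost[OF ndiagram_stack[OF E D] ndiagram_stack[OF e(1) d(1)]] by blast
    then show ?thesis unfolding DL_class_eq_iff by (rule DL_rel_sym)
  qed
  then have "(\<Union>D'\<in>DL_class n D. \<Union>E'\<in>DL_class n E. DL_class n (stack n E' D')) = DL_class n (stack n E D)"
    using DL_class_self[of D n] DL_class_self[of E n] by blast
  then show ?thesis by (simp add: DL_monoid_def)
qed

lemma DL_monoid_foldr:
  "set w \<subseteq> {1..n} \<Longrightarrow>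
     foldr (\<lambda>i Y. DL_class n (elementary i) \<otimes>\<^bsub>DL_monoid n\<^esub> Y) w \<one>\<^bsub>DL_monoid n\<^esub> = DL_class n (word_diagram n w)"
proof (induction w)
  case (Cons i w)
  then show ?case
    using DL_class_stack[OF ndiagram_elementary[of i n] ndiagram_word_diagram[of w n]] by simp
qed (simp add: DL_monoid_def)

lemma epsilon_class:
  assumes w: "set w \<subseteq> {1..n}"
  shows "epsilon n (L_rel n `` {w}) = DL_class n (word_diagram n w)"
proof -
  have "foldr (\<lambda>i Y. DL_class n (elementary i) \<otimes>\<^bsub>DL_monoid n\<^esub> Y) v \<one>\<^bsub>DL_monoid n\<^esub> = DL_class n (word_diagram n w)"
    if "v \<in> L_rel n `` {w}" for v
  proof -
    have wv: "(w, v) \<in> L_rel n" using that by simp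
    then have "set v \<subseteq> {1..n}" using L_rel_inv w by blast
    then show ?thesis using DL_monoid_foldr L_rel_DL_rel[OF wv w] DL_class_eq_iff DL_rel_sym by metis
  qed
  moreover have "w \<in> L_rel n `` {w}" using L_rel_equiv by (simp add: equiv_def refl_on_def)
  ultimately show ?thesis unfolding epsilon_def by blast
qed

text \<open>Surjective because every diagram is isotopic to a word diagram; injective because the
  map of a class in \<open>L_monoid\<close> can be recovered from its diagram.\<close>

lemma bij_epsilon: "bij_betw (epsilon n) (carrier (L_monoid n)) (carrier (DL_monoid n))"
  unfolding bij_betw_def
proof
  have cL: "carrier (L_monoid n) = (\<lambda>w. L_rel n `` {w}) ` {w. set w \<subseteq> {1..n}}"
    by (auto simp: L_monoid_def quotient_def lists_eq_set)
  have cD: "carrier (DL_monoid n) = DL_class n ` {D. ndiagram n D}"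
    by (auto simp: DL_monoid_def quotient_def)
  show "inj_on (epsilon n) (carrier (L_monoid n))"
  proof (rule inj_onI)
    fix X Y assume "X \<in> carrier (L_monoid n)" "Y \<in> carrier (L_monoid n)" and eq: "epsilon n X = epsilon n Y"
    then obtain v w where v: "X = L_rel n `` {v}" "set v \<subseteq> {1..n}" and w: "Y = L_rel n `` {w}" "set w \<subseteq> {1..n}"
      unfolding cL by blast
    have "(word_diagram n v, word_diagram n w) \<in> DL_rel n"
      using eq epsilon_class[OF v(2)] epsilon_class[OF w(2)] v(1) w(1) DL_class_eq_iff by metis
    from rightmost_DL_rel(2)[OF this ndiagram_word_diagram[OF v(2)]]
    have "\<forall>k\<in>{1..n+1}. word_map v k = word_map w k"
      using rightmost_word_diagram[OF v(2)] rightmost_word_diagram[OF w(2)] by metis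
    then have "(v, w) \<in> L_rel n" using L_rel_iff[OF v(2) w(2)] by blast
    then show "X = Y" unfolding v(1) w(1) by (rule equiv_class_eq[OF L_rel_equiv])
  qed
  show "epsilon n ` carrier (L_monoid n) = carrier (DL_monoid n)"
  proof (intro Set.set_eqI iffI)
    fix X assume "X \<in> epsilon n ` carrier (L_monoid n)"
    then obtain w where w: "set w \<subseteq> {1..n}" "X = epsilon n (L_rel n `` {w})" unfolding cL by blast
    show "X \<in> carrier (DL_monoid n)"
      unfolding cD w(2) epsilon_class[OF w(1)] using ndiagram_word_diagram[OF w(1)] by blast
  next
    fix X assume "X \<in> carrier (DL_monoid n)"
    then obtain D where D: "ndiagram n D" "X = DL_class n D" unfolding cD by blast
    obtain w where w: "has_word n D w" using has_word_exists[OF D(1)] by blast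
    note sw = has_word_set[OF w]
    have "(D, word_diagram n w) \<in> DL_rel n"
      using same_word_isotopic[OF w has_word_word_diagram[OF sw]] by (intro DL_relI) blast
    then have "X = epsilon n (L_rel n `` {w})" unfolding epsilon_class[OF sw] D(2) DL_class_eq_iff .
    then show "X \<in> epsilon n ` carrier (L_monoid n)" unfolding cL using sw by blast
  qed
qed

section \<open>Isotopy classes of webs\<close>

abbreviation isotopy_class :: "nat \<Rightarrow> diagram \<Rightarrow> diagram set" where
  "isotopy_class n D \<equiv> isotopy_rel n `` {D}"

lemma WL_eq: "WL n = isotopy_class n ` {D. nweb n D}"
  by (auto simp: WL_def quotient_def)

lemma isotopy_class_eqI: "isotopic n D E \<Longrightarrow> isotopy_class n D = isotopy_class n E"
  unfolding isotopy_rel_def using isotopic_trans isotopic_sym by blast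

lemma isotopy_class_self: "ndiagram n D \<Longrightarrow> D \<in> isotopy_class n D"
  unfolding isotopy_rel_def using isotopic_refl by blast

lemma iota_class:
  assumes "ndiagram n D"
  shows "iota n (isotopy_class n D) = DL_class n D"
proof -
  have "DL_class n E = DL_class n D" if "E \<in> isotopy_class n D" for E
  proof -
    have "isotopic n D E" using that by (simp add: isotopy_rel_def)
    then have "(D, E) \<in> DL_rel n" by (intro DL_relI) blast
    then show ?thesis unfolding DL_class_eq_iff by (rule DL_rel_sym)
  qed
  then show ?thesis unfolding iota_def using isotopy_class_self[OF assms] by blast
qed

lemma web_perm_class:
  assumes "ndiagram n D"
  shows "web_perm n (isotopy_class n D) = endpoint_perm n D"
proof -
  have "endpoint_perm n ` isotopy_class n D = {endpoint_perm n D}"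
  proof -
    have "endpoint_perm n E = endpoint_perm n D" if "E \<in> isotopy_class n D" for E
      using that by (intro endpoint_perm_isotopic) (simp add: isotopy_rel_def)
    then show ?thesis using isotopy_class_self[OF assms] by blast
  qed
  then show ?thesis by (simp add: web_perm_def)
qed

lemma rho_web_perm_class:
  assumes "nf_blocks n bl" "isotopic n D (word_diagram n (nf_word bl))"
  shows "(rho n \<circ> web_perm n) (isotopy_class n D) = nf_pair bl"
proof -
  have "ndiagram n D" using assms(2) by (simp add: isotopic_def)
  moreover have "rho n (endpoint_perm n D) = nf_pair bl"
    using endpoint_perm_isotopic[OF assms(2)] endpoint_perm_word_diagram[OF nf_word_set[OF assms(1)]]
    by (intro rho_nf[OF assms(1)]) simp
  ultimately show ?thesis using web_perm_class by simp
qed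

lemma WL_normal_form:
  assumes "X \<in> WL n"
  obtains D bl where "X = isotopy_class n D" "nweb n D" "nf_blocks n bl" "isotopic n D (word_diagram n (nf_word bl))"
proof -
  obtain D where "X = isotopy_class n D" "nweb n D" using assms unfolding WL_eq by blast
  then show thesis using nweb_normal_form that by blast
qed

text \<open>Every class of diagrams contains the diagram of a normal form, which is a web.
  Conversely a web is isotopic to a normal form diagram, and different normal forms have different
  maps, so equivalent webs are isotopic.\<close>

lemma bij_iota: "bij_betw (iota n) (WL n) (carrier (DL_monoid n))"
  unfolding bij_betw_def
proof
  have cD: "carrier (DL_monoid n) = DL_class n ` {D. ndiagram n D}"
    by (auto simp: DL_monoid_def quotient_def)
  have web_nd: "ndiagram n D" if "nweb n D" for D using that by (simp add: nweb_def)
  show "inj_on (iota n) (WL n)"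
  proof (rule inj_onI)
    fix X Y assume X: "X \<in> WL n" and Y: "Y \<in> WL n" and eq: "iota n X = iota n Y"
    obtain D a where D: "X = isotopy_class n D" "nweb n D" "nf_blocks n a" "isotopic n D (word_diagram n (nf_word a))"
      using WL_normal_form[OF X] by blast
    obtain E b where E: "Y = isotopy_class n E" "nweb n E" "nf_blocks n b" "isotopic n E (word_diagram n (nf_word b))"
      using WL_normal_form[OF Y] by blast
    have "DL_class n D = DL_class n E" using eq iota_class web_nd D(1,2) E(1,2) by metis
    then have "(D, E) \<in> DL_rel n" unfolding DL_class_eq_iff .
    then have "rightmost n D k = rightmost n E k" if "k \<in> {1..n+1}" for k
      using rightmost_DL_rel(2)[OF _ web_nd[OF D(2)] that] by blast
    then have "word_map (nf_word a) k = word_map (nf_word b) k" if "k \<in> {1..n+1}" for k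
      using that rightmost_isotopic[OF D(4)] rightmost_isotopic[OF E(4)]
        rightmost_word_diagram[OF nf_word_set[OF D(3)] that] rightmost_word_diagram[OF nf_word_set[OF E(3)] that] by metis
    then have "a = b" using nf_blocks_unique[OF D(3) E(3)] by blast
    then have "isotopic n D E" using D(4) E(4) isotopic_trans isotopic_sym by blast
    then show "X = Y" unfolding D(1) E(1) by (rule isotopy_class_eqI)
  qed
  show "iota n ` WL n = carrier (DL_monoid n)"
  proof (intro Set.set_eqI iffI)
    fix X assume "X \<in> iota n ` WL n"
    then obtain D where "nweb n D" "X = iota n (isotopy_class n D)" unfolding WL_eq by blast
    then show "X \<in> carrier (DL_monoid n)" using iota_class web_nd unfolding cD by blast
  next
    fix X assume "X \<in> carrier (DL_monoid n)"
    then obtain D where D: "ndiagram n D" "X = DL_class n D" unfolding cD by blast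
    obtain w where w: "has_word n D w" using has_word_exists[OF D(1)] by blast
    note sw = has_word_set[OF w]
    obtain bl where bl: "nf_blocks n bl" "(w, nf_word bl) \<in> L_rel n" using L_rel_normal_form[OF sw] by blast
    let ?W = "word_diagram n (nf_word bl)"
    have "(D, word_diagram n w) \<in> DL_rel n"
      using same_word_isotopic[OF w has_word_word_diagram[OF sw]] by (intro DL_relI) blast
    then have "(D, ?W) \<in> DL_rel n" using L_rel_DL_rel[OF bl(2) sw] DL_rel_trans by blast
    then have "X = DL_class n ?W" unfolding D(2) DL_class_eq_iff .
    moreover have web: "nweb n ?W" by (rule nweb_nf_word[OF bl(1)])
    ultimately have "X = iota n (isotopy_class n ?W)" using iota_class[OF web_nd[OF web]] by simp
    then show "X \<in> iota n ` WL n" unfolding WL_eq using web by blast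
  qed
qed

text \<open>Both sides are parametrized by block lists: a web isotopic to the diagram of
  \<open>bl\<close> is sent to \<open>nf_pair bl\<close>.\<close>

lemma bij_rho_web_perm: "bij_betw (rho n \<circ> web_perm n) (WL n) (II n)"
  unfolding bij_betw_def
proof
  show "inj_on (rho n \<circ> web_perm n) (WL n)"
  proof (rule inj_onI)
    fix X Y assume X: "X \<in> WL n" and Y: "Y \<in> WL n" and eq: "(rho n \<circ> web_perm n) X = (rho n \<circ> web_perm n) Y"
    obtain D a where D: "X = isotopy_class n D" "nweb n D" "nf_blocks n a" "isotopic n D (word_diagram n (nf_word a))"
      using WL_normal_form[OF X] by blast
    obtain E b where E: "Y = isotopy_class n E" "nweb n E" "nf_blocks n b" "isotopic n E (word_diagram n (nf_word b))"
      using WL_normal_form[OF Y] by blast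
    have "nf_pair a = nf_pair b" using eq rho_web_perm_class[OF D(3,4)] rho_web_perm_class[OF E(3,4)] D(1) E(1) by simp
    then have "a = b" by (rule inj_nf_pair)
    then have "isotopic n D E" using D(4) E(4) isotopic_trans isotopic_sym by blast
    then show "X = Y" unfolding D(1) E(1) by (rule isotopy_class_eqI)
  qed
  show "(rho n \<circ> web_perm n) ` WL n = II n"
  proof (intro Set.set_eqI iffI)
    fix p assume "p \<in> (rho n \<circ> web_perm n) ` WL n"
    then obtain X where X: "X \<in> WL n" "p = (rho n \<circ> web_perm n) X" by blast
    obtain D a where D: "X = isotopy_class n D" "nweb n D" "nf_blocks n a" "isotopic n D (word_diagram n (nf_word a))"
      using WL_normal_form[OF X(1)] by blast
    have "p = nf_pair a" using X(2) D(1) rho_web_perm_class[OF D(3,4)] by simp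
    then show "p \<in> II n" using nf_pair_II D(3) by blast
  next
    fix p assume "p \<in> II n"
    then obtain bl where bl: "nf_blocks n bl" "p = nf_pair bl" using nf_pair_II by blast
    let ?W = "word_diagram n (nf_word bl)"
    have web: "nweb n ?W" by (rule nweb_nf_word[OF bl(1)])
    then have "ndiagram n ?W" by (simp add: nweb_def)
    then have "(rho n \<circ> web_perm n) (isotopy_class n ?W) = p"
      using rho_web_perm_class[OF bl(1) isotopic_refl] bl(2) by simp
    moreover have "isotopy_class n ?W \<in> WL n" unfolding WL_eq using web by blast
    ultimately show "p \<in> (rho n \<circ> web_perm n) ` WL n" by blast
  qed
qed

theorem theorem6p1:
  fixes n :: nat
  shows "bij_betw (iota n) (WL n) (carrier (DL_monoid n)) \<and>
    bij_betw (inv_into (carrier (L_monoid n)) (epsilon n) \<circ> iota n) (WL n) (carrier (L_monoid n)) \<and>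
    bij_betw (rho n \<circ> web_perm n) (WL n) (II n) \<and>
    bij_betw ((rho n \<circ> web_perm n) \<circ>
        inv_into (WL n) (inv_into (carrier (L_monoid n)) (epsilon n) \<circ> iota n))
      (carrier (L_monoid n)) (II n)"
proof -
  have "bij_betw (inv_into (carrier (L_monoid n)) (epsilon n) \<circ> iota n) (WL n) (carrier (L_monoid n))"
    by (rule bij_betw_trans[OF bij_iota bij_betw_inv_into[OF bij_epsilon]])
  then show ?thesis
    using bij_iota bij_rho_web_perm bij_betw_trans[OF bij_betw_inv_into bij_rho_web_perm] by blast
qed

end
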